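(* Let $Y=(Y_i)_{i\in\mathbb{Z}}$ be a stationary ergodic sequence of real-valued random variables with common distribution function $F_Y$, and let $F_n(t)=\frac1n\sum_{i=1}^n\mathbf{1}_{Y_i\le t}$. Assume that $$\sum_{k\ge1}\frac{1}{\sqrt k}\int_0^{\tilde\alpha(k)}\frac{Q_Y(u)}{\sqrt u}\,du<\infty .$$ Then $\{t\mapsto\sqrt n(F_n(t)-F_Y(t)),\ t\in\mathbb{R}\}$ converges in law in $\mathbf{L}^1(\lambda)$, as $n\to\infty$, to a centered Gaussian random variable with covariance function: for any $f,g\in\mathbf{L}^\infty(\lambda)$, $$\Phi_\lambda(f,g)=\int_{\mathbb{R}^2}f(s)g(t)\,C(s,t)\,dt\,ds,$$ with $$C(s,t)=F_Y(t\wedge s)-F_Y(t)F_Y(s)+2\sum_{k\ge1}\big(\mathbb{P}(Y_0\le t,Y_k\le s)-F_Y(t)F_Y(s)\big).$$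
   Context: $\lambda$ is the Lebesgue measure on $\mathbb{R}$; $\mathbf{L}^1(\lambda)$ is the space of Lebesgue-integrable real functions with norm $\int_{\mathbb{R}}|x(t)|\,dt$, with dual $\mathbf{L}^\infty(\lambda)$ acting by $f(x)=\int_{\mathbb{R}} f(t)x(t)\,dt$. The covariance function of a centered Gaussian $G$ in $\mathbf{L}^1(\lambda)$ is $(f,g)\mapsto\mathbb{E}(f(G)g(G))$. $t\wedge s$ denotes the minimum. With $\mathcal{F}_0=\sigma(Y_i,\,i\le0)$, the dependence coefficients are, for integers $k\ge0$, $$\tilde\alpha(k)=\sup_{t\in\mathbb{R}}\|\mathbb{P}(Y_k\le t\mid\mathcal{F}_0)-\mathbb{P}(Y_k\le t)\|_1,$$ where $\|Z\|_1=\mathbb{E}|Z|$. $Q_Y$ is the quantile function of $|Y_0|$, i.e. the cadlag inverse of the tail function $x\mapsto\mathbb{P}(|Y_0|>x)$.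
   Formalization: If α̃(1)=0 (the i.i.d. case, where the series condition is vacuous), ∫_0^1 Q_Y(u)/√u du<∞ is also assumed; since C(s,t) need not be symmetric, the limit's covariance is stated as the symmetric part (Φ_λ(f,g)+Φ_λ(g,f))/2. *)

theory Defs
  imports "HOL-Probability.Probability"
begin

section \<open>The Banach space of Lebesgue integrable functions\<close>

text \<open>
  Elements are classes of integrable functions modulo almost-everywhere equality. Using
  \<^const>\<open>lborel\<close> instead of its completion gives the same space, since every Lebesgue
  measurable function is almost everywhere equal to a Borel function.
\<close>

definition L1_rel :: "(real \<Rightarrow> real) \<Rightarrow> (real \<Rightarrow> real) \<Rightarrow> bool" where
  "L1_rel x y \<longleftrightarrow> integrable lborel x \<and> integrable lborel y \<and> (AE t in lborel. x t = y t)"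

lemma part_equivp_L1_rel: "part_equivp L1_rel"
proof (rule part_equivpI)
  show "\<exists>x. L1_rel x x"
    by (rule exI[of _ "\<lambda>_. 0"]) (simp add: L1_rel_def)
  show "symp L1_rel"
    by (rule sympI) (auto simp: L1_rel_def elim: AE_mp)
  show "transp L1_rel"
    by (rule transpI) (auto simp: L1_rel_def elim: AE_mp)
qed

quotient_type L1 = "real \<Rightarrow> real" / partial: L1_rel
  by (rule part_equivp_L1_rel)

instantiation L1 :: real_normed_vector
begin

lift_definition zero_L1 :: L1 is "\<lambda>_. 0"
  by (simp add: L1_rel_def)

lift_definition plus_L1 :: "L1 \<Rightarrow> L1 \<Rightarrow> L1" is "\<lambda>x y t. x t + y t"
  by (auto simp: L1_rel_def)

lift_definition minus_L1 :: "L1 \<Rightarrow> L1 \<Rightarrow> L1" is "\<lambda>x y t. x t - y t"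
  by (auto simp: L1_rel_def)

lift_definition uminus_L1 :: "L1 \<Rightarrow> L1" is "\<lambda>x t. - x t"
  by (auto simp: L1_rel_def)

lift_definition scaleR_L1 :: "real \<Rightarrow> L1 \<Rightarrow> L1" is "\<lambda>c x t. c * x t"
  by (auto simp: L1_rel_def)

lift_definition norm_L1 :: "L1 \<Rightarrow> real" is "\<lambda>x. LINT t|lborel. \<bar>x t\<bar>"
  unfolding L1_rel_def by (intro integral_cong_AE) auto

definition dist_L1 :: "L1 \<Rightarrow> L1 \<Rightarrow> real" where
  "dist_L1 x y = norm (x - y)"

definition sgn_L1 :: "L1 \<Rightarrow> L1" where
  "sgn_L1 x = inverse (norm x) *\<^sub>R x"

definition uniformity_L1 :: "(L1 \<times> L1) filter" where
  "uniformity_L1 = (INF e\<in>{0<..}. principal {(x, y). dist x y < e})"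

definition open_L1 :: "L1 set \<Rightarrow> bool" where
  "open_L1 U \<longleftrightarrow> (\<forall>x\<in>U. \<forall>\<^sub>F (x', y) in uniformity. x' = x \<longrightarrow> y \<in> U)"

instance
proof
  fix x y z :: L1 and a b :: real
  show "dist x y = norm (x - y)" by (rule dist_L1_def)
  show "sgn x = inverse (norm x) *\<^sub>R x" by (rule sgn_L1_def)
  show "(uniformity :: (L1 \<times> L1) filter) = (INF e\<in>{0<..}. principal {(x, y). dist x y < e})"
    by (rule uniformity_L1_def)
  show "open U = (\<forall>x\<in>U. \<forall>\<^sub>F (x', y) in uniformity. x' = x \<longrightarrow> y \<in> U)" for U :: "L1 set"
    by (rule open_L1_def)
  show "x + y + z = x + (y + z)" by transfer (simp add: L1_rel_def add.assoc)
  show "x + y = y + x" by transfer (simp add: L1_rel_def add.commute)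
  show "0 + x = x" by transfer (simp add: L1_rel_def)
  show "- x + x = 0" by transfer (simp add: L1_rel_def)
  show "x - y = x + - y" by transfer (simp add: L1_rel_def)
  show "a *\<^sub>R (x + y) = a *\<^sub>R x + a *\<^sub>R y" by transfer (simp add: L1_rel_def distrib_left)
  show "(a + b) *\<^sub>R x = a *\<^sub>R x + b *\<^sub>R x" by transfer (simp add: L1_rel_def distrib_right)
  show "a *\<^sub>R b *\<^sub>R x = (a * b) *\<^sub>R x" by transfer (simp add: L1_rel_def mult.assoc)
  show "1 *\<^sub>R x = x" by transfer (simp add: L1_rel_def)
  show "norm x = 0 \<longleftrightarrow> x = 0"
    by transfer (auto simp: L1_rel_def integral_nonneg_eq_0_iff_AE)
  show "norm (x + y) \<le> norm x + norm y"
  proof transfer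
    fix x y :: "real \<Rightarrow> real"
    assume "L1_rel x x" "L1_rel y y"
    then have i: "integrable lborel x" "integrable lborel y"
      by (auto simp: L1_rel_def)
    have "(LINT t|lborel. \<bar>x t + y t\<bar>) \<le> (LINT t|lborel. \<bar>x t\<bar> + \<bar>y t\<bar>)"
      using i by (intro integral_mono) auto
    then show "(LINT t|lborel. \<bar>x t + y t\<bar>) \<le> (LINT t|lborel. \<bar>x t\<bar>) + (LINT t|lborel. \<bar>y t\<bar>)"
      using i by simp
  qed
  show "norm (a *\<^sub>R x) = \<bar>a\<bar> * norm x"
    by transfer (simp add: abs_mult)
qed

end

definition Linf :: "(real \<Rightarrow> real) set" where
  "Linf = {f \<in> borel_measurable lborel. \<exists>c. AE t in lborel. \<bar>f t\<bar> \<le> c}"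

definition pairing :: "(real \<Rightarrow> real) \<Rightarrow> L1 \<Rightarrow> real" where
  "pairing f x = (LINT t|lborel. f t * rep_L1 x t)"


section \<open>Convergence in law and Gaussian laws\<close>

definition converges_in_law ::
  "'a measure \<Rightarrow> (nat \<Rightarrow> 'a \<Rightarrow> 'b::topological_space) \<Rightarrow> 'b measure \<Rightarrow> bool" where
  "converges_in_law M X N \<longleftrightarrow>
     (\<forall>n. X n \<in> borel_measurable M) \<and>
     (\<forall>h :: 'b \<Rightarrow> real. continuous_on UNIV h \<and> bounded (range h) \<longrightarrow>
        (\<lambda>n. LINT \<omega>|M. h (X n \<omega>)) \<longlonglongrightarrow> (LINT x|N. h x))"

text \<open>The value \<open>\<sigma> = 0\<close> is allowed, so point masses at \<open>0\<close> count as Gaussian.\<close>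

definition centered_gaussian :: "'b::real_normed_vector measure \<Rightarrow> bool" where
  "centered_gaussian N \<longleftrightarrow>
     prob_space N \<and> sets N = sets borel \<and>
     (\<forall>\<phi> :: 'b \<Rightarrow> real. bounded_linear \<phi> \<longrightarrow>
        (\<exists>\<sigma>. distr N borel \<phi> = distr std_normal_distribution borel (\<lambda>z. \<sigma> * z)))"


section \<open>Stationary sequences, dependence coefficients and quantiles\<close>

definition path_law :: "'a measure \<Rightarrow> (int \<Rightarrow> 'a \<Rightarrow> real) \<Rightarrow> (int \<Rightarrow> real) measure" where
  "path_law M Y = distr M (Pi\<^sub>M UNIV (\<lambda>_. borel)) (\<lambda>\<omega> i. Y i \<omega>)"

definition shift :: "(int \<Rightarrow> real) \<Rightarrow> int \<Rightarrow> real" where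
  "shift y = (\<lambda>i. y (i + 1))"

definition stationary :: "'a measure \<Rightarrow> (int \<Rightarrow> 'a \<Rightarrow> real) \<Rightarrow> bool" where
  "stationary M Y \<longleftrightarrow> path_law M (\<lambda>i. Y (i + 1)) = path_law M Y"

definition ergodic :: "'a measure \<Rightarrow> (int \<Rightarrow> 'a \<Rightarrow> real) \<Rightarrow> bool" where
  "ergodic M Y \<longleftrightarrow>
     (\<forall>A \<in> sets (Pi\<^sub>M UNIV (\<lambda>_. borel)). shift -` A = A \<longrightarrow> measure (path_law M Y) A \<in> {0, 1})"

definition past :: "'a measure \<Rightarrow> (int \<Rightarrow> 'a \<Rightarrow> real) \<Rightarrow> 'a measure" where
  "past M Y = sigma (space M) {Y i -` B \<inter> space M | i B. i \<le> 0 \<and> B \<in> sets borel}"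

definition tilde_alpha :: "'a measure \<Rightarrow> (int \<Rightarrow> 'a \<Rightarrow> real) \<Rightarrow> nat \<Rightarrow> real" where
  "tilde_alpha M Y k =
     (SUP t. LINT \<omega>|M. \<bar>real_cond_exp M (past M Y) (indicator {\<omega> \<in> space M. Y (int k) \<omega> \<le> t}) \<omega>
                        - measure M {\<omega> \<in> space M. Y (int k) \<omega> \<le> t}\<bar>)"

text \<open>
  Only arguments \<open>0 < u \<le> 1\<close> matter. Restricting the infimum to \<open>x \<ge> 0\<close> has an effect for
  \<open>u = 1\<close> only.
\<close>

definition quantile :: "'a measure \<Rightarrow> (int \<Rightarrow> 'a \<Rightarrow> real) \<Rightarrow> real \<Rightarrow> real" where
  "quantile M Y u = Inf {x. 0 \<le> x \<and> measure M {\<omega> \<in> space M. \<bar>Y 0 \<omega>\<bar> > x} \<le> u}"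

text \<open>
  The series condition on \<open>\<Sum>k\<ge>1. k powr (-1/2) * quantile_integral M Y (tilde_alpha M Y k)\<close> implies
  \<open>quantile_integral M Y 1 < \<infinity>\<close> as soon as \<open>tilde_alpha M Y 1 > 0\<close>. If \<open>tilde_alpha M Y 1 = 0\<close>, the
  sequence is i.i.d., the series vanishes and carries no information on the tails, and
  \<open>quantile_integral M Y 1 < \<infinity>\<close> is necessary for the central limit theorem in \<open>L1\<close>; it has to
  be assumed separately in that case.
\<close>

definition quantile_integral :: "'a measure \<Rightarrow> (int \<Rightarrow> 'a \<Rightarrow> real) \<Rightarrow> real \<Rightarrow> ennreal" where
  "quantile_integral M Y a = (\<integral>\<^sup>+u\<in>{0<..a}. ennreal (quantile M Y u / sqrt u) \<partial>lborel)"


section \<open>The empirical process and its limit covariance\<close>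

definition F_marg :: "'a measure \<Rightarrow> (int \<Rightarrow> 'a \<Rightarrow> real) \<Rightarrow> real \<Rightarrow> real" where
  "F_marg M Y = cdf (distr M borel (Y 0))"

definition F_emp :: "(int \<Rightarrow> 'a \<Rightarrow> real) \<Rightarrow> nat \<Rightarrow> 'a \<Rightarrow> real \<Rightarrow> real" where
  "F_emp Y n \<omega> t = 1 / real n * (\<Sum>i = 1..n. indicator {..t} (Y (int i) \<omega>))"

definition emp_process :: "'a measure \<Rightarrow> (int \<Rightarrow> 'a \<Rightarrow> real) \<Rightarrow> nat \<Rightarrow> 'a \<Rightarrow> real \<Rightarrow> real" where
  "emp_process M Y n \<omega> t = sqrt (real n) * (F_emp Y n \<omega> t - F_marg M Y t)"

definition C_term :: "'a measure \<Rightarrow> (int \<Rightarrow> 'a \<Rightarrow> real) \<Rightarrow> real \<Rightarrow> real \<Rightarrow> nat \<Rightarrow> real" where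
  "C_term M Y s t k =
     measure M {\<omega> \<in> space M. Y 0 \<omega> \<le> t \<and> Y (int k) \<omega> \<le> s} - F_marg M Y t * F_marg M Y s"

definition C_kernel :: "'a measure \<Rightarrow> (int \<Rightarrow> 'a \<Rightarrow> real) \<Rightarrow> real \<Rightarrow> real \<Rightarrow> real" where
  "C_kernel M Y s t =
     F_marg M Y (min t s) - F_marg M Y t * F_marg M Y s + 2 * (\<Sum>k. C_term M Y s t (Suc k))"

definition Phi :: "'a measure \<Rightarrow> (int \<Rightarrow> 'a \<Rightarrow> real) \<Rightarrow> (real \<Rightarrow> real) \<Rightarrow> (real \<Rightarrow> real) \<Rightarrow> real" where
  "Phi M Y f g = (\<integral>(s, t). f s * g t * C_kernel M Y s t \<partial>(lborel \<Otimes>\<^sub>M lborel))"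

text \<open>
  Unless the sequence is reversible, \<^const>\<open>C_kernel\<close> need not be symmetric in \<open>s\<close> and \<open>t\<close>, so
  \<^const>\<open>Phi\<close> determines a covariance through its diagonal values \<open>Phi M Y f f\<close>; by polarization
  the covariance is the symmetric part of \<^const>\<open>Phi\<close>. The predicate below also asks that the
  series and the integrals in \<^const>\<open>Phi\<close> converge, so that no default value of \<^const>\<open>suminf\<close> or
  of the Bochner integral is used.
\<close>

definition has_covariance_Phi :: "'a measure \<Rightarrow> (int \<Rightarrow> 'a \<Rightarrow> real) \<Rightarrow> L1 measure \<Rightarrow> bool" where
  "has_covariance_Phi M Y N \<longleftrightarrow>
     (\<forall>s t. summable (\<lambda>k. C_term M Y s t (Suc k))) \<and>
     (\<forall>f \<in> Linf. \<forall>g \<in> Linf.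
        integrable (lborel \<Otimes>\<^sub>M lborel) (\<lambda>(s, t). f s * g t * C_kernel M Y s t) \<and>
        has_bochner_integral N (\<lambda>x. pairing f x * pairing g x) ((Phi M Y f g + Phi M Y g f) / 2))"

end

theory Submission
  imports Defs
begin

text \<open>Reverse time: on the space of past trajectories the shift into the past is an ergodic map, and
  \<open>X t y = 1(y 0 \<le> t) - F(t)\<close> is a bounded observable with mixing rate \<open>\<alpha>\<close>. The coefficient condition
  makes \<open>\<alpha>\<close> summable, so that Gordin's martingale approximation and McLeish's argument give the central
  limit theorem for every linear combination of the \<open>X t\<close>, hence for the finite-dimensional laws of the
  empirical process.

  To lift this to \<open>L1\<close>, write \<open>\<Gamma> d = (\<Sum>k. min (\<beta> k) d)\<close>, where \<open>\<beta>\<close> agrees with \<open>\<alpha>\<close> at positive lags.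
  The absolute mean of the empirical process at \<open>t\<close> is at most
  \<open>2 * sqrt (\<Gamma> (P(\<bar>Y 0\<bar> \<ge> \<bar>t\<bar>)))\<close> uniformly in \<open>n\<close>, and its increments satisfy a similar bound in terms of
  the increments of \<open>F\<close>. The coefficient condition ensures that this bound is integrable in \<open>t\<close>.
  Sampling the process on a finite grid therefore changes it in \<open>L1\<close> mean by a
  quantity that vanishes with the mesh, uniformly in \<open>n\<close>. The sampled processes converge to Gaussian step
  functions, these form a Cauchy sequence in mean, and their limit is the limit law.\<close>

section \<open>Birkhoff's theorem for bounded observables\<close>

text \<open>The shape of the coefficient condition has two sources. If \<open>0 < u < H t\<close>,
  then \<open>\<bar>t\<bar>\<close> is at most the quantile at \<open>u\<close>; so by Fubini the
  integral over \<open>t\<close> of \<open>sqrt (min a (H t))\<close> is bounded by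
  \<open>2 * quantile_integral M Y a\<close>. And for a nonincreasing sequence the root of its sum
  is at most the sum of its roots weighted by \<open>1 / sqrt (k + 1)\<close>. Together they make
  the root of \<open>\<Gamma> (H t)\<close> integrable. Time is reversed because the coefficients
  control a future value given the whole past: on reversed paths that past is the image of the path
  under the \<open>k\<close>-th power of the shift, so \<open>\<alpha> k\<close> bounds the
  correlation of \<open>X t\<close> with every bounded function of this image. No tightness in
  \<open>L1\<close> has to be shown: the sampling error is uniform in \<open>n\<close>, and the
  limit variable is built from the completeness of \<open>L1\<close>. The kernel in the covariance
  may be asymmetric, so the Gaussian variables are built from its symmetrisation, which has the same
  quadratic forms.\<close>

locale mp_map = prob_space M for M :: "'a measure" +
  fixes T :: "'a \<Rightarrow> 'a"
  assumes T[measurable]: "T \<in> measurable M M"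
    and distr_T: "distr M M T = M"
begin

lemma Tn[measurable]: "(T ^^ n) \<in> measurable M M"
  by (induction n) (auto intro: measurable_comp[OF _ T] simp: comp_def)

lemma distr_Tn: "distr M M (T ^^ n) = M"
proof (induction n)
  case (Suc n)
  have "distr M M (T ^^ Suc n) = distr (distr M M (T ^^ n)) M T"
    unfolding funpow.simps by (rule distr_distr[symmetric]) measurable
  also have "\<dots> = M"
    by (simp only: Suc distr_T)
  finally show ?case .
qed (simp add: distr_id2)

lemma integral_Tn:
  fixes f :: "'a \<Rightarrow> 'b::{banach, second_countable_topology}"
  assumes [measurable]: "f \<in> borel_measurable M"
  shows "(\<integral>x. f ((T ^^ n) x) \<partial>M) = (\<integral>x. f x \<partial>M)"
  by (metis assms distr_Tn Tn integral_distr)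

lemma integral_T:
  fixes f :: "'a \<Rightarrow> 'b::{banach, second_countable_topology}"
  assumes [measurable]: "f \<in> borel_measurable M"
  shows "(\<integral>x. f (T x) \<partial>M) = (\<integral>x. f x \<partial>M)"
  using integral_Tn[OF assms, of 1] by simp

lemma integrable_bounded:
  fixes f :: "'a \<Rightarrow> 'b::{banach, second_countable_topology}"
  assumes "f \<in> borel_measurable M" "\<And>x. norm (f x) \<le> B"
  shows "integrable M f"
  using assms by (intro integrable_const_bound[of _ B]) auto

text \<open>The largest of \<open>0\<close> and the Birkhoff sums of length at most
  \<open>n\<close>. The recursion through \<open>T x\<close> is the form from which Garsia's
  inequality can be read off.\<close>

primrec max_sums :: "('a \<Rightarrow> real) \<Rightarrow> nat \<Rightarrow> 'a \<Rightarrow> real" where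
  "max_sums g 0 x = 0"
| "max_sums g (Suc n) x = max 0 (g x + max_sums g n (T x))"

lemma max_sums_nonneg: "0 \<le> max_sums g n x"
  by (cases n) auto

lemma max_sums_mono: "max_sums g n x \<le> max_sums g (Suc n) x"
proof (induction n arbitrary: x)
  case (Suc n)
  have "max_sums g (Suc n) x = max 0 (g x + max_sums g n (T x))"
    "max_sums g (Suc (Suc n)) x = max 0 (g x + max_sums g (Suc n) (T x))"
    by (rule max_sums.simps)+
  moreover have "max 0 a \<le> max 0 b" if "a \<le> b" for a b :: real
    using that by auto
  ultimately show ?case
    by (metis Suc.IH add_left_mono)
qed (simp only: max_sums.simps max.cobounded1)

lemma max_sums_measurable[measurable]:
  assumes [measurable]: "g \<in> borel_measurable M"
  shows "max_sums g n \<in> borel_measurable M"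
proof (induction n)
  case 0
  have "max_sums g 0 = (\<lambda>_. 0)" by auto
  then show ?case by simp
next
  case (Suc n)
  note [measurable] = Suc
  have "max_sums g (Suc n) = (\<lambda>x. max 0 (g x + max_sums g n (T x)))"
    by auto
  then show ?case by simp
qed

lemma max_sums_bound:
  assumes "\<And>x. \<bar>g x\<bar> \<le> B"
  shows "\<bar>max_sums g n x\<bar> \<le> real n * B"
proof (induction n arbitrary: x)
  case (Suc n)
  show ?case
    using Suc.IH[of "T x"] assms[of x] by (auto simp: algebra_simps abs_le_iff max_def)
qed simp

lemma max_sums_ge_sum: "(\<Sum>i<n. g ((T ^^ i) x)) \<le> max_sums g n x"
proof (induction n arbitrary: x)
  case (Suc n)
  have "(\<Sum>i<Suc n. g ((T ^^ i) x)) = g x + (\<Sum>i<n. g ((T ^^ i) (T x)))"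
    by (subst sum.lessThan_Suc_shift) (simp add: funpow_swap1)
  then show ?case
    using Suc.IH[of "T x"] by simp
qed simp

text \<open>Garsia's argument. Where the maximum is positive, it is \<open>g x\<close> plus the
  shorter maximum at \<open>T x\<close>, hence at most \<open>g x\<close> plus the full maximum at
  \<open>T x\<close>; elsewhere it is \<open>0\<close>, and subtracting its value at
  \<open>T x\<close> leaves something at most \<open>0\<close>. When this pointwise bound is
  integrated, the two maxima cancel by invariance.\<close>

lemma maximal_ergodic:
  assumes [measurable]: "g \<in> borel_measurable M" and B: "\<And>x. \<bar>g x\<bar> \<le> B"
  shows "0 \<le> (\<integral>x. g x * indicator {x. 0 < max_sums g n x} x \<partial>M)"
proof (cases n)
  case (Suc m)
  let ?f = "max_sums g n"
  have i: "integrable M ?f"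
    using max_sums_bound[of g B] B by (intro integrable_bounded[where B = "real n * B"]) auto
  have iT: "integrable M (\<lambda>x. ?f (T x))"
    using max_sums_bound[of g B] B by (intro integrable_bounded[where B = "real n * B"]) auto
  have "0 = (\<integral>x. ?f x - ?f (T x) \<partial>M)"
    using i iT by (simp add: integral_T)
  also have "\<dots> \<le> (\<integral>x. g x * indicator {x. 0 < ?f x} x \<partial>M)"
  proof (rule integral_mono)
    show "integrable M (\<lambda>x. ?f x - ?f (T x))" using i iT by simp
    show "integrable M (\<lambda>x. g x * indicator {x. 0 < ?f x} x)"
      using B order_trans[OF abs_ge_zero B]
      by (intro integrable_bounded[where B = B]) (auto simp: indicator_def)
    fix x
    show "?f x - ?f (T x) \<le> g x * indicator {x. 0 < ?f x} x"
      using max_sums_mono[of g m "T x"] max_sums_nonneg[of g m "T x"] max_sums_nonneg[of g n x]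
        max_sums_nonneg[of g n "T x"]
      unfolding Suc by (auto simp: indicator_def max_def not_less split: if_splits)
  qed
  finally show ?thesis .
qed simp

end

section \<open>From the maximal inequality to almost sure averages\<close>

locale ergodic_map = mp_map +
  assumes erg: "\<And>A. A \<in> sets M \<Longrightarrow> T -` A \<inter> space M = A \<Longrightarrow> prob A = 0 \<or> prob A = 1"
begin

text \<open>The event that the sums are unbounded above is invariant, so it has probability
  \<open>0\<close> or \<open>1\<close>. In the second case the sets of the maximal inequality
  exhaust almost all of the space, and in the limit the inequality says that \<open>g\<close> has
  nonnegative mean, against \<open>neg\<close>.\<close>

lemma sums_bounded_above:
  fixes g :: "'a \<Rightarrow> real"
  assumes g[measurable]: "g \<in> borel_measurable M" and B: "\<And>x. \<bar>g x\<bar> \<le> B"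
    and neg: "(\<integral>x. g x \<partial>M) < 0"
  shows "AE x in M. \<exists>K. \<forall>n. (\<Sum>i<n. g ((T ^^ i) x)) \<le> K"
proof -
  let ?S = "\<lambda>n x. \<Sum>i<n. g ((T ^^ i) x)"
  define A where "A = {x \<in> space M. \<forall>K::nat. \<exists>n. real K < ?S n x}"
  have A[measurable]: "A \<in> sets M"
    unfolding A_def by measurable
  have ST: "?S n (T x) = ?S (Suc n) x - g x" for n x
    by (subst sum.lessThan_Suc_shift) (simp add: funpow_swap1)
  have step: "(\<forall>K::nat. \<exists>n. real K < ?S n (T x)) \<longleftrightarrow> (\<forall>K::nat. \<exists>n. real K < ?S n x)" for x
  proof safe
    fix K :: nat
    assume "\<forall>K::nat. \<exists>n. real K < ?S n (T x)"
    then obtain n where "real (K + nat \<lceil>\<bar>g x\<bar>\<rceil>) < ?S n (T x)" by blast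
    then have "real K < ?S (Suc n) x"
      unfolding ST by linarith
    then show "\<exists>n. real K < ?S n x" ..
  next
    fix K :: nat
    assume "\<forall>K::nat. \<exists>n. real K < ?S n x"
    then obtain n where n: "real (K + nat \<lceil>\<bar>g x\<bar>\<rceil>) < ?S n x" by blast
    \<comment> \<open>The empty sum is not positive, so \<open>n\<close> is a successor and the
      first term can be removed.\<close>
    have "0 < ?S n x"
      by (rule le_less_trans[OF of_nat_0_le_iff n])
    then obtain m where m: "n = Suc m"
      by (cases n) auto
    from n[unfolded m] have "real K < ?S m (T x)"
      unfolding ST by linarith
    then show "\<exists>n. real K < ?S n (T x)" ..
  qed
  have inv: "T -` A \<inter> space M = A"
    using step T[THEN measurable_space] by (auto simp: A_def)
  have "prob A \<noteq> 1"
  proof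
    assume "prob A = 1"
    then have "AE x in M. x \<in> A"
      using AE_in_set_eq_1 A by blast
    then have lim: "AE x in M. (\<lambda>n. g x * indicator {x. 0 < max_sums g n x} x) \<longlonglongrightarrow> g x"
    proof eventually_elim
      case (elim x)
      then obtain n where "real 0 < ?S n x" unfolding A_def by blast
      then have n: "0 < max_sums g n x"
        using max_sums_ge_sum[of g x n] by simp
      have "0 < max_sums g m x" if "n \<le> m" for m
        using n lift_Suc_mono_le[of "\<lambda>n. max_sums g n x", OF max_sums_mono that] by simp
      then have "\<forall>\<^sub>F m in sequentially. g x * indicator {x. 0 < max_sums g m x} x = g x"
        by (auto simp: eventually_sequentially intro!: exI[of _ n])
      then show ?case
        by (rule tendsto_eventually)
    qed
    have "(\<lambda>n. \<integral>x. g x * indicator {x. 0 < max_sums g n x} x \<partial>M) \<longlonglongrightarrow> (\<integral>x. g x \<partial>M)"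
    proof (rule integral_dominated_convergence[where w = "\<lambda>_. B"])
      show "AE x in M. (\<lambda>n. g x * indicator {x. 0 < max_sums g n x} x) \<longlonglongrightarrow> g x" by fact
      show "AE x in M. norm (g x * indicator {x. 0 < max_sums g n x} x) \<le> B" for n
        using B order_trans[OF abs_ge_zero B] by (auto simp: indicator_def)
    qed auto
    then have "0 \<le> (\<integral>x. g x \<partial>M)"
      by (rule LIMSEQ_le_const) (use maximal_ergodic[OF g B] in blast)
    with neg show False by simp
  qed
  with erg[OF A inv] have "prob A = 0" by auto
  then have "A \<in> null_sets M"
    using A by (auto simp: emeasure_eq_measure)
  then show ?thesis
    by (rule AE_I') (force simp: A_def not_le)
qed

text \<open>Of the margin \<open>2 / real (Suc k)\<close>, one half makes the centred observable
  have negative mean, so that its sums stay bounded above; the other half absorbs this bound divided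
  by \<open>n\<close>. Applying the upper estimate to \<open>- g\<close> gives the lower
  one.\<close>

theorem birkhoff_bounded:
  fixes g :: "'a \<Rightarrow> real"
  assumes g[measurable]: "g \<in> borel_measurable M" and B: "\<And>x. \<bar>g x\<bar> \<le> B"
  shows "AE x in M. (\<lambda>n. (\<Sum>i<n. g ((T ^^ i) x)) / real n) \<longlonglongrightarrow> (\<integral>x. g x \<partial>M)"
proof -
  have upper: "AE x in M. \<forall>k. \<forall>\<^sub>F n in sequentially.
      (\<Sum>i<n. h ((T ^^ i) x)) / real n < (\<integral>x. h x \<partial>M) + 2 / real (Suc k)"
    if [measurable]: "h \<in> borel_measurable M" and Bh: "\<And>x. \<bar>h x\<bar> \<le> B" for h :: "'a \<Rightarrow> real"
  proof (subst AE_all_countable, intro allI)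
    fix k
    let ?e = "1 / real (Suc k)"
    let ?g = "\<lambda>x. h x - ((\<integral>x. h x \<partial>M) + ?e)"
    have ih: "integrable M h" using Bh by (intro integrable_bounded[where B = B]) auto
    have "AE x in M. \<exists>K. \<forall>n. (\<Sum>i<n. ?g ((T ^^ i) x)) \<le> K"
    proof (rule sums_bounded_above)
      show "\<bar>?g x\<bar> \<le> B + \<bar>(\<integral>x. h x \<partial>M) + ?e\<bar>" for x
        using Bh[of x] by linarith
      show "(\<integral>x. ?g x \<partial>M) < 0"
        using ih by (simp add: prob_space)
    qed simp
    then show "AE x in M. \<forall>\<^sub>F n in sequentially.
        (\<Sum>i<n. h ((T ^^ i) x)) / real n < (\<integral>x. h x \<partial>M) + 2 / real (Suc k)"
    proof eventually_elim
      case (elim x)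
      then obtain K where K: "\<And>n. (\<Sum>i<n. ?g ((T ^^ i) x)) \<le> K" by blast
      have "\<forall>\<^sub>F n in sequentially. \<bar>K\<bar> / real n < ?e"
        using lim_const_over_n[of "\<bar>K\<bar>"] by (rule order_tendstoD) simp
      then show ?case
        using eventually_gt_at_top[of 0]
      proof eventually_elim
        case (elim n)
        have "(\<Sum>i<n. h ((T ^^ i) x)) \<le> \<bar>K\<bar> + real n * ((\<integral>x. h x \<partial>M) + ?e)"
          using K[of n] by (simp add: sum_subtractf)
        then have "(\<Sum>i<n. h ((T ^^ i) x)) / real n \<le> \<bar>K\<bar> / real n + ((\<integral>x. h x \<partial>M) + ?e)"
          using elim(2) by (subst pos_divide_le_eq) (auto simp: algebra_simps)
        also have "\<dots> < ?e + ((\<integral>x. h x \<partial>M) + ?e)"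
          using elim(1) by simp
        finally show ?case by simp
      qed
    qed
  qed
  have "AE x in M. \<forall>k. \<forall>\<^sub>F n in sequentially.
      (\<Sum>i<n. - g ((T ^^ i) x)) / real n < (\<integral>x. - g x \<partial>M) + 2 / real (Suc k)"
    using upper[of "\<lambda>x. - g x"] B by simp
  moreover note upper[OF g B]
  ultimately show ?thesis
  proof eventually_elim
    case (elim x)
    show ?case
    proof (rule tendstoI)
      fix e :: real assume "0 < e"
      then obtain k where k: "2 / real (Suc k) < e"
        using reals_Archimedean[of "e / 2"] by (auto simp: field_simps)
      from elim(1)[rule_format, of k] elim(2)[rule_format, of k]
      show "\<forall>\<^sub>F n in sequentially. dist ((\<Sum>i<n. g ((T ^^ i) x)) / real n) (\<integral>x. g x \<partial>M) < e"
      proof eventually_elim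
        case (elim n)
        then show ?case
          using k by (simp add: dist_real_def sum_negf abs_less_iff)
      qed
    qed
  qed
qed

end

section \<open>Martingale approximation and the scalar central limit theorem\<close>

lemma cesaro:
  fixes b :: "nat \<Rightarrow> real"
  assumes "b \<longlonglongrightarrow> l"
  shows "(\<lambda>n. (\<Sum>m<n. b m) / real n) \<longlonglongrightarrow> l"
proof (rule tendstoI)
  fix e :: real assume "0 < e"
  then obtain N where N: "\<And>n. N \<le> n \<Longrightarrow> \<bar>b n - l\<bar> < e / 2"
    using LIMSEQ_D[OF assms, of "e / 2"] by auto
  define K where "K = (\<Sum>m<N. \<bar>b m - l\<bar>)"
  have "\<forall>\<^sub>F n in sequentially. K / real n < e / 2"
    using lim_const_over_n[of K] by (rule order_tendstoD) (use \<open>0 < e\<close> in simp)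
  then show "\<forall>\<^sub>F n in sequentially. dist ((\<Sum>m<n. b m) / real n) l < e"
    using eventually_ge_at_top[of "Suc N"]
  proof eventually_elim
    case (elim n)
    have "\<bar>(\<Sum>m<n. b m) - real n * l\<bar> = \<bar>\<Sum>m<n. b m - l\<bar>"
      by (simp add: sum_subtractf)
    also have "\<dots> \<le> (\<Sum>m<n. \<bar>b m - l\<bar>)"
      by (rule sum_abs)
    also have "\<dots> = K + (\<Sum>m\<in>{N..<n}. \<bar>b m - l\<bar>)"
      unfolding K_def using elim(2)
      by (subst sum.union_disjoint[symmetric]) (auto intro!: sum.cong)
    also have "(\<Sum>m\<in>{N..<n}. \<bar>b m - l\<bar>) \<le> (\<Sum>m\<in>{N..<n}. e / 2)"
    proof (rule sum_mono)
      fix m assume "m \<in> {N..<n}"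
      then show "\<bar>b m - l\<bar> \<le> e / 2"
        using N[of m] by simp
    qed
    also have "\<dots> \<le> real n * (e / 2)"
      using \<open>0 < e\<close> by simp
    finally have "\<bar>(\<Sum>m<n. b m) - real n * l\<bar> / real n \<le> (K + real n * (e / 2)) / real n"
      by (intro divide_right_mono) auto
    also have "\<dots> = K / real n + e / 2"
      using elim(2) by (simp add: field_simps)
    finally have "\<bar>(\<Sum>m<n. b m) - real n * l\<bar> / real n < e"
      using elim(1) by linarith
    moreover have "(\<Sum>m<n. b m) / real n - l = ((\<Sum>m<n. b m) - real n * l) / real n"
      using elim(2) by (simp add: field_simps)
    ultimately show ?case
      by (simp add: dist_real_def)
  qed
qed

text \<open>Integrate \<open>2 * c * d * \<bar>f x * g x\<bar> \<le> c\<^sup>2 * (f x)\<^sup>2 +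
  d\<^sup>2 * (g x)\<^sup>2\<close> and take for \<open>c\<close> and \<open>d\<close> the norms of
  \<open>g\<close> and \<open>f\<close>. If one norm vanishes, the other parameter stays fixed and a
  large multiplier forces the left side to be zero.\<close>

lemma (in prob_space) cauchy_schwarz_bounded:
  fixes f g :: "'a \<Rightarrow> real"
  assumes [measurable]: "f \<in> borel_measurable M" "g \<in> borel_measurable M"
    and F: "\<And>x. \<bar>f x\<bar> \<le> F" and G: "\<And>x. \<bar>g x\<bar> \<le> G"
  shows "expectation (\<lambda>x. \<bar>f x * g x\<bar>) \<le> sqrt (expectation (\<lambda>x. (f x)\<^sup>2)) * sqrt (expectation (\<lambda>x. (g x)\<^sup>2))"
proof -
  have F0: "0 \<le> F" and G0: "0 \<le> G"
    using F[of undefined] G[of undefined] by linarith+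
  have sq: "integrable M (\<lambda>x. (h x)\<^sup>2)"
    if [measurable]: "h \<in> borel_measurable M" and "\<And>x. \<bar>h x\<bar> \<le> H" for h :: "'a \<Rightarrow> real" and H
    using power_mono[OF that(2) abs_ge_zero, of _ 2]
    by (intro integrable_const_bound[of _ "H\<^sup>2"]) auto
  have i: "integrable M (\<lambda>x. (f x)\<^sup>2)" "integrable M (\<lambda>x. (g x)\<^sup>2)"
    using sq[OF _ F] sq[OF _ G] by auto
  have i': "integrable M (\<lambda>x. \<bar>f x * g x\<bar>)"
    using F G F0 G0 by (intro integrable_const_bound[of _ "F * G"] AE_I2) (auto simp: abs_mult intro: mult_mono)
  define a b where "a = sqrt (expectation (\<lambda>x. (f x)\<^sup>2))" and "b = sqrt (expectation (\<lambda>x. (g x)\<^sup>2))"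
  have a: "expectation (\<lambda>x. (f x)\<^sup>2) = a\<^sup>2" "0 \<le> a" and b: "expectation (\<lambda>x. (g x)\<^sup>2) = b\<^sup>2" "0 \<le> b"
    by (auto simp: a_def b_def)
  have young: "2 * c * d * expectation (\<lambda>x. \<bar>f x * g x\<bar>) \<le> c\<^sup>2 * a\<^sup>2 + d\<^sup>2 * b\<^sup>2" if "0 \<le> c" "0 \<le> d" for c d :: real
  proof -
    have "expectation (\<lambda>x. 2 * c * d * \<bar>f x * g x\<bar>) \<le> expectation (\<lambda>x. c\<^sup>2 * (f x)\<^sup>2 + d\<^sup>2 * (g x)\<^sup>2)"
    proof (rule integral_mono)
      fix x
      have "0 \<le> (c * \<bar>f x\<bar> - d * \<bar>g x\<bar>)\<^sup>2" by simp
      then show "2 * c * d * \<bar>f x * g x\<bar> \<le> c\<^sup>2 * (f x)\<^sup>2 + d\<^sup>2 * (g x)\<^sup>2"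
        by (simp add: power2_diff power_mult_distrib abs_mult mult.assoc mult.left_commute)
    qed (use i i' in auto)
    then show ?thesis
      using i i' by (simp add: a(1) b(1))
  qed
  show ?thesis
  proof (cases "a = 0 \<or> b = 0")
    case True
    have "expectation (\<lambda>x. \<bar>f x * g x\<bar>) \<le> 0"
    proof (rule ccontr)
      assume "\<not> ?thesis"
      then have p: "0 < expectation (\<lambda>x. \<bar>f x * g x\<bar>)" (is "0 < ?e") by simp
      from True show False
      proof
        assume "a = 0"
        \<comment> \<open>With this choice \<open>c * ?e\<close> is \<open>b\<^sup>2 + 1\<close>,
          whereas \<open>young\<close> at \<open>a = 0\<close> allows twice that to be at most
          \<open>b\<^sup>2\<close>.\<close>
        define c where "c = (b\<^sup>2 + 1) / ?e"
        have c: "c * ?e = b\<^sup>2 + 1" "0 \<le> c"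
          using p by (auto simp: c_def)
        then have "2 * (c * ?e) \<le> b\<^sup>2"
          using young[of c 1] \<open>a = 0\<close> by (simp add: mult.assoc)
        then show False
          using c zero_le_power2[of b] by linarith
      next
        assume "b = 0"
        define c where "c = (a\<^sup>2 + 1) / ?e"
        have c: "c * ?e = a\<^sup>2 + 1" "0 \<le> c"
          using p by (auto simp: c_def)
        then have "2 * (c * ?e) \<le> a\<^sup>2"
          using young[of 1 c] \<open>b = 0\<close> by (simp add: mult.assoc)
        then show False
          using c zero_le_power2[of a] by linarith
      qed
    qed
    then show ?thesis
      unfolding a_def[symmetric] b_def[symmetric] using a b by (meson mult_nonneg_nonneg order_trans)
  next
    case False
    then have "0 < a" "0 < b" using a b by auto
    then have "2 * a * b * expectation (\<lambda>x. \<bar>f x * g x\<bar>) \<le> 2 * a * b * (a * b)"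
      using young[of b a] by (simp add: power2_eq_square mult_ac)
    then show ?thesis
      unfolding a_def[symmetric] b_def[symmetric] using \<open>0 < a\<close> \<open>0 < b\<close> by simp
  qed
qed

lemma (in prob_space) expectation_abs_le_sqrt:
  fixes f :: "'a \<Rightarrow> real"
  assumes "f \<in> borel_measurable M" "\<And>x. \<bar>f x\<bar> \<le> F"
  shows "expectation (\<lambda>x. \<bar>f x\<bar>) \<le> sqrt (expectation (\<lambda>x. (f x)\<^sup>2))"
  using cauchy_schwarz_bounded[OF assms(1) _ assms(2), of "\<lambda>_. 1" 1] by (simp add: prob_space)

section \<open>Second moments of Birkhoff sums\<close>

context mp_map
begin

definition bsum :: "('a \<Rightarrow> real) \<Rightarrow> nat \<Rightarrow> 'a \<Rightarrow> real" where
  "bsum g n x = (\<Sum>j<n. g ((T ^^ j) x))"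

definition acov :: "('a \<Rightarrow> real) \<Rightarrow> nat \<Rightarrow> real" where
  "acov g k = (\<integral>x. g x * g ((T ^^ k) x) \<partial>M)"

lemma bsum_measurable[measurable]:
  assumes [measurable]: "g \<in> borel_measurable M"
  shows "bsum g n \<in> borel_measurable M"
  unfolding bsum_def[abs_def] by measurable

lemma bsum_Suc: "bsum g (Suc n) x = g x + bsum g n (T x)"
  unfolding bsum_def by (subst sum.lessThan_Suc_shift) (simp add: funpow_swap1)

lemma bsum_bound: "(\<And>x. \<bar>g x\<bar> \<le> B) \<Longrightarrow> \<bar>bsum g n x\<bar> \<le> real n * B"
  unfolding bsum_def by (rule order_trans[OF sum_abs]) (simp add: sum_bounded_above[where K = B, of "{..<n}", simplified])

text \<open>Square \<open>g x + bsum g n (T x)\<close>: the cross term collects the autocovariances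
  at lags \<open>1\<close> to \<open>n\<close>, and invariance removes \<open>T\<close> from the
  square of the second summand.\<close>

lemma second_moment_bsum_Suc:
  assumes g[measurable]: "g \<in> borel_measurable M" and B: "\<And>x. \<bar>g x\<bar> \<le> B"
  shows "(\<integral>x. (bsum g (Suc n) x)\<^sup>2 \<partial>M)
    = (\<integral>x. (bsum g n x)\<^sup>2 \<partial>M) + (acov g 0 + 2 * (\<Sum>k<n. acov g (Suc k)))"
proof -
  have B0: "0 \<le> B" using B[of undefined] by linarith
  have ii: "integrable M (\<lambda>x. g x * g ((T ^^ k) x))" for k
    using B B0 by (intro integrable_bounded[where B = "B * B"]) (auto simp: abs_mult intro: mult_mono)
  have iS: "integrable M (\<lambda>x. 2 * (\<Sum>k<n. g x * g ((T ^^ Suc k) x)))"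
    by (intro integrable_mult_right Bochner_Integration.integrable_sum ii)
  have i2: "integrable M (\<lambda>x. (bsum g n (T x))\<^sup>2)"
    using bsum_bound[OF B, where n = n] B0
    by (intro integrable_bounded[where B = "(real n * B)\<^sup>2"]) (auto simp: abs_le_square_iff[symmetric])
  have "(\<integral>x. (bsum g (Suc n) x)\<^sup>2 \<partial>M)
    = (\<integral>x. (g x * g ((T ^^ 0) x) + 2 * (\<Sum>k<n. g x * g ((T ^^ Suc k) x))) + (bsum g n (T x))\<^sup>2 \<partial>M)"
    unfolding bsum_Suc
    by (intro Bochner_Integration.integral_cong)
       (auto simp: power2_eq_square bsum_def sum_distrib_left algebra_simps funpow_swap1)
  also have "\<dots> = (\<integral>x. g x * g ((T ^^ 0) x) + 2 * (\<Sum>k<n. g x * g ((T ^^ Suc k) x)) \<partial>M) + (\<integral>x. (bsum g n (T x))\<^sup>2 \<partial>M)"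
    by (rule Bochner_Integration.integral_add[OF Bochner_Integration.integrable_add[OF ii iS] i2])
  also have "(\<integral>x. g x * g ((T ^^ 0) x) + 2 * (\<Sum>k<n. g x * g ((T ^^ Suc k) x)) \<partial>M)
      = acov g 0 + 2 * (\<Sum>k<n. acov g (Suc k))"
    unfolding acov_def by (subst Bochner_Integration.integral_add[OF ii iS]) (simp add: ii del: funpow.simps)
  finally show ?thesis
    using integral_T[of "\<lambda>x. (bsum g n x)\<^sup>2"] by simp
qed

lemma second_moment_bsum_le:
  assumes "g \<in> borel_measurable M" and "\<And>x. \<bar>g x\<bar> \<le> B"
  shows "(\<integral>x. (bsum g n x)\<^sup>2 \<partial>M) \<le> real n * (2 * (\<Sum>k<n. \<bar>acov g k\<bar>))"
proof (induction n)
  case (Suc n)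
  have "(\<integral>x. (bsum g (Suc n) x)\<^sup>2 \<partial>M)
    = (\<integral>x. (bsum g n x)\<^sup>2 \<partial>M) + (acov g 0 + 2 * (\<Sum>k<n. acov g (Suc k)))"
    by (rule second_moment_bsum_Suc[OF assms])
  also have "(\<integral>x. (bsum g n x)\<^sup>2 \<partial>M) \<le> real n * (2 * (\<Sum>k<Suc n. \<bar>acov g k\<bar>))"
    by (rule order_trans[OF Suc]) (intro mult_left_mono, auto)
  also have "acov g 0 + 2 * (\<Sum>k<n. acov g (Suc k)) \<le> 2 * \<bar>acov g 0\<bar> + 2 * (\<Sum>k<n. \<bar>acov g (Suc k)\<bar>)"
    by (intro add_mono mult_left_mono sum_mono) auto
  also have "\<dots> = 2 * (\<Sum>k<Suc n. \<bar>acov g k\<bar>)"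
    by (subst sum.lessThan_Suc_shift) simp
  finally show ?case
    by (simp add: algebra_simps)
qed (simp add: bsum_def)

text \<open>The increments of the second moment are the partial sums of the long-run variance, so
  the quotient by \<open>n\<close> is their Cesaro mean.\<close>

lemma second_moment_bsum_lim:
  assumes "g \<in> borel_measurable M" and "\<And>x. \<bar>g x\<bar> \<le> B" and s: "summable (\<lambda>k. acov g (Suc k))"
  shows "(\<lambda>n. (\<integral>x. (bsum g n x)\<^sup>2 \<partial>M) / real n) \<longlonglongrightarrow> acov g 0 + 2 * (\<Sum>k. acov g (Suc k))"
proof -
  have "(\<integral>x. (bsum g n x)\<^sup>2 \<partial>M) = (\<Sum>m<n. acov g 0 + 2 * (\<Sum>k<m. acov g (Suc k)))" for n
  proof (induction n)
    case (Suc n)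
    then show ?case
      by (simp add: second_moment_bsum_Suc[OF assms(1,2)])
  qed (simp add: bsum_def)
  moreover have "(\<lambda>m. acov g 0 + 2 * (\<Sum>k<m. acov g (Suc k))) \<longlonglongrightarrow> acov g 0 + 2 * (\<Sum>k. acov g (Suc k))"
    using s by (intro tendsto_intros summable_LIMSEQ)
  ultimately show ?thesis
    using cesaro by simp
qed

end

section \<open>Estimates for complex exponentials\<close>

lemma cmod_iexp_diff_le: "cmod (iexp a - iexp b) \<le> \<bar>a - b\<bar>"
proof -
  have "iexp a - iexp b = iexp b * (iexp (a - b) - 1)"
    by (simp add: right_diff_distrib exp_add[symmetric] algebra_simps)
  then show ?thesis
    using iexp_approx1[of "a - b" 0] by (simp add: norm_mult)
qed

lemma cmod_one_plus_le: "cmod (1 + \<i> * complex_of_real y) \<le> exp (y\<^sup>2 / 2)"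
proof -
  have "cmod (1 + \<i> * complex_of_real y) = sqrt (1 + y\<^sup>2)"
    by (simp add: cmod_def)
  also have "\<dots> \<le> sqrt (exp (y\<^sup>2))"
    using exp_ge_add_one_self[of "y\<^sup>2"] by simp
  also have "\<dots> = exp (y\<^sup>2 / 2)"
    by (rule real_sqrt_unique) (auto simp: power2_eq_square exp_add[symmetric])
  finally show ?thesis .
qed

text \<open>Factors of modulus at most \<open>1\<close> are what the comparison of two products by
  the sum of the differences of their factors requires.\<close>

lemma cmod_one_plus_exp_le: "cmod ((1 + \<i> * complex_of_real y) * exp (- (y\<^sup>2 / 2))) \<le> 1"
proof -
  have "cmod (1 + \<i> * y) * exp (- (y\<^sup>2 / 2)) \<le> exp (y\<^sup>2 / 2) * exp (- (y\<^sup>2 / 2))"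
    by (intro mult_right_mono cmod_one_plus_le) auto
  then show ?thesis
    by (simp add: norm_mult exp_add[symmetric])
qed

text \<open>The logarithm of \<open>1 + \<i> * x\<close> is \<open>\<i> * x + x\<^sup>2 / 2\<close>
  up to third order, so both expressions agree to second order. For \<open>\<bar>x\<bar> > 1\<close>
  each has modulus at most \<open>1\<close> and the bound is trivial.\<close>

lemma iexp_eq_prod_approx:
  "cmod (iexp x - (1 + \<i> * x) * exp (- (x\<^sup>2 / 2))) \<le> 2 * \<bar>x\<bar> ^ 3"
proof (cases "\<bar>x\<bar> \<le> 1")
  case True
  define y where "y = x\<^sup>2 / 2"
  have y: "0 \<le> y" "y \<le> 1 / 2"
    using True by (auto simp: y_def abs_square_le_1)
  have e: "\<bar>exp (- y) - (1 - y)\<bar> \<le> y\<^sup>2"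
  proof -
    have "exp (- y) \<ge> 1 - y"
      using exp_ge_add_one_self[of "- y"] by simp
    moreover have "exp (- y) \<le> 1 - y + y\<^sup>2"
    proof -
      have "exp (- y) \<le> 1 / (1 + y)"
        using exp_ge_add_one_self[of y] y by (simp add: exp_minus field_simps)
      also have "\<dots> \<le> 1 - y + y\<^sup>2"
        using y by (simp add: field_simps power2_eq_square)
      finally show ?thesis .
    qed
    ultimately show ?thesis by simp
  qed
  have c2: "(\<Sum>k\<le>2. (\<i> * x) ^ k / fact k) = 1 + \<i> * x - y"
    by (simp add: numeral_2_eq_2 y_def power2_eq_square algebra_simps)
  have a: "cmod (iexp x - (1 + \<i> * x - y)) \<le> \<bar>x\<bar> ^ 3 / 6"
    using iexp_approx1[of x 2] unfolding c2 by (simp add: fact_numeral)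
  have b: "cmod ((1 + \<i> * x) * of_real (exp (- y) - (1 - y))) \<le> 2 * y\<^sup>2"
    unfolding norm_mult norm_of_real using e True
    by (intro mult_mono order_trans[OF norm_triangle_ineq]) (auto simp: norm_mult)
  have yx: "\<bar>x\<bar> * y = \<bar>x\<bar> ^ 3 / 2" "y\<^sup>2 = \<bar>x\<bar> ^ 3 * \<bar>x\<bar> / 4"
    by (simp_all add: y_def power2_eq_square power3_eq_cube)
  have "y\<^sup>2 \<le> \<bar>x\<bar> ^ 3 / 4"
    unfolding yx using mult_left_mono[OF True, of "\<bar>x\<bar> ^ 3"] by simp
  have "iexp x - (1 + \<i> * x) * exp (- y)
      = (iexp x - (1 + \<i> * x - y)) - (1 + \<i> * x) * of_real (exp (- y) - (1 - y)) + \<i> * x * y"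
    by (simp add: algebra_simps)
  also have "cmod \<dots> \<le> \<bar>x\<bar> ^ 3 / 6 + 2 * y\<^sup>2 + \<bar>x\<bar> * y"
    using y(1)
    by (intro order_trans[OF norm_triangle_ineq add_mono[OF order_trans[OF norm_triangle_ineq4 add_mono[OF a b]]]])
       (simp add: norm_mult)
  also have "\<dots> \<le> 2 * \<bar>x\<bar> ^ 3"
    using \<open>y\<^sup>2 \<le> \<bar>x\<bar> ^ 3 / 4\<close> yx(1) zero_le_power[of "\<bar>x\<bar>" 3] by linarith
  finally show ?thesis
    by (simp add: y_def)
next
  case False
  have "cmod (iexp x - (1 + \<i> * x) * exp (- (x\<^sup>2 / 2))) \<le> 1 + 1"
    by (intro order_trans[OF norm_triangle_ineq4] add_mono cmod_one_plus_exp_le) auto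
  also have "\<dots> \<le> 2 * \<bar>x\<bar> ^ 3"
    using False one_le_power[of "\<bar>x\<bar>" 3] by simp
  finally show ?thesis .
qed

context mp_map
begin

lemma complex_orthogonal:
  fixes D :: "'a \<Rightarrow> real" and q :: "'a \<Rightarrow> complex"
  assumes [measurable]: "D \<in> borel_measurable M" "q \<in> borel_measurable M"
    and D: "\<And>x. \<bar>D x\<bar> \<le> C" and q: "\<And>x. cmod (q x) \<le> B"
    and orth: "\<And>\<phi> b. \<phi> \<in> borel_measurable M \<Longrightarrow> (\<And>x. \<bar>\<phi> x\<bar> \<le> b) \<Longrightarrow> (\<integral>x. D x * \<phi> (T x) \<partial>M) = 0"
  shows "(\<integral>x. complex_of_real (D x) * q (T x) \<partial>M) = 0"
proof -
  have "0 \<le> C" using D[of undefined] by linarith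
  then have i: "integrable M (\<lambda>x. complex_of_real (D x) * q (T x))"
    using D q by (intro integrable_bounded[where B = "C * B"]) (auto simp: norm_mult intro: mult_mono)
  have "(\<integral>x. D x * Re (q (T x)) \<partial>M) = 0" "(\<integral>x. D x * Im (q (T x)) \<partial>M) = 0"
    using orth[of "\<lambda>x. Re (q x)" B] orth[of "\<lambda>x. Im (q x)" B] q abs_Re_le_cmod abs_Im_le_cmod order_trans
    by (auto; blast)+
  then show ?thesis
    using integral_Re[OF i] integral_Im[OF i] by (simp add: complex_eq_iff)
qed

end

text \<open>McLeish's argument: since \<open>D\<close> is orthogonal to functions of \<open>T x\<close>, the product of the
  \<open>1 + \<i> w D(T\<^sup>j x)\<close> has mean \<open>1\<close>, while Birkhoff's theorem makes the quadratic correction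
  asymptotically constant.\<close>

theorem (in ergodic_map) bounded_martingale_clt:
  fixes D :: "'a \<Rightarrow> real"
  assumes D[measurable]: "D \<in> borel_measurable M" and C: "\<And>x. \<bar>D x\<bar> \<le> C"
    and orth: "\<And>\<phi> b. \<phi> \<in> borel_measurable M \<Longrightarrow> (\<And>x. \<bar>\<phi> x\<bar> \<le> b) \<Longrightarrow> (\<integral>x. D x * \<phi> (T x) \<partial>M) = 0"
  shows "(\<lambda>n. \<integral>x. iexp (bsum D n x / sqrt (real n)) \<partial>M) \<longlonglongrightarrow> exp (- ((\<integral>x. (D x)\<^sup>2 \<partial>M) / 2))"
proof -
  have C0: "0 \<le> C" using C[of undefined] by linarith
  define s where "s = (\<integral>x. (D x)\<^sup>2 \<partial>M)"
  define q where "q w n x = (\<Prod>j<n. 1 + \<i> * complex_of_real (w * D ((T ^^ j) x)))" for w :: real and n x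
  have q_meas[measurable]: "q w n \<in> borel_measurable M" for w n
    unfolding q_def[abs_def] by measurable
  have q_le: "cmod (q w n x) \<le> exp (w\<^sup>2 * (\<Sum>j<n. (D ((T ^^ j) x))\<^sup>2) / 2)" for w n x
  proof -
    have "cmod (q w n x) \<le> (\<Prod>j<n. exp ((w * D ((T ^^ j) x))\<^sup>2 / 2))"
      unfolding q_def prod_norm[symmetric] by (intro prod_mono conjI cmod_one_plus_le norm_ge_zero)
    also have "\<dots> = exp (w\<^sup>2 * (\<Sum>j<n. (D ((T ^^ j) x))\<^sup>2) / 2)"
      by (simp add: exp_sum[symmetric] power_mult_distrib sum_distrib_left sum_divide_distrib)
    finally show ?thesis .
  qed
  have sumD: "(\<Sum>j<n. (D ((T ^^ j) x))\<^sup>2) \<le> real n * C\<^sup>2" for n x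
    using sum_bounded_above[of "{..<n}" "\<lambda>j. (D ((T ^^ j) x))\<^sup>2" "C\<^sup>2"] power_mono[OF C abs_ge_zero, of _ 2]
    by simp
  have q_bound: "cmod (q w n x) \<le> exp (w\<^sup>2 * (real n * C\<^sup>2) / 2)" for w n x
    by (rule order_trans[OF q_le]) (simp add: mult_left_mono sumD)
  have q1: "(\<integral>x. q w n x \<partial>M) = 1" for w n
  proof (induction n)
    case (Suc n)
    have eq: "q w (Suc n) x = q w n (T x) + \<i> * w * (D x * q w n (T x))" for x
      unfolding q_def by (subst prod.lessThan_Suc_shift) (simp add: funpow_swap1 algebra_simps)
    have i1: "integrable M (\<lambda>x. q w n (T x))"
      using q_bound by (intro integrable_bounded) auto
    have i2: "integrable M (\<lambda>x. complex_of_real (D x) * q w n (T x))"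
      using q_bound[of w n] C C0
      by (intro integrable_bounded[where B = "C * exp (w\<^sup>2 * (real n * C\<^sup>2) / 2)"])
         (auto simp: norm_mult intro!: mult_mono)
    have "(\<integral>x. q w (Suc n) x \<partial>M) = (\<integral>x. q w n (T x) \<partial>M) + \<i> * w * (\<integral>x. D x * q w n (T x) \<partial>M)"
      unfolding eq using i1 i2 by (subst Bochner_Integration.integral_add) auto
    also have "(\<integral>x. D x * q w n (T x) \<partial>M) = 0"
      by (rule complex_orthogonal[OF D q_meas C q_bound orth])
    finally show ?case
      by (simp add: integral_T Suc)
  qed (simp add: q_def prob_space)
  define V where "V n x = (\<Sum>j<n. (D ((T ^^ j) x))\<^sup>2) / real n" for n x
  have V_meas[measurable]: "V n \<in> borel_measurable M" for n
    unfolding V_def[abs_def] by measurable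
  have V0: "0 \<le> V n x" for n x
    by (auto simp: V_def intro!: sum_nonneg divide_nonneg_nonneg)
  let ?w = "\<lambda>n. 1 / sqrt (real n)"
  have w2: "(?w n)\<^sup>2 * real n \<le> 1" for n
    by (cases "n = 0") (auto simp: power_divide)
  \<comment> \<open>At \<open>w = 1 / sqrt n\<close> the products are bounded uniformly in
    \<open>n\<close> and \<open>x\<close>, so multiplying them by a bounded factor that tends to
    \<open>0\<close> almost surely gives a vanishing integral.\<close>
  have qw: "cmod (q (?w n) n x) \<le> exp (C\<^sup>2 / 2)" for n x
  proof (rule order_trans[OF q_bound], subst exp_le_cancel_iff)
    show "(?w n)\<^sup>2 * (real n * C\<^sup>2) / 2 \<le> C\<^sup>2 / 2"
      using mult_right_mono[OF w2[of n], of "C\<^sup>2"] by (simp add: mult.assoc)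
  qed
  have approx: "cmod (iexp (bsum D n x / sqrt (real n)) - q (?w n) n x * exp (- (V n x / 2)))
      \<le> 2 * C ^ 3 / sqrt (real n)" if n: "0 < n" for n x
  proof -
    let ?y = "\<lambda>j. ?w n * D ((T ^^ j) x)"
    have e1: "iexp (bsum D n x / sqrt (real n)) = (\<Prod>j<n. iexp (?y j))"
      by (simp add: bsum_def exp_sum[symmetric] sum_divide_distrib sum_distrib_left)
    have e2: "q (?w n) n x * exp (- (V n x / 2)) = (\<Prod>j<n. (1 + \<i> * ?y j) * exp (- ((?y j)\<^sup>2 / 2)))"
      unfolding q_def V_def prod.distrib of_real_prod[symmetric]
      by (simp add: exp_sum[symmetric] sum_negf power_divide sum_divide_distrib[symmetric] flip: of_real_prod)
    have "cmod ((\<Prod>j<n. iexp (?y j)) - (\<Prod>j<n. (1 + \<i> * ?y j) * exp (- ((?y j)\<^sup>2 / 2))))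
      \<le> (\<Sum>j<n. cmod (iexp (?y j) - (1 + \<i> * ?y j) * exp (- ((?y j)\<^sup>2 / 2))))"
      by (intro norm_prod_diff cmod_one_plus_exp_le) auto
    also have "\<dots> \<le> (\<Sum>j<n. 2 * (C / sqrt (real n)) ^ 3)"
    proof (rule sum_mono)
      fix j
      have "\<bar>?y j\<bar> \<le> C / sqrt (real n)"
        using C by (simp add: abs_mult divide_right_mono)
      then have "2 * \<bar>?y j\<bar> ^ 3 \<le> 2 * (C / sqrt (real n)) ^ 3"
        by (intro mult_left_mono power_mono) auto
      then show "cmod (iexp (?y j) - (1 + \<i> * ?y j) * exp (- ((?y j)\<^sup>2 / 2))) \<le> 2 * (C / sqrt (real n)) ^ 3"
        by (rule order_trans[OF iexp_eq_prod_approx])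
    qed
    also have "\<dots> = 2 * C ^ 3 / sqrt (real n)"
      using n by (simp add: power_divide power3_eq_cube)
    finally show ?thesis
      unfolding e1 e2 .
  qed
  have lim1: "(\<lambda>n. \<integral>x. q (?w n) n x * (exp (- (V n x / 2)) - exp (- (s / 2))) \<partial>M) \<longlonglongrightarrow> 0"
  proof -
    have Vlim: "AE x in M. (\<lambda>n. V n x) \<longlonglongrightarrow> s"
      unfolding V_def s_def
      using birkhoff_bounded[of "\<lambda>x. (D x)\<^sup>2" "C\<^sup>2"] C C0 by (simp add: abs_le_square_iff[symmetric])
    have "(\<lambda>n. \<integral>x. q (?w n) n x * (exp (- (V n x / 2)) - exp (- (s / 2))) \<partial>M) \<longlonglongrightarrow> (\<integral>x. 0 \<partial>M)"
    proof (rule integral_dominated_convergence[where w = "\<lambda>_. exp (C\<^sup>2 / 2) * 2"])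
      show "AE x in M. (\<lambda>n. q (?w n) n x * (exp (- (V n x / 2)) - exp (- (s / 2)))) \<longlonglongrightarrow> 0"
        using Vlim
      proof eventually_elim
        case (elim x)
        have "(\<lambda>n. complex_of_real (exp (- (V n x / 2)) - exp (- (s / 2)))) \<longlonglongrightarrow> of_real (exp (- (s / 2)) - exp (- (s / 2)))"
          by (intro tendsto_intros elim) auto
        then have "(\<lambda>n. complex_of_real (exp (- (V n x / 2)) - exp (- (s / 2)))) \<longlonglongrightarrow> 0"
          by simp
        then show ?case
          using qw by (intro lim_null_mult_left_bounded[where B = "exp (C\<^sup>2 / 2)"]) (auto simp: norm_mult)
      qed
      show "AE x in M. cmod (q (?w n) n x * (exp (- (V n x / 2)) - exp (- (s / 2)))) \<le> exp (C\<^sup>2 / 2) * 2" for n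
      proof (rule AE_I2)
        fix x
        have "0 \<le> s" by (simp add: s_def)
        then have "\<bar>exp (- (V n x / 2)) - exp (- (s / 2))\<bar> \<le> 2"
          using V0[of n x] exp_le_one_iff[of "- (V n x / 2)"] exp_le_one_iff[of "- (s / 2)"]
            exp_gt_zero[of "- (V n x / 2)"] exp_gt_zero[of "- (s / 2)"] by linarith
        then show "cmod (q (?w n) n x * (exp (- (V n x / 2)) - exp (- (s / 2)))) \<le> exp (C\<^sup>2 / 2) * 2"
          unfolding norm_mult using qw[of n x]
          by (intro mult_mono) (auto simp del: of_real_diff simp flip: of_real_diff)
      qed
    qed auto
    then show ?thesis by simp
  qed
  \<comment> \<open>Since \<open>q\<close> has mean \<open>1\<close>, the target is the integral of
    \<open>q\<close> times the constant \<open>exp (- (s / 2))\<close>. The difference splits into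
    the error of the factorwise approximation and the fluctuation of \<open>V n\<close> around
    \<open>s\<close>.\<close>
  have bound: "cmod ((\<integral>x. iexp (bsum D n x / sqrt (real n)) \<partial>M) - exp (- (s / 2)))
      \<le> 2 * C ^ 3 / sqrt (real n) + cmod (\<integral>x. q (?w n) n x * (exp (- (V n x / 2)) - exp (- (s / 2))) \<partial>M)"
    if n: "0 < n" for n
  proof -
    have e1: "exp (- (V n x / 2)) \<le> 1" for x
      using V0[of n x] by simp
    have i1: "integrable M (\<lambda>x. iexp (bsum D n x / sqrt (real n)))"
      by (intro integrable_bounded[where B = 1]) auto
    have i2: "integrable M (\<lambda>x. q (?w n) n x * complex_of_real (exp (- (V n x / 2))))"
      by (intro integrable_bounded[where B = "exp (C\<^sup>2 / 2)"])
         (auto simp: norm_mult intro!: order_trans[OF mult_left_le[OF e1 norm_ge_zero] qw])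
    have i3: "integrable M (\<lambda>x. q (?w n) n x)"
      using qw[of n] by (intro integrable_bounded) auto
    have "(\<integral>x. iexp (bsum D n x / sqrt (real n)) \<partial>M) - exp (- (s / 2))
      = (\<integral>x. iexp (bsum D n x / sqrt (real n)) - q (?w n) n x * exp (- (V n x / 2)) \<partial>M)
        + (\<integral>x. q (?w n) n x * (exp (- (V n x / 2)) - exp (- (s / 2))) \<partial>M)"
      using i1 i2 i3 by (simp add: right_diff_distrib q1)
    moreover have "cmod (\<integral>x. iexp (bsum D n x / sqrt (real n)) - q (?w n) n x * exp (- (V n x / 2)) \<partial>M)
      \<le> 2 * C ^ 3 / sqrt (real n)"
    proof (rule order_trans[OF integral_norm_bound integral_le_const])
      show "integrable M (\<lambda>x. cmod (iexp (bsum D n x / sqrt (real n)) - q (?w n) n x * exp (- (V n x / 2))))"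
        using i1 i2 by (intro integrable_norm Bochner_Integration.integrable_diff)
    qed (use approx[OF n] in auto)
    ultimately show ?thesis
      by (simp only:) (rule order_trans[OF norm_triangle_ineq add_right_mono])
  qed
  have ev: "\<forall>\<^sub>F n in sequentially. cmod ((\<integral>x. iexp (bsum D n x / sqrt (real n)) \<partial>M) - exp (- (s / 2)))
      \<le> 2 * C ^ 3 / sqrt (real n) + cmod (\<integral>x. q (?w n) n x * (exp (- (V n x / 2)) - exp (- (s / 2))) \<partial>M)"
    using eventually_gt_at_top[of 0] by eventually_elim (rule bound)
  have "(\<lambda>n. 2 * C ^ 3 / sqrt (real n)) \<longlonglongrightarrow> 0"
    by (rule real_tendsto_divide_at_top[OF tendsto_const filterlim_compose[OF sqrt_at_top filterlim_real_sequentially]])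
  with tendsto_norm_zero[OF lim1]
  have "(\<lambda>n. 2 * C ^ 3 / sqrt (real n)
      + cmod (\<integral>x. q (?w n) n x * (exp (- (V n x / 2)) - exp (- (s / 2))) \<partial>M)) \<longlonglongrightarrow> 0"
    using tendsto_add_zero by blast
  from Lim_null_comparison[OF ev this] show ?thesis
    unfolding s_def[symmetric] by (simp add: LIM_zero_iff)
qed


text \<open>Gordin's approximation: \<open>e k\<close> is the image of \<open>Z\<close> under the \<open>k\<close>-th power of the
  transfer operator, and up to a coboundary and a small remainder \<open>Z\<close> is the martingale difference
  \<open>\<Sum>k<K. e k - e (k + 1) \<circ> T\<close>.\<close>

theorem (in ergodic_map) gordin_clt:
  fixes Z :: "'a \<Rightarrow> real" and e :: "nat \<Rightarrow> 'a \<Rightarrow> real"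
  assumes e[measurable]: "\<And>k. e k \<in> borel_measurable M" and C: "\<And>k x. \<bar>e k x\<bar> \<le> C"
    and e0: "e 0 = Z"
    and adj: "\<And>k \<phi> b. \<phi> \<in> borel_measurable M \<Longrightarrow> (\<And>x. \<bar>\<phi> x\<bar> \<le> b) \<Longrightarrow>
      (\<integral>x. e k x * \<phi> x \<partial>M) = (\<integral>x. Z x * \<phi> ((T ^^ k) x) \<partial>M)"
    and \<gamma>: "summable \<gamma>" "\<And>k. 0 \<le> \<gamma> k"
    and \<gamma>_bound: "\<And>k \<phi> b. \<phi> \<in> borel_measurable M \<Longrightarrow> (\<And>x. \<bar>\<phi> x\<bar> \<le> b) \<Longrightarrow>
      \<bar>\<integral>x. Z x * \<phi> ((T ^^ k) x) \<partial>M\<bar> \<le> b * \<gamma> k"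
  shows "(\<lambda>n. \<integral>x. iexp (bsum Z n x / sqrt (real n)) \<partial>M)
    \<longlonglongrightarrow> exp (- ((acov Z 0 + 2 * (\<Sum>k. acov Z (Suc k))) / 2))"
proof -
  have C0: "0 \<le> C" using C[of 0 undefined] by linarith
  have Z[measurable]: "Z \<in> borel_measurable M" and ZC: "\<And>x. \<bar>Z x\<bar> \<le> C"
    using e[of 0] C[of 0] by (auto simp: e0)
  define s where "s = acov Z 0 + 2 * (\<Sum>k. acov Z (Suc k))"
  define D where "D K x = (\<Sum>k<K. e k x - e (Suc k) (T x))" for K x
  \<comment> \<open>The telescoping sum in \<open>D K x\<close> ends in \<open>Z (T x)\<close>
    instead of \<open>Z x\<close>, so the sums of \<open>Z\<close> are started at
    \<open>T x\<close>; by invariance this leaves their law unchanged.\<close>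
  define R where "R K n x = bsum Z n (T x) - bsum (D K) n x" for K n x
  define \<theta> where "\<theta> K x = (\<Sum>k<K. e k x)" for K x
  \<comment> \<open>Twice the sum of the bounds \<open>C * \<gamma> (k + K)\<close> on the
    autocovariances of \<open>e K\<close>: it bounds the second moment per step of the part of
    \<open>R\<close> that is not a coboundary.\<close>
  define \<rho> where "\<rho> K = 2 * C * (\<Sum>k. \<gamma> (k + K))" for K
  have D_meas[measurable]: "D K \<in> borel_measurable M" and \<theta>_meas[measurable]: "\<theta> K \<in> borel_measurable M"
    and R_meas[measurable]: "R K n \<in> borel_measurable M" for K n
    unfolding D_def[abs_def] \<theta>_def[abs_def] R_def[abs_def] by measurable
  have D_bound: "\<bar>D K x\<bar> \<le> real K * (2 * C)" for K x
  proof -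
    have "\<bar>e k x - e (Suc k) (T x)\<bar> \<le> 2 * C" for k
      using C[of k x] C[of "Suc k" "T x"] by linarith
    then show ?thesis
      unfolding D_def
      using sum_bounded_above[of "{..<K}" "\<lambda>k. \<bar>e k x - e (Suc k) (T x)\<bar>" "2 * C"] by (intro order_trans[OF sum_abs]) auto
  qed
  have \<theta>_bound: "\<bar>\<theta> K x\<bar> \<le> real K * C" for K x
    unfolding \<theta>_def using sum_bounded_above[of "{..<K}" "\<lambda>k. \<bar>e k x\<bar>" C] C by (intro order_trans[OF sum_abs]) auto
  have D_orth: "(\<integral>x. D K x * \<phi> (T x) \<partial>M) = 0"
    if [measurable]: "\<phi> \<in> borel_measurable M" and b: "\<And>x. \<bar>\<phi> x\<bar> \<le> b" for K \<phi> b
  proof -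
    have b0: "0 \<le> b" using b[of undefined] by linarith
    have i: "integrable M (\<lambda>x. e k x * \<phi> (T x))" "integrable M (\<lambda>x. e k (T x) * \<phi> (T x))" for k
      using C b C0 b0 by (auto intro!: integrable_bounded[where B = "C * b"] mult_mono simp: abs_mult)
    \<comment> \<open>Both sides are the correlation of \<open>Z\<close> with \<open>\<phi>\<close>
      composed with the power \<open>Suc k\<close> of \<open>T\<close>: adjointness applies to
      \<open>e k\<close> tested against \<open>\<phi>\<close> after \<open>T\<close>, and to
      \<open>e (Suc k)\<close> tested against \<open>\<phi>\<close>.\<close>
    have "(\<integral>x. e k x * \<phi> (T x) \<partial>M) = (\<integral>x. e (Suc k) (T x) * \<phi> (T x) \<partial>M)" for k
    proof -
      have "(\<integral>x. e k x * \<phi> (T x) \<partial>M) = (\<integral>x. Z x * \<phi> ((T ^^ Suc k) x) \<partial>M)"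
        using adj[of "\<lambda>x. \<phi> (T x)" b k] b by simp
      also have "\<dots> = (\<integral>x. e (Suc k) x * \<phi> x \<partial>M)"
        using adj[of \<phi> b "Suc k"] b by simp
      also have "\<dots> = (\<integral>x. e (Suc k) (T x) * \<phi> (T x) \<partial>M)"
        using integral_T[of "\<lambda>x. e (Suc k) x * \<phi> x"] by simp
      finally show ?thesis .
    qed
    then show ?thesis
      unfolding D_def using i by (simp add: sum_distrib_right left_diff_distrib)
  qed
  have cob: "Z (T x) = D K x - \<theta> K x + \<theta> K (T x) + e K (T x)" for K x
  proof (induction K)
    case (Suc K)
    then show ?case by (simp add: D_def \<theta>_def)
  qed (simp add: D_def \<theta>_def e0)
  have R_eq: "R K n x = \<theta> K ((T ^^ n) x) - \<theta> K x + bsum (e K) n (T x)" for K n x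
  proof (induction n arbitrary: x)
    case (Suc n)
    have "R K (Suc n) x = Z (T x) - D K x + R K n (T x)"
      by (simp add: R_def bsum_Suc)
    then show ?case
      by (simp add: Suc cob[of x K] bsum_Suc funpow_swap1)
  qed (simp add: R_def bsum_def)
  \<comment> \<open>Adjointness turns the autocovariance of \<open>e K\<close> at lag
    \<open>k\<close> into a correlation of \<open>Z\<close> at lag \<open>k + K\<close>, which is
    small for large \<open>K\<close> summably in \<open>k\<close>.\<close>
  have acov_e: "\<bar>acov (e K) k\<bar> \<le> C * \<gamma> (k + K)" for K k
  proof -
    have "acov (e K) k = (\<integral>x. Z x * e K ((T ^^ (k + K)) x) \<partial>M)"
      unfolding acov_def using adj[of "\<lambda>x. e K ((T ^^ k) x)" C K] C by (simp add: funpow_add)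
    then show ?thesis
      using \<gamma>_bound[of "e K" C "k + K"] C by simp
  qed
  have sumK: "summable (\<lambda>k. \<gamma> (k + K))" for K
    using \<gamma>(1) by (rule summable_ignore_initial_segment)
  have \<rho>0: "0 \<le> \<rho> K" for K
    unfolding \<rho>_def using C0 suminf_nonneg[OF sumK] \<gamma>(2) by simp
  have \<rho>_lim: "\<rho> \<longlonglongrightarrow> 0"
    unfolding \<rho>_def using suminf_exist_split2[OF \<gamma>(1)] by (auto intro!: tendsto_mult_right_zero)
  have bsum_e: "(\<integral>x. (bsum (e K) n (T x))\<^sup>2 \<partial>M) \<le> real n * \<rho> K" for K n
  proof -
    have "(\<integral>x. (bsum (e K) n (T x))\<^sup>2 \<partial>M) = (\<integral>x. (bsum (e K) n x)\<^sup>2 \<partial>M)"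
      using integral_T[of "\<lambda>x. (bsum (e K) n x)\<^sup>2"] by simp
    also have "\<dots> \<le> real n * (2 * (\<Sum>k<n. \<bar>acov (e K) k\<bar>))"
      by (rule second_moment_bsum_le[OF e C])
    also have "(\<Sum>k<n. \<bar>acov (e K) k\<bar>) \<le> (\<Sum>k<n. C * \<gamma> (k + K))"
      by (intro sum_mono acov_e)
    also have "\<dots> \<le> C * (\<Sum>k. \<gamma> (k + K))"
      unfolding sum_distrib_left[symmetric]
      by (intro mult_left_mono sum_le_suminf sumK) (auto simp: \<gamma>(2) C0)
    finally show ?thesis
      by (simp add: \<rho>_def mult.assoc mult_left_mono)
  qed
  define B where "B K n = 2 * real K * C + real n * C" for K n
  have R_bound: "\<bar>R K n x\<bar> \<le> B K n" for K n x
    using \<theta>_bound[of K x] \<theta>_bound[of K "(T ^^ n) x"] bsum_bound[of "e K" C n "T x", OF C]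
    unfolding R_eq B_def by linarith
  have iB: "integrable M (\<lambda>x. (bsum (e K) n (T x))\<^sup>2)" for K n
    using power_mono[OF bsum_bound[of "e K" C n, OF C] abs_ge_zero, of _ 2]
    by (intro integrable_bounded[where B = "(real n * C)\<^sup>2"]) auto
  have R2: "(\<integral>x. (R K n x)\<^sup>2 \<partial>M) \<le> 2 * (2 * real K * C)\<^sup>2 + 2 * (real n * \<rho> K)" for K n
  proof -
    have "(\<integral>x. (R K n x)\<^sup>2 \<partial>M) \<le> (\<integral>x. 2 * (2 * real K * C)\<^sup>2 + 2 * (bsum (e K) n (T x))\<^sup>2 \<partial>M)"
    proof (rule integral_mono)
      show "integrable M (\<lambda>x. (R K n x)\<^sup>2)"
        using power_mono[OF R_bound abs_ge_zero, of K n _ 2] by (intro integrable_bounded) auto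
      show "integrable M (\<lambda>x. 2 * (2 * real K * C)\<^sup>2 + 2 * (bsum (e K) n (T x))\<^sup>2)"
        using iB by simp
      fix x
      let ?a = "\<theta> K ((T ^^ n) x) - \<theta> K x" and ?b = "bsum (e K) n (T x)"
      have "\<bar>?a\<bar> \<le> 2 * real K * C"
        using \<theta>_bound[of K x] \<theta>_bound[of K "(T ^^ n) x"] by linarith
      then have "?a\<^sup>2 \<le> (2 * real K * C)\<^sup>2"
        using power_mono[OF _ abs_ge_zero, of ?a _ 2] by simp
      moreover have "(?a + ?b)\<^sup>2 \<le> 2 * ?a\<^sup>2 + 2 * ?b\<^sup>2"
        using zero_le_power2[of "?a - ?b"] by (simp add: power2_eq_square algebra_simps)
      ultimately show "(R K n x)\<^sup>2 \<le> 2 * (2 * real K * C)\<^sup>2 + 2 * ?b\<^sup>2"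
        unfolding R_eq by linarith
    qed
    also have "\<dots> = 2 * (2 * real K * C)\<^sup>2 + 2 * (\<integral>x. (bsum (e K) n (T x))\<^sup>2 \<partial>M)"
      using iB by (simp add: prob_space)
    also have "\<dots> \<le> 2 * (2 * real K * C)\<^sup>2 + 2 * (real n * \<rho> K)"
      using bsum_e[of K n] by simp
    finally show ?thesis .
  qed
  have acovZ: "\<bar>acov Z k\<bar> \<le> C * \<gamma> k" for k
    unfolding acov_def using \<gamma>_bound[OF Z ZC] .
  have sum_acov: "summable (\<lambda>k. acov Z (Suc k))"
    using acovZ by (intro summable_comparison_test'[OF summable_mult[OF sumK[of 1]], of 0 _ C]) simp
  define \<tau> where "\<tau> K = (\<integral>x. (D K x)\<^sup>2 \<partial>M)" for K
  have \<tau>0: "0 \<le> \<tau> K" for K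
    by (simp add: \<tau>_def)
  \<comment> \<open>Martingale differences are orthogonal, so the second moment grows exactly
    linearly.\<close>
  have D2: "(\<integral>x. (bsum (D K) n x)\<^sup>2 \<partial>M) = real n * \<tau> K" for K n
  proof (induction n)
    case (Suc n)
    have "acov (D K) (Suc k) = 0" for k
      unfolding acov_def using D_orth[of "\<lambda>x. D K ((T ^^ k) x)" "real K * (2 * C)" K] D_bound
      by (simp add: funpow_swap1)
    moreover have "acov (D K) 0 = \<tau> K"
      by (simp add: acov_def \<tau>_def power2_eq_square)
    ultimately show ?case
      unfolding second_moment_bsum_Suc[OF D_meas D_bound] Suc by (simp add: algebra_simps)
  qed (simp add: bsum_def)
  define v where "v n = (\<integral>x. (bsum Z n (T x))\<^sup>2 \<partial>M) / real n" for n
  have v_lim: "v \<longlonglongrightarrow> s"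
  proof -
    have "v = (\<lambda>n. (\<integral>x. (bsum Z n x)\<^sup>2 \<partial>M) / real n)"
      unfolding v_def using integral_T[of "\<lambda>x. (bsum Z _ x)\<^sup>2"] by simp
    then show ?thesis
      unfolding s_def using second_moment_bsum_lim[OF Z ZC sum_acov] by simp
  qed
  define r where "r K n = sqrt (2 * (2 * real K * C)\<^sup>2 / real n + 2 * \<rho> K)" for K n
  have r0: "0 \<le> r K n" for K n
    using \<rho>0 by (simp add: r_def)
  have r_lim: "(\<lambda>n. r K n) \<longlonglongrightarrow> sqrt (2 * \<rho> K)" for K
  proof -
    have "(\<lambda>n. sqrt (2 * (2 * real K * C)\<^sup>2 / real n + 2 * \<rho> K)) \<longlonglongrightarrow> sqrt (0 + 2 * \<rho> K)"
      by (intro tendsto_intros lim_const_over_n)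
    then show ?thesis by (simp add: r_def)
  qed
  have R_r: "sqrt (\<integral>x. (R K n x)\<^sup>2 \<partial>M) \<le> sqrt (real n) * r K n" if "0 < n" for K n
  proof -
    have "sqrt (real n) * r K n = sqrt (real n * (2 * (2 * real K * C)\<^sup>2 / real n + 2 * \<rho> K))"
      by (simp add: r_def real_sqrt_mult)
    also have "real n * (2 * (2 * real K * C)\<^sup>2 / real n + 2 * \<rho> K) = 2 * (2 * real K * C)\<^sup>2 + 2 * (real n * \<rho> K)"
      using that by (simp add: field_simps)
    finally show ?thesis
      using R2[of K n] by simp
  qed
  \<comment> \<open>The sum of \<open>D K\<close> is that of \<open>Z\<close> minus
    \<open>R\<close>. Expanding its square and estimating the cross term by Cauchy-Schwarz compares
    the two variances per step.\<close>
  have SR: "\<bar>\<tau> K - v n\<bar> \<le> 2 * sqrt (v n) * r K n + (r K n)\<^sup>2" if n: "0 < n" for K n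
  proof -
    let ?S = "\<lambda>x. bsum Z n (T x)"
    have S_bound: "\<bar>?S x\<bar> \<le> real n * C" for x
      using bsum_bound[OF ZC] .
    have sq: "integrable M (\<lambda>x. (h x)\<^sup>2)"
      if "h \<in> borel_measurable M" "\<And>x. \<bar>h x\<bar> \<le> b" for h :: "'a \<Rightarrow> real" and b
      using that(1) power_mono[OF that(2) abs_ge_zero, of _ 2]
      by (intro integrable_bounded[where B = "b\<^sup>2"]) auto
    have iS: "integrable M (\<lambda>x. (?S x)\<^sup>2)" and iR: "integrable M (\<lambda>x. (R K n x)\<^sup>2)"
      by (rule sq[OF _ S_bound] sq[OF _ R_bound]; measurable)+
    have nC: "0 \<le> real n * C" using C0 by simp
    have iSR: "integrable M (\<lambda>x. ?S x * R K n x)"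
      using S_bound R_bound
      by (intro integrable_bounded[where B = "(real n * C) * B K n"]) (auto simp: abs_mult intro!: mult_mono nC)
    have "real n * \<tau> K = (\<integral>x. (?S x)\<^sup>2 - 2 * (?S x * R K n x) + (R K n x)\<^sup>2 \<partial>M)"
      unfolding D2[symmetric] by (simp add: R_def power2_eq_square algebra_simps)
    also have "\<dots> = real n * v n - 2 * (\<integral>x. ?S x * R K n x \<partial>M) + (\<integral>x. (R K n x)\<^sup>2 \<partial>M)"
      using iS iR iSR n by (simp add: v_def)
    moreover have R2_nonneg: "0 \<le> (\<integral>x. (R K n x)\<^sup>2 \<partial>M)"
      by simp
    ultimately have "\<bar>real n * \<tau> K - real n * v n\<bar> \<le> 2 * \<bar>\<integral>x. ?S x * R K n x \<partial>M\<bar> + (\<integral>x. (R K n x)\<^sup>2 \<partial>M)"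
      using R2_nonneg by linarith
    also have "\<dots> \<le> 2 * (sqrt (real n * v n) * (sqrt (real n) * r K n)) + (sqrt (real n) * r K n)\<^sup>2"
    proof (intro add_mono mult_left_mono)
      have "\<bar>\<integral>x. ?S x * R K n x \<partial>M\<bar> \<le> (\<integral>x. \<bar>?S x * R K n x\<bar> \<partial>M)"
        by (rule integral_abs_bound)
      also have "\<dots> \<le> sqrt (\<integral>x. (?S x)\<^sup>2 \<partial>M) * sqrt (\<integral>x. (R K n x)\<^sup>2 \<partial>M)"
        by (rule cauchy_schwarz_bounded[OF _ _ S_bound R_bound]) measurable
      also have "\<dots> \<le> sqrt (real n * v n) * (sqrt (real n) * r K n)"
        using R_r[OF n, of K] n by (intro mult_mono) (auto simp: v_def)
      finally show "\<bar>\<integral>x. ?S x * R K n x \<partial>M\<bar> \<le> sqrt (real n * v n) * (sqrt (real n) * r K n)" .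
      show "(\<integral>x. (R K n x)\<^sup>2 \<partial>M) \<le> (sqrt (real n) * r K n)\<^sup>2"
        using R_r[OF n, of K] by (rule sqrt_le_D)
    qed simp
    also have "\<dots> = real n * (2 * sqrt (v n) * r K n + (r K n)\<^sup>2)"
      by (simp add: real_sqrt_mult power_mult_distrib algebra_simps)
    finally have "real n * \<bar>\<tau> K - v n\<bar> \<le> real n * (2 * sqrt (v n) * r K n + (r K n)\<^sup>2)"
      by (simp add: right_diff_distrib[symmetric] abs_mult)
    then show ?thesis
      using n by simp
  qed
  \<comment> \<open>With \<open>K\<close> fixed and \<open>n\<close> tending to infinity, the
    bounded coboundary drops out and only \<open>\<rho> K\<close> remains.\<close>
  have \<tau>s: "\<bar>\<tau> K - s\<bar> \<le> 2 * sqrt s * sqrt (2 * \<rho> K) + (sqrt (2 * \<rho> K))\<^sup>2" for K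
  proof (rule tendsto_le)
    show "(\<lambda>n. \<bar>\<tau> K - v n\<bar>) \<longlonglongrightarrow> \<bar>\<tau> K - s\<bar>"
      by (intro tendsto_intros v_lim)
    show "(\<lambda>n. 2 * sqrt (v n) * r K n + (r K n)\<^sup>2) \<longlonglongrightarrow> 2 * sqrt s * sqrt (2 * \<rho> K) + (sqrt (2 * \<rho> K))\<^sup>2"
      by (intro tendsto_intros v_lim r_lim)
    show "\<forall>\<^sub>F n in sequentially. \<bar>\<tau> K - v n\<bar> \<le> 2 * sqrt (v n) * r K n + (r K n)\<^sup>2"
      using eventually_gt_at_top[of 0] by eventually_elim (rule SR)
  qed simp
  have "\<tau> \<longlonglongrightarrow> s"
  proof -
    have "(\<lambda>K. 2 * sqrt s * sqrt (2 * \<rho> K) + (sqrt (2 * \<rho> K))\<^sup>2) \<longlonglongrightarrow> 2 * sqrt s * sqrt (2 * 0) + (sqrt (2 * 0))\<^sup>2"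
      by (intro tendsto_intros \<rho>_lim)
    then have lim: "(\<lambda>K. 2 * sqrt s * sqrt (2 * \<rho> K) + (sqrt (2 * \<rho> K))\<^sup>2) \<longlonglongrightarrow> 0"
      by simp
    have "\<forall>\<^sub>F K in sequentially. norm (\<tau> K - s) \<le> 2 * sqrt s * sqrt (2 * \<rho> K) + (sqrt (2 * \<rho> K))\<^sup>2"
      using \<tau>s by (simp only: real_norm_def eventually_True simp_thms)
    then have "(\<lambda>K. \<tau> K - s) \<longlonglongrightarrow> 0"
      using lim by (rule Lim_null_comparison)
    then show ?thesis by (simp add: LIM_zero_iff)
  qed
  then have exp_lim: "(\<lambda>K. exp (- (\<tau> K / 2))) \<longlonglongrightarrow> exp (- (s / 2))"
    by (intro tendsto_intros) auto
  have sqrt\<rho>: "(\<lambda>K. sqrt (2 * \<rho> K)) \<longlonglongrightarrow> 0"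
    using tendsto_real_sqrt[OF tendsto_mult_right_zero[OF \<rho>_lim, of 2]] by simp
  let ?\<psi> = "\<lambda>n. \<integral>x. iexp (bsum Z n x / sqrt (real n)) \<partial>M"
  let ?\<chi> = "\<lambda>K n. \<integral>x. iexp (bsum (D K) n x / sqrt (real n)) \<partial>M"
  have \<psi>\<chi>: "cmod (?\<psi> n - ?\<chi> K n) \<le> r K n" if n: "0 < n" for K n
  proof -
    have ii: "integrable M (\<lambda>x. iexp (h x / sqrt (real n)))" if [measurable]: "h \<in> borel_measurable M" for h :: "'a \<Rightarrow> real"
      by (intro integrable_bounded[where B = 1]) auto
    have iR: "integrable M (\<lambda>x. \<bar>R K n x\<bar> / sqrt (real n))"
      using R_bound[of K n] by (intro integrable_divide integrable_bounded[where B = "B K n"]) auto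
    have "?\<psi> n = (\<integral>x. iexp (bsum Z n (T x) / sqrt (real n)) \<partial>M)"
      using integral_T[of "\<lambda>x. iexp (bsum Z n x / sqrt (real n))"] by simp
    then have "cmod (?\<psi> n - ?\<chi> K n)
      = cmod (\<integral>x. iexp (bsum Z n (T x) / sqrt (real n)) - iexp (bsum (D K) n x / sqrt (real n)) \<partial>M)"
      using ii by simp
    also have "\<dots> \<le> (\<integral>x. \<bar>R K n x\<bar> / sqrt (real n) \<partial>M)"
    proof (rule order_trans[OF integral_norm_bound integral_mono])
      show "cmod (iexp (bsum Z n (T x) / sqrt (real n)) - iexp (bsum (D K) n x / sqrt (real n)))
          \<le> \<bar>R K n x\<bar> / sqrt (real n)" for x
        using cmod_iexp_diff_le[of "bsum Z n (T x) / sqrt (real n)" "bsum (D K) n x / sqrt (real n)"]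
        by (simp add: R_def diff_divide_distrib[symmetric])
      show "integrable M (\<lambda>x. cmod (iexp (bsum Z n (T x) / sqrt (real n)) - iexp (bsum (D K) n x / sqrt (real n))))"
        using ii by (intro integrable_norm Bochner_Integration.integrable_diff) auto
    qed (rule iR)
    also have "\<dots> = (\<integral>x. \<bar>R K n x\<bar> \<partial>M) / sqrt (real n)"
      by simp
    also have "\<dots> \<le> (sqrt (real n) * r K n) / sqrt (real n)"
      using order_trans[OF expectation_abs_le_sqrt[OF R_meas R_bound] R_r[OF n]]
      by (rule divide_right_mono) simp
    finally show ?thesis
      using n by simp
  qed
  have \<chi>: "?\<chi> K \<longlonglongrightarrow> exp (- (\<tau> K / 2))" for K
    unfolding \<tau>_def by (rule bounded_martingale_clt[OF D_meas D_bound D_orth])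
  show ?thesis
    unfolding s_def[symmetric]
  proof (rule tendstoI)
    fix \<epsilon> :: real assume "0 < \<epsilon>"
    then have "\<forall>\<^sub>F K in sequentially. sqrt (2 * \<rho> K) < \<epsilon> / 4"
      "\<forall>\<^sub>F K in sequentially. dist (exp (- (\<tau> K / 2))) (exp (- (s / 2))) < \<epsilon> / 4"
      using order_tendstoD(2)[OF sqrt\<rho>, of "\<epsilon> / 4"] tendstoD[OF exp_lim, of "\<epsilon> / 4"] by auto
    then obtain K where K: "sqrt (2 * \<rho> K) < \<epsilon> / 4" "dist (exp (- (\<tau> K / 2))) (exp (- (s / 2))) < \<epsilon> / 4"
      using eventually_happens'[OF sequentially_bot eventually_conj] by blast
    have "\<forall>\<^sub>F n in sequentially. r K n < \<epsilon> / 4"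
      using order_tendstoD(2)[OF r_lim K(1)] .
    moreover have "\<forall>\<^sub>F n in sequentially. dist (?\<chi> K n) (exp (- (\<tau> K / 2))) < \<epsilon> / 4"
      using tendstoD[OF \<chi>, of "\<epsilon> / 4" K] \<open>0 < \<epsilon>\<close> by simp
    ultimately show "\<forall>\<^sub>F n in sequentially. dist (?\<psi> n) (exp (- (s / 2))) < \<epsilon>"
      using eventually_gt_at_top[of 0]
    proof eventually_elim
      case (elim n)
      have "dist (complex_of_real (exp (- (\<tau> K / 2)))) (complex_of_real (exp (- (s / 2)))) < \<epsilon> / 4"
        using K(2) by (simp only: dist_of_real)
      moreover have "dist (?\<psi> n) (?\<chi> K n) < \<epsilon> / 4"
        using \<psi>\<chi>[of n K] elim by (simp add: dist_norm)
      ultimately show ?case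
        using elim(2) dist_triangle[of "?\<psi> n" "complex_of_real (exp (- (s / 2)))" "?\<chi> K n"]
          dist_triangle[of "?\<chi> K n" "complex_of_real (exp (- (s / 2)))" "complex_of_real (exp (- (\<tau> K / 2)))"] \<open>0 < \<epsilon>\<close>
        by linarith
    qed
  qed
qed

section \<open>From characteristic functions to finite-dimensional weak convergence\<close>

lemma (in prob_space) tilted_prob_space:
  fixes w :: "'a \<Rightarrow> real"
  assumes [measurable]: "w \<in> borel_measurable M" "X \<in> borel_measurable M"
    and w: "\<And>x. 0 < c \<and> c \<le> w x \<and> w x \<le> C"
  defines "a \<equiv> \<integral>x. w x \<partial>M"
  defines "\<mu> \<equiv> distr (density M (\<lambda>x. ennreal (w x / a))) borel X"
  shows "0 < a" "real_distribution \<mu>"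
    and "\<And>g :: real \<Rightarrow> real. g \<in> borel_measurable borel \<Longrightarrow>
      (\<integral>y. g y \<partial>\<mu>) = (\<integral>x. w x * g (X x) \<partial>M) / a"
proof -
  have i: "integrable M w"
  proof (intro integrable_const_bound[of _ C] AE_I2)
    show "norm (w x) \<le> C" for x
      using w[of x] by auto
  qed simp
  have "c \<le> a"
    unfolding a_def using w i by (intro integral_ge_const) auto
  then show a: "0 < a"
    using w by fastforce
  have w0: "0 \<le> w x" for x
    using w[of x] by auto
  have "emeasure (density M (\<lambda>x. ennreal (w x / a))) (space M) = (\<integral>\<^sup>+x. ennreal (w x / a) \<partial>M)"
    by (simp add: emeasure_density cong: nn_integral_cong)
  also have "\<dots> = ennreal (\<integral>x. w x / a \<partial>M)"
    using i w0 a by (intro nn_integral_eq_integral) auto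
  also have "\<dots> = 1"
    using a by (simp add: a_def)
  finally interpret D: prob_space "density M (\<lambda>x. ennreal (w x / a))"
    by (intro prob_spaceI) simp
  show "real_distribution \<mu>"
    unfolding \<mu>_def by (rule D.real_distribution_distr) simp
  fix g :: "real \<Rightarrow> real"
  assume [measurable]: "g \<in> borel_measurable borel"
  have "(\<integral>y. g y \<partial>\<mu>) = (\<integral>x. (w x / a) * g (X x) \<partial>M)"
    unfolding \<mu>_def using w0 a by (subst integral_distr) (auto simp: integral_density)
  then show "(\<integral>y. g y \<partial>\<mu>) = (\<integral>x. w x * g (X x) \<partial>M) / a"
    by simp
qed

text \<open>The weights carry the coordinates already treated: normalised to densities they give laws on the
  line, so that the one-dimensional continuity theorem replaces one cosine at a time by a general
  bounded continuous function.\<close>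

lemma tilted_convergence:
  fixes w :: "nat \<Rightarrow> 'a \<Rightarrow> real" and v :: "'b \<Rightarrow> real"
  assumes M: "prob_space M" and N: "prob_space N"
    and [measurable]: "\<And>n. w n \<in> borel_measurable M" "\<And>n. X n \<in> borel_measurable M"
      "v \<in> borel_measurable N" "V \<in> borel_measurable N"
    and w: "\<And>n x. 0 < c \<and> c \<le> w n x \<and> w n x \<le> C" and v: "\<And>x. 0 < c \<and> c \<le> v x \<and> v x \<le> C"
    and conv: "\<And>t \<psi>. (\<lambda>n. \<integral>x. w n x * cos (t * X n x + \<psi>) \<partial>M) \<longlonglongrightarrow> (\<integral>x. v x * cos (t * V x + \<psi>) \<partial>N)"
    and f: "continuous_on UNIV f" "\<And>y. \<bar>f y\<bar> \<le> B"
  shows "(\<lambda>n. \<integral>x. w n x * f (X n x) \<partial>M) \<longlonglongrightarrow> (\<integral>x. v x * f (V x) \<partial>N)"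
proof -
  interpret M: prob_space M by fact
  interpret N: prob_space N by fact
  define a where "a n = (\<integral>x. w n x \<partial>M)" for n
  define b where "b = (\<integral>x. v x \<partial>N)"
  define \<mu> where "\<mu> n = distr (density M (\<lambda>x. ennreal (w n x / a n))) borel (X n)" for n
  define \<nu> where "\<nu> = distr (density N (\<lambda>x. ennreal (v x / b))) borel V"
  have tM: "0 < a n" "real_distribution (\<mu> n)" and tM_int: "\<And>g. g \<in> borel_measurable borel \<Longrightarrow>
      (\<integral>y. g y \<partial>\<mu> n) = (\<integral>x. w n x * g (X n x) \<partial>M) / a n" for n
    using M.tilted_prob_space[of "w n" "X n" c C, OF assms(3) assms(4) w, folded a_def] unfolding \<mu>_def by auto
  have tN: "0 < b" "real_distribution \<nu>" and tN_int: "\<And>g. g \<in> borel_measurable borel \<Longrightarrow>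
      (\<integral>y. g y \<partial>\<nu>) = (\<integral>x. v x * g (V x) \<partial>N) / b"
    using N.tilted_prob_space[OF assms(5) assms(6) v, folded b_def] unfolding \<nu>_def by auto
  \<comment> \<open>Frequency and phase \<open>0\<close> in \<open>conv\<close> give convergence of
    the total masses that normalise the weights.\<close>
  have ab: "a \<longlonglongrightarrow> b"
    using conv[of 0 0] by (simp add: a_def[abs_def] b_def)
  have "(\<lambda>n. char (\<mu> n) t) \<longlonglongrightarrow> char \<nu> t" for t
  proof -
    interpret \<mu>: real_distribution "\<mu> n" for n by (rule tM)
    interpret \<nu>: real_distribution \<nu> by (rule tN)
    \<comment> \<open>The phase \<open>- pi / 2\<close> turns the cosine into a sine, so cosines
      with arbitrary phase determine the characteristic function.\<close>
    have ce: "char m t = Complex (\<integral>y. cos (t * y + 0) \<partial>m) (\<integral>y. cos (t * y + (- pi / 2)) \<partial>m)"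
      if "real_distribution m" for m :: "real measure"
    proof -
      interpret m: real_distribution m by fact
      have i: "integrable m (\<lambda>y. iexp (t * y))"
        by (intro m.integrable_const_bound[of _ 1]) auto
      have "cos (t * y + (- pi / 2)) = sin (t * y)" for y
        by (simp add: cos_diff)
      moreover have "Re (iexp (t * y)) = cos (t * y)" "Im (iexp (t * y)) = sin (t * y)" for y
        by (simp_all flip: cis_conv_exp of_real_mult)
      ultimately show ?thesis
        unfolding char_def using integral_Re[OF i] integral_Im[OF i]
        by (simp add: complex_eq_iff)
    qed
    have lim: "(\<lambda>n. \<integral>y. cos (t * y + \<psi>) \<partial>\<mu> n) \<longlonglongrightarrow> (\<integral>y. cos (t * y + \<psi>) \<partial>\<nu>)" for \<psi>
      using tM_int[of "\<lambda>y. cos (t * y + \<psi>)"] tN_int[of "\<lambda>y. cos (t * y + \<psi>)"]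
        tendsto_divide[OF conv[of t \<psi>] ab] tN(1)
      by simp
    show ?thesis
      unfolding ce[OF tM(2)] ce[OF tN(2)]
      by (intro tendsto_Complex lim)
  qed
  then have "weak_conv_m \<mu> \<nu>"
    by (intro levy_continuity tM tN)
  then have "(\<lambda>n. \<integral>y. f y \<partial>\<mu> n) \<longlonglongrightarrow> (\<integral>y. f y \<partial>\<nu>)"
    using f by (intro weak_conv_imp_integral_bdd_continuous_conv[OF tM(2) tN(2)])
      (auto simp: continuous_on_eq_continuous_at)
  from tendsto_mult[OF ab this]
  show ?thesis
    using tM(1) tN(1) borel_measurable_continuous_onI[OF f(1)]
    by (simp add: tM_int tN_int less_imp_neq[symmetric])
qed

text \<open>Vectors of dimension \<open>d\<close> are encoded as functions on \<open>nat\<close>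
  with the topology of pointwise convergence; only the coordinates below \<open>d\<close> enter the
  hypothesis \<open>char_conv\<close>.\<close>

locale fidi_convergence = M: prob_space M + N: prob_space N for M :: "'a measure" and N :: "'b measure" +
  fixes X :: "nat \<Rightarrow> 'a \<Rightarrow> nat \<Rightarrow> real" and V :: "'b \<Rightarrow> nat \<Rightarrow> real" and d :: nat
  assumes X[measurable]: "\<And>n l. (\<lambda>x. X n x l) \<in> borel_measurable M"
    and V[measurable]: "\<And>l. (\<lambda>x. V x l) \<in> borel_measurable N"
    and char_conv: "\<And>u. (\<lambda>n. \<integral>x. iexp (\<Sum>l<d. u l * X n x l) \<partial>M) \<longlonglongrightarrow> (\<integral>x. iexp (\<Sum>l<d. u l * V x l) \<partial>N)"
begin

lemma cos_conv:
  "(\<lambda>n. \<integral>x. cos ((\<Sum>l<d. u l * X n x l) + \<theta>) \<partial>M) \<longlonglongrightarrow> (\<integral>x. cos ((\<Sum>l<d. u l * V x l) + \<theta>) \<partial>N)"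
proof -
  have eq: "(\<integral>x. cos (h x + \<theta>) \<partial>P) = Re ((\<integral>x. iexp (h x) \<partial>P) * iexp \<theta>)"
    if "prob_space P" "h \<in> borel_measurable P" for P :: "'c measure" and h
  proof -
    interpret P: prob_space P by fact
    note [measurable] = that(2)
    have i: "integrable P (\<lambda>x. iexp (h x) * iexp \<theta>)"
      by (intro P.integrable_const_bound[of _ 1]) (auto simp: norm_mult)
    have "Re (iexp (h x) * iexp \<theta>) = cos (h x + \<theta>)" for x
      unfolding exp_add[symmetric] distrib_left[symmetric] of_real_add[symmetric]
      by (simp flip: cis_conv_exp of_real_add)
    then show ?thesis
      using integral_Re[OF i] by simp
  qed
  have m: "(\<lambda>x. \<Sum>l<d. u l * X n x l) \<in> borel_measurable M" "(\<lambda>x. \<Sum>l<d. u l * V x l) \<in> borel_measurable N" for n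
    by measurable
  show ?thesis
    unfolding eq[OF M.prob_space_axioms m(1)] eq[OF N.prob_space_axioms m(2)]
    by (intro tendsto_Re tendsto_mult char_conv tendsto_const)
qed

text \<open>Induction on the number of coordinates that carry a general factor. A cosine in all
  coordinates is kept throughout, because it supplies, by addition formulas, the test frequencies
  that the next tilting step needs.\<close>

lemma product_cos_conv:
  assumes "k \<le> d" and f: "\<And>l. continuous_on UNIV (f l)" "0 < c" "\<And>l y. c \<le> f l y \<and> f l y \<le> C"
  shows "(\<lambda>n. \<integral>x. (\<Prod>l<k. f l (X n x l)) * cos ((\<Sum>l<d. u l * X n x l) + \<theta>) \<partial>M)
    \<longlonglongrightarrow> (\<integral>x. (\<Prod>l<k. f l (V x l)) * cos ((\<Sum>l<d. u l * V x l) + \<theta>) \<partial>N)"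
  using assms(1)
proof (induction k arbitrary: u \<theta>)
  case 0
  then show ?case using cos_conv by simp
next
  case (Suc k)
  then have k: "k < d" and IH: "\<And>u \<theta>. (\<lambda>n. \<integral>x. (\<Prod>l<k. f l (X n x l)) * cos ((\<Sum>l<d. u l * X n x l) + \<theta>) \<partial>M)
    \<longlonglongrightarrow> (\<integral>x. (\<Prod>l<k. f l (V x l)) * cos ((\<Sum>l<d. u l * V x l) + \<theta>) \<partial>N)" by auto
  have [measurable]: "f l \<in> borel_measurable borel" for l
    by (rule borel_measurable_continuous_onI[OF f(1)])
  define p where "p y = (\<Prod>l<k. f l (y l))" for y :: "nat \<Rightarrow> real"
  have p: "c ^ k \<le> p y" "p y \<le> C ^ k" "0 < p y" for y
  proof -
    show "c ^ k \<le> p y"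
      unfolding p_def using prod_mono[of "{..<k}" "\<lambda>_. c" "\<lambda>l. f l (y l)"] f by simp
    then show "0 < p y"
      by (rule less_le_trans[OF zero_less_power[OF f(2)]])
    show "p y \<le> C ^ k"
      unfolding p_def using prod_mono[of "{..<k}" "\<lambda>l. f l (y l)" "\<lambda>_. C"] f(2,3)
      by (simp add: order_trans[OF less_imp_le[OF f(2)]])
  qed
  have p_meas[measurable]: "(\<lambda>x. p (X n x)) \<in> borel_measurable M" "(\<lambda>x. p (V x)) \<in> borel_measurable N" for n
    unfolding p_def by measurable
  \<comment> \<open>A cosine may be negative. Adding \<open>2\<close> to it makes it a factor
    between \<open>1\<close> and \<open>3\<close>, so the weight has a positive lower bound and can
    be tilted.\<close>
  have main: "(\<lambda>n. \<integral>x. (p (X n x) * (2 + cos ((\<Sum>l<d. u l * X n x l) + \<theta>))) * f k (X n x k) \<partial>M)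
    \<longlonglongrightarrow> (\<integral>x. (p (V x) * (2 + cos ((\<Sum>l<d. u l * V x l) + \<theta>))) * f k (V x k) \<partial>N)" for u \<theta>
  proof (rule tilted_convergence[OF M.prob_space_axioms N.prob_space_axioms, where c = "c ^ k" and C = "C ^ k * 3" and B = C
      and f = "f k" and X = "\<lambda>n x. X n x k" and V = "\<lambda>x. V x k"
      and w = "\<lambda>n x. p (X n x) * (2 + cos ((\<Sum>l<d. u l * X n x l) + \<theta>))"
      and v = "\<lambda>x. p (V x) * (2 + cos ((\<Sum>l<d. u l * V x l) + \<theta>))"])
    have bd: "0 < c ^ k \<and> c ^ k \<le> p y * (2 + cos z) \<and> p y * (2 + cos z) \<le> C ^ k * 3" for y z
    proof -
      have "1 \<le> 2 + cos z" "2 + cos z \<le> 3"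
        using cos_ge_minus_one[of z] cos_le_one[of z] by linarith+
      then show ?thesis
        using p[of y] f(2) mult_mono[of "c ^ k" "p y" 1 "2 + cos z"] mult_mono[of "p y" "C ^ k" "2 + cos z" 3] by auto
    qed
    show "0 < c ^ k \<and> c ^ k \<le> p (X n x) * (2 + cos ((\<Sum>l<d. u l * X n x l) + \<theta>)) \<and>
         p (X n x) * (2 + cos ((\<Sum>l<d. u l * X n x l) + \<theta>)) \<le> C ^ k * 3" for n x
      by (rule bd)
    show "0 < c ^ k \<and> c ^ k \<le> p (V x) * (2 + cos ((\<Sum>l<d. u l * V x l) + \<theta>)) \<and>
         p (V x) * (2 + cos ((\<Sum>l<d. u l * V x l) + \<theta>)) \<le> C ^ k * 3" for x
      by (rule bd)
    show "\<bar>f k y\<bar> \<le> C" for y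
      using f(2) f(3)[of k y] by auto
    fix t \<psi> :: real
    have upd: "(\<Sum>l<d. (u(k := u k + t)) l * y l) = (\<Sum>l<d. u l * y l) + t * y k" for y :: "nat \<Rightarrow> real" and t
    proof -
      have "(u(k := u k + t)) l * y l = u l * y l + (if l = k then t * y k else 0)" for l
        by (auto simp: algebra_simps)
      then show ?thesis
        using k by (simp add: sum.distrib)
    qed
    \<comment> \<open>The product of the two cosines becomes a half sum of cosines whose frequency
      in coordinate \<open>k\<close> is moved by \<open>t\<close> in either direction; all three
      terms are instances of the induction hypothesis.\<close>
    have split: "(p y * (2 + cos ((\<Sum>l<d. u l * y l) + \<theta>))) * cos (t * y k + \<psi>)
      = 2 * (p y * cos ((\<Sum>l<d. ((\<lambda>_. 0)(k := t)) l * y l) + \<psi>))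
        + (1 / 2) * (p y * cos ((\<Sum>l<d. (u(k := u k + (- t))) l * y l) + (\<theta> - \<psi>)))
        + (1 / 2) * (p y * cos ((\<Sum>l<d. (u(k := u k + t)) l * y l) + (\<theta> + \<psi>)))" for y
    proof -
      have "(\<Sum>l<d. ((\<lambda>_. 0)(k := t)) l * y l) = (\<Sum>l<d. if l = k then t * y k else 0)"
        by (intro sum.cong) auto
      also have "\<dots> = t * y k"
        using k by simp
      finally show ?thesis
        unfolding upd distrib_left[of "p y"] distrib_right[of _ _ "cos (t * y k + \<psi>)"] mult.assoc[of _ _ "cos (t * y k + \<psi>)"]
          cos_times_cos by (simp add: algebra_simps)
    qed
    have int: "integrable P (\<lambda>x. p (Y x) * cos ((\<Sum>l<d. u l * Y x l) + \<theta>))"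
      if "prob_space P" and [measurable]: "\<And>l. (\<lambda>x. Y x l) \<in> borel_measurable P" for P :: "'c measure" and Y u \<theta>
    proof -
      interpret P: prob_space P by fact
      have [measurable]: "(\<lambda>x. p (Y x)) \<in> borel_measurable P"
        unfolding p_def by measurable
      show ?thesis
        using p abs_cos_le_one
        by (intro P.integrable_const_bound[of _ "C ^ k * 1"]) (auto simp: abs_mult less_imp_le simp del: mult_1_right intro!: mult_mono order_trans[OF less_imp_le[OF p(3)] p(2)])
    qed
    have lin: "(\<integral>x. 2 * A x + (1 / 2) * B x + (1 / 2) * C x \<partial>P)
        = 2 * (\<integral>x. A x \<partial>P) + (1 / 2) * (\<integral>x. B x \<partial>P) + (1 / 2) * (\<integral>x. C x \<partial>P)"
      if "integrable P A" "integrable P B" "integrable P C" for P :: "'c measure" and A B C :: "'c \<Rightarrow> real"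
      using that by simp
    note iM = int[OF M.prob_space_axioms X] and iN = int[OF N.prob_space_axioms V]
    show "(\<lambda>n. \<integral>x. p (X n x) * (2 + cos ((\<Sum>l<d. u l * X n x l) + \<theta>)) * cos (t * X n x k + \<psi>) \<partial>M)
      \<longlonglongrightarrow> (\<integral>x. p (V x) * (2 + cos ((\<Sum>l<d. u l * V x l) + \<theta>)) * cos (t * V x k + \<psi>) \<partial>N)"
      unfolding split lin[OF iM iM iM] lin[OF iN iN iN]
      by (intro tendsto_intros IH[folded p_def])
  qed (use f in measurable)
  have int: "integrable P (\<lambda>x. (p (Y x) * h x) * f k (Y x k))"
    if "prob_space P" and [measurable]: "\<And>l. (\<lambda>x. Y x l) \<in> borel_measurable P" "h \<in> borel_measurable P"
      and h: "\<And>x. \<bar>h x\<bar> \<le> 3" for P :: "'c measure" and Y h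
  proof -
    interpret P: prob_space P by fact
    have [measurable]: "(\<lambda>x. p (Y x)) \<in> borel_measurable P"
      unfolding p_def by measurable
    have "\<bar>f k y\<bar> \<le> C" for y
      using f(2) f(3)[of k y] by auto
    then show ?thesis
      using p h
      by (intro P.integrable_const_bound[of _ "(C ^ k * 3) * C"])
         (auto simp: abs_mult less_imp_le intro!: mult_mono order_trans[OF less_imp_le[OF p(3)] p(2)])
  qed
  \<comment> \<open>The auxiliary \<open>2\<close> is subtracted again: with zero frequencies and
    phase the factor \<open>2 + cos\<close> is \<open>3\<close>, so two thirds of that integral is
    the surplus.\<close>
  have eq: "(\<integral>x. (\<Prod>l<Suc k. f l (Y x l)) * cos ((\<Sum>l<d. u l * Y x l) + \<theta>) \<partial>P)
    = (\<integral>x. (p (Y x) * (2 + cos ((\<Sum>l<d. u l * Y x l) + \<theta>))) * f k (Y x k) \<partial>P)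
      - (2 / 3) * (\<integral>x. (p (Y x) * (2 + cos ((\<Sum>l<d. 0 * Y x l) + 0))) * f k (Y x k) \<partial>P)"
    if P: "prob_space P" and Y[measurable]: "\<And>l. (\<lambda>x. Y x l) \<in> borel_measurable P" for P :: "'c measure" and Y
  proof -
    have c3: "\<bar>2 + cos z\<bar> \<le> 3" for z :: real
      using cos_ge_minus_one[of z] cos_le_one[of z] by linarith
    have z: "2 + cos ((\<Sum>l<d. 0 * Y x l) + 0) = 3" for x
      by simp
    have i1: "integrable P (\<lambda>x. (p (Y x) * (2 + cos ((\<Sum>l<d. u l * Y x l) + \<theta>))) * f k (Y x k))"
      by (rule int[OF P Y]) (auto intro: c3)
    have i2: "integrable P (\<lambda>x. (p (Y x) * 3) * f k (Y x k))"
      by (rule int[OF P Y]) auto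
    have "(\<integral>x. (\<Prod>l<Suc k. f l (Y x l)) * cos ((\<Sum>l<d. u l * Y x l) + \<theta>) \<partial>P)
      = (\<integral>x. (p (Y x) * (2 + cos ((\<Sum>l<d. u l * Y x l) + \<theta>))) * f k (Y x k) - (2 / 3) * ((p (Y x) * 3) * f k (Y x k)) \<partial>P)"
      by (intro Bochner_Integration.integral_cong) (auto simp: p_def algebra_simps)
    also have "\<dots> = (\<integral>x. (p (Y x) * (2 + cos ((\<Sum>l<d. u l * Y x l) + \<theta>))) * f k (Y x k) \<partial>P)
      - (2 / 3) * (\<integral>x. (p (Y x) * 3) * f k (Y x k) \<partial>P)"
      by (subst Bochner_Integration.integral_diff[OF i1 integrable_mult_right[OF i2]])
         (simp only: integral_mult_right_zero)
    finally show ?thesis by (simp only: z)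
  qed
  show ?case
    unfolding eq[OF M.prob_space_axioms X] eq[OF N.prob_space_axioms V]
    by (intro tendsto_intros main)
qed

end

section \<open>An algebra of product functions and its density on boxes\<close>

text \<open>Generating factors have a positive lower bound because they later serve as weights. This
  loses nothing: a bounded continuous factor is the difference of such a factor and a
  constant.\<close>

inductive_set prodalg :: "nat \<Rightarrow> ((nat \<Rightarrow> real) \<Rightarrow> real) set" for d where
  const: "(\<lambda>_. r) \<in> prodalg d"
| mul: "p \<in> prodalg d \<Longrightarrow> l < d \<Longrightarrow> continuous_on UNIV f \<Longrightarrow> 0 < c \<Longrightarrow> (\<And>y. c \<le> f y \<and> f y \<le> C) \<Longrightarrow>
    (\<lambda>x. f (x l) * p x) \<in> prodalg d"
| add: "p \<in> prodalg d \<Longrightarrow> q \<in> prodalg d \<Longrightarrow> (\<lambda>x. p x + q x) \<in> prodalg d"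

lemma prodalg_cmult: "p \<in> prodalg d \<Longrightarrow> (\<lambda>x. r * p x) \<in> prodalg d"
proof (induction rule: prodalg.induct)
  case (mul p l f c C)
  then show ?case
    using prodalg.mul[of "\<lambda>x. r * p x" d l f c C] by (simp add: mult.left_commute)
qed (auto simp: distrib_left intro: prodalg.const prodalg.add)

lemma prodalg_mult: "p \<in> prodalg d \<Longrightarrow> q \<in> prodalg d \<Longrightarrow> (\<lambda>x. p x * q x) \<in> prodalg d"
proof (induction rule: prodalg.induct)
  case (mul p l f c C)
  then show ?case
    using prodalg.mul[of "\<lambda>x. p x * q x" d l f c C] by (simp add: mult.assoc)
qed (auto simp: distrib_right intro: prodalg_cmult prodalg.add)

lemma prodalg_bounded_mul:
  assumes "p \<in> prodalg d" "l < d" "continuous_on UNIV f" and B: "\<And>y. \<bar>f y\<bar> \<le> B"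
  shows "(\<lambda>x. f (x l) * p x) \<in> prodalg d"
proof -
  have "(\<lambda>x. (f (x l) + (B + 1)) * p x) \<in> prodalg d"
  proof (rule prodalg.mul[OF assms(1,2), of _ 1 "2 * B + 1"])
    show "continuous_on UNIV (\<lambda>y. f y + (B + 1))"
      by (intro continuous_intros assms(3))
    show "1 \<le> f y + (B + 1) \<and> f y + (B + 1) \<le> 2 * B + 1" for y
      using B[of y] by (auto simp: abs_le_iff)
  qed simp
  from prodalg.add[OF this prodalg_cmult[OF assms(1), of "- (B + 1)"]]
  show ?thesis by (simp add: algebra_simps)
qed

lemma prodalg_prod: "(\<And>l. continuous_on UNIV (f l)) \<Longrightarrow> (\<And>l y. \<bar>f l y\<bar> \<le> B) \<Longrightarrow> k \<le> d \<Longrightarrow> (\<lambda>x. \<Prod>l<k. f l (x l)) \<in> prodalg d"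
proof (induction k)
  case (Suc k)
  then have "(\<lambda>x. f k (x k) * (\<Prod>l<k. f l (x l))) \<in> prodalg d"
    by (intro prodalg_bounded_mul[where B = B]) auto
  then show ?case by (simp add: mult.commute)
qed (simp add: prodalg.const)

lemma prodalg_continuous: "p \<in> prodalg d \<Longrightarrow> continuous_on UNIV p"
proof (induction rule: prodalg.induct)
  case (mul p l f c C)
  have "continuous_on UNIV (\<lambda>x :: nat \<Rightarrow> real. f (x l))"
    by (rule continuous_on_compose2[OF mul(3) continuous_on_product_coordinates]) auto
  with mul show ?case by (intro continuous_intros)
qed (auto intro!: continuous_intros)

lemma prodalg_bounded: "p \<in> prodalg d \<Longrightarrow> \<exists>B. \<forall>x. \<bar>p x\<bar> \<le> B"
proof (induction rule: prodalg.induct)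
  case (mul p l f c C)
  then obtain B where B: "\<And>x. \<bar>p x\<bar> \<le> B" by auto
  have "\<bar>f y\<bar> \<le> C" for y
    using mul(4) mul(5)[of y] by auto
  then have "\<bar>f (x l) * p x\<bar> \<le> C * B" for x
    unfolding abs_mult using B by (intro mult_mono) (auto intro: order_trans[OF abs_ge_zero])
  then show ?case by blast
next
  case (add p q)
  then obtain A B where "\<And>x. \<bar>p x\<bar> \<le> A" "\<And>x. \<bar>q x\<bar> \<le> B" by auto
  then have "\<bar>p x + q x\<bar> \<le> A + B" for x
    by (rule order_trans[OF abs_triangle_ineq add_mono])
  then show ?case by blast
qed auto

lemma prodalg_cong: "p \<in> prodalg d \<Longrightarrow> (\<And>l. l < d \<Longrightarrow> x l = y l) \<Longrightarrow> p x = p y"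
  by (induction rule: prodalg.induct) auto

definition clip :: "real \<Rightarrow> real \<Rightarrow> real" where
  "clip R y = max (- R) (min R y)"

lemma prodalg_clip: "p \<in> prodalg d \<Longrightarrow> (\<lambda>x. p (\<lambda>l. clip R (x l))) \<in> prodalg d"
proof (induction rule: prodalg.induct)
  case (mul p l f c C)
  have "continuous_on UNIV (\<lambda>y. f (clip R y))"
    unfolding clip_def by (rule continuous_on_compose2[OF mul(3)]) (auto intro!: continuous_intros)
  with mul show ?case
    using prodalg.mul[of "\<lambda>x. p (\<lambda>l. clip R (x l))" d l "\<lambda>y. f (clip R y)" c C] by simp
qed (auto intro: prodalg.const prodalg.add)

text \<open>Tychonoff's theorem: the coordinates from \<open>d\<close> on are frozen at
  \<open>0\<close>, so the set is a product of compact intervals and singletons.\<close>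

lemma compact_box:
  fixes R :: real
  shows "compact {x :: nat \<Rightarrow> real. (\<forall>l<d. \<bar>x l\<bar> \<le> R) \<and> (\<forall>l\<ge>d. x l = 0)}"
proof -
  have "compactin (product_topology (\<lambda>_. euclidean) UNIV) (\<Pi>\<^sub>E l\<in>(UNIV :: nat set). if l < d then {- R..R} else {0})"
    by (subst compactin_PiE) auto
  moreover have "(\<Pi>\<^sub>E l\<in>(UNIV :: nat set). if l < d then {- R..R} else {0})
      = {x :: nat \<Rightarrow> real. (\<forall>l<d. \<bar>x l\<bar> \<le> R) \<and> (\<forall>l\<ge>d. x l = 0)}"
  proof -
    have "x l \<in> (if l < d then {- R..R} else {0}) \<longleftrightarrow> (l < d \<longrightarrow> \<bar>x l\<bar> \<le> R) \<and> (d \<le> l \<longrightarrow> x l = 0)" for x :: "nat \<Rightarrow> real" and l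
      by (cases "l < d") (simp_all add: abs_le_iff minus_le_iff conj_commute)
    then show ?thesis
      unfolding PiE_UNIV_domain Pi_def by blast
  qed
  ultimately show ?thesis
    by (simp add: euclidean_product_topology)
qed

lemma prodalg_dense:
  assumes h: "continuous_on UNIV h" and "0 < e"
  shows "\<exists>p\<in>prodalg d. \<forall>x. (\<forall>l<d. \<bar>x l\<bar> \<le> R) \<and> (\<forall>l\<ge>d. x l = 0) \<longrightarrow> \<bar>h x - p x\<bar> < e"
proof -
  let ?S = "{x :: nat \<Rightarrow> real. (\<forall>l<d. \<bar>x l\<bar> \<le> R) \<and> (\<forall>l\<ge>d. x l = 0)}"
  interpret function_ring_on "prodalg d" ?S
  proof
    show "compact ?S" by (rule compact_box)
    show "continuous_on ?S f" if "f \<in> prodalg d" for f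
      using prodalg_continuous[OF that] by (rule continuous_on_subset) simp
    fix x y :: "nat \<Rightarrow> real" assume xy: "x \<in> ?S" "y \<in> ?S" "x \<noteq> y"
    then obtain l where "x l \<noteq> y l" by (auto simp: fun_eq_iff)
    with xy have l: "l < d"
      by (metis (mono_tags, lifting) mem_Collect_eq not_le)
    \<comment> \<open>Coordinate functions are unbounded and so lie outside the reach of
      \<open>prodalg_bounded_mul\<close>; their arctangents separate points equally well.\<close>
    have "\<bar>arctan y\<bar> \<le> 2" for y
      using arctan_ubound[of y] arctan_lbound[of y] pi_half_less_two by linarith
    then have "(\<lambda>x. arctan (x l) * 1) \<in> prodalg d"
      using l by (intro prodalg_bounded_mul[where B = 2] prodalg.const) (auto intro!: continuous_intros)
    then show "\<exists>f\<in>prodalg d. f x \<noteq> f y"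
      using \<open>x l \<noteq> y l\<close> by (intro bexI[of _ "\<lambda>x. arctan (x l) * 1"]) (auto simp: arctan_eq_iff)
  qed (auto intro: prodalg.intros prodalg_mult)
  show ?thesis
    using Stone_Weierstrass_basic[of h e] \<open>0 < e\<close> continuous_on_subset[OF h] by auto
qed

section \<open>Weak convergence of vectors by truncation\<close>

context fidi_convergence
begin

lemma X_borel[measurable]: "X n \<in> borel_measurable M" and V_borel[measurable]: "V \<in> borel_measurable N"
  by (rule measurable_coordinatewise_then_product; measurable)+

text \<open>The statement carries a product of weights so that the induction closes: a factor of the
  algebra is absorbed into the weight of its coordinate.\<close>

lemma prodalg_conv_weighted:
  "p \<in> prodalg d \<Longrightarrow> (\<And>l. continuous_on UNIV (f l)) \<Longrightarrow> 0 < c \<Longrightarrow> (\<And>l y. c \<le> f l y \<and> f l y \<le> C) \<Longrightarrow>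
    (\<lambda>n. \<integral>x. (\<Prod>l<d. f l (X n x l)) * p (X n x) \<partial>M) \<longlonglongrightarrow> (\<integral>x. (\<Prod>l<d. f l (V x l)) * p (V x) \<partial>N)"
proof (induction arbitrary: f c C rule: prodalg.induct)
  case (const r)
  then show ?case
    using tendsto_mult_right[OF product_cos_conv[of d f c C "\<lambda>_. 0" 0], of r] by simp
next
  case (mul p k g c' C')
  have eq: "(\<Prod>l<d. f l (y l)) * (g (y k) * p y) = (\<Prod>l<d. (f(k := \<lambda>z. f k z * g z)) l (y l)) * p y" for y
  proof -
    have "(\<Prod>l<d. (f(k := \<lambda>z. f k z * g z)) l (y l)) = (\<Prod>l<d. f l (y l) * (if l = k then g (y k) else 1))"
      by (intro prod.cong) auto
    also have "\<dots> = (\<Prod>l<d. f l (y l)) * g (y k)"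
      using mul.hyps by (simp add: prod.distrib)
    finally show ?thesis by simp
  qed
  show ?case
    unfolding eq
  proof (rule mul.IH)
    show "continuous_on UNIV ((f(k := \<lambda>z. f k z * g z)) l)" for l
      using mul by (auto intro!: continuous_intros)
    \<comment> \<open>The weight of coordinate \<open>k\<close> has the new bounds
      \<open>c * c'\<close> and \<open>C * C'\<close> while all others keep \<open>c\<close> and
      \<open>C\<close>; minimum and maximum cover both.\<close>
    show "0 < min c (c * c')"
      using mul by simp
    show "min c (c * c') \<le> (f(k := \<lambda>z. f k z * g z)) l y \<and> (f(k := \<lambda>z. f k z * g z)) l y \<le> max C (C * C')" for l y
    proof (cases "l = k")
      case True
      have "c * c' \<le> f k y * g y" "f k y * g y \<le> C * C'"
        using mul.prems(2) mul.prems(3)[of k y] mul.hyps(4) mul.hyps(5)[of y] by (auto intro!: mult_mono)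
      with True show ?thesis by (simp add: min.coboundedI2 max.coboundedI2)
    next
      case False
      then show ?thesis using mul.prems(3)[of l y] by auto
    qed
  qed
next
  case (add p q)
  have int: "integrable P (\<lambda>x. (\<Prod>l<d. f l (Y x l)) * r (Y x))"
    if "prob_space P" and [measurable]: "\<And>l. (\<lambda>x. Y x l) \<in> borel_measurable P" "Y \<in> borel_measurable P" and r: "r \<in> prodalg d"
    for P :: "'c measure" and Y r
  proof -
    interpret P: prob_space P by fact
    have [measurable]: "f l \<in> borel_measurable borel" for l
      by (rule borel_measurable_continuous_onI) fact
    have [measurable]: "r \<in> borel_measurable borel"
      by (rule borel_measurable_continuous_onI[OF prodalg_continuous[OF r]])
    obtain B where B: "\<And>x. \<bar>r x\<bar> \<le> B" using prodalg_bounded[OF r] by auto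
    have fb: "\<bar>f l y\<bar> \<le> C" for l y
      using add.prems(2) add.prems(3)[of l y] by auto
    have "\<bar>\<Prod>l<d. f l (y l)\<bar> \<le> C ^ d" for y
      unfolding abs_prod using prod_mono[of "{..<d}" "\<lambda>l. \<bar>f l (y l)\<bar>" "\<lambda>_. C"] fb by simp
    then show ?thesis
      using B by (intro P.integrable_const_bound[of _ "C ^ d * B"])
        (auto simp: abs_mult intro!: mult_mono order_trans[OF abs_ge_zero])
  qed
  show ?case
    unfolding distrib_left
      Bochner_Integration.integral_add[OF int[OF M.prob_space_axioms X X_borel add.hyps(1)] int[OF M.prob_space_axioms X X_borel add.hyps(2)]]
      Bochner_Integration.integral_add[OF int[OF N.prob_space_axioms V V_borel add.hyps(1)] int[OF N.prob_space_axioms V V_borel add.hyps(2)]]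
    by (intro tendsto_add add.IH[OF add.prems])
qed

lemma prodalg_conv: "p \<in> prodalg d \<Longrightarrow> (\<lambda>n. \<integral>x. p (X n x) \<partial>M) \<longlonglongrightarrow> (\<integral>x. p (V x) \<partial>N)"
  using prodalg_conv_weighted[of p "\<lambda>_ _. 1" 1 1] by simp

theorem weak_convergence:
  fixes h :: "(nat \<Rightarrow> real) \<Rightarrow> real"
  assumes h: "continuous_on UNIV h" and B: "\<And>x. \<bar>h x\<bar> \<le> B"
    and dep: "\<And>x y. (\<And>l. l < d \<Longrightarrow> x l = y l) \<Longrightarrow> h x = h y"
  shows "(\<lambda>n. \<integral>x. h (X n x) \<partial>M) \<longlonglongrightarrow> (\<integral>x. h (V x) \<partial>N)"
proof (rule tendstoI)
  fix e :: real assume "0 < e"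
  have B0: "0 \<le> B" using B[of "\<lambda>_. 0"] by linarith
  \<comment> \<open>The constants anticipate the final sum: replacing \<open>h\<close> by
    \<open>q\<close> costs \<open>\<epsilon> + (2 * B + 1) * (2 * \<epsilon>)\<close> for
    \<open>X n\<close> and \<open>\<epsilon> + (2 * B + 1) * \<epsilon>\<close> for
    \<open>V\<close>, and the convergence for \<open>q\<close> costs another
    \<open>\<epsilon>\<close>. The bound \<open>\<epsilon> \<le> 1\<close> gives
    \<open>\<bar>q x\<bar> \<le> B + 1\<close>.\<close>
  define \<epsilon> where "\<epsilon> = min 1 (e / (2 * (3 + 3 * (2 * B + 1))))"
  have \<epsilon>: "0 < \<epsilon>" "\<epsilon> \<le> 1" "\<epsilon> * (3 + 3 * (2 * B + 1)) < e"
  proof -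
    show "0 < \<epsilon>" using \<open>0 < e\<close> B0 by (simp add: \<epsilon>_def)
    have "\<epsilon> * (3 + 3 * (2 * B + 1)) \<le> e / (2 * (3 + 3 * (2 * B + 1))) * (3 + 3 * (2 * B + 1))"
      using B0 by (intro mult_right_mono) (auto simp: \<epsilon>_def)
    also have "\<dots> = e / 2" using B0 by (simp add: field_simps)
    finally show "\<epsilon> * (3 + 3 * (2 * B + 1)) < e" using \<open>0 < e\<close> by simp
  qed (simp add: \<epsilon>_def)
  define \<tau> where "\<tau> R y = max 0 (min 1 (R + 1 - \<bar>y\<bar>))" for R y :: real
  \<comment> \<open>This cutoff is \<open>1\<close> where the first \<open>d\<close> coordinates are
    at most \<open>R\<close> in absolute value and \<open>0\<close> where one of them exceeds
    \<open>R + 1\<close>. It lies in the algebra, so the convergence of its mean yields tightness of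
    the vectors \<open>X n\<close>.\<close>
  define cut where "cut R x = (\<Prod>l<d. \<tau> R (x l))" for R and x :: "nat \<Rightarrow> real"
  have \<tau>01: "0 \<le> \<tau> R y" "\<tau> R y \<le> 1" for R y
    by (auto simp: \<tau>_def)
  have cut01: "0 \<le> cut R x" "cut R x \<le> 1" for R x
    unfolding cut_def using \<tau>01 by (auto intro!: prod_nonneg prod_le_1)
  have cut_alg: "cut R \<in> prodalg d" for R
    unfolding cut_def[abs_def]
  proof (rule prodalg_prod[where B = 1])
    show "continuous_on UNIV (\<tau> R)" for R
      unfolding \<tau>_def[abs_def] by (intro continuous_intros)
  qed (use \<tau>01 in auto)
  have cut_meas[measurable]: "cut R \<in> borel_measurable borel" for R
    by (rule borel_measurable_continuous_onI[OF prodalg_continuous[OF cut_alg]])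
  have "(\<lambda>k. \<integral>x. cut (real k) (V x) \<partial>N) \<longlonglongrightarrow> (\<integral>x. 1 \<partial>N)"
  proof (rule integral_dominated_convergence[where w = "\<lambda>_. 1"])
    show "AE x in N. (\<lambda>k. cut (real k) (V x)) \<longlonglongrightarrow> 1"
    proof (rule AE_I2, rule tendsto_eventually)
      fix x
      have "\<forall>\<^sub>F k in sequentially. \<forall>l\<in>{..<d}. \<bar>V x l\<bar> \<le> real k"
        unfolding eventually_ball_finite_distrib[OF finite_lessThan]
      proof
        fix l
        show "\<forall>\<^sub>F k in sequentially. \<bar>V x l\<bar> \<le> real k"
          using filterlim_real_sequentially by (simp add: filterlim_at_top)
      qed
      then show "\<forall>\<^sub>F k in sequentially. cut (real k) (V x) = 1"
        by eventually_elim (auto simp: cut_def \<tau>_def)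
    qed
  qed (use cut01 in auto)
  then have "(\<lambda>k. \<integral>x. cut (real k) (V x) \<partial>N) \<longlonglongrightarrow> 1"
    by (simp add: N.prob_space)
  then have "\<forall>\<^sub>F k in sequentially. 1 - \<epsilon> < (\<integral>x. cut (real k) (V x) \<partial>N)"
    by (rule order_tendstoD) (use \<epsilon> in simp)
  then obtain k :: nat where k: "1 - \<epsilon> < (\<integral>x. cut (real k) (V x) \<partial>N)"
    using eventually_happens'[OF sequentially_bot] by blast
  define R where "R = real k"
  have R: "0 \<le> R" "1 - \<epsilon> < (\<integral>x. cut R (V x) \<partial>N)"
    using k by (auto simp: R_def)
  obtain p where p: "p \<in> prodalg d" "\<And>x. (\<forall>l<d. \<bar>x l\<bar> \<le> R + 1) \<Longrightarrow> (\<forall>l\<ge>d. x l = 0) \<Longrightarrow> \<bar>h x - p x\<bar> < \<epsilon>"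
    using prodalg_dense[OF h \<epsilon>(1), of d "R + 1"] by blast
  define q where "q x = p (\<lambda>l. clip (R + 1) (x l))" for x
  have q: "q \<in> prodalg d"
    unfolding q_def[abs_def] by (rule prodalg_clip[OF p(1)])
  have [measurable]: "q \<in> borel_measurable borel" "h \<in> borel_measurable borel"
    by (rule borel_measurable_continuous_onI[OF prodalg_continuous[OF q]] borel_measurable_continuous_onI[OF h])+
  \<comment> \<open>Inside the box of half-width \<open>R + 1\<close> clipping changes nothing and
    \<open>dep\<close> allows the remaining coordinates to be set to \<open>0\<close>. Outside it
    the cutoff vanishes, and the crude bound \<open>2 * B + 1\<close> takes over.\<close>
  have hq: "\<bar>h x - q x\<bar> \<le> \<epsilon> + (2 * B + 1) * (1 - cut R x)" and qb: "\<bar>q x\<bar> \<le> B + 1" for x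
  proof -
    define x' where "x' l = (if l < d then clip (R + 1) (x l) else 0)" for l
    have qx: "q x = p x'"
      unfolding q_def by (rule prodalg_cong[OF p(1)]) (simp add: x'_def)
    have hp: "\<bar>h x' - p x'\<bar> < \<epsilon>"
      using R(1) by (intro p(2)) (auto simp: x'_def clip_def)
    then show "\<bar>q x\<bar> \<le> B + 1"
      unfolding qx using B[of x'] \<epsilon>(2) by linarith
    show "\<bar>h x - q x\<bar> \<le> \<epsilon> + (2 * B + 1) * (1 - cut R x)"
    proof (cases "\<forall>l<d. \<bar>x l\<bar> \<le> R + 1")
      case True
      then have "h x = h x'"
        by (intro dep) (auto simp: x'_def clip_def)
      moreover have "0 \<le> (2 * B + 1) * (1 - cut R x)"
        using cut01 B0 by simp
      ultimately show ?thesis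
        unfolding qx using hp by linarith
    next
      case False
      then obtain l where l: "l < d" "R + 1 < \<bar>x l\<bar>" by (auto simp: not_le)
      then have "\<tau> R (x l) = 0" by (simp add: \<tau>_def)
      with l have "cut R x = 0"
        unfolding cut_def by (intro prod_zero) auto
      then show ?thesis
        unfolding qx using hp B[of x'] B[of x] \<epsilon> by simp
    qed
  qed
  have comp: "\<bar>(\<integral>x. h (Y x) \<partial>P) - (\<integral>x. q (Y x) \<partial>P)\<bar> \<le> \<epsilon> + (2 * B + 1) * (1 - (\<integral>x. cut R (Y x) \<partial>P))"
    if "prob_space P" and [measurable]: "Y \<in> borel_measurable P" for P :: "'c measure" and Y
  proof -
    interpret P: prob_space P by fact
    have i: "integrable P (\<lambda>x. r (Y x))" if [measurable]: "r \<in> borel_measurable borel" and "\<And>x. \<bar>r x\<bar> \<le> b"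
      for r :: "(nat \<Rightarrow> real) \<Rightarrow> real" and b
      using that(2) by (intro P.integrable_const_bound[of _ b]) auto
    have i: "integrable P (\<lambda>x. h (Y x))" "integrable P (\<lambda>x. q (Y x))" "integrable P (\<lambda>x. cut R (Y x))"
      using i[of h B] i[of q "B + 1"] i[of "cut R" 1] B qb cut01 by auto
    have "\<bar>(\<integral>x. h (Y x) \<partial>P) - (\<integral>x. q (Y x) \<partial>P)\<bar> = \<bar>\<integral>x. h (Y x) - q (Y x) \<partial>P\<bar>"
      using i by simp
    also have "\<dots> \<le> (\<integral>x. \<bar>h (Y x) - q (Y x)\<bar> \<partial>P)"
      by (rule integral_abs_bound)
    also have "\<dots> \<le> (\<integral>x. \<epsilon> + (2 * B + 1) * (1 - cut R (Y x)) \<partial>P)"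
      using i hq by (intro integral_mono) auto
    also have "\<dots> = \<epsilon> + (2 * B + 1) * (1 - (\<integral>x. cut R (Y x) \<partial>P))"
      using i by (simp add: P.prob_space)
    finally show ?thesis .
  qed
  have "\<forall>\<^sub>F n in sequentially. dist (\<integral>x. q (X n x) \<partial>M) (\<integral>x. q (V x) \<partial>N) < \<epsilon>"
    using tendstoD[OF prodalg_conv[OF q] \<epsilon>(1)] .
  moreover have "\<forall>\<^sub>F n in sequentially. dist (\<integral>x. cut R (X n x) \<partial>M) (\<integral>x. cut R (V x) \<partial>N) < \<epsilon>"
    using tendstoD[OF prodalg_conv[OF cut_alg] \<epsilon>(1)] .
  ultimately show "\<forall>\<^sub>F n in sequentially. dist (\<integral>x. h (X n x) \<partial>M) (\<integral>x. h (V x) \<partial>N) < e"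
  proof eventually_elim
    case (elim n)
    have "1 - (\<integral>x. cut R (X n x) \<partial>M) \<le> 2 * \<epsilon>" "1 - (\<integral>x. cut R (V x) \<partial>N) \<le> \<epsilon>"
      using elim(2) R(2) by (auto simp: dist_real_def)
    then have "(2 * B + 1) * (1 - (\<integral>x. cut R (X n x) \<partial>M)) \<le> (2 * B + 1) * (2 * \<epsilon>)"
      "(2 * B + 1) * (1 - (\<integral>x. cut R (V x) \<partial>N)) \<le> (2 * B + 1) * \<epsilon>"
      using B0 by (auto intro!: mult_left_mono)
    then have "\<bar>(\<integral>x. h (X n x) \<partial>M) - (\<integral>x. h (V x) \<partial>N)\<bar> \<le> \<epsilon> * (3 + 3 * (2 * B + 1))"
      using comp[OF M.prob_space_axioms X_borel, of n] comp[OF N.prob_space_axioms V_borel] elim(1)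
      by (simp add: dist_real_def algebra_simps)
    then show ?case
      using \<epsilon>(3) by (simp add: dist_real_def)
  qed
qed

end

section \<open>Gaussian sequences with a prescribed covariance\<close>

definition psd_kernel :: "('i \<Rightarrow> 'i \<Rightarrow> real) \<Rightarrow> bool" where
  "psd_kernel K \<longleftrightarrow> (\<forall>p q. K p q = K q p) \<and> (\<forall>A c. finite A \<longrightarrow> 0 \<le> (\<Sum>p\<in>A. \<Sum>q\<in>A. c p * c q * K p q))"

lemma psd_kernelD: "psd_kernel K \<Longrightarrow> finite A \<Longrightarrow> 0 \<le> (\<Sum>p\<in>A. \<Sum>q\<in>A. c p * c q * K p q)"
  by (simp add: psd_kernel_def)

lemma psd_kernel_diag: "psd_kernel K \<Longrightarrow> 0 \<le> K p p"
  using psd_kernelD[of K "{p}" "\<lambda>_. 1"] by simp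

text \<open>With a zero on the diagonal, the quadratic form in the coefficients \<open>1\<close> at
  \<open>p\<close> and \<open>t\<close> at \<open>i\<close> is affine in \<open>t\<close>; unless
  the off-diagonal entry vanishes, the chosen \<open>t\<close> gives it the value
  \<open>-1\<close>.\<close>

lemma psd_kernel_zero:
  assumes K: "psd_kernel K" and 0: "K i i = 0"
  shows "K p i = 0"
proof (rule ccontr)
  assume ne: "K p i \<noteq> 0"
  with 0 have pi: "p \<noteq> i" by auto
  have sym: "K i p = K p i" using K by (auto simp: psd_kernel_def)
  define t where "t = - (K p p + 1) / (2 * K p i)"
  have "0 \<le> (\<Sum>x\<in>{p, i}. \<Sum>y\<in>{p, i}. (if x = p then 1 else t) * (if y = p then 1 else t) * K x y)"
    by (rule psd_kernelD[OF K]) simp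
  also have "\<dots> = K p p + 2 * t * K p i"
    using pi 0 sym by (auto simp: algebra_simps)
  also have "\<dots> = -1"
    using ne by (simp add: t_def field_simps)
  finally show False by simp
qed

section \<open>Cholesky factorisation by Schur complements\<close>

text \<open>The Schur complement with pivot \<open>i\<close>. For a zero pivot the division by zero
  leaves \<open>K\<close> unchanged, which is the right value since then the whole column is zero by
  \<open>psd_kernel_zero\<close>.\<close>

definition schur_step :: "(nat \<Rightarrow> nat \<Rightarrow> real) \<Rightarrow> nat \<Rightarrow> nat \<Rightarrow> nat \<Rightarrow> real" where
  "schur_step K i p q = K p q - K p i * K i q / K i i"

text \<open>The form of the complement at \<open>c\<close> is the form of \<open>K\<close> at
  \<open>c\<close> lowered by \<open>x\<close> in coordinate \<open>i\<close>, where
  \<open>x = L / K i i\<close> minimises it; hence it is nonnegative.\<close>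

lemma psd_schur_step:
  assumes K: "psd_kernel K"
  shows "psd_kernel (schur_step K i)"
proof (cases "K i i = 0")
  case True
  then have "schur_step K i = K"
    by (intro ext) (simp add: schur_step_def)
  with K show ?thesis by simp
next
  case False
  have sym: "K p q = K q p" for p q using K by (auto simp: psd_kernel_def)
  have "0 \<le> (\<Sum>p\<in>A. \<Sum>q\<in>A. c p * c q * schur_step K i p q)" if A: "finite A" for A c
  proof -
    \<comment> \<open>The pivot may lie outside \<open>A\<close>; extending \<open>c\<close> by zero
      allows the sums to run over a set that contains it.\<close>
    define c' where "c' p = (if p \<in> A then c p else 0)" for p
    define B where "B = insert i A"
    have B: "finite B" "i \<in> B" "A \<subseteq> B" using A by (auto simp: B_def)
    define L where "L = (\<Sum>p\<in>B. c' p * K p i)"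
    define x where "x = L / K i i"
    define Q where "Q = (\<Sum>p\<in>B. \<Sum>q\<in>B. c' p * c' q * K p q)"
    have delta: "(\<Sum>q\<in>B. (c' q - (if q = i then x else 0)) * u q) = (\<Sum>q\<in>B. c' q * u q) - x * u i" for u
      using B by (simp add: left_diff_distrib sum_subtractf if_distrib[where f = "\<lambda>v. v * _"] cong: if_cong)
    have "0 \<le> (\<Sum>p\<in>B. \<Sum>q\<in>B. (c' p - (if p = i then x else 0)) * (c' q - (if q = i then x else 0)) * K p q)"
      by (rule psd_kernelD[OF K B(1)])
    also have "\<dots> = (\<Sum>p\<in>B. (c' p - (if p = i then x else 0)) * (\<Sum>q\<in>B. (c' q - (if q = i then x else 0)) * K p q))"
      by (simp add: sum_distrib_left mult.assoc)
    also have "\<dots> = (\<Sum>p\<in>B. c' p * ((\<Sum>q\<in>B. c' q * K p q) - x * K p i)) - x * ((\<Sum>q\<in>B. c' q * K i q) - x * K i i)"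
      unfolding delta by (rule refl)
    also have "(\<Sum>p\<in>B. c' p * ((\<Sum>q\<in>B. c' q * K p q) - x * K p i)) = Q - x * L"
      by (simp add: Q_def L_def right_diff_distrib sum_subtractf sum_distrib_left mult_ac)
    also have "(\<Sum>q\<in>B. c' q * K i q) = L"
      unfolding L_def by (subst sym) (rule refl)
    finally have "0 \<le> Q - L * L / K i i"
      using False by (simp add: x_def)
    also have "Q = (\<Sum>p\<in>A. \<Sum>q\<in>A. c p * c q * K p q)"
    proof -
      have "Q = (\<Sum>p\<in>A. \<Sum>q\<in>B. c' p * c' q * K p q)"
        unfolding Q_def using B by (intro sum.mono_neutral_right) (auto simp: c'_def)
      also have "\<dots> = (\<Sum>p\<in>A. \<Sum>q\<in>A. c' p * c' q * K p q)"
        using B by (intro sum.cong refl sum.mono_neutral_right) (auto simp: c'_def)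
      finally show ?thesis by (simp add: c'_def cong: sum.cong)
    qed
    also have "L = (\<Sum>p\<in>A. c p * K p i)"
    proof -
      have "L = (\<Sum>p\<in>A. c' p * K p i)"
        unfolding L_def using B by (intro sum.mono_neutral_right) (auto simp: c'_def)
      then show ?thesis by (simp add: c'_def cong: sum.cong)
    qed
    also have "(\<Sum>p\<in>A. \<Sum>q\<in>A. c p * c q * K p q) - (\<Sum>p\<in>A. c p * K p i) * (\<Sum>p\<in>A. c p * K p i) / K i i
      = (\<Sum>p\<in>A. \<Sum>q\<in>A. c p * c q * schur_step K i p q)"
      unfolding schur_step_def sum_product sum_divide_distrib sum_subtractf[symmetric]
    proof (intro sum.cong refl)
      fix p q
      show "c p * c q * K p q - c p * K p i * (c q * K q i) / K i i = c p * c q * (K p q - K p i * K i q / K i i)"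
        unfolding sym[of i q] by (simp add: right_diff_distrib)
    qed
    finally show ?thesis .
  qed
  moreover have "schur_step K i p q = schur_step K i q p" for p q
    unfolding schur_step_def sym[of p q] sym[of p i] sym[of i q] by (simp add: mult.commute)
  ultimately show ?thesis
    unfolding psd_kernel_def by blast
qed

primrec schur :: "(nat \<Rightarrow> nat \<Rightarrow> real) \<Rightarrow> nat \<Rightarrow> nat \<Rightarrow> nat \<Rightarrow> real" where
  "schur K 0 = K"
| "schur K (Suc n) = schur_step (schur K n) n"

lemma psd_schur: "psd_kernel K \<Longrightarrow> psd_kernel (schur K n)"
  by (induction n) (auto intro: psd_schur_step)

lemma schur_sym: "psd_kernel K \<Longrightarrow> schur K n p q = schur K n q p"
  using psd_schur[of K n] by (auto simp: psd_kernel_def)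

text \<open>Each step clears the column of its pivot. Later steps keep it clear, because what they
  subtract contains an entry of that column as a factor.\<close>

lemma schur_zero:
  assumes K: "psd_kernel K"
  shows "q < n \<Longrightarrow> schur K n p q = 0"
proof (induction n arbitrary: p)
  case (Suc n)
  show ?case
  proof (cases "q = n")
    case True
    then show ?thesis
      using psd_kernel_zero[OF psd_schur[OF K], of n n p] by (auto simp: schur_step_def)
  next
    case False
    with Suc.prems have "q < n" by simp
    then show ?thesis
      using Suc.IH by (simp add: schur_step_def)
  qed
qed simp

text \<open>The pivot column divided by the root of the pivot; for a zero pivot both are zero and so
  is the quotient.\<close>

definition cholesky :: "(nat \<Rightarrow> nat \<Rightarrow> real) \<Rightarrow> nat \<Rightarrow> nat \<Rightarrow> real" where
  "cholesky K p i = schur K i p i / sqrt (schur K i i i)"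

lemma cholesky_lower: "psd_kernel K \<Longrightarrow> p < i \<Longrightarrow> cholesky K p i = 0"
  using schur_zero[of K p i i] schur_sym[of K i p i] by (simp add: cholesky_def)

lemma cholesky_schur:
  assumes K: "psd_kernel K"
  shows "K p q = (\<Sum>i<n. cholesky K p i * cholesky K q i) + schur K n p q"
proof (induction n)
  case (Suc n)
  have "cholesky K p n * cholesky K q n = schur K n p n * schur K n n q / schur K n n n"
    using psd_kernel_diag[OF psd_schur[OF K], of n n] schur_sym[OF K, of n q n]
    by (simp add: cholesky_def)
  then show ?case
    using Suc by (simp add: schur_step_def)
qed simp

lemma cholesky:
  assumes K: "psd_kernel K" and "q < n"
  shows "K p q = (\<Sum>i<n. cholesky K p i * cholesky K q i)"
  using cholesky_schur[OF K, of p q n] schur_zero[OF K \<open>q < n\<close>] by simp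

lemma char_iid_normal:
  fixes b :: "nat \<Rightarrow> real"
  shows "(\<integral>\<omega>. iexp (\<Sum>i<n. b i * \<omega> i) \<partial>(\<Pi>\<^sub>M i\<in>UNIV. std_normal_distribution)) = exp (- ((\<Sum>i<n. (b i)\<^sup>2) / 2))"
proof -
  interpret N: prob_space std_normal_distribution
    by (rule prob_space_normal_density) simp
  interpret P: product_prob_space "\<lambda>_. std_normal_distribution" "UNIV :: nat set" ..
  have [measurable_cong]: "sets std_normal_distribution = sets borel" by simp
  have "(\<integral>\<omega>. iexp (\<Sum>i<n. b i * \<omega> i) \<partial>(\<Pi>\<^sub>M i\<in>UNIV. std_normal_distribution))
      = (\<integral>\<omega>. (\<Prod>i<n. iexp (b i * restrict \<omega> {..<n} i)) \<partial>(\<Pi>\<^sub>M i\<in>UNIV. std_normal_distribution))"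
    by (simp add: exp_sum[symmetric] sum_distrib_left of_real_sum)
  also have "\<dots> = (\<integral>\<omega>. (\<Prod>i<n. iexp (b i * \<omega> i)) \<partial>distr (\<Pi>\<^sub>M i\<in>UNIV. std_normal_distribution)
      (\<Pi>\<^sub>M i\<in>{..<n}. std_normal_distribution) (\<lambda>x. restrict x {..<n}))"
    by (subst integral_distr) auto
  also have "\<dots> = (\<integral>\<omega>. (\<Prod>i<n. iexp (b i * \<omega> i)) \<partial>(\<Pi>\<^sub>M i\<in>{..<n}. std_normal_distribution))"
    by (subst P.distr_PiM_restrict_finite) auto
  also have "\<dots> = (\<Prod>i<n. char std_normal_distribution (b i))"
    unfolding char_def
    by (subst P.product_integral_prod) (auto intro!: N.integrable_const_bound[of _ 1])
  also have "\<dots> = exp (- ((\<Sum>i<n. (b i)\<^sup>2) / 2))"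
    by (simp add: char_std_normal_distribution exp_sum[symmetric] sum_negf sum_divide_distrib flip: of_real_prod)
  finally show ?thesis .
qed

text \<open>Rows of the Cholesky factor are applied to independent standard normal variables; each
  row is finite, so no convergence question arises. The map \<open>\<sigma>\<close> permits repeated
  indices, which occur when distinct summands refer to the same time.\<close>

theorem gaussian_sequence_exists:
  assumes K: "psd_kernel K"
  obtains \<Omega> :: "(nat \<Rightarrow> real) measure" and G :: "nat \<Rightarrow> (nat \<Rightarrow> real) \<Rightarrow> real"
  where "prob_space \<Omega>" "\<And>p. G p \<in> borel_measurable \<Omega>"
    "\<And>(I :: nat set) c \<sigma>. finite I \<Longrightarrow> (\<integral>\<omega>. iexp (\<Sum>p\<in>I. c p * G (\<sigma> p) \<omega>) \<partial>\<Omega>)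
      = exp (- ((\<Sum>p\<in>I. \<Sum>q\<in>I. c p * c q * K (\<sigma> p) (\<sigma> q)) / 2))"
proof -
  let ?\<Omega> = "\<Pi>\<^sub>M i\<in>(UNIV :: nat set). std_normal_distribution"
  let ?G = "\<lambda>p \<omega>. \<Sum>i<Suc p. cholesky K p i * \<omega> i"
  have [measurable_cong]: "sets std_normal_distribution = sets borel" by simp
  have prob: "prob_space ?\<Omega>"
    by (intro prob_space_PiM prob_space_normal_density) simp
  have meas: "?G p \<in> borel_measurable ?\<Omega>" for p
    by measurable
  have char: "(\<integral>\<omega>. iexp (\<Sum>p\<in>I. c p * ?G (\<sigma> p) \<omega>) \<partial>?\<Omega>)
    = exp (- ((\<Sum>p\<in>I. \<Sum>q\<in>I. c p * c q * K (\<sigma> p) (\<sigma> q)) / 2))"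
    if I: "finite I" for I :: "nat set" and c \<sigma>
  proof -
    obtain n where n: "\<And>p. p \<in> I \<Longrightarrow> \<sigma> p < n"
      using I finite_nat_set_iff_bounded[of "\<sigma> ` I"] by auto
    define b where "b i = (\<Sum>p\<in>I. c p * cholesky K (\<sigma> p) i)" for i
    have "(\<Sum>p\<in>I. c p * ?G (\<sigma> p) \<omega>) = (\<Sum>i<n. b i * \<omega> i)" for \<omega>
    proof -
      have "?G p \<omega> = (\<Sum>i<n. cholesky K p i * \<omega> i)" if "p < n" for p
        using that cholesky_lower[OF K, of p] by (intro sum.mono_neutral_left) auto
      then have "(\<Sum>p\<in>I. c p * ?G (\<sigma> p) \<omega>) = (\<Sum>p\<in>I. c p * (\<Sum>i<n. cholesky K (\<sigma> p) i * \<omega> i))"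
        using n by (intro sum.cong) auto
      also have "\<dots> = (\<Sum>i<n. b i * \<omega> i)"
        unfolding b_def sum_distrib_left sum_distrib_right by (subst sum.swap) (simp add: mult.assoc)
      finally show ?thesis .
    qed
    then have "(\<integral>\<omega>. iexp (\<Sum>p\<in>I. c p * ?G (\<sigma> p) \<omega>) \<partial>?\<Omega>) = exp (- ((\<Sum>i<n. (b i)\<^sup>2) / 2))"
      by (simp only: char_iid_normal)
    also have "(\<Sum>i<n. (b i)\<^sup>2) = (\<Sum>i<n. \<Sum>p\<in>I. \<Sum>q\<in>I. c p * c q * (cholesky K (\<sigma> p) i * cholesky K (\<sigma> q) i))"
      by (simp add: b_def power2_eq_square sum_product mult_ac)
    also have "\<dots> = (\<Sum>p\<in>I. \<Sum>q\<in>I. \<Sum>i<n. c p * c q * (cholesky K (\<sigma> p) i * cholesky K (\<sigma> q) i))"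
      by (subst sum.swap) (intro sum.cong refl sum.swap)
    also have "\<dots> = (\<Sum>p\<in>I. \<Sum>q\<in>I. c p * c q * K (\<sigma> p) (\<sigma> q))"
    proof (intro sum.cong refl)
      fix p q assume "q \<in> I"
      then show "(\<Sum>i<n. c p * c q * (cholesky K (\<sigma> p) i * cholesky K (\<sigma> q) i)) = c p * c q * K (\<sigma> p) (\<sigma> q)"
        using cholesky[OF K n, of q "\<sigma> p"] by (simp add: sum_distrib_left)
    qed
    finally show ?thesis .
  qed
  show thesis
    by (rule that[of ?\<Omega> ?G, OF prob meas char])
qed

section \<open>The space of integrable functions\<close>

lemma L1_rel_refl: "L1_rel f f \<longleftrightarrow> integrable lborel f"
  by (auto simp: L1_rel_def)

lemma abs_rep_L1: "abs_L1 (rep_L1 x) = x"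
  by (rule Quotient_abs_rep[OF Quotient_L1])

lemma integrable_rep_L1[simp]: "integrable lborel (rep_L1 x)"
  using Quotient_rep_reflp[OF Quotient_L1, of x] by (simp add: L1_rel_def)

lemma rep_abs_L1:
  assumes "integrable lborel f"
  shows "AE t in lborel. rep_L1 (abs_L1 f) t = f t"
  using Quotient_rep_abs[OF Quotient_L1, of f] assms by (simp add: L1_rel_def)

lemma norm_abs_L1: "integrable lborel f \<Longrightarrow> norm (abs_L1 f) = (\<integral>t. \<bar>f t\<bar> \<partial>lborel)"
  by (rule norm_L1.abs_eq) (simp add: L1_rel_refl)

lemma norm_L1_rep: "norm x = (\<integral>t. \<bar>rep_L1 x t\<bar> \<partial>lborel)"
  using norm_abs_L1[of "rep_L1 x"] by (simp add: abs_rep_L1)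

lemma abs_L1_add: "integrable lborel f \<Longrightarrow> integrable lborel g \<Longrightarrow> abs_L1 f + abs_L1 g = abs_L1 (\<lambda>t. f t + g t)"
  by (rule plus_L1.abs_eq) (simp_all add: L1_rel_refl)

lemma abs_L1_diff: "integrable lborel f \<Longrightarrow> integrable lborel g \<Longrightarrow> abs_L1 f - abs_L1 g = abs_L1 (\<lambda>t. f t - g t)"
  by (rule minus_L1.abs_eq) (simp_all add: L1_rel_refl)

lemma abs_L1_scaleR: "integrable lborel f \<Longrightarrow> c *\<^sub>R abs_L1 f = abs_L1 (\<lambda>t. c * f t)"
  by (rule scaleR_L1.abs_eq) (simp add: L1_rel_refl)

lemma abs_L1_sum:
  assumes "finite I" "\<And>i. i \<in> I \<Longrightarrow> integrable lborel (f i)"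
  shows "(\<Sum>i\<in>I. abs_L1 (f i)) = abs_L1 (\<lambda>t. \<Sum>i\<in>I. f i t)"
  using assms
proof (induction I)
  case empty
  then show ?case by (simp add: zero_L1_def)
next
  case (insert i I)
  then show ?case by (simp add: abs_L1_add)
qed

lemma Linf_bound:
  assumes "f \<in> Linf"
  obtains c where "0 \<le> c" "AE t in lborel. \<bar>f t\<bar> \<le> c"
proof -
  obtain c where c: "AE t in lborel. \<bar>f t\<bar> \<le> c"
    using assms by (auto simp: Linf_def)
  have "AE t in lborel. \<bar>f t\<bar> \<le> max 0 c"
    using c by eventually_elim auto
  then show thesis by (intro that[of "max 0 c"]) auto
qed

lemma Linf_measurable: "f \<in> Linf \<Longrightarrow> f \<in> borel_measurable borel"
  by (simp add: Linf_def)

lemma Linf_add: "f \<in> Linf \<Longrightarrow> g \<in> Linf \<Longrightarrow> (\<lambda>t. f t + g t) \<in> Linf"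
proof -
  assume fg: "f \<in> Linf" "g \<in> Linf"
  obtain a b where "AE t in lborel. \<bar>f t\<bar> \<le> a" "AE t in lborel. \<bar>g t\<bar> \<le> b"
    using fg by (auto simp: Linf_def)
  then have "AE t in lborel. \<bar>f t + g t\<bar> \<le> a + b"
    by eventually_elim linarith
  with fg show ?thesis by (auto simp: Linf_def)
qed

lemma Linf_uminus: "f \<in> Linf \<Longrightarrow> (\<lambda>t. - f t) \<in> Linf"
  by (auto simp: Linf_def)

lemma integrable_Linf_mult:
  assumes f: "f \<in> Linf" and g: "integrable lborel g"
  shows "integrable lborel (\<lambda>t. f t * g t)"
proof -
  obtain c where c: "0 \<le> c" "AE t in lborel. \<bar>f t\<bar> \<le> c"
    using f by (rule Linf_bound)
  have [measurable]: "f \<in> borel_measurable borel"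
    using f by (rule Linf_measurable)
  have [measurable]: "g \<in> borel_measurable borel"
    using g by auto
  show ?thesis
  proof (rule Bochner_Integration.integrable_bound[OF integrable_mult_right[OF integrable_abs[OF g], of c]])
    show "AE t in lborel. norm (f t * g t) \<le> norm (c * \<bar>g t\<bar>)"
      using c(2) by eventually_elim (use c(1) in \<open>auto simp: abs_mult intro!: mult_right_mono\<close>)
  qed simp
qed

lemma pairing_abs_L1:
  assumes f: "f \<in> Linf" and g: "integrable lborel g"
  shows "pairing f (abs_L1 g) = (\<integral>t. f t * g t \<partial>lborel)"
proof -
  have [measurable]: "f \<in> borel_measurable borel" "g \<in> borel_measurable borel" "rep_L1 (abs_L1 g) \<in> borel_measurable borel"
    using f g integrable_rep_L1[of "abs_L1 g"] by (auto simp: Linf_measurable simp del: integrable_rep_L1)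
  show ?thesis
    unfolding pairing_def using rep_abs_L1[OF g]
    by (intro integral_cong_AE) auto
qed

lemma bounded_linear_pairing:
  assumes f: "f \<in> Linf"
  shows "bounded_linear (pairing f)"
proof -
  obtain c where c: "0 \<le> c" "AE t in lborel. \<bar>f t\<bar> \<le> c"
    using f by (rule Linf_bound)
  note i = integrable_Linf_mult[OF f integrable_rep_L1]
  show ?thesis
  proof (rule bounded_linear_intro[where K = c])
    fix x y :: L1 and r :: real
    have "x + y = abs_L1 (\<lambda>t. rep_L1 x t + rep_L1 y t)" "r *\<^sub>R x = abs_L1 (\<lambda>t. r * rep_L1 x t)"
      using abs_L1_add[of "rep_L1 x" "rep_L1 y"] abs_L1_scaleR[of "rep_L1 x" r] by (simp_all add: abs_rep_L1)
    then show "pairing f (x + y) = pairing f x + pairing f y" "pairing f (r *\<^sub>R x) = r *\<^sub>R pairing f x"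
      using i by (simp_all add: pairing_abs_L1[OF f] distrib_left mult.left_commute) (simp_all add: pairing_def)
    have "norm (pairing f x) \<le> (\<integral>t. \<bar>f t * rep_L1 x t\<bar> \<partial>lborel)"
      unfolding pairing_def real_norm_def by (rule integral_abs_bound)
    also have "\<dots> \<le> (\<integral>t. c * \<bar>rep_L1 x t\<bar> \<partial>lborel)"
    proof (rule integral_mono_AE)
      show "AE t in lborel. \<bar>f t * rep_L1 x t\<bar> \<le> c * \<bar>rep_L1 x t\<bar>"
        using c(2) by eventually_elim (auto simp: abs_mult intro!: mult_right_mono)
    qed (use i in auto)
    finally show "norm (pairing f x) \<le> norm x * c"
      by (simp add: norm_L1_rep mult.commute)
  qed
qed

section \<open>Completeness and measurability in the space of integrable functions\<close>

text \<open>Completeness in the form of convergence of absolutely convergent series. The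
  representatives are summed pointwise almost everywhere, and the sum of their absolute values
  dominates the remainders.\<close>

lemma L1_summable_norm:
  fixes x :: "nat \<Rightarrow> L1"
  assumes s: "summable (\<lambda>k. norm (x k))"
  shows "\<exists>l. (\<lambda>n. \<Sum>k<n. x k) \<longlonglongrightarrow> l"
proof -
  define g where "g k = rep_L1 (x k)" for k
  have i: "integrable lborel (g k)" for k
    by (simp add: g_def)
  have [measurable]: "g k \<in> borel_measurable borel" for k
    using i[of k] by auto
  have n: "(\<integral>t. \<bar>g k t\<bar> \<partial>lborel) = norm (x k)" for k
    by (simp add: g_def norm_L1_rep)
  have "(\<integral>\<^sup>+t. (\<Sum>k. ennreal \<bar>g k t\<bar>) \<partial>lborel) = (\<Sum>k. ennreal (norm (x k)))"
  proof -
    have "(\<integral>\<^sup>+t. ennreal \<bar>g k t\<bar> \<partial>lborel) = ennreal (norm (x k))" for k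
      unfolding n[of k, symmetric] using i[of k] by (intro nn_integral_eq_integral) auto
    then show ?thesis
      by (subst nn_integral_suminf) simp_all
  qed
  also have "\<dots> = ennreal (\<Sum>k. norm (x k))"
    by (rule suminf_ennreal2[OF norm_ge_zero s])
  also have "\<dots> \<noteq> \<infinity>"
    by simp
  finally have "AE t in lborel. (\<Sum>k. ennreal \<bar>g k t\<bar>) \<noteq> \<infinity>"
    by (intro nn_integral_PInf_AE) auto
  then have AE: "AE t in lborel. summable (\<lambda>k. \<bar>g k t\<bar>)"
    by eventually_elim (rule summable_suminf_not_top, auto)
  have ai: "integrable lborel (\<lambda>t. \<Sum>k. \<bar>g k t\<bar>)"
    using integrable_suminf[of lborel "\<lambda>k t. \<bar>g k t\<bar>"] i AE s by (simp add: n)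
  have gi: "integrable lborel (\<lambda>t. \<Sum>k. g k t)"
    using integrable_suminf[of lborel g] i AE s by (simp add: n)
  have "(\<lambda>n. \<integral>t. \<bar>(\<Sum>k<n. g k t) - (\<Sum>k. g k t)\<bar> \<partial>lborel) \<longlonglongrightarrow> integral\<^sup>L lborel (\<lambda>t::real. 0)"
  proof (rule integral_dominated_convergence[where w = "\<lambda>t. \<Sum>k. \<bar>g k t\<bar>"])
    show "AE t in lborel. (\<lambda>n. \<bar>(\<Sum>k<n. g k t) - (\<Sum>k. g k t)\<bar>) \<longlonglongrightarrow> 0"
      using AE
    proof eventually_elim
      case (elim t)
      then have "(\<lambda>n. (\<Sum>k<n. g k t)) \<longlonglongrightarrow> (\<Sum>k. g k t)"
        by (rule summable_LIMSEQ[OF summable_rabs_cancel])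
      then show ?case
        by (rule tendsto_rabs_zero[OF LIM_zero])
    qed
    show "AE t in lborel. norm \<bar>(\<Sum>k<n. g k t) - (\<Sum>k. g k t)\<bar> \<le> (\<Sum>k. \<bar>g k t\<bar>)" for n
      using AE
    proof eventually_elim
      case (elim t)
      then have sg: "summable (\<lambda>k. g k t)" by (rule summable_rabs_cancel)
      have tail: "summable (\<lambda>k. \<bar>g (k + n) t\<bar>)"
        using summable_iff_shift[of "\<lambda>k. \<bar>g k t\<bar>" n] elim by simp
      have "\<bar>(\<Sum>k<n. g k t) - (\<Sum>k. g k t)\<bar> = \<bar>\<Sum>k. g (k + n) t\<bar>"
        using suminf_split_initial_segment[OF sg, of n] by simp
      also have "\<dots> \<le> (\<Sum>k. \<bar>g (k + n) t\<bar>)"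
        by (rule summable_rabs[OF tail])
      also have "\<dots> \<le> (\<Sum>k. \<bar>g k t\<bar>)"
        using suminf_split_initial_segment[OF elim, of n] by (simp add: sum_nonneg)
      finally show ?case by simp
    qed
  qed (use ai in auto)
  moreover have "norm ((\<Sum>k<n. x k) - abs_L1 (\<lambda>t. \<Sum>k. g k t)) = (\<integral>t. \<bar>(\<Sum>k<n. g k t) - (\<Sum>k. g k t)\<bar> \<partial>lborel)" for n
  proof -
    have "(\<Sum>k<n. x k) = abs_L1 (\<lambda>t. \<Sum>k<n. g k t)"
      using i by (subst abs_L1_sum[symmetric]) (auto simp: g_def abs_rep_L1)
    then show ?thesis
      using i gi by (simp add: abs_L1_diff norm_abs_L1)
  qed
  ultimately have "(\<lambda>n. norm ((\<Sum>k<n. x k) - abs_L1 (\<lambda>t. \<Sum>k. g k t))) \<longlonglongrightarrow> 0"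
    by simp
  then have "(\<lambda>n. \<Sum>k<n. x k) \<longlonglongrightarrow> abs_L1 (\<lambda>t. \<Sum>k. g k t)"
    by (rule LIM_zero_cancel[OF tendsto_norm_zero_cancel])
  then show ?thesis ..
qed

text \<open>The target space carries no countability assumption, so the combination is treated as a
  continuous function of the sequence of coefficients.\<close>

lemma borel_measurable_combination:
  fixes e :: "nat \<Rightarrow> 'b::real_normed_vector"
  assumes [measurable]: "\<And>i. X i \<in> borel_measurable M"
  shows "(\<lambda>\<omega>. \<Sum>i<n. X i \<omega> *\<^sub>R e i) \<in> borel_measurable M"
proof -
  have "(\<lambda>\<omega> i. X i \<omega>) \<in> borel_measurable M"
    by (rule measurable_coordinatewise_then_product) simp
  moreover have "continuous_on UNIV (\<lambda>x :: nat \<Rightarrow> real. \<Sum>i<n. x i *\<^sub>R e i)"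
    by (intro continuous_intros continuous_on_product_coordinates)
  then have "(\<lambda>x :: nat \<Rightarrow> real. \<Sum>i<n. x i *\<^sub>R e i) \<in> borel_measurable borel"
    by (rule borel_measurable_continuous_onI)
  ultimately show ?thesis
    by (rule measurable_compose)
qed

section \<open>Lipschitz test functions\<close>

text \<open>The infimal convolution of \<open>h\<close> with \<open>k\<close> times the distance:
  the penalty makes it Lipschitz with constant \<open>k\<close>, and for large \<open>k\<close> only
  points near \<open>x\<close> compete.\<close>

lemma lipschitz_approximation_below:
  fixes h :: "'b::metric_space \<Rightarrow> real"
  assumes h: "continuous_on UNIV h" and B: "\<And>x. \<bar>h x\<bar> \<le> B"
  obtains g :: "nat \<Rightarrow> 'b \<Rightarrow> real" where "\<And>k. (real k)-lipschitz_on UNIV (g k)" "\<And>k x. g k x \<le> h x"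
    "\<And>k x. \<bar>g k x\<bar> \<le> B" "\<And>x. (\<lambda>k. g k x) \<longlonglongrightarrow> h x"
proof
  let ?g = "\<lambda>k x. INF y. h y + real k * dist x y"
  have nn: "0 \<le> real k * dist x y" for k and x y :: 'b
    by simp
  have bdd: "bdd_below (range (\<lambda>y. h y + real k * dist x y))" for k x
  proof (rule bdd_belowI2[where m = "- B"])
    show "- B \<le> h y + real k * dist x y" for y
      using B[of y] nn[of k x y] by linarith
  qed
  show le: "?g k x \<le> h x" for k x
    using cINF_lower[OF bdd, of x k x] by simp
  have ge: "- B \<le> ?g k x" for k x
  proof (rule cINF_greatest)
    show "- B \<le> h y + real k * dist x y" for y
      using B[of y] nn[of k x y] by linarith
  qed simp
  show "\<bar>?g k x\<bar> \<le> B" for k x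
    using le[of k x] ge[of k x] B[of x] by auto
  show "(real k)-lipschitz_on UNIV (?g k)" for k
  proof (rule lipschitz_onI)
    have "?g k x - ?g k y \<le> real k * dist x y" for x y
    proof -
      have "?g k x - real k * dist x y \<le> ?g k y"
      proof (rule cINF_greatest)
        fix z
        have "?g k x \<le> h z + real k * dist x z"
          by (rule cINF_lower[OF bdd]) simp
        also have "real k * dist x z \<le> real k * (dist x y + dist y z)"
          by (intro mult_left_mono dist_triangle) simp
        finally show "?g k x - real k * dist x y \<le> h z + real k * dist y z"
          by (simp add: distrib_left)
      qed simp
      then show ?thesis by simp
    qed
    note lip = this
    show "dist (?g k x) (?g k y) \<le> real k * dist x y" for x y
      unfolding dist_real_def using lip[of x y] lip[of y x, unfolded dist_commute[of y x]] by linarith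
  qed simp
  show "(\<lambda>k. ?g k x) \<longlonglongrightarrow> h x" for x
  proof (rule LIMSEQ_I)
    fix e :: real assume "0 < e"
    then obtain d where d: "0 < d" "\<And>y. dist y x < d \<Longrightarrow> dist (h y) (h x) < e / 2"
      using h[unfolded continuous_on_iff, rule_format, of x "e / 2"] by auto
    \<comment> \<open>Beyond distance \<open>d\<close> the penalty is then at least
      \<open>2 * B\<close>, more than any gain from a smaller value of \<open>h\<close>.\<close>
    obtain K :: nat where K: "2 * B / d \<le> real K"
      using real_arch_simple by blast
    have "norm (?g k x - h x) < e" if "K \<le> k" for k
    proof -
      have "h x - e / 2 \<le> ?g k x"
      proof (rule cINF_greatest)
        fix y
        show "h x - e / 2 \<le> h y + real k * dist x y"
        proof (cases "dist y x < d")
          case True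
          then have "\<bar>h y - h x\<bar> < e / 2" using d(2) by (simp add: dist_real_def)
          then show ?thesis
            using nn[of k x y] by linarith
        next
          case False
          have "2 * B \<le> real K * d"
            using K d(1) by (simp add: field_simps)
          also have "\<dots> \<le> real k * dist x y"
            using False that d(1) by (intro mult_mono) (auto simp: dist_commute)
          finally show ?thesis
            using B[of x] B[of y] \<open>0 < e\<close> by auto
        qed
      qed simp
      then show ?thesis
        using le[of k x] \<open>0 < e\<close> by auto
    qed
    then show "\<exists>K. \<forall>k\<ge>K. norm (?g k x - h x) < e" by blast
  qed
qed

text \<open>Part of the portmanteau theorem: Lipschitz functions below \<open>h\<close> give a lower
  bound for the means of \<open>h\<close> along the sequence, and the same argument for
  \<open>- h\<close> gives the upper bound.\<close>

theorem converges_in_law_lipschitz: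
  fixes X :: "nat \<Rightarrow> 'a \<Rightarrow> 'b::metric_space"
  assumes "prob_space M" "prob_space N" and sets: "sets N = sets borel"
    and X[measurable]: "\<And>n. X n \<in> borel_measurable M"
    and conv: "\<And>(h :: 'b \<Rightarrow> real) L B. L-lipschitz_on UNIV h \<Longrightarrow> (\<And>x. \<bar>h x\<bar> \<le> B) \<Longrightarrow>
      (\<lambda>n. \<integral>\<omega>. h (X n \<omega>) \<partial>M) \<longlonglongrightarrow> (\<integral>x. h x \<partial>N)"
  shows "converges_in_law M X N"
proof -
  interpret M: prob_space M by fact
  interpret N: prob_space N by fact
  note [measurable_cong] = sets
  have lower: "\<forall>\<^sub>F n in sequentially. (\<integral>x. h x \<partial>N) - e < (\<integral>\<omega>. h (X n \<omega>) \<partial>M)"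
    if h: "continuous_on UNIV h" and B: "\<And>x. \<bar>h x\<bar> \<le> B" and e: "0 < e" for h :: "'b \<Rightarrow> real" and B e
  proof -
    obtain g :: "nat \<Rightarrow> 'b \<Rightarrow> real" where g: "\<And>k. (real k)-lipschitz_on UNIV (g k)" "\<And>k x. g k x \<le> h x"
      "\<And>k x. \<bar>g k x\<bar> \<le> B" "\<And>x. (\<lambda>k. g k x) \<longlonglongrightarrow> h x"
      using lipschitz_approximation_below[OF h B] by blast
    have [measurable]: "h \<in> borel_measurable borel" "g k \<in> borel_measurable borel" for k
      using h lipschitz_on_continuous_on[OF g(1)] by (auto intro: borel_measurable_continuous_onI)
    have "(\<lambda>k. \<integral>x. g k x \<partial>N) \<longlonglongrightarrow> (\<integral>x. h x \<partial>N)"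
      using g(3,4) by (intro integral_dominated_convergence[where w = "\<lambda>_. B"]) auto
    then have "\<forall>\<^sub>F k in sequentially. (\<integral>x. h x \<partial>N) - e < (\<integral>x. g k x \<partial>N)"
      by (rule order_tendstoD) (use e in simp)
    then obtain k where "(\<integral>x. h x \<partial>N) - e < (\<integral>x. g k x \<partial>N)"
      using eventually_happens'[OF sequentially_bot] by blast
    then have "\<forall>\<^sub>F n in sequentially. (\<integral>x. h x \<partial>N) - e < (\<integral>\<omega>. g k (X n \<omega>) \<partial>M)"
      by (rule order_tendstoD(1)[OF conv[OF g(1) g(3)]])
    then show ?thesis
    proof eventually_elim
      case (elim n)
      have "(\<integral>\<omega>. g k (X n \<omega>) \<partial>M) \<le> (\<integral>\<omega>. h (X n \<omega>) \<partial>M)"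
        using g(2,3) B by (intro integral_mono M.integrable_const_bound[of _ B]) auto
      with elim show ?case by simp
    qed
  qed
  have "(\<lambda>n. \<integral>\<omega>. h (X n \<omega>) \<partial>M) \<longlonglongrightarrow> (\<integral>x. h x \<partial>N)"
    if h: "continuous_on UNIV h" and "bounded (range h)" for h :: "'b \<Rightarrow> real"
  proof (rule tendstoI)
    obtain B where B: "\<And>x. \<bar>h x\<bar> \<le> B"
      using \<open>bounded (range h)\<close> by (auto simp: bounded_iff)
    fix e :: real assume e: "0 < e"
    have "\<forall>\<^sub>F n in sequentially. (\<integral>x. - h x \<partial>N) - e < (\<integral>\<omega>. - h (X n \<omega>) \<partial>M)"
      using lower[OF continuous_on_minus[OF h] _ e, of B] B by simp
    with lower[OF h B e]
    show "\<forall>\<^sub>F n in sequentially. dist (\<integral>\<omega>. h (X n \<omega>) \<partial>M) (\<integral>x. h x \<partial>N) < e"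
      by eventually_elim (auto simp: dist_real_def abs_less_iff)
  qed
  then show ?thesis
    unfolding converges_in_law_def using X by blast
qed

section \<open>Past trajectories\<close>

abbreviation path_space :: "(nat \<Rightarrow> real) measure" where
  "path_space \<equiv> \<Pi>\<^sub>M j\<in>UNIV. borel"

locale stationary_sequence = prob_space M for M :: "'a measure" +
  fixes Y :: "int \<Rightarrow> 'a \<Rightarrow> real"
  assumes Y_measurable[measurable]: "\<And>i. Y i \<in> borel_measurable M"
    and stationary: "stationary M Y"
    and ergodic: "ergodic M Y"
begin

text \<open>Paths run backwards in time, so that \<open>sh\<close> forgets the most recent value and
  \<open>(sh ^^ k) y\<close> is the past seen \<open>k\<close> steps earlier.\<close>

definition hist :: "nat \<Rightarrow> 'a \<Rightarrow> nat \<Rightarrow> real" where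
  "hist n \<omega> = (\<lambda>j. Y (int n - int j) \<omega>)"

lemma hist_measurable[measurable]: "hist n \<in> measurable M path_space"
  unfolding hist_def[abs_def] by (rule measurable_PiM_single') auto

definition PP :: "(nat \<Rightarrow> real) measure" where
  "PP = distr M path_space (hist 0)"

lemma sets_PP[measurable_cong, simp]: "sets PP = sets path_space"
  by (simp add: PP_def)

lemma space_PP[simp]: "space PP = UNIV"
  by (simp add: PP_def space_PiM)

lemma path_measurable: "(\<lambda>\<omega> i. Y (i + m) \<omega>) \<in> measurable M (\<Pi>\<^sub>M i\<in>UNIV. borel)"
  by (rule measurable_PiM_single') auto

lemma distr_hist: "distr M path_space (hist n) = PP"
proof (induction n)
  case (Suc n)
  have g: "(\<lambda>y j. y (int n - int j)) \<in> measurable (\<Pi>\<^sub>M i\<in>UNIV. borel) path_space"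
    by (rule measurable_PiM_single') auto
  have b: "hist (Suc n) = (\<lambda>y j. y (int n - int j)) \<circ> (\<lambda>\<omega> i. Y (i + 1) \<omega>)"
    "hist n = (\<lambda>y j. y (int n - int j)) \<circ> (\<lambda>\<omega> i. Y (i + 0) \<omega>)"
    by (auto simp: hist_def fun_eq_iff algebra_simps)
  have "distr M path_space (hist (Suc n)) = distr (path_law M (\<lambda>i. Y (i + 1))) path_space (\<lambda>y j. y (int n - int j))"
    unfolding path_law_def b by (rule distr_distr[symmetric, OF g path_measurable])
  also have "\<dots> = distr (path_law M Y) path_space (\<lambda>y j. y (int n - int j))"
    using stationary by (simp add: stationary_def)
  also have "\<dots> = distr M path_space (hist n)"
    unfolding path_law_def b using distr_distr[OF g path_measurable[of 0]] by simp
  finally show ?case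
    by (simp add: Suc)
qed (simp add: PP_def)

definition sh :: "(nat \<Rightarrow> real) \<Rightarrow> nat \<Rightarrow> real" where
  "sh y = (\<lambda>j. y (Suc j))"

lemma sh_measurable[measurable]: "sh \<in> measurable path_space path_space"
  unfolding sh_def[abs_def] by (rule measurable_PiM_single') auto

lemma sh_funpow: "(sh ^^ k) y = (\<lambda>j. y (j + k))"
  by (induction k arbitrary: y) (auto simp: sh_def)

lemma sh_hist: "(sh ^^ k) (hist k \<omega>) = hist 0 \<omega>"
  by (auto simp: sh_funpow hist_def)

sublocale P: ergodic_map PP sh
proof (intro ergodic_map.intro mp_map.intro ergodic_map_axioms.intro mp_map_axioms.intro)
  show "prob_space PP"
    unfolding PP_def by (rule prob_space_distr) simp
  show "sh \<in> measurable PP PP"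
    by simp
  have "sh \<circ> hist 1 = hist 0"
    by (auto simp: sh_def hist_def fun_eq_iff)
  then have "distr PP path_space sh = PP"
    unfolding distr_hist[of 1, symmetric] by (subst distr_distr) (auto simp: distr_hist)
  moreover have "distr PP PP sh = distr PP path_space sh"
    by (rule distr_cong) auto
  ultimately show "distr PP PP sh = PP"
    by simp
  fix A assume A: "A \<in> sets PP" "sh -` A \<inter> space PP = A"
  \<comment> \<open>The two-sided paths whose past, read backwards from time \<open>0\<close>, lies
    in \<open>A\<close>. \<open>shift\<close> moves forward in time and \<open>sh\<close> back, so
    \<open>sh\<close> undoes \<open>shift\<close> on this past and \<open>A'\<close> inherits
    invariance from \<open>A\<close>.\<close>
  define A' where "A' = (\<lambda>y :: int \<Rightarrow> real. \<lambda>j. y (- int j)) -` A"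
  have g[measurable]: "(\<lambda>y j. y (- int j)) \<in> measurable (\<Pi>\<^sub>M i\<in>UNIV. borel :: real measure) path_space"
    by (rule measurable_PiM_single') auto
  have p[measurable]: "(\<lambda>\<omega> i. Y i \<omega>) \<in> measurable M (\<Pi>\<^sub>M i\<in>UNIV. borel)"
    using path_measurable[of 0] by simp
  have A': "A' \<in> sets (\<Pi>\<^sub>M i\<in>UNIV. borel)"
    using measurable_sets[OF g, of A] A by (simp add: A'_def space_PiM)
  have "y \<in> A \<longleftrightarrow> sh y \<in> A" for y
    using A(2) by auto
  moreover have "sh (\<lambda>j. shift y (- int j)) = (\<lambda>j. y (- int j))" for y
    by (auto simp: sh_def shift_def)
  ultimately have "shift y \<in> A' \<longleftrightarrow> y \<in> A'" for y
    unfolding A'_def vimage_eq by metis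
  then have "shift -` A' = A'"
    by blast
  with ergodic A' have "measure (path_law M Y) A' \<in> {0, 1}"
    unfolding ergodic_def by blast
  moreover have "measure (path_law M Y) A' = measure PP A"
    unfolding path_law_def PP_def using A A'
    by (simp add: measure_distr) (auto simp: A'_def hist_def intro!: arg_cong[where f = prob])
  ultimately show "measure PP A = 0 \<or> measure PP A = 1"
    by auto
qed

lemma integral_hist:
  fixes f :: "(nat \<Rightarrow> real) \<Rightarrow> 'b::{banach, second_countable_topology}"
  assumes "f \<in> borel_measurable path_space"
  shows "(\<integral>\<omega>. f (hist n \<omega>) \<partial>M) = (\<integral>y. f y \<partial>PP)"
  unfolding distr_hist[of n, symmetric] using assms by (subst integral_distr) auto

lemma F_marg_eq: "F_marg M Y t = prob {\<omega> \<in> space M. Y (int k) \<omega> \<le> t}"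
proof -
  have eq: "prob {\<omega> \<in> space M. Y (int k) \<omega> \<le> t} = measure PP {y. y 0 \<le> t}" for k
  proof -
    have "{y. y 0 \<le> t} \<in> sets path_space"
      using measurable_sets[of "\<lambda>y. y 0" path_space borel "{..t}"] by (simp add: space_PiM vimage_def)
    then have "measure PP {y. y 0 \<le> t} = prob (hist k -` {y. y 0 \<le> t} \<inter> space M)"
      unfolding distr_hist[of k, symmetric] by (subst measure_distr) auto
    then show ?thesis
      by (auto simp: hist_def intro!: arg_cong[where f = prob])
  qed
  have "F_marg M Y t = prob {\<omega> \<in> space M. Y (int 0) \<omega> \<le> t}"
    by (auto simp: F_marg_def cdf_def measure_distr intro!: arg_cong[where f = prob])
  then show ?thesis
    by (simp only: eq)
qed

lemma F_marg_01: "0 \<le> F_marg M Y t" "F_marg M Y t \<le> 1"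
  unfolding F_marg_eq[of t 0] by simp_all

lemma F_marg_mono: "s \<le> t \<Longrightarrow> F_marg M Y s \<le> F_marg M Y t"
  unfolding F_marg_eq[of _ 0] by (intro finite_measure_mono) auto

definition X :: "real \<Rightarrow> (nat \<Rightarrow> real) \<Rightarrow> real" where
  "X t y = indicator {..t} (y 0) - F_marg M Y t"

lemma X_measurable[measurable]: "X t \<in> borel_measurable path_space"
  unfolding X_def[abs_def] by measurable

lemma X_bound: "\<bar>X t y\<bar> \<le> 1"
  using F_marg_01[of t] by (auto simp: X_def indicator_def)

section \<open>Conditional probabilities given the past and the mixing coefficients\<close>

lemma past_generator: "{Y i -` B \<inter> space M | i B. i \<le> 0 \<and> B \<in> sets borel} \<subseteq> Pow (space M)"
  by blast

lemma sets_past: "sets (past M Y) = sigma_sets (space M) {Y i -` B \<inter> space M | i B. i \<le> 0 \<and> B \<in> sets borel}"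
  unfolding past_def by (rule sets_measure_of[OF past_generator])

lemma space_past: "space (past M Y) = space M"
  unfolding past_def by (rule space_measure_of[OF past_generator])

lemma past_subalgebra: "subalgebra M (past M Y)"
proof -
  have "sigma_sets (space M) {Y i -` B \<inter> space M | i B. i \<le> 0 \<and> B \<in> sets borel} \<subseteq> sets M"
    by (rule sets.sigma_sets_subset) auto
  then show ?thesis
    unfolding subalgebra_def sets_past space_past by simp
qed

lemma hist_past[measurable]: "hist 0 \<in> measurable (past M Y) path_space"
  unfolding hist_def[abs_def]
proof (rule measurable_PiM_single')
  fix j :: nat
  show "Y (int 0 - int j) \<in> borel_measurable (past M Y)"
  proof (rule measurableI)
    fix B :: "real set" assume "B \<in> sets borel"
    then have "Y (int 0 - int j) -` B \<inter> space M \<in> {Y i -` B \<inter> space M | i B. i \<le> 0 \<and> B \<in> sets borel}"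
      by (intro CollectI exI[of _ "int 0 - int j"] exI[of _ B]) auto
    then show "Y (int 0 - int j) -` B \<inter> space (past M Y) \<in> sets (past M Y)"
      unfolding space_past sets_past by (rule sigma_sets.Basic)
  qed simp
qed auto

text \<open>Every past event is an event of the reversed path; this makes the sign of a conditional
  expectation available as a function on path space.\<close>

lemma sets_past_factor:
  assumes "S \<in> sets (past M Y)"
  obtains B where "B \<in> sets path_space" "S = hist 0 -` B \<inter> space M"
proof -
  have b: "hist 0 \<in> space M \<rightarrow> space path_space"
    by (auto simp: space_PiM)
  have "{Y i -` B \<inter> space M | i B. i \<le> 0 \<and> B \<in> sets borel} \<subseteq> sets (vimage_algebra (space M) (hist 0) path_space)"
  proof safe
    fix i :: int and B :: "real set" assume i: "i \<le> 0" and B: "B \<in> sets borel"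
    have "(\<lambda>y. y (nat (- i))) -` B \<inter> space path_space \<in> sets path_space"
      by (rule measurable_sets[OF _ B]) simp
    moreover have "Y i -` B \<inter> space M = hist 0 -` ((\<lambda>y. y (nat (- i))) -` B \<inter> space path_space) \<inter> space M"
      using i by (auto simp: hist_def space_PiM)
    ultimately show "Y i -` B \<inter> space M \<in> sets (vimage_algebra (space M) (hist 0) path_space)"
      unfolding sets_vimage_algebra2[OF b] by blast
  qed
  then have "sets (past M Y) \<subseteq> sets (vimage_algebra (space M) (hist 0) path_space)"
    unfolding sets_past using sets.sigma_sets_subset[of _ "vimage_algebra (space M) (hist 0) path_space"]
    by simp
  with assms that show thesis
    unfolding sets_vimage_algebra2[OF b] by blast
qed

sublocale past: finite_measure_subalgebra M "past M Y"
  by unfold_locales (rule past_subalgebra)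

abbreviation cexp :: "nat \<Rightarrow> real \<Rightarrow> 'a \<Rightarrow> real" where
  "cexp k t \<equiv> real_cond_exp M (past M Y) (indicator {\<omega> \<in> space M. Y (int k) \<omega> \<le> t})"

lemma integrable_cexp: "integrable M (cexp k t)"
  by (rule past.real_cond_exp_int) (simp add: emeasure_eq_measure)

definition \<alpha> :: "nat \<Rightarrow> real" where
  "\<alpha> = tilde_alpha M Y"

lemma \<alpha>_eq: "\<alpha> k = (SUP t. \<integral>\<omega>. \<bar>cexp k t \<omega> - F_marg M Y t\<bar> \<partial>M)"
  by (simp add: \<alpha>_def tilde_alpha_def F_marg_eq[of _ k])

text \<open>A crude bound whose purpose is that the supremum in \<open>tilde_alpha\<close> ranges
  over a bounded set and so is a genuine least upper bound.\<close>

lemma cexp_dev_le: "(\<integral>\<omega>. \<bar>cexp k t \<omega> - F_marg M Y t\<bar> \<partial>M) \<le> 2"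
proof -
  have pos: "AE \<omega> in M. 0 \<le> cexp k t \<omega>"
    by (rule past.real_cond_exp_pos) auto
  have "(\<integral>\<omega>. \<bar>cexp k t \<omega> - F_marg M Y t\<bar> \<partial>M) \<le> (\<integral>\<omega>. cexp k t \<omega> + 1 \<partial>M)"
  proof (rule integral_mono_AE)
    show "AE \<omega> in M. \<bar>cexp k t \<omega> - F_marg M Y t\<bar> \<le> cexp k t \<omega> + 1"
      using pos by eventually_elim (use F_marg_01[of t] in auto)
  qed (use integrable_cexp in auto)
  also have "\<dots> = (\<integral>\<omega>. indicator {\<omega> \<in> space M. Y (int k) \<omega> \<le> t} \<omega> \<partial>M) + 1"
    using integrable_cexp past.real_cond_exp_int(2)[of "indicator {\<omega> \<in> space M. Y (int k) \<omega> \<le> t}"]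
    by (simp add: prob_space emeasure_eq_measure)
  also have "\<dots> \<le> 2"
    by simp
  finally show ?thesis .
qed

lemma \<alpha>_upper: "(\<integral>\<omega>. \<bar>cexp k t \<omega> - F_marg M Y t\<bar> \<partial>M) \<le> \<alpha> k"
  unfolding \<alpha>_eq by (rule cSUP_upper) (auto intro: bdd_aboveI2[where M = 2] cexp_dev_le)

lemma \<alpha>_nonneg: "0 \<le> \<alpha> k"
  by (rule order_trans[OF _ \<alpha>_upper[of k 0]]) simp

lemma \<alpha>_le_2: "\<alpha> k \<le> 2"
  unfolding \<alpha>_eq by (rule cSUP_least) (auto intro: cexp_dev_le)

text \<open>By stationarity the path may be taken as \<open>hist k\<close>, whose
  \<open>k\<close>-th shift is \<open>hist 0\<close>. The factor
  \<open>\<phi> (hist 0 \<omega>)\<close> is measurable in the past, so the indicator can be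
  replaced by its conditional expectation.\<close>

lemma X_past_eq:
  assumes \<phi>[measurable]: "\<phi> \<in> borel_measurable path_space" and b: "\<And>y. \<bar>\<phi> y\<bar> \<le> b"
  shows "(\<integral>y. X t y * \<phi> ((sh ^^ k) y) \<partial>PP) = (\<integral>\<omega>. \<phi> (hist 0 \<omega>) * (cexp k t \<omega> - F_marg M Y t) \<partial>M)"
proof -
  have m: "(sh ^^ k) \<in> measurable path_space path_space" for k
    using P.Tn[of k] by simp
  note [measurable] = m
  let ?I = "indicator {\<omega> \<in> space M. Y (int k) \<omega> \<le> t} :: 'a \<Rightarrow> real"
  have b0: "0 \<le> b" using b[of undefined] by linarith
  have i: "integrable M (\<lambda>\<omega>. \<phi> (hist 0 \<omega>) * ?I \<omega>)" "integrable M (\<lambda>\<omega>. \<phi> (hist 0 \<omega>))"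
    using b b0 by (auto intro!: integrable_const_bound[of _ b] simp: abs_mult indicator_def)
  have pb: "(\<lambda>\<omega>. \<phi> (hist 0 \<omega>)) \<in> borel_measurable (past M Y)"
    by measurable
  have "(\<integral>y. X t y * \<phi> ((sh ^^ k) y) \<partial>PP) = (\<integral>\<omega>. X t (hist k \<omega>) * \<phi> (hist 0 \<omega>) \<partial>M)"
    by (subst integral_hist[of _ k, symmetric]) (auto simp: sh_hist)
  also have "\<dots> = (\<integral>\<omega>. \<phi> (hist 0 \<omega>) * ?I \<omega> - \<phi> (hist 0 \<omega>) * F_marg M Y t \<partial>M)"
    by (intro Bochner_Integration.integral_cong) (auto simp: X_def hist_def indicator_def algebra_simps)
  also have "\<dots> = (\<integral>\<omega>. \<phi> (hist 0 \<omega>) * ?I \<omega> \<partial>M) - (\<integral>\<omega>. \<phi> (hist 0 \<omega>) * F_marg M Y t \<partial>M)"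
    using i by (intro Bochner_Integration.integral_diff) auto
  also have "(\<integral>\<omega>. \<phi> (hist 0 \<omega>) * ?I \<omega> \<partial>M) = (\<integral>\<omega>. \<phi> (hist 0 \<omega>) * cexp k t \<omega> \<partial>M)"
    using past.real_cond_exp_intg(2)[OF i(1) pb] by simp
  also have "\<dots> - (\<integral>\<omega>. \<phi> (hist 0 \<omega>) * F_marg M Y t \<partial>M)
      = (\<integral>\<omega>. \<phi> (hist 0 \<omega>) * cexp k t \<omega> - \<phi> (hist 0 \<omega>) * F_marg M Y t \<partial>M)"
    using i past.real_cond_exp_intg(1)[OF i(1) pb] by (intro Bochner_Integration.integral_diff[symmetric]) auto
  finally show ?thesis
    by (simp add: right_diff_distrib)
qed

lemma X_past_le:
  assumes [measurable]: "\<phi> \<in> borel_measurable path_space" and b: "\<And>y. \<bar>\<phi> y\<bar> \<le> b"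
  shows "\<bar>\<integral>y. X t y * \<phi> ((sh ^^ k) y) \<partial>PP\<bar> \<le> b * \<alpha> k"
proof -
  have b0: "0 \<le> b" using b[of undefined] by linarith
  let ?D = "\<lambda>\<omega>. cexp k t \<omega> - F_marg M Y t"
  have iD: "integrable M ?D" using integrable_cexp by simp
  have "\<bar>\<integral>y. X t y * \<phi> ((sh ^^ k) y) \<partial>PP\<bar> \<le> (\<integral>\<omega>. \<bar>\<phi> (hist 0 \<omega>) * ?D \<omega>\<bar> \<partial>M)"
    unfolding X_past_eq[OF assms] by (rule integral_abs_bound)
  also have "\<dots> \<le> (\<integral>\<omega>. b * \<bar>?D \<omega>\<bar> \<partial>M)"
  proof (rule integral_mono)
    show "\<bar>\<phi> (hist 0 \<omega>) * ?D \<omega>\<bar> \<le> b * \<bar>?D \<omega>\<bar>" for \<omega>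
      using b by (auto simp: abs_mult intro: mult_right_mono)
    then show "integrable M (\<lambda>\<omega>. \<bar>\<phi> (hist 0 \<omega>) * ?D \<omega>\<bar>)"
      using iD b0 by (intro Bochner_Integration.integrable_bound[OF integrable_mult_right[OF integrable_abs[OF iD], of b]]) auto
  qed (use iD in auto)
  also have "\<dots> \<le> b * \<alpha> k"
    using mult_left_mono[OF \<alpha>_upper b0] by simp
  finally show ?thesis .
qed

text \<open>The test function is the sign of the conditional deviation, which attains its mean
  absolute value. Hence the bound \<open>X_past_le\<close> is sharp, and coefficients can be
  compared through correlations alone.\<close>

lemma cexp_dev_eq:
  obtains \<phi> where "\<phi> \<in> borel_measurable path_space" "\<And>y. \<bar>\<phi> y\<bar> \<le> 1"
    "(\<integral>\<omega>. \<bar>cexp k t \<omega> - F_marg M Y t\<bar> \<partial>M) = (\<integral>y. X t y * \<phi> ((sh ^^ k) y) \<partial>PP)"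
proof -
  let ?D = "\<lambda>\<omega>. cexp k t \<omega> - F_marg M Y t"
  have cm[measurable]: "cexp k t \<in> borel_measurable (past M Y)"
    by (rule borel_measurable_cond_exp)
  have "{\<omega> \<in> space (past M Y). 0 < ?D \<omega>} \<in> sets (past M Y)"
    by measurable
  then obtain B where B: "B \<in> sets path_space" "{\<omega> \<in> space M. 0 < ?D \<omega>} = hist 0 -` B \<inter> space M"
    unfolding space_past by (rule sets_past_factor)
  note [measurable] = B(1)
  define \<phi> :: "(nat \<Rightarrow> real) \<Rightarrow> real" where "\<phi> y = 2 * indicator B y - 1" for y
  have \<phi>[measurable]: "\<phi> \<in> borel_measurable path_space" and \<phi>1: "\<And>y. \<bar>\<phi> y\<bar> \<le> 1"
    by (auto simp: \<phi>_def[abs_def] indicator_def)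
  have "(\<integral>\<omega>. \<bar>?D \<omega>\<bar> \<partial>M) = (\<integral>\<omega>. \<phi> (hist 0 \<omega>) * ?D \<omega> \<partial>M)"
  proof (rule Bochner_Integration.integral_cong)
    fix \<omega> assume "\<omega> \<in> space M"
    then have "0 < ?D \<omega> \<longleftrightarrow> hist 0 \<omega> \<in> B" using B(2) by auto
    then show "\<bar>?D \<omega>\<bar> = \<phi> (hist 0 \<omega>) * ?D \<omega>"
      by (auto simp: \<phi>_def indicator_def)
  qed simp
  also have "\<dots> = (\<integral>y. X t y * \<phi> ((sh ^^ k) y) \<partial>PP)"
    by (rule X_past_eq[OF \<phi> \<phi>1, symmetric])
  finally have eq: "(\<integral>\<omega>. \<bar>?D \<omega>\<bar> \<partial>M) = (\<integral>y. X t y * \<phi> ((sh ^^ k) y) \<partial>PP)" .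
  show thesis
    by (rule that[of \<phi>, OF \<phi> \<phi>1 eq])
qed

text \<open>A test function at lag \<open>Suc k\<close> is, after one more shift, a test function at
  lag \<open>k\<close>. Monotonicity is what \<open>sqrt_sum_le_weighted\<close> requires
  later.\<close>

lemma \<alpha>_antimono_Suc: "\<alpha> (Suc k) \<le> \<alpha> k"
  unfolding \<alpha>_eq[of "Suc k"]
proof (rule cSUP_least)
  fix t
  obtain \<phi> where [measurable]: "\<phi> \<in> borel_measurable path_space" and \<phi>1: "\<And>y. \<bar>\<phi> y\<bar> \<le> 1"
    and eq: "(\<integral>\<omega>. \<bar>cexp (Suc k) t \<omega> - F_marg M Y t\<bar> \<partial>M) = (\<integral>y. X t y * \<phi> ((sh ^^ Suc k) y) \<partial>PP)"
    by (rule cexp_dev_eq[of "Suc k" t]) (rule that)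
  have "(\<integral>y. X t y * \<phi> ((sh ^^ Suc k) y) \<partial>PP) = (\<integral>y. X t y * (\<lambda>y. \<phi> (sh y)) ((sh ^^ k) y) \<partial>PP)"
    by simp
  also have "\<dots> \<le> 1 * \<alpha> k"
    using X_past_le[of "\<lambda>y. \<phi> (sh y)" 1 t k] \<phi>1 by (simp del: funpow.simps add: abs_le_iff)
  finally show "(\<integral>\<omega>. \<bar>cexp (Suc k) t \<omega> - F_marg M Y t\<bar> \<partial>M) \<le> \<alpha> k"
    unfolding eq by simp
qed simp

lemma \<alpha>_antimono: "i \<le> j \<Longrightarrow> \<alpha> j \<le> \<alpha> i"
  using lift_Suc_antimono_le[of \<alpha>, OF \<alpha>_antimono_Suc] by blast

lemma sh_funpow_measurable[measurable]: "(sh ^^ k) \<in> measurable path_space path_space"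
  using P.Tn[of k] by simp

lemma measure_PP_UNIV[simp]: "measure PP UNIV = 1"
  using P.prob_space by simp

lemma integrable_PP_bounded:
  fixes f :: "(nat \<Rightarrow> real) \<Rightarrow> real"
  assumes "f \<in> borel_measurable path_space" "\<And>y. \<bar>f y\<bar> \<le> b"
  shows "integrable PP f"
  using assms by (intro P.integrable_bounded[where B = b]) auto

text \<open>\<open>f\<close> is the conditional probability of \<open>Y k \<le> t\<close> given the past, obtained as a Radon-Nikodym
  derivative on path space in order to have a version with values in \<open>[0, 1]\<close> everywhere.\<close>

lemma indicator_adjoint:
  "\<exists>f :: (nat \<Rightarrow> real) \<Rightarrow> real. f \<in> borel_measurable path_space \<and> (\<forall>y. 0 \<le> f y \<and> f y \<le> 1) \<and>
      (\<forall>\<phi> b. \<phi> \<in> borel_measurable path_space \<longrightarrow> (\<forall>y. \<bar>\<phi> y\<bar> \<le> b) \<longrightarrow>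
        (\<integral>y. f y * \<phi> y \<partial>PP) = (\<integral>y. indicator {..t} (y 0) * \<phi> ((sh ^^ k) y) \<partial>PP))"
proof -
  let ?i = "\<lambda>y :: nat \<Rightarrow> real. indicator {..t} (y 0) :: real"
  define D where "D = density PP (\<lambda>y. ennreal (?i y))"
  \<comment> \<open>The law of the past \<open>k\<close> steps earlier, restricted to the event
    \<open>y 0 \<le> t\<close>. By invariance it is dominated by \<open>PP\<close>, so its density
    is at most \<open>1\<close> almost everywhere.\<close>
  define \<nu> where "\<nu> = distr D PP (sh ^^ k)"
  have setsD[measurable_cong]: "sets D = sets path_space" and sets\<nu>[measurable_cong]: "sets \<nu> = sets PP"
    by (auto simp: D_def \<nu>_def)
  have le: "emeasure \<nu> A \<le> emeasure PP A" if A: "A \<in> sets PP" for A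
  proof -
    have A'[measurable]: "A \<in> sets path_space" using A by simp
    have pre: "(sh ^^ k) -` A \<in> sets path_space"
      using measurable_sets[OF sh_funpow_measurable A'] by (simp add: space_PiM)
    have "emeasure \<nu> A = emeasure D ((sh ^^ k) -` A)"
      unfolding \<nu>_def by (subst emeasure_distr) (auto simp: D_def)
    also have "\<dots> = (\<integral>\<^sup>+y. ennreal (?i y) * indicator ((sh ^^ k) -` A) y \<partial>PP)"
      unfolding D_def using pre by (subst emeasure_density) auto
    also have "\<dots> \<le> (\<integral>\<^sup>+y. indicator ((sh ^^ k) -` A) y \<partial>PP)"
      by (intro nn_integral_mono) (auto simp: indicator_def)
    also have "\<dots> = emeasure PP ((sh ^^ k) -` A)"
      using pre by simp
    also have "\<dots> = emeasure (distr PP PP (sh ^^ k)) A"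
      using A by (subst emeasure_distr) auto
    also have "\<dots> = emeasure PP A"
      by (simp add: P.distr_Tn)
    finally show ?thesis .
  qed
  have "absolutely_continuous PP \<nu>"
    unfolding absolutely_continuous_def
  proof
    fix A assume A: "A \<in> null_sets PP"
    then have "emeasure \<nu> A \<le> 0"
      using le[of A] by (auto simp: null_sets_def)
    then show "A \<in> null_sets \<nu>"
      using A by (auto simp: null_sets_def sets\<nu>)
  qed
  define f0 where "f0 = RN_deriv PP \<nu>"
  have f0[measurable]: "f0 \<in> borel_measurable path_space"
    using borel_measurable_RN_deriv[of PP \<nu>] by (simp add: f0_def)
  have dens: "density PP f0 = \<nu>"
    unfolding f0_def by (rule P.density_RN_deriv) fact+
  \<comment> \<open>The integral of \<open>f0 - 1\<close> over \<open>A\<close> is the excess of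
    \<open>\<nu>\<close> over \<open>PP\<close> on \<open>A\<close>, which is zero; since the
    integrand is positive there, \<open>A\<close> is a null set.\<close>
  define A where "A = {y. 1 < f0 y}"
  have A[measurable]: "A \<in> sets path_space"
    using measurable_sets[OF f0, of "{1<..}"] by (auto simp: A_def space_PiM vimage_def)
  have "(\<integral>\<^sup>+y\<in>A. (f0 y - 1) \<partial>PP) = (\<integral>\<^sup>+y. f0 y * indicator A y - indicator A y \<partial>PP)"
    by (intro nn_integral_cong) (auto simp: indicator_def)
  also have "\<dots> = (\<integral>\<^sup>+y. f0 y * indicator A y \<partial>PP) - (\<integral>\<^sup>+y. indicator A y \<partial>PP)"
  proof (rule nn_integral_diff)
    have "(\<integral>\<^sup>+y. indicator A y \<partial>PP) = ennreal (measure PP A)"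
      by (simp add: P.emeasure_eq_measure)
    then show "(\<integral>\<^sup>+y. indicator A y \<partial>PP) \<noteq> \<infinity>"
      by simp
    show "AE y in PP. indicator A y \<le> f0 y * indicator A y"
      by (auto simp: indicator_def A_def less_imp_le)
  qed auto
  also have "\<dots> = emeasure \<nu> A - emeasure PP A"
    unfolding dens[symmetric] by (subst emeasure_density) auto
  also have "\<dots> = 0"
  proof (rule diff_eq_0_ennreal)
    show "emeasure \<nu> A \<le> emeasure PP A"
      by (rule le) simp
    also have "\<dots> < top"
      by (simp add: P.emeasure_eq_measure)
    finally show "emeasure \<nu> A < top" .
  qed
  finally have "A \<in> null_sets PP"
    by (intro null_if_pos_func_has_zero_nn_int[of "\<lambda>y. f0 y - 1"])
       (use A in \<open>auto simp: A_def diff_gr0_ennreal\<close>)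
  then have AE: "AE y in PP. f0 y \<le> 1"
    by (rule AE_I') (auto simp: A_def not_le)
  define f where "f y = min 1 (enn2real (f0 y))" for y
  have [measurable]: "f \<in> borel_measurable path_space"
    unfolding f_def[abs_def] by measurable
  have f01: "0 \<le> f y" "f y \<le> 1" for y
    by (auto simp: f_def)
  have "density PP f0 = density PP (\<lambda>y. ennreal (f y))"
  proof (rule density_cong)
    show "AE y in PP. f0 y = ennreal (f y)"
      using AE
    proof eventually_elim
      case (elim y)
      then have "f0 y < top" by (auto simp: less_top[symmetric] top_unique)
      then have "f0 y = ennreal (enn2real (f0 y))" by simp
      moreover from elim have "enn2real (f0 y) \<le> 1"
        using enn2real_mono[of "f0 y" 1] by simp
      ultimately show ?case by (simp add: f_def min_def)
    qed
  qed auto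
  with dens have dens': "density PP (\<lambda>y. ennreal (f y)) = \<nu>" by simp
  show ?thesis
  proof (intro exI[of _ f] conjI allI impI)
    fix \<phi> :: "(nat \<Rightarrow> real) \<Rightarrow> real" and b
    assume [measurable]: "\<phi> \<in> borel_measurable path_space"
    have "(\<integral>y. f y * \<phi> y \<partial>PP) = (\<integral>y. \<phi> y \<partial>\<nu>)"
      unfolding dens'[symmetric] using f01 by (subst integral_density) auto
    also have "\<dots> = (\<integral>y. \<phi> ((sh ^^ k) y) \<partial>D)"
      unfolding \<nu>_def by (subst integral_distr) auto
    also have "\<dots> = (\<integral>y. ?i y * \<phi> ((sh ^^ k) y) \<partial>PP)"
      unfolding D_def by (subst integral_density) auto
    finally show "(\<integral>y. f y * \<phi> y \<partial>PP) = (\<integral>y. ?i y * \<phi> ((sh ^^ k) y) \<partial>PP)" .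
  qed (use f01 in auto)
qed

section \<open>Covariances and linear combinations of indicators\<close>

definition cov :: "nat \<Rightarrow> real \<Rightarrow> real \<Rightarrow> real" where
  "cov k s t = (\<integral>y. X s y * X t ((sh ^^ k) y) \<partial>PP)"

lemma integrable_X_mult:
  assumes [measurable]: "\<phi> \<in> borel_measurable path_space" and b: "\<And>y. \<bar>\<phi> y\<bar> \<le> b"
  shows "integrable PP (\<lambda>y. X t y * \<phi> ((sh ^^ k) y))"
proof (rule integrable_PP_bounded)
  show "\<bar>X t y * \<phi> ((sh ^^ k) y)\<bar> \<le> 1 * b" for y
    unfolding abs_mult using X_bound b by (intro mult_mono) auto
qed measurable

text \<open>Under \<open>hist k\<close> the entry \<open>y 0\<close> is \<open>Y k\<close> and the
  \<open>k\<close>-th shift leads back to \<open>Y 0\<close>; hence \<open>s\<close> belongs to the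
  later and \<open>t\<close> to the earlier time.\<close>

lemma C_term_eq: "C_term M Y s t k = cov k s t"
proof -
  let ?A = "{\<omega> \<in> space M. Y (int k) \<omega> \<le> s}" and ?B = "{\<omega> \<in> space M. Y (int 0) \<omega> \<le> t}"
  have "cov k s t = (\<integral>\<omega>. X s (hist k \<omega>) * X t (hist 0 \<omega>) \<partial>M)"
    unfolding cov_def by (subst integral_hist[of _ k, symmetric]) (auto simp: sh_hist)
  also have "\<dots> = (\<integral>\<omega>. indicator (?A \<inter> ?B) \<omega> - F_marg M Y t * indicator ?A \<omega> - F_marg M Y s * indicator ?B \<omega>
      + F_marg M Y s * F_marg M Y t \<partial>M)"
    by (intro Bochner_Integration.integral_cong) (auto simp: X_def hist_def indicator_def algebra_simps)
  also have "\<dots> = prob (?A \<inter> ?B) - F_marg M Y t * prob ?A - F_marg M Y s * prob ?B + F_marg M Y s * F_marg M Y t"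
    by (simp add: prob_space emeasure_eq_measure)
  also have "prob ?A = F_marg M Y s"
    by (rule F_marg_eq[symmetric])
  also have "prob ?B = F_marg M Y t"
    by (rule F_marg_eq[symmetric])
  also have "prob (?A \<inter> ?B) = prob {\<omega> \<in> space M. Y 0 \<omega> \<le> t \<and> Y (int k) \<omega> \<le> s}"
    by (auto intro!: arg_cong[where f = prob])
  finally show ?thesis
    by (simp add: C_term_def algebra_simps)
qed

lemma C_kernel_eq: "C_kernel M Y s t = cov 0 s t + 2 * (\<Sum>k. cov (Suc k) s t)"
proof -
  have "F_marg M Y (min t s) - F_marg M Y t * F_marg M Y s = C_term M Y s t 0"
    by (simp add: C_term_def F_marg_eq[of _ 0])
  then show ?thesis
    by (simp add: C_kernel_def C_term_eq)
qed

text \<open>At lag \<open>0\<close> the trivial bound \<open>1\<close> replaces the coefficient. It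
  is at least every tail probability, so the term of \<open>\<Gamma> (H t)\<close> at lag
  \<open>0\<close> is \<open>H t\<close> itself.\<close>

definition \<beta> :: "nat \<Rightarrow> real" where
  "\<beta> k = (if k = 0 then 1 else \<alpha> k)"

lemma \<beta>_nonneg: "0 \<le> \<beta> k"
  by (simp add: \<beta>_def \<alpha>_nonneg)

lemma X_past_le_\<beta>:
  assumes [measurable]: "\<phi> \<in> borel_measurable path_space" and b: "\<And>y. \<bar>\<phi> y\<bar> \<le> b"
  shows "\<bar>\<integral>y. X t y * \<phi> ((sh ^^ k) y) \<partial>PP\<bar> \<le> b * \<beta> k"
proof (cases "k = 0")
  case True
  have "\<bar>\<integral>y. X t y * \<phi> ((sh ^^ k) y) \<partial>PP\<bar> \<le> (\<integral>y. \<bar>X t y * \<phi> ((sh ^^ k) y)\<bar> \<partial>PP)"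
    by (rule integral_abs_bound)
  also have "\<dots> \<le> (\<integral>y. 1 * b \<partial>PP)"
  proof (rule integral_mono)
    show "\<bar>X t y * \<phi> ((sh ^^ k) y)\<bar> \<le> 1 * b" for y
      unfolding abs_mult using X_bound b by (intro mult_mono) auto
  qed (use integrable_X_mult[OF assms] in auto)
  finally show ?thesis
    using True by (simp add: \<beta>_def P.prob_space)
next
  case False
  then show ?thesis
    using X_past_le[OF assms] by (simp add: \<beta>_def)
qed

definition comb :: "'i set \<Rightarrow> ('i \<Rightarrow> real) \<Rightarrow> ('i \<Rightarrow> real) \<Rightarrow> (nat \<Rightarrow> real) \<Rightarrow> real" where
  "comb I c \<tau> y = (\<Sum>p\<in>I. c p * X (\<tau> p) y)"

lemma comb_measurable[measurable]: "comb I c \<tau> \<in> borel_measurable path_space"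
  unfolding comb_def[abs_def] by measurable

lemma sum_mult_bound:
  assumes "\<And>p. p \<in> I \<Longrightarrow> \<bar>g p\<bar> \<le> (B :: real)"
  shows "\<bar>\<Sum>p\<in>I. c p * g p\<bar> \<le> (\<Sum>p\<in>I. \<bar>c p\<bar>) * B"
proof -
  have "\<bar>\<Sum>p\<in>I. c p * g p\<bar> \<le> (\<Sum>p\<in>I. \<bar>c p * g p\<bar>)"
    by (rule sum_abs)
  also have "\<dots> \<le> (\<Sum>p\<in>I. \<bar>c p\<bar> * B)"
    unfolding abs_mult by (intro sum_mono mult_left_mono assms) auto
  finally show ?thesis
    by (simp add: sum_distrib_right)
qed

lemma comb_bound: "\<bar>comb I c \<tau> y\<bar> \<le> (\<Sum>p\<in>I. \<bar>c p\<bar>)"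
  unfolding comb_def using sum_mult_bound[of I "\<lambda>p. X (\<tau> p) y" 1 c] X_bound by simp

lemma comb_past:
  assumes "\<phi> \<in> borel_measurable path_space" "\<And>y. \<bar>\<phi> y\<bar> \<le> b"
  shows "(\<integral>y. comb I c \<tau> y * \<phi> ((sh ^^ k) y) \<partial>PP) = (\<Sum>p\<in>I. c p * (\<integral>y. X (\<tau> p) y * \<phi> ((sh ^^ k) y) \<partial>PP))"
  unfolding comb_def sum_distrib_right mult.assoc
  using integrable_X_mult[OF assms] by (subst Bochner_Integration.integral_sum) auto

lemma acov_comb: "P.acov (comb I c \<tau>) k = (\<Sum>p\<in>I. \<Sum>q\<in>I. c p * c q * cov k (\<tau> p) (\<tau> q))"
proof -
  have "(\<integral>y. X s y * comb I c \<tau> ((sh ^^ k) y) \<partial>PP) = (\<Sum>q\<in>I. c q * cov k s (\<tau> q))" for s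
  proof -
    have "(\<integral>y. X s y * comb I c \<tau> ((sh ^^ k) y) \<partial>PP) = (\<integral>y. (\<Sum>q\<in>I. c q * (X s y * X (\<tau> q) ((sh ^^ k) y))) \<partial>PP)"
      by (simp add: comb_def sum_distrib_left mult.left_commute)
    also have "\<dots> = (\<Sum>q\<in>I. c q * cov k s (\<tau> q))"
      unfolding cov_def using integrable_X_mult[OF X_measurable X_bound]
      by (subst Bochner_Integration.integral_sum) auto
    finally show ?thesis .
  qed
  then show ?thesis
    unfolding P.acov_def comb_past[OF comb_measurable comb_bound]
    by (simp add: sum_distrib_left mult.assoc)
qed

lemma cov_le_\<beta>: "\<bar>cov k s t\<bar> \<le> \<beta> k"
  unfolding cov_def using X_past_le_\<beta>[OF X_measurable X_bound] by simp

end

section \<open>Finite-dimensional limits under summable coefficients\<close>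

locale summable_sequence = stationary_sequence +
  assumes summable_\<alpha>: "summable \<alpha>"
begin

lemma summable_\<beta>: "summable \<beta>"
proof -
  have "summable (\<lambda>k. \<beta> (Suc k))"
    using summable_ignore_initial_segment[OF summable_\<alpha>, of 1] by (simp add: \<beta>_def)
  then show ?thesis
    by (simp only: summable_Suc_iff)
qed

lemma summable_cov: "summable (\<lambda>k. cov (Suc k) s t)"
proof (rule summable_comparison_test'[of "\<lambda>k. \<beta> (Suc k)" 0])
  show "summable (\<lambda>k. \<beta> (Suc k))"
    by (simp only: summable_Suc_iff summable_\<beta>)
qed (simp add: cov_le_\<beta>)

lemma long_run_variance_comb:
  assumes "finite I"
  shows "P.acov (comb I c \<tau>) 0 + 2 * (\<Sum>k. P.acov (comb I c \<tau>) (Suc k))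
    = (\<Sum>p\<in>I. \<Sum>q\<in>I. c p * c q * C_kernel M Y (\<tau> p) (\<tau> q))"
proof -
  have "(\<Sum>k. P.acov (comb I c \<tau>) (Suc k)) = (\<Sum>p\<in>I. \<Sum>q\<in>I. c p * c q * (\<Sum>k. cov (Suc k) (\<tau> p) (\<tau> q)))"
    unfolding acov_comb
    by (rule sums_unique[symmetric]) (intro sums_sum sums_mult summable_sums summable_cov)
  then show ?thesis
    unfolding acov_comb C_kernel_eq
    by (simp add: sum.distrib sum_distrib_left distrib_left mult.left_commute)
qed

lemma summable_acov_comb:
  assumes "finite I"
  shows "summable (\<lambda>k. P.acov (comb I c \<tau>) (Suc k))"
  unfolding acov_comb by (intro summable_sum summable_mult summable_cov)

lemma variance_comb_lim:
  assumes "finite I"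
  shows "(\<lambda>n. (\<integral>y. (P.bsum (comb I c \<tau>) n y)\<^sup>2 \<partial>PP) / real n)
    \<longlonglongrightarrow> (\<Sum>p\<in>I. \<Sum>q\<in>I. c p * c q * C_kernel M Y (\<tau> p) (\<tau> q))"
  unfolding long_run_variance_comb[OF assms, symmetric]
  by (rule P.second_moment_bsum_lim[OF _ comb_bound summable_acov_comb[OF assms]]) simp

text \<open>The quadratic form is a limit of normalised second moments.\<close>

lemma quadratic_C_kernel_nonneg:
  assumes "finite I"
  shows "0 \<le> (\<Sum>p\<in>I. \<Sum>q\<in>I. c p * c q * C_kernel M Y (\<tau> p) (\<tau> q))"
  by (rule LIMSEQ_le_const[OF variance_comb_lim[OF assms]]) auto

theorem fidi_clt:
  assumes I: "finite I"
  shows "(\<lambda>n. \<integral>y. iexp (P.bsum (comb I c \<tau>) n y / sqrt (real n)) \<partial>PP)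
    \<longlonglongrightarrow> exp (- ((\<Sum>p\<in>I. \<Sum>q\<in>I. c p * c q * C_kernel M Y (\<tau> p) (\<tau> q)) / 2))"
proof -
  let ?Q = "\<lambda>k t (f :: (nat \<Rightarrow> real) \<Rightarrow> real). f \<in> borel_measurable path_space \<and> (\<forall>y. 0 \<le> f y \<and> f y \<le> 1) \<and>
      (\<forall>\<phi> b. \<phi> \<in> borel_measurable path_space \<longrightarrow> (\<forall>y. \<bar>\<phi> y\<bar> \<le> b) \<longrightarrow>
        (\<integral>y. f y * \<phi> y \<partial>PP) = (\<integral>y. indicator {..t} (y 0) * \<phi> ((sh ^^ k) y) \<partial>PP))"
  define f where "f k t = (SOME f. ?Q k t f)" for k t
  have Q: "?Q k t (f k t)" for k t
    unfolding f_def by (rule someI_ex[of "?Q k t", OF indicator_adjoint])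
  have f[measurable]: "f k t \<in> borel_measurable path_space" for k t
    by (rule conjunct1[OF Q])
  have f01: "0 \<le> f k t y \<and> f k t y \<le> 1" for k t y
    by (rule spec[OF conjunct1[OF conjunct2[OF Q]]])
  have f_adj: "(\<integral>y. f k t y * \<phi> y \<partial>PP) = (\<integral>y. indicator {..t} (y 0) * \<phi> ((sh ^^ k) y) \<partial>PP)"
    if "\<phi> \<in> borel_measurable path_space" "\<And>y. \<bar>\<phi> y\<bar> \<le> b" for k t \<phi> b
    by (rule conjunct2[OF conjunct2[OF Q], rule_format]) (fact that)+
  \<comment> \<open>Gordin's theorem asks for equality with the observable at \<open>k = 0\<close>,
    whereas a conditional probability would agree with the indicator only almost everywhere; hence
    the case distinction. For larger \<open>k\<close>, versions with values in \<open>[0, 1]\<close>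
    give a uniform bound.\<close>
  define e where "e k y = (if k = 0 then comb I c \<tau> y else (\<Sum>p\<in>I. c p * (f k (\<tau> p) y - F_marg M Y (\<tau> p))))" for k y
  let ?c = "\<Sum>p\<in>I. \<bar>c p\<bar>"
  have "(\<lambda>n. \<integral>y. iexp (P.bsum (comb I c \<tau>) n y / sqrt (real n)) \<partial>PP)
    \<longlonglongrightarrow> exp (- ((P.acov (comb I c \<tau>) 0 + 2 * (\<Sum>k. P.acov (comb I c \<tau>) (Suc k))) / 2))"
  proof (rule P.gordin_clt[where e = e and C = ?c and \<gamma> = "\<lambda>k. ?c * \<beta> k"])
    show "e k \<in> borel_measurable PP" for k
      unfolding e_def[abs_def] by (cases "k = 0") auto
    show "\<bar>e k y\<bar> \<le> ?c" for k y
    proof (cases "k = 0")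
      case False
      have "\<bar>f k (\<tau> p) y - F_marg M Y (\<tau> p)\<bar> \<le> 1" for p
        using f01[of k "\<tau> p" y] F_marg_01[of "\<tau> p"] by (auto simp: abs_le_iff)
      then show ?thesis
        using False sum_mult_bound[of I "\<lambda>p. f k (\<tau> p) y - F_marg M Y (\<tau> p)" 1 c] by (simp add: e_def)
    qed (simp add: e_def comb_bound)
    show "e 0 = comb I c \<tau>"
      by (auto simp: e_def)
    show "summable (\<lambda>k. ?c * \<beta> k)"
      by (intro summable_mult summable_\<beta>)
    show "0 \<le> ?c * \<beta> k" for k
      by (intro mult_nonneg_nonneg sum_nonneg \<beta>_nonneg) auto
    fix k :: nat and \<phi> :: "(nat \<Rightarrow> real) \<Rightarrow> real" and b
    assume \<phi>': "\<phi> \<in> borel_measurable PP" and b: "\<And>y. \<bar>\<phi> y\<bar> \<le> b"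
    then have \<phi>[measurable]: "\<phi> \<in> borel_measurable path_space" by simp
    show "\<bar>\<integral>y. comb I c \<tau> y * \<phi> ((sh ^^ k) y) \<partial>PP\<bar> \<le> b * (?c * \<beta> k)"
      unfolding comb_past[OF \<phi> b]
      using sum_mult_bound[of I "\<lambda>p. \<integral>y. X (\<tau> p) y * \<phi> ((sh ^^ k) y) \<partial>PP" "b * \<beta> k" c] X_past_le_\<beta>[OF \<phi> b]
      by (simp add: mult.left_commute)
    show "(\<integral>y. e k y * \<phi> y \<partial>PP) = (\<integral>y. comb I c \<tau> y * \<phi> ((sh ^^ k) y) \<partial>PP)"
    proof (cases "k = 0")
      case False
      have b0: "0 \<le> b" using b[of undefined] by linarith
      have i\<phi>: "integrable PP \<phi>" "integrable PP (\<lambda>y. \<phi> ((sh ^^ k) y))"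
        by (rule integrable_PP_bounded[where b = b]; use b in simp)+
      have ifp: "integrable PP (\<lambda>y. f k t y * \<phi> y)" for t
      proof (rule integrable_PP_bounded)
        show "\<bar>f k t y * \<phi> y\<bar> \<le> 1 * b" for y
          unfolding abs_mult using f01[of k t y] b[of y] by (intro mult_mono) auto
      qed measurable
      have ii: "integrable PP (\<lambda>y. indicator {..t} (y 0) * \<phi> ((sh ^^ k) y))" for t
        using b b0 by (intro integrable_PP_bounded[where b = b]) (auto simp: indicator_def)
      have "(\<integral>y. e k y * \<phi> y \<partial>PP) = (\<Sum>p\<in>I. c p * (\<integral>y. f k (\<tau> p) y * \<phi> y - F_marg M Y (\<tau> p) * \<phi> y \<partial>PP))"
        unfolding e_def using False i\<phi> ifp
        by (simp add: sum_distrib_right mult.assoc left_diff_distrib)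
      also have "\<dots> = (\<Sum>p\<in>I. c p * (\<integral>y. X (\<tau> p) y * \<phi> ((sh ^^ k) y) \<partial>PP))"
      proof (intro sum.cong refl arg_cong2[where f = "(*)"])
        fix p
        have "(\<integral>y. f k (\<tau> p) y * \<phi> y - F_marg M Y (\<tau> p) * \<phi> y \<partial>PP)
          = (\<integral>y. indicator {..\<tau> p} (y 0) * \<phi> ((sh ^^ k) y) \<partial>PP) - F_marg M Y (\<tau> p) * (\<integral>y. \<phi> ((sh ^^ k) y) \<partial>PP)"
          using i\<phi> ifp f_adj[OF \<phi> b] P.integral_Tn[of \<phi> k] by simp
        also have "\<dots> = (\<integral>y. X (\<tau> p) y * \<phi> ((sh ^^ k) y) \<partial>PP)"
          unfolding X_def left_diff_distrib using ii i\<phi> by simp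
        finally show "(\<integral>y. f k (\<tau> p) y * \<phi> y - F_marg M Y (\<tau> p) * \<phi> y \<partial>PP)
          = (\<integral>y. X (\<tau> p) y * \<phi> ((sh ^^ k) y) \<partial>PP)" .
      qed
      finally show ?thesis
        unfolding comb_past[OF \<phi> b] .
    qed (simp add: e_def)
  qed
  then show ?thesis
    unfolding long_run_variance_comb[OF I] .
qed

end

section \<open>Moment bounds for the empirical process\<close>

text \<open>Let \<open>T\<close> be the right side. By monotonicity its first \<open>k + 1\<close>
  terms are each at least \<open>sqrt (b k) / sqrt (k + 1)\<close>, so
  \<open>sqrt (b k) \<le> T / sqrt (k + 1)\<close>. Replacing one of the two roots in every
  \<open>b k\<close> by this bound shows that the sum is at most \<open>T * T\<close>.\<close>

lemma sqrt_sum_le_weighted: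
  fixes b :: "nat \<Rightarrow> real"
  assumes b: "\<And>k. 0 \<le> b k" and anti: "\<And>i j. i \<le> j \<Longrightarrow> b j \<le> b i"
  shows "sqrt (\<Sum>k<n. b k) \<le> (\<Sum>k<n. sqrt (b k) / sqrt (real (Suc k)))"
proof -
  define T where "T = (\<Sum>k<n. sqrt (b k) / sqrt (real (Suc k)))"
  have T0: "0 \<le> T"
    unfolding T_def using b by (intro sum_nonneg) auto
  have le: "sqrt (b k) \<le> T / sqrt (real (Suc k))" if "k < n" for k
  proof -
    have "sqrt (b k) * sqrt (real (Suc k)) = sqrt (b k) * (real (Suc k) / sqrt (real (Suc k)))"
      by (simp only: real_div_sqrt of_nat_0_le_iff)
    also have "\<dots> = (\<Sum>j<Suc k. sqrt (b k) / sqrt (real (Suc k)))"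
      by (simp del: of_nat_Suc)
    also have "\<dots> \<le> (\<Sum>j<Suc k. sqrt (b j) / sqrt (real (Suc j)))"
      using anti b by (intro sum_mono frac_le) auto
    also have "\<dots> \<le> T"
      unfolding T_def using that b by (intro sum_mono2) auto
    finally show ?thesis
      by (simp add: field_simps)
  qed
  have "(\<Sum>k<n. b k) = (\<Sum>k<n. sqrt (b k) * sqrt (b k))"
    using b by simp
  also have "\<dots> \<le> (\<Sum>k<n. sqrt (b k) * (T / sqrt (real (Suc k))))"
    using le b by (intro sum_mono mult_left_mono) auto
  also have "\<dots> = (\<Sum>k<n. T * (sqrt (b k) / sqrt (real (Suc k))))"
    by (intro sum.cong) auto
  also have "\<dots> = T * T"
    unfolding sum_distrib_left[symmetric] T_def[symmetric] by (rule refl)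
  finally show ?thesis
    unfolding T_def[symmetric] using T0 by (intro real_le_lsqrt) (simp_all add: power2_eq_square)
qed

context stationary_sequence
begin

text \<open>The tail is closed so that it also bounds \<open>F_marg\<close> on the negative axis,
  where \<open>Y 0 = t\<close> belongs to the event.\<close>

definition H :: "real \<Rightarrow> real" where
  "H t = prob {\<omega> \<in> space M. \<bar>t\<bar> \<le> \<bar>Y 0 \<omega>\<bar>}"

lemma H_nonneg: "0 \<le> H t" and H_le_1: "H t \<le> 1"
  by (auto simp: H_def)

lemma H_antimono: "\<bar>s\<bar> \<le> \<bar>t\<bar> \<Longrightarrow> H t \<le> H s"
  unfolding H_def by (intro finite_measure_mono) auto

lemma H_measurable[measurable]: "H \<in> borel_measurable borel"
proof -
  have "(\<lambda>x. - prob {\<omega> \<in> space M. x \<le> \<bar>Y 0 \<omega>\<bar>}) \<in> borel_measurable borel"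
    by (rule borel_measurable_mono) (auto intro!: monoI finite_measure_mono)
  then have m[measurable]: "(\<lambda>x. prob {\<omega> \<in> space M. x \<le> \<bar>Y 0 \<omega>\<bar>}) \<in> borel_measurable borel"
    by simp
  show ?thesis
    unfolding H_def[abs_def] by (rule measurable_compose[OF _ m]) simp
qed

lemma F_marg_compl: "1 - F_marg M Y t = prob {\<omega> \<in> space M. t < Y 0 \<omega>}"
proof -
  have "prob {\<omega> \<in> space M. t < Y 0 \<omega>} = prob (space M - {\<omega> \<in> space M. Y (int 0) \<omega> \<le> t})"
    by (intro arg_cong[where f = prob]) auto
  then show ?thesis
    by (simp add: prob_compl F_marg_eq[of t 0])
qed

lemma F_marg_upper_tail: "0 \<le> t \<Longrightarrow> 1 - F_marg M Y t \<le> H t"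
  unfolding F_marg_compl H_def by (intro finite_measure_mono) auto

lemma F_marg_lower_tail: "t \<le> 0 \<Longrightarrow> F_marg M Y t \<le> H t"
  unfolding F_marg_eq[of t 0] H_def by (intro finite_measure_mono) auto

text \<open>When \<open>s\<close> lies farther out than \<open>t\<close> on the same side, the
  increment of the distribution function is part of one tail beyond \<open>t\<close>.\<close>

lemma F_marg_diff_le_H:
  assumes "0 \<le> t \<and> t \<le> s \<or> t \<le> 0 \<and> s \<le> t"
  shows "\<bar>F_marg M Y t - F_marg M Y s\<bar> \<le> H t"
  using assms F_marg_upper_tail[of t] F_marg_lower_tail[of t] F_marg_mono[of t s] F_marg_mono[of s t]
    F_marg_01[of s] by (auto simp: abs_le_iff)

lemma integral_indicator_PP: "(\<integral>y. indicator {..t} (y 0) \<partial>PP) = F_marg M Y t"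
proof -
  have "(\<integral>y. (indicator {..t} (y 0) :: real) \<partial>PP) = (\<integral>\<omega>. indicator {..t} (hist 0 \<omega> 0) \<partial>M)"
    by (rule integral_hist[symmetric]) measurable
  also have "\<dots> = (\<integral>\<omega>. indicator {\<omega> \<in> space M. Y (int 0) \<omega> \<le> t} \<omega> \<partial>M)"
    by (intro Bochner_Integration.integral_cong) (auto simp: hist_def indicator_def)
  also have "\<dots> = prob ({\<omega> \<in> space M. Y (int 0) \<omega> \<le> t} \<inter> space M)"
    by (rule Bochner_Integration.integral_indicator)
  also have "{\<omega> \<in> space M. Y (int 0) \<omega> \<le> t} \<inter> space M = {\<omega> \<in> space M. Y (int 0) \<omega> \<le> t}"
    by auto
  finally show ?thesis
    by (simp only: F_marg_eq[of t 0])
qed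

lemma integrable_indicator_PP: "integrable PP (\<lambda>y. indicator {..t} (y 0) :: real)"
  by (rule integrable_PP_bounded[where b = 1]) (auto simp: indicator_def)

lemma integral_abs_X_le: "(\<integral>y. \<bar>X t y\<bar> \<partial>PP) \<le> 2 * (F_marg M Y t * (1 - F_marg M Y t))"
proof -
  have eq: "\<bar>X t y\<bar> = indicator {..t} (y 0) * (1 - 2 * F_marg M Y t) + F_marg M Y t" for y
    using F_marg_01[of t] by (auto simp: X_def indicator_def)
  show ?thesis
    unfolding eq using integrable_indicator_PP integral_indicator_PP
    by (simp add: algebra_simps)
qed

lemma integral_abs_X_le_H: "(\<integral>y. \<bar>X t y\<bar> \<partial>PP) \<le> 2 * H t"
proof -
  have "F_marg M Y t * (1 - F_marg M Y t) \<le> H t"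
  proof (cases "0 \<le> t")
    case True
    then show ?thesis
      using F_marg_upper_tail[of t] F_marg_01[of t]
      by (intro order_trans[OF mult_left_le_one_le]) auto
  next
    case False
    then show ?thesis
      using F_marg_lower_tail[of t] F_marg_01[of t]
      by (intro order_trans[OF mult_right_le_one_le]) auto
  qed
  then show ?thesis
    using integral_abs_X_le[of t] by simp
qed

lemma X_diff_bound: "\<bar>X t y - X s y\<bar> \<le> 1"
proof -
  have *: "\<bar>X t y - X s y\<bar> \<le> 1" if "s \<le> t" for s t
    using F_marg_01[of s] F_marg_01[of t] F_marg_mono[OF that] that
    by (auto simp: X_def indicator_def)
  show ?thesis
    using *[of s t] *[of t s] by (cases "s \<le> t") (auto simp: abs_minus_commute)
qed

lemma integral_abs_X_diff_le: "(\<integral>y. \<bar>X t y - X s y\<bar> \<partial>PP) \<le> 2 * \<bar>F_marg M Y t - F_marg M Y s\<bar>"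
proof -
  have *: "(\<integral>y. \<bar>X t y - X s y\<bar> \<partial>PP) \<le> 2 * \<bar>F_marg M Y t - F_marg M Y s\<bar>" if st: "s \<le> t" for s t
  proof -
    have "(\<integral>y. \<bar>X t y - X s y\<bar> \<partial>PP)
      \<le> (\<integral>y. (indicator {..t} (y 0) - indicator {..s} (y 0)) + (F_marg M Y t - F_marg M Y s) \<partial>PP)"
    proof (rule integral_mono)
      show "integrable PP (\<lambda>y. \<bar>X t y - X s y\<bar>)"
        using X_diff_bound by (intro integrable_PP_bounded[where b = 1]) auto
      show "\<bar>X t y - X s y\<bar> \<le> (indicator {..t} (y 0) - indicator {..s} (y 0)) + (F_marg M Y t - F_marg M Y s)" for y
        using F_marg_mono[OF st] st by (auto simp: X_def indicator_def)
    qed (use integrable_indicator_PP in auto)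
    also have "\<dots> = 2 * \<bar>F_marg M Y t - F_marg M Y s\<bar>"
      using integrable_indicator_PP F_marg_mono[OF st] by (simp add: integral_indicator_PP)
    finally show ?thesis .
  qed
  show ?thesis
    using *[of s t] *[of t s] by (cases "s \<le> t") (auto simp: abs_minus_commute)
qed

lemma X_diff_past_le_\<beta>:
  assumes "\<phi> \<in> borel_measurable path_space" and "\<And>y. \<bar>\<phi> y\<bar> \<le> b"
  shows "\<bar>\<integral>y. (X t y - X s y) * \<phi> ((sh ^^ k) y) \<partial>PP\<bar> \<le> b * (2 * \<beta> k)"
proof -
  have "(\<integral>y. (X t y - X s y) * \<phi> ((sh ^^ k) y) \<partial>PP)
    = (\<integral>y. X t y * \<phi> ((sh ^^ k) y) \<partial>PP) - (\<integral>y. X s y * \<phi> ((sh ^^ k) y) \<partial>PP)"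
    using integrable_X_mult[OF assms] by (simp add: left_diff_distrib)
  then show ?thesis
    using X_past_le_\<beta>[OF assms, of t k] X_past_le_\<beta>[OF assms, of s k] by linarith
qed

lemma integral_mult_le_left:
  fixes g \<phi> :: "(nat \<Rightarrow> real) \<Rightarrow> real"
  assumes [measurable]: "g \<in> borel_measurable path_space" "\<phi> \<in> borel_measurable path_space"
    and g: "\<And>y. \<bar>g y\<bar> \<le> c" and \<phi>: "\<And>y. \<bar>\<phi> y\<bar> \<le> 1"
  shows "\<bar>\<integral>y. g y * \<phi> y \<partial>PP\<bar> \<le> (\<integral>y. \<bar>g y\<bar> \<partial>PP)"
proof (rule order_trans[OF integral_abs_bound integral_mono])
  show le: "\<bar>g y * \<phi> y\<bar> \<le> \<bar>g y\<bar>" for y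
    unfolding abs_mult using \<phi>[of y] by (intro mult_left_le) auto
  show "integrable PP (\<lambda>y. \<bar>g y * \<phi> y\<bar>)"
    using order_trans[OF le g] by (intro integrable_PP_bounded[where b = c]) auto
  show "integrable PP (\<lambda>y. \<bar>g y\<bar>)"
    using g by (intro integrable_PP_bounded[where b = c]) auto
qed

lemma integral_mult_shift_le_right:
  fixes g \<phi> :: "(nat \<Rightarrow> real) \<Rightarrow> real"
  assumes [measurable]: "g \<in> borel_measurable path_space" "\<phi> \<in> borel_measurable path_space"
    and g: "\<And>y. \<bar>g y\<bar> \<le> c" and \<phi>: "\<And>y. \<bar>\<phi> y\<bar> \<le> 1"
  shows "\<bar>\<integral>y. \<phi> y * g ((sh ^^ k) y) \<partial>PP\<bar> \<le> (\<integral>y. \<bar>g y\<bar> \<partial>PP)"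
proof -
  have "\<bar>\<integral>y. g ((sh ^^ k) y) * \<phi> y \<partial>PP\<bar> \<le> (\<integral>y. \<bar>g ((sh ^^ k) y)\<bar> \<partial>PP)"
    by (rule integral_mult_le_left) (use g \<phi> in auto)
  also have "\<dots> = (\<integral>y. \<bar>g y\<bar> \<partial>PP)"
    using P.integral_Tn[of "\<lambda>y. \<bar>g y\<bar>" k] by simp
  finally show ?thesis
    by (simp add: mult.commute)
qed

lemma cov_le_H: "\<bar>cov k s t\<bar> \<le> 2 * H s" "\<bar>cov k s t\<bar> \<le> 2 * H t"
proof -
  have "\<bar>cov k s t\<bar> \<le> (\<integral>y. \<bar>X s y\<bar> \<partial>PP)"
    unfolding cov_def by (rule integral_mult_le_left) (use X_bound in auto)
  then show "\<bar>cov k s t\<bar> \<le> 2 * H s"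
    using integral_abs_X_le_H[of s] by simp
  have "\<bar>cov k s t\<bar> \<le> (\<integral>y. \<bar>X t y\<bar> \<partial>PP)"
    unfolding cov_def by (rule integral_mult_shift_le_right[OF _ _ X_bound X_bound]) auto
  then show "\<bar>cov k s t\<bar> \<le> 2 * H t"
    using integral_abs_X_le_H[of t] by simp
qed

lemma cov_diff_le:
  "\<bar>cov k s t - cov k s' t\<bar> \<le> 2 * min (\<beta> k) \<bar>F_marg M Y s - F_marg M Y s'\<bar>"
  "\<bar>cov k s t - cov k s t'\<bar> \<le> 2 * min (\<beta> k) \<bar>F_marg M Y t - F_marg M Y t'\<bar>"
proof -
  have "cov k s t - cov k s' t = (\<integral>y. (X s y - X s' y) * X t ((sh ^^ k) y) \<partial>PP)"
    unfolding cov_def using integrable_X_mult[OF X_measurable X_bound] by (simp add: left_diff_distrib)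
  moreover have "\<bar>\<integral>y. (X s y - X s' y) * X t ((sh ^^ k) y) \<partial>PP\<bar> \<le> (\<integral>y. \<bar>X s y - X s' y\<bar> \<partial>PP)"
    by (rule integral_mult_le_left) (use X_bound X_diff_bound in auto)
  ultimately show "\<bar>cov k s t - cov k s' t\<bar> \<le> 2 * min (\<beta> k) \<bar>F_marg M Y s - F_marg M Y s'\<bar>"
    using X_diff_past_le_\<beta>[of "X t" 1 s s' k] integral_abs_X_diff_le[of s s'] X_bound by (simp add: min_def)
  have "cov k s t - cov k s t' = (\<integral>y. X s y * (X t ((sh ^^ k) y) - X t' ((sh ^^ k) y)) \<partial>PP)"
    unfolding cov_def using integrable_X_mult[OF X_measurable X_bound] by (simp add: right_diff_distrib)
  moreover have "\<bar>\<integral>y. X s y * (X t ((sh ^^ k) y) - X t' ((sh ^^ k) y)) \<partial>PP\<bar> \<le> (\<integral>y. \<bar>X t y - X t' y\<bar> \<partial>PP)"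
    using integral_mult_shift_le_right[of "\<lambda>y. X t y - X t' y" "X s" 1 k] X_bound X_diff_bound by simp
  moreover have "\<bar>\<integral>y. X s y * (X t ((sh ^^ k) y) - X t' ((sh ^^ k) y)) \<partial>PP\<bar> \<le> 1 * \<beta> k"
    using X_past_le_\<beta>[of "\<lambda>y. X t y - X t' y" 1 s k] X_diff_bound by simp
  ultimately show "\<bar>cov k s t - cov k s t'\<bar> \<le> 2 * min (\<beta> k) \<bar>F_marg M Y t - F_marg M Y t'\<bar>"
    using integral_abs_X_diff_le[of t t'] \<beta>_nonneg[of k] by (simp add: min_def)
qed

end

section \<open>Variance and kernel bounds in terms of a modulus\<close>

context summable_sequence
begin

definition \<Gamma> :: "real \<Rightarrow> real" where
  "\<Gamma> d = (\<Sum>k. min (\<beta> k) d)"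

lemma summable_min_\<beta>: "0 \<le> d \<Longrightarrow> summable (\<lambda>k. min (\<beta> k) d)"
  by (rule summable_comparison_test'[OF summable_\<beta>, of 0]) (auto simp: \<beta>_nonneg)

lemma \<Gamma>_nonneg: "0 \<le> d \<Longrightarrow> 0 \<le> \<Gamma> d"
  unfolding \<Gamma>_def by (intro suminf_nonneg summable_min_\<beta>) (auto simp: \<beta>_nonneg)

lemma \<Gamma>_mono: "0 \<le> d \<Longrightarrow> d \<le> e \<Longrightarrow> \<Gamma> d \<le> \<Gamma> e"
  unfolding \<Gamma>_def by (intro suminf_le summable_min_\<beta>) auto

lemma \<Gamma>_zero[simp]: "\<Gamma> 0 = 0"
  by (simp add: \<Gamma>_def \<beta>_nonneg min_absorb2)

lemma \<Gamma>_subadd: "0 \<le> d \<Longrightarrow> 0 \<le> e \<Longrightarrow> \<Gamma> (d + e) \<le> \<Gamma> d + \<Gamma> e"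
  unfolding \<Gamma>_def
  by (subst suminf_add[OF summable_min_\<beta> summable_min_\<beta>], assumption+)
     (intro suminf_le summable_add summable_min_\<beta>; simp add: min_def \<beta>_nonneg)

lemma \<Gamma>_tendsto_0:
  assumes "d \<longlonglongrightarrow> 0" and d: "\<And>n. 0 \<le> d n"
  shows "(\<lambda>n. \<Gamma> (d n)) \<longlonglongrightarrow> 0"
proof -
  have "(\<lambda>n. \<Sum>k. min (\<beta> k) (d n)) \<longlonglongrightarrow> (\<Sum>k. min (\<beta> k) 0)"
  proof (rule tannerys_theorem[of _ _ _ \<beta>, THEN conjunct2, THEN conjunct2])
    show "(\<lambda>n. min (\<beta> k) (d n)) \<longlonglongrightarrow> min (\<beta> k) 0" for k
      by (intro tendsto_intros assms)
    show "\<forall>\<^sub>F (k, n) in at_top \<times>\<^sub>F sequentially. norm (min (\<beta> k) (d n)) \<le> \<beta> k"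
      using d by (intro always_eventually) (auto simp: \<beta>_nonneg)
  qed (auto simp: summable_\<beta>)
  then show ?thesis
    by (simp add: \<Gamma>_def \<beta>_nonneg min_absorb2)
qed

text \<open>Monotonicity is available for nonnegative arguments; truncation extends it to the line,
  where monotone functions are measurable.\<close>

lemma \<Gamma>_measurable: "(\<lambda>d. \<Gamma> (max 0 d)) \<in> borel_measurable borel"
  by (rule borel_measurable_mono) (auto intro!: monoI \<Gamma>_mono)

text \<open>Each autocovariance is bounded both by mixing and by the mean of
  \<open>\<bar>g\<bar>\<close>, hence by \<open>2 * min (\<beta> k) d\<close>. The other factor
  \<open>2\<close> comes from counting every lag in both directions.\<close>

lemma bsum_second_moment_le:
  fixes g :: "(nat \<Rightarrow> real) \<Rightarrow> real"
  assumes [measurable]: "g \<in> borel_measurable path_space" and g: "\<And>y. \<bar>g y\<bar> \<le> 1"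
    and d: "(\<integral>y. \<bar>g y\<bar> \<partial>PP) \<le> 2 * d"
    and past: "\<And>k. \<bar>\<integral>y. g y * g ((sh ^^ k) y) \<partial>PP\<bar> \<le> 2 * \<beta> k"
  shows "(\<integral>y. (P.bsum g n y)\<^sup>2 \<partial>PP) \<le> real n * (4 * \<Gamma> d)"
proof -
  have d0: "0 \<le> d"
  proof -
    have "0 \<le> (\<integral>y. \<bar>g y\<bar> \<partial>PP)" by simp
    with d show ?thesis by linarith
  qed
  have "\<bar>P.acov g k\<bar> \<le> 2 * min (\<beta> k) d" for k
  proof -
    have "\<bar>\<integral>y. g y * g ((sh ^^ k) y) \<partial>PP\<bar> \<le> (\<integral>y. \<bar>g y\<bar> \<partial>PP)"
      by (rule integral_mult_le_left) (use g in auto)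
    then show ?thesis
      unfolding P.acov_def using d past[of k] by (simp add: min_def)
  qed
  then have "(\<Sum>k<n. \<bar>P.acov g k\<bar>) \<le> (\<Sum>k<n. 2 * min (\<beta> k) d)"
    by (intro sum_mono) auto
  also have "\<dots> \<le> 2 * \<Gamma> d"
    unfolding sum_distrib_left[symmetric] \<Gamma>_def
    by (intro mult_left_mono sum_le_suminf summable_min_\<beta>) (auto simp: \<beta>_nonneg d0)
  finally have "real n * (2 * (\<Sum>k<n. \<bar>P.acov g k\<bar>)) \<le> real n * (2 * (2 * \<Gamma> d))"
    by (intro mult_left_mono) auto
  then show ?thesis
    using P.second_moment_bsum_le[of g 1 n] g by simp
qed

definition emp :: "nat \<Rightarrow> (nat \<Rightarrow> real) \<Rightarrow> real \<Rightarrow> real" where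
  "emp n y t = P.bsum (X t) n y / sqrt (real n)"

lemma bsum_diff: "P.bsum (X t) n y - P.bsum (X s) n y = P.bsum (\<lambda>y. X t y - X s y) n y"
  by (simp add: P.bsum_def sum_subtractf)

lemma bsum_abs_le:
  fixes g :: "(nat \<Rightarrow> real) \<Rightarrow> real"
  assumes [measurable]: "g \<in> borel_measurable path_space" and g: "\<And>y. \<bar>g y\<bar> \<le> 1" and "0 \<le> d"
    and le: "(\<integral>y. (P.bsum g n y)\<^sup>2 \<partial>PP) \<le> real n * (4 * \<Gamma> d)"
  shows "(\<integral>y. \<bar>P.bsum g n y / sqrt (real n)\<bar> \<partial>PP) \<le> 2 * sqrt (\<Gamma> d)"
proof (cases "n = 0")
  case False
  have "(\<integral>y. \<bar>P.bsum g n y\<bar> \<partial>PP) \<le> sqrt (\<integral>y. (P.bsum g n y)\<^sup>2 \<partial>PP)"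
    using P.bsum_bound[OF g] by (intro P.expectation_abs_le_sqrt[where F = "real n * 1"]) auto
  also have "\<dots> \<le> sqrt (real n * (4 * \<Gamma> d))"
    using le by simp
  also have "\<dots> = sqrt (real n) * (2 * sqrt (\<Gamma> d))"
    by (simp add: real_sqrt_mult)
  finally show ?thesis
    using False by (simp add: abs_div field_simps)
qed (simp add: \<Gamma>_nonneg \<open>0 \<le> d\<close>)

lemma emp_abs_le: "(\<integral>y. \<bar>emp n y t\<bar> \<partial>PP) \<le> 2 * sqrt (\<Gamma> (H t))"
  unfolding emp_def
proof (rule bsum_abs_le[OF X_measurable X_bound H_nonneg bsum_second_moment_le[OF X_measurable X_bound integral_abs_X_le_H]])
  show "\<bar>\<integral>y. X t y * X t ((sh ^^ k) y) \<partial>PP\<bar> \<le> 2 * \<beta> k" for k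
    using X_past_le_\<beta>[of "X t" 1 t k] X_bound \<beta>_nonneg[of k] by simp
qed

lemma emp_diff_abs_le:
  "(\<integral>y. \<bar>emp n y t - emp n y s\<bar> \<partial>PP) \<le> 2 * sqrt (\<Gamma> \<bar>F_marg M Y t - F_marg M Y s\<bar>)"
  unfolding emp_def diff_divide_distrib[symmetric] bsum_diff
proof (rule bsum_abs_le[OF _ X_diff_bound abs_ge_zero bsum_second_moment_le[OF _ X_diff_bound integral_abs_X_diff_le]])
  show "\<bar>\<integral>y. (X t y - X s y) * (X t ((sh ^^ k) y) - X s ((sh ^^ k) y)) \<partial>PP\<bar> \<le> 2 * \<beta> k" for k
    using X_diff_past_le_\<beta>[of "\<lambda>y. X t y - X s y" 1 t s k] X_diff_bound by simp
qed auto

text \<open>Stated for a general sequence \<open>u\<close>, so that it applies both to the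
  covariances and to their increments in one argument.\<close>

lemma C_kernel_bound:
  assumes d0: "0 \<le> d" and d: "\<And>k. \<bar>u k\<bar> \<le> 2 * min (\<beta> k) d"
  shows "summable (\<lambda>k. u (Suc k))" "\<bar>u 0 + 2 * (\<Sum>k. u (Suc k))\<bar> \<le> 4 * \<Gamma> d"
proof -
  have s: "summable (\<lambda>k. 2 * min (\<beta> (Suc k)) d)"
    using summable_min_\<beta>[OF d0] by (intro summable_mult) (simp only: summable_Suc_iff[of "\<lambda>k. min (\<beta> k) d"])
  have sa: "summable (\<lambda>k. \<bar>u (Suc k)\<bar>)"
    by (rule summable_comparison_test'[OF s, of 0]) (simp add: d)
  then show "summable (\<lambda>k. u (Suc k))"
    by (rule summable_rabs_cancel)
  have "\<bar>\<Sum>k. u (Suc k)\<bar> \<le> (\<Sum>k. \<bar>u (Suc k)\<bar>)"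
    by (rule summable_rabs[OF sa])
  also have "\<dots> \<le> (\<Sum>k. 2 * min (\<beta> (Suc k)) d)"
    by (intro suminf_le sa s d)
  also have "\<dots> = 2 * (\<Sum>k. min (\<beta> (Suc k)) d)"
    using summable_min_\<beta>[OF d0] by (intro suminf_mult) (simp only: summable_Suc_iff[of "\<lambda>k. min (\<beta> k) d"])
  also have "(\<Sum>k. min (\<beta> (Suc k)) d) = \<Gamma> d - min (\<beta> 0) d"
    using suminf_split_head[OF summable_min_\<beta>[OF d0]] by (simp add: \<Gamma>_def)
  finally show "\<bar>u 0 + 2 * (\<Sum>k. u (Suc k))\<bar> \<le> 4 * \<Gamma> d"
    using d[of 0] \<beta>_nonneg[of 0] d0 by (simp add: abs_le_iff)
qed

lemma C_kernel_le: "\<bar>C_kernel M Y s t\<bar> \<le> 4 * \<Gamma> (min (H s) (H t))"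
  unfolding C_kernel_eq
proof (rule C_kernel_bound(2))
  show "\<bar>cov k s t\<bar> \<le> 2 * min (\<beta> k) (min (H s) (H t))" for k
    using cov_le_\<beta>[of k s t] cov_le_H[of k s t] \<beta>_nonneg[of k] by (auto simp: min_def)
qed (auto simp: H_nonneg)

lemma C_kernel_diff_le:
  "\<bar>C_kernel M Y s t - C_kernel M Y s' t'\<bar>
    \<le> 4 * \<Gamma> \<bar>F_marg M Y s - F_marg M Y s'\<bar> + 4 * \<Gamma> \<bar>F_marg M Y t - F_marg M Y t'\<bar>"
proof -
  have eq: "C_kernel M Y a b - C_kernel M Y a' b'
    = (cov 0 a b - cov 0 a' b') + 2 * (\<Sum>k. cov (Suc k) a b - cov (Suc k) a' b')" for a b a' b'
    unfolding C_kernel_eq using suminf_diff[OF summable_cov[of a b] summable_cov[of a' b']] by simp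
  have "\<bar>C_kernel M Y s t - C_kernel M Y s' t\<bar> \<le> 4 * \<Gamma> \<bar>F_marg M Y s - F_marg M Y s'\<bar>"
    unfolding eq by (rule C_kernel_bound(2)[of _ "\<lambda>k. cov k s t - cov k s' t"]) (auto intro: cov_diff_le)
  moreover have "\<bar>C_kernel M Y s' t - C_kernel M Y s' t'\<bar> \<le> 4 * \<Gamma> \<bar>F_marg M Y t - F_marg M Y t'\<bar>"
    unfolding eq by (rule C_kernel_bound(2)[of _ "\<lambda>k. cov k s' t - cov k s' t'"]) (auto intro: cov_diff_le)
  ultimately show ?thesis by linarith
qed

end

section \<open>Tail integrals and quantile integrals\<close>

text \<open>The integral equals twice the left side. Bounding the integrand below by its value at
  \<open>m\<close> loses this factor and avoids an improper integral.\<close>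

lemma sqrt_le_nn_integral:
  assumes "0 \<le> m"
  shows "ennreal (sqrt m) \<le> (\<integral>\<^sup>+u. ennreal (1 / sqrt u) * indicator {0<..<m} u \<partial>lborel)"
proof (cases "m = 0")
  case False
  with assms have m: "0 < m" by simp
  have "ennreal (sqrt m) = ennreal (1 / sqrt m) * ennreal m"
    using m by (simp add: ennreal_mult[symmetric] real_div_sqrt)
  also have "\<dots> = (\<integral>\<^sup>+u. ennreal (1 / sqrt m) * indicator {0<..<m} u \<partial>lborel)"
    using m by (subst nn_integral_cmult_indicator) auto
  also have "\<dots> \<le> (\<integral>\<^sup>+u. ennreal (1 / sqrt u) * indicator {0<..<m} u \<partial>lborel)"
    by (intro nn_integral_mono) (auto simp: indicator_def intro!: divide_left_mono)
  finally show ?thesis .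
qed simp

context stationary_sequence
begin

text \<open>If \<open>x < \<bar>t\<bar>\<close>, the tail beyond \<open>x\<close> is at least
  \<open>H t\<close> and exceeds \<open>u\<close>, so no such \<open>x\<close> competes in the
  infimum. The tail tends to \<open>0\<close>, so the set is nonempty and \<open>Inf\<close> is
  meaningful.\<close>

lemma quantile_ge:
  assumes u: "0 < u" "u < H t"
  shows "\<bar>t\<bar> \<le> quantile M Y u"
  unfolding quantile_def
proof (rule cInf_greatest)
  let ?T = "\<lambda>x. measure M {\<omega> \<in> space M. \<bar>Y 0 \<omega>\<bar> > x}"
  have "(\<lambda>n. ?T (real n)) \<longlonglongrightarrow> prob (\<Inter>n. {\<omega> \<in> space M. \<bar>Y 0 \<omega>\<bar> > real n})"
    by (rule finite_Lim_measure_decseq) (auto simp: decseq_def)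
  moreover have "(\<Inter>n. {\<omega> \<in> space M. \<bar>Y 0 \<omega>\<bar> > real n}) = {}"
  proof (rule equals0I)
    fix \<omega> assume "\<omega> \<in> (\<Inter>n. {\<omega> \<in> space M. \<bar>Y 0 \<omega>\<bar> > real n})"
    then have "real n < \<bar>Y 0 \<omega>\<bar>" for n by auto
    moreover obtain n where "\<bar>Y 0 \<omega>\<bar> \<le> real n"
      using real_arch_simple by blast
    ultimately show False by (meson not_le)
  qed
  ultimately have "(\<lambda>n. ?T (real n)) \<longlonglongrightarrow> 0"
    by simp
  then have "\<forall>\<^sub>F n in sequentially. ?T (real n) < u"
    by (rule order_tendstoD) (use u in simp)
  then obtain n where "?T (real n) < u"
    using eventually_happens'[OF sequentially_bot] by blast
  then have "real n \<in> {x. 0 \<le> x \<and> ?T x \<le> u}"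
    by simp
  then show "{x. 0 \<le> x \<and> ?T x \<le> u} \<noteq> {}" by blast
  fix x assume "x \<in> {x. 0 \<le> x \<and> ?T x \<le> u}"
  then have x: "?T x \<le> u" by simp
  show "\<bar>t\<bar> \<le> x"
  proof (rule ccontr)
    assume "\<not> \<bar>t\<bar> \<le> x"
    then have "H t \<le> ?T x"
      unfolding H_def by (intro finite_measure_mono) auto
    with x u show False by simp
  qed
qed

lemma nn_integral_sqrt_min_le:
  assumes a: "0 \<le> a"
  shows "(\<integral>\<^sup>+t. ennreal (sqrt (min a (H t))) \<partial>lborel) \<le> 2 * quantile_integral M Y a"
proof -
  let ?f = "\<lambda>t u. ennreal (1 / sqrt u) * indicator {0<..<min a (H t)} u"
  have meas[measurable]: "case_prod ?f \<in> borel_measurable (lborel \<Otimes>\<^sub>M lborel)"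
  proof -
    have "case_prod ?f = (\<lambda>p. if 0 < snd p \<and> snd p < a \<and> snd p < H (fst p) then ennreal (1 / sqrt (snd p)) else 0)"
      by (auto simp: fun_eq_iff indicator_def)
    then show ?thesis by simp
  qed
  \<comment> \<open>For fixed \<open>u\<close>, the points with \<open>u < H t\<close> lie in an
    interval whose length is twice the quantile. The factor \<open>1 / 2\<close> cancels this,
    leaving the integrand of \<open>quantile_integral\<close>.\<close>
  have inner: "ennreal (1 / 2) * (\<integral>\<^sup>+t. ?f t u \<partial>lborel)
      \<le> ennreal (quantile M Y u / sqrt u) * indicator {0<..a} u" for u
  proof (cases "0 < u \<and> u < a")
    case True
    show ?thesis
    proof (cases "\<exists>t. u < H t")
      case False
      then have "(\<integral>\<^sup>+t. ?f t u \<partial>lborel) = (\<integral>\<^sup>+t. 0 \<partial>(lborel :: real measure))"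
        by (intro nn_integral_cong) (auto simp: indicator_def)
      then show ?thesis by simp
    next
      case ex: True
      \<comment> \<open>The sign of the quantile comes from a witness \<open>t\<close>, through
        \<open>quantile_ge\<close>.\<close>
      then have q0: "0 \<le> quantile M Y u"
        using quantile_ge[of u] True by (meson abs_ge_zero order_trans)
      have "(\<integral>\<^sup>+t. ?f t u \<partial>lborel) \<le> (\<integral>\<^sup>+t. ennreal (1 / sqrt u) * indicator {- quantile M Y u..quantile M Y u} t \<partial>lborel)"
        using quantile_ge[of u] by (intro nn_integral_mono) (auto simp: indicator_def abs_le_iff minus_le_iff[of "quantile M Y u"])
      also have "\<dots> = ennreal (1 / sqrt u) * ennreal (2 * quantile M Y u)"
        using q0 by (subst nn_integral_cmult_indicator) auto
      finally have "ennreal (1 / 2) * (\<integral>\<^sup>+t. ?f t u \<partial>lborel)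
        \<le> ennreal (1 / 2) * (ennreal (1 / sqrt u) * ennreal (2 * quantile M Y u))"
        by (intro mult_left_mono) auto
      also have "ennreal (1 / sqrt u) * ennreal (2 * quantile M Y u) = ennreal (1 / sqrt u * (2 * quantile M Y u))"
        using q0 True by (intro ennreal_mult[symmetric]) auto
      also have "ennreal (1 / 2) * \<dots> = ennreal (1 / 2 * (1 / sqrt u * (2 * quantile M Y u)))"
        using q0 True by (intro ennreal_mult[symmetric]) auto
      also have "1 / 2 * (1 / sqrt u * (2 * quantile M Y u)) = quantile M Y u / sqrt u"
        by simp
      finally show ?thesis
        using True by simp
    qed
  next
    case False
    then have "(\<integral>\<^sup>+t. ?f t u \<partial>lborel) = (\<integral>\<^sup>+t. 0 \<partial>(lborel :: real measure))"
      by (intro nn_integral_cong) (auto simp: indicator_def)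
    then show ?thesis by simp
  qed
  have "(\<integral>\<^sup>+t. ennreal (sqrt (min a (H t))) \<partial>lborel) \<le> (\<integral>\<^sup>+t. \<integral>\<^sup>+u. ?f t u \<partial>lborel \<partial>lborel)"
    using a H_nonneg by (intro nn_integral_mono sqrt_le_nn_integral) auto
  also have "\<dots> = (\<integral>\<^sup>+u. \<integral>\<^sup>+t. ?f t u \<partial>lborel \<partial>lborel)"
    by (rule lborel_pair.Fubini'[OF meas, symmetric])
  finally have "ennreal (1 / 2) * (\<integral>\<^sup>+t. ennreal (sqrt (min a (H t))) \<partial>lborel)
    \<le> ennreal (1 / 2) * (\<integral>\<^sup>+u. \<integral>\<^sup>+t. ?f t u \<partial>lborel \<partial>lborel)"
    by (intro mult_left_mono) auto
  also have "\<dots> = (\<integral>\<^sup>+u. ennreal (1 / 2) * (\<integral>\<^sup>+t. ?f t u \<partial>lborel) \<partial>lborel)"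
  proof (rule nn_integral_cmult[symmetric])
    show "(\<lambda>u. \<integral>\<^sup>+t. ?f t u \<partial>lborel) \<in> borel_measurable lborel"
      using lborel.borel_measurable_nn_integral[of "\<lambda>u t. ?f t u" lborel] measurable_compose[OF measurable_pair_swap' meas]
      by (simp add: case_prod_beta')
  qed
  also have "\<dots> \<le> quantile_integral M Y a"
    unfolding quantile_integral_def by (intro nn_integral_mono inner)
  finally have half: "ennreal (1 / 2) * (\<integral>\<^sup>+t. ennreal (sqrt (min a (H t))) \<partial>lborel) \<le> quantile_integral M Y a" .
  have "(\<integral>\<^sup>+t. ennreal (sqrt (min a (H t))) \<partial>lborel) = 2 * (ennreal (1 / 2) * (\<integral>\<^sup>+t. ennreal (sqrt (min a (H t))) \<partial>lborel))"
  proof -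
    have "(2 :: ennreal) * ennreal (1 / 2) = 1"
    proof -
      have "ennreal (2 * (1 / 2)) = 2 * ennreal (1 / 2)"
        by (subst ennreal_mult) auto
      then show ?thesis by simp
    qed
    then show ?thesis
      by (simp flip: mult.assoc)
  qed
  also have "\<dots> \<le> 2 * quantile_integral M Y a"
    by (intro mult_left_mono half) auto
  finally show ?thesis .
qed

end

section \<open>Consequences of the series condition\<close>

locale quantile_sequence = stationary_sequence +
  assumes series: "(\<Sum>k. ennreal (1 / sqrt (real (Suc k))) * quantile_integral M Y (tilde_alpha M Y (Suc k))) < \<infinity>"
    and iid_case: "tilde_alpha M Y 1 = 0 \<Longrightarrow> quantile_integral M Y 1 < \<infinity>"
begin

definition weights :: "real \<Rightarrow> nat \<Rightarrow> real" where
  "weights t k = sqrt (min (\<alpha> (Suc k)) (H t)) / sqrt (real (Suc k))"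

lemma weights_nonneg: "0 \<le> weights t k"
  by (simp add: weights_def \<alpha>_nonneg H_nonneg)

lemma weights_measurable[measurable]: "(\<lambda>t. weights t k) \<in> borel_measurable borel"
  unfolding weights_def[abs_def] by measurable

lemma nn_integral_weights: "(\<integral>\<^sup>+t. (\<Sum>k. ennreal (weights t k)) \<partial>lborel) < \<infinity>"
proof -
  have "(\<integral>\<^sup>+t. ennreal (weights t k) \<partial>lborel)
    \<le> 2 * (ennreal (1 / sqrt (real (Suc k))) * quantile_integral M Y (tilde_alpha M Y (Suc k)))" for k
  proof -
    have "(\<integral>\<^sup>+t. ennreal (weights t k) \<partial>lborel)
      = (\<integral>\<^sup>+t. ennreal (1 / sqrt (real (Suc k))) * ennreal (sqrt (min (\<alpha> (Suc k)) (H t))) \<partial>lborel)"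
      by (intro nn_integral_cong) (simp add: weights_def ennreal_mult[symmetric] \<alpha>_nonneg H_nonneg del: of_nat_Suc)
    also have "\<dots> = ennreal (1 / sqrt (real (Suc k))) * (\<integral>\<^sup>+t. ennreal (sqrt (min (\<alpha> (Suc k)) (H t))) \<partial>lborel)"
      by (rule nn_integral_cmult) measurable
    also have "\<dots> \<le> ennreal (1 / sqrt (real (Suc k))) * (2 * quantile_integral M Y (\<alpha> (Suc k)))"
      by (intro mult_left_mono nn_integral_sqrt_min_le \<alpha>_nonneg) auto
    finally show ?thesis
      by (simp add: \<alpha>_def mult.left_commute del: of_nat_Suc)
  qed
  then have "(\<Sum>k. \<integral>\<^sup>+t. ennreal (weights t k) \<partial>lborel)
    \<le> (\<Sum>k. 2 * (ennreal (1 / sqrt (real (Suc k))) * quantile_integral M Y (tilde_alpha M Y (Suc k))))"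
    by (intro suminf_le) auto
  also have "\<dots> = 2 * (\<Sum>k. ennreal (1 / sqrt (real (Suc k))) * quantile_integral M Y (tilde_alpha M Y (Suc k)))"
    by (rule ennreal_suminf_cmult)
  also have "\<dots> < \<infinity>"
    using series by (simp add: ennreal_mult_less_top del: of_nat_Suc)
  finally show ?thesis
    by (subst nn_integral_suminf) auto
qed

text \<open>The contribution of lag \<open>0\<close>, which the series leaves out. If
  \<open>\<alpha> 1\<close> is positive, it is dominated by a multiple of the term at lag
  \<open>1\<close>, because \<open>H t \<le> 1\<close>; otherwise it is controlled by the separate
  hypothesis \<open>iid_case\<close>.\<close>

lemma nn_integral_sqrt_H: "(\<integral>\<^sup>+t. ennreal (sqrt (H t)) \<partial>lborel) < \<infinity>"
proof (cases "\<alpha> 1 = 0")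
  case True
  have "(\<integral>\<^sup>+t. ennreal (sqrt (min 1 (H t))) \<partial>lborel) \<le> 2 * quantile_integral M Y 1"
    by (rule nn_integral_sqrt_min_le) simp
  also have "\<dots> < \<infinity>"
    using iid_case True by (simp add: \<alpha>_def ennreal_mult_less_top)
  finally show ?thesis
    by (simp add: H_le_1 min_absorb2)
next
  case False
  then have a: "0 < \<alpha> 1" using \<alpha>_nonneg[of 1] by simp
  define c where "c = sqrt (min (\<alpha> 1) 1)"
  have c: "0 < c" using a by (simp add: c_def)
  have "sqrt (H t) \<le> (1 / c) * weights t 0" for t
  proof -
    have "min (\<alpha> 1) 1 * H t \<le> min (\<alpha> 1) (H t)"
    proof -
      have "min (\<alpha> 1) 1 * H t \<le> 1 * H t"
        by (intro mult_right_mono H_nonneg) simp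
      moreover have "min (\<alpha> 1) 1 * H t \<le> \<alpha> 1 * 1"
        using a by (intro mult_mono H_nonneg H_le_1) simp_all
      ultimately show ?thesis by simp
    qed
    then have "c * sqrt (H t) \<le> weights t 0"
      by (simp add: c_def weights_def real_sqrt_mult[symmetric])
    then show ?thesis
      using c by (simp add: field_simps)
  qed
  then have "(\<integral>\<^sup>+t. ennreal (sqrt (H t)) \<partial>lborel) \<le> (\<integral>\<^sup>+t. ennreal (1 / c) * ennreal (weights t 0) \<partial>lborel)"
    using c by (intro nn_integral_mono) (simp add: ennreal_mult[symmetric] weights_nonneg)
  also have "\<dots> = ennreal (1 / c) * (\<integral>\<^sup>+t. ennreal (weights t 0) \<partial>lborel)"
    by (rule nn_integral_cmult) measurable
  also have "(\<integral>\<^sup>+t. ennreal (weights t 0) \<partial>lborel) \<le> (\<integral>\<^sup>+t. (\<Sum>k. ennreal (weights t k)) \<partial>lborel)"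
  proof (rule nn_integral_mono)
    show "ennreal (weights t 0) \<le> (\<Sum>k. ennreal (weights t k))" for t
      using sum_le_suminf[of "\<lambda>k. ennreal (weights t k)" "{0}"] by simp
  qed
  finally show ?thesis
    using nn_integral_weights by (simp add: ennreal_mult_less_top le_less_trans mult_left_mono)
qed

text \<open>If \<open>H\<close> vanishes off \<open>0\<close>, then \<open>Y\<close> is almost surely \<open>0\<close> and the series condition carries no
  information about \<open>\<alpha>\<close>.\<close>

lemma degenerate_\<alpha>:
  assumes "\<And>t. 0 < t \<Longrightarrow> H t = 0"
  shows "\<alpha> k = 0"
proof -
  have F: "F_marg M Y t * (1 - F_marg M Y t) = 0" for t
  proof (cases "t < 0")
    case True
    then have "H t = 0"
      using assms[of "- t"] by (simp add: H_def)
    then show ?thesis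
      using F_marg_lower_tail[of t] F_marg_01[of t] True by simp
  next
    case False
    have "prob {\<omega> \<in> space M. t < Y 0 \<omega>} \<le> prob (\<Union>n. {\<omega> \<in> space M. \<bar>1 / real (Suc n)\<bar> \<le> \<bar>Y 0 \<omega>\<bar>})"
    proof (rule finite_measure_mono)
      show "{\<omega> \<in> space M. t < Y 0 \<omega>} \<subseteq> (\<Union>n. {\<omega> \<in> space M. \<bar>1 / real (Suc n)\<bar> \<le> \<bar>Y 0 \<omega>\<bar>})"
      proof safe
        fix \<omega> assume "\<omega> \<in> space M" "t < Y 0 \<omega>"
        with False obtain n where "inverse (real (Suc n)) < Y 0 \<omega>"
          using reals_Archimedean[of "Y 0 \<omega>"] by auto
        with \<open>\<omega> \<in> space M\<close> show "\<omega> \<in> (\<Union>n. {\<omega> \<in> space M. \<bar>1 / real (Suc n)\<bar> \<le> \<bar>Y 0 \<omega>\<bar>})"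
          by (auto simp: inverse_eq_divide intro!: exI[of _ n])
      qed
    qed measurable
    also have "\<dots> = 0"
    proof -
      have "(\<Union>n. {\<omega> \<in> space M. \<bar>1 / real (Suc n)\<bar> \<le> \<bar>Y 0 \<omega>\<bar>}) \<in> null_sets M"
      proof (rule null_sets_UN)
        fix n
        have "H (1 / real (Suc n)) = 0" by (rule assms) simp
        then show "{\<omega> \<in> space M. \<bar>1 / real (Suc n)\<bar> \<le> \<bar>Y 0 \<omega>\<bar>} \<in> null_sets M"
          by (intro null_setsI) (auto simp: H_def emeasure_eq_measure)
      qed
      then show ?thesis by (simp add: null_sets_def measure_def)
    qed
    finally show ?thesis
      unfolding F_marg_compl using measure_nonneg[of M "{\<omega> \<in> space M. t < Y 0 \<omega>}"] by simp
  qed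
  have "(\<integral>\<omega>. \<bar>cexp k t \<omega> - F_marg M Y t\<bar> \<partial>M) \<le> 0" for t
  proof -
    obtain \<phi> where [measurable]: "\<phi> \<in> borel_measurable path_space" and \<phi>1: "\<And>y. \<bar>\<phi> y\<bar> \<le> 1"
      and eq: "(\<integral>\<omega>. \<bar>cexp k t \<omega> - F_marg M Y t\<bar> \<partial>M) = (\<integral>y. X t y * \<phi> ((sh ^^ k) y) \<partial>PP)"
      by (rule cexp_dev_eq[of k t]) (rule that)
    have "\<bar>\<integral>y. X t y * \<phi> ((sh ^^ k) y) \<partial>PP\<bar> \<le> (\<integral>y. \<bar>X t y\<bar> \<partial>PP)"
      by (rule integral_mult_le_left[OF _ _ X_bound \<phi>1]) auto
    then show ?thesis
      unfolding eq using integral_abs_X_le[of t] F[of t] by simp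
  qed
  then have "\<alpha> k \<le> 0"
    unfolding \<alpha>_eq by (intro cSUP_least) auto
  then show ?thesis
    using \<alpha>_nonneg[of k] by simp
qed

lemma summable_of_weights:
  assumes "summable w" and anti: "\<And>i j. i \<le> j \<Longrightarrow> b j \<le> b i" and b: "\<And>k. 0 \<le> b k"
    and w: "\<And>k. sqrt (b k) / sqrt (real (Suc k)) \<le> w k"
  shows "summable b" "sqrt (suminf b) \<le> suminf w"
proof -
  have w0: "0 \<le> w k" for k
    using order_trans[OF _ w[of k]] b[of k] by simp
  have part: "sqrt (\<Sum>k<n. b k) \<le> suminf w" for n
  proof -
    have "sqrt (\<Sum>k<n. b k) \<le> (\<Sum>k<n. sqrt (b k) / sqrt (real (Suc k)))"
      by (rule sqrt_sum_le_weighted[OF b anti])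
    also have "\<dots> \<le> (\<Sum>k<n. w k)"
      by (intro sum_mono w)
    also have "\<dots> \<le> suminf w"
      by (intro sum_le_suminf assms(1)) (auto simp: w0)
    finally show ?thesis .
  qed
  have W: "0 \<le> suminf w"
    using suminf_nonneg[OF assms(1) w0] .
  show s: "summable b"
  proof (rule summableI_nonneg_bounded[of b "(suminf w)\<^sup>2"])
    show "(\<Sum>k<n. b k) \<le> (suminf w)\<^sup>2" for n
      using part[of n] by (rule sqrt_le_D)
  qed (rule b)
  have "(\<lambda>n. sqrt (\<Sum>k<n. b k)) \<longlonglongrightarrow> sqrt (suminf b)"
    by (intro tendsto_intros summable_LIMSEQ s)
  then show "sqrt (suminf b) \<le> suminf w"
    by (rule LIMSEQ_le_const2) (use part in blast)
qed

lemma AE_summable_weights: "AE t in lborel. summable (weights t)"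
proof -
  have "AE t in lborel. (\<Sum>k. ennreal (weights t k)) \<noteq> \<infinity>"
    using nn_integral_weights by (intro nn_integral_PInf_AE) auto
  then show ?thesis
    by eventually_elim (rule summable_suminf_not_top, auto simp: weights_nonneg)
qed

text \<open>The weights are summable for almost every \<open>t\<close>, hence for some
  \<open>t\<close> at which the tail \<open>H t\<close> is positive. There
  \<open>min (\<alpha> (Suc k)) (H t)\<close> is comparable to
  \<open>\<alpha> (Suc k)\<close>.\<close>

lemma summable_\<alpha>: "summable \<alpha>"
proof (cases "\<exists>t>0. H t \<noteq> 0")
  case True
  then obtain x where x: "0 < x" "H x \<noteq> 0" by blast
  have "\<exists>t\<in>{0<..<x}. summable (weights t)"
  proof (rule ccontr)
    assume "\<not> ?thesis"
    then have "{0<..<x} \<subseteq> {t \<in> space lborel. \<not> summable (weights t)}" by auto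
    moreover obtain N where N: "{t \<in> space lborel. \<not> summable (weights t)} \<subseteq> N" "emeasure lborel N = 0" "N \<in> sets lborel"
      using AE_E[OF AE_summable_weights] by blast
    ultimately have "emeasure lborel {0<..<x} \<le> emeasure lborel N"
      by (intro emeasure_mono) auto
    with N x show False by simp
  qed
  then obtain t where t: "0 < t" "t < x" "summable (weights t)" by auto
  \<comment> \<open>The coefficients are at most \<open>2\<close>, so the factor
    \<open>H t / 2\<close> brings them below \<open>H t\<close>; the other bound \<open>1\<close>
    keeps the product below the coefficient itself.\<close>
  define \<delta> where "\<delta> = min 1 (H t / 2)"
  have "H x \<le> H t" using t by (intro H_antimono) auto
  then have "0 < H t" using x(2) H_nonneg[of x] by linarith
  then have \<delta>: "0 < \<delta>" by (simp add: \<delta>_def)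
  have "\<delta> * \<alpha> (Suc k) \<le> min (\<alpha> (Suc k)) (H t)" for k
  proof -
    have "\<delta> * \<alpha> (Suc k) \<le> 1 * \<alpha> (Suc k)"
      by (intro mult_right_mono \<alpha>_nonneg) (simp add: \<delta>_def)
    moreover have "\<delta> * \<alpha> (Suc k) \<le> (H t / 2) * 2"
      using \<open>0 < H t\<close> by (intro mult_mono \<alpha>_nonneg \<alpha>_le_2) (simp_all add: \<delta>_def)
    ultimately show ?thesis by simp
  qed
  then have w: "sqrt (\<delta> * \<alpha> (Suc k)) / sqrt (real (Suc k)) \<le> weights t k" for k
    unfolding weights_def by (intro divide_right_mono real_sqrt_le_mono) auto
  have "summable (\<lambda>k. \<delta> * \<alpha> (Suc k))"
    using \<delta> by (intro summable_of_weights(1)[OF t(3) _ _ w]) (auto intro: \<alpha>_antimono simp: \<alpha>_nonneg)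
  then have "summable (\<lambda>k. \<alpha> (Suc k))"
    using summable_mult[of "\<lambda>k. \<delta> * \<alpha> (Suc k)" "1 / \<delta>"] \<delta> by simp
  then show ?thesis
    by (simp only: summable_Suc_iff)
next
  case False
  then have "\<alpha> = (\<lambda>_. 0)"
    using degenerate_\<alpha> by auto
  then show ?thesis by simp
qed

end

sublocale quantile_sequence \<subseteq> summable_sequence
  by unfold_locales (rule summable_\<alpha>)

context quantile_sequence
begin

definition \<kappa> :: "real \<Rightarrow> real" where
  "\<kappa> t = sqrt (\<Gamma> (H t))"

lemma \<kappa>_nonneg: "0 \<le> \<kappa> t"
  by (simp add: \<kappa>_def \<Gamma>_nonneg H_nonneg)

lemma \<Gamma>_comp_measurable:
  assumes [measurable]: "f \<in> borel_measurable N" and f: "\<And>x. 0 \<le> f x"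
  shows "(\<lambda>x. \<Gamma> (f x)) \<in> borel_measurable N"
proof -
  have "(\<lambda>x. \<Gamma> (max 0 (f x))) \<in> borel_measurable N"
    by (rule measurable_compose[OF _ \<Gamma>_measurable]) simp
  then show ?thesis
    using f by (simp add: max_absorb2)
qed

lemma \<kappa>_measurable[measurable]: "\<kappa> \<in> borel_measurable borel"
  unfolding \<kappa>_def[abs_def] using \<Gamma>_comp_measurable[OF H_measurable H_nonneg] by simp

text \<open>Split lag \<open>0\<close> off \<open>\<Gamma> (H t)\<close> and use subadditivity of
  the square root. The remaining sum is nonincreasing in the lag, so
  \<open>summable_of_weights\<close> bounds its root by the sum of the weights.\<close>

lemma integrable_\<kappa>: "integrable lborel \<kappa>"
proof (rule integrableI_nonneg)
  have "(\<integral>\<^sup>+t. ennreal (\<kappa> t) \<partial>lborel) \<le> (\<integral>\<^sup>+t. ennreal (sqrt (H t)) + (\<Sum>k. ennreal (weights t k)) \<partial>lborel)"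
  proof (rule nn_integral_mono_AE)
    show "AE t in lborel. ennreal (\<kappa> t) \<le> ennreal (sqrt (H t)) + (\<Sum>k. ennreal (weights t k))"
      using AE_summable_weights
    proof eventually_elim
      case (elim t)
      have anti: "min (\<alpha> (Suc j)) (H t) \<le> min (\<alpha> (Suc i)) (H t)" if "i \<le> j" for i j
        using that by (intro min.mono \<alpha>_antimono order_refl) simp
      have nonneg: "0 \<le> min (\<alpha> (Suc k)) (H t)" for k
        by (simp add: \<alpha>_nonneg H_nonneg)
      have w: "sqrt (min (\<alpha> (Suc k)) (H t)) / sqrt (real (Suc k)) \<le> weights t k" for k
        by (simp add: weights_def)
      note s = summable_of_weights[OF elim anti nonneg w]
      have "\<Gamma> (H t) = min (\<beta> 0) (H t) + (\<Sum>k. min (\<beta> (Suc k)) (H t))"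
        using suminf_split_head[OF summable_min_\<beta>[OF H_nonneg], of t] by (simp add: \<Gamma>_def)
      then have "\<Gamma> (H t) = H t + (\<Sum>k. min (\<alpha> (Suc k)) (H t))"
        by (simp add: \<beta>_def H_le_1 min_absorb2)
      moreover have "0 \<le> (\<Sum>k. min (\<alpha> (Suc k)) (H t))"
        by (rule suminf_nonneg[OF s(1) nonneg])
      ultimately have "\<kappa> t \<le> sqrt (H t) + sqrt (\<Sum>k. min (\<alpha> (Suc k)) (H t))"
        unfolding \<kappa>_def using H_nonneg[of t] by (simp add: sqrt_add_le_add_sqrt)
      also have "\<dots> \<le> sqrt (H t) + suminf (weights t)"
        using s(2) by simp
      finally have "ennreal (\<kappa> t) \<le> ennreal (sqrt (H t)) + ennreal (suminf (weights t))"
        using H_nonneg[of t] suminf_nonneg[OF elim weights_nonneg] by (simp add: ennreal_plus[symmetric] del: ennreal_plus)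
      also have "ennreal (suminf (weights t)) = (\<Sum>k. ennreal (weights t k))"
        by (rule suminf_ennreal2[OF weights_nonneg elim, symmetric])
      finally show ?case .
    qed
  qed
  also have "\<dots> = (\<integral>\<^sup>+t. ennreal (sqrt (H t)) \<partial>lborel) + (\<integral>\<^sup>+t. (\<Sum>k. ennreal (weights t k)) \<partial>lborel)"
    by (rule nn_integral_add) measurable
  also have "\<dots> < \<infinity>"
    using nn_integral_sqrt_H nn_integral_weights by simp
  finally show "(\<integral>\<^sup>+t. ennreal (\<kappa> t) \<partial>lborel) < \<infinity>" .
qed (auto simp: \<kappa>_nonneg)

lemma integrable_H: "integrable lborel H"
proof -
  have "integrable lborel (\<lambda>t. sqrt (H t))"
    using nn_integral_sqrt_H by (intro integrableI_nonneg) (auto simp: H_nonneg)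
  then show ?thesis
  proof (rule Bochner_Integration.integrable_bound)
    show "AE t in lborel. norm (H t) \<le> norm (sqrt (H t))"
      using H_nonneg H_le_1 by (auto simp: real_le_rsqrt power_le_one_iff power2_eq_square mult_left_le)
  qed simp
qed

end

section \<open>Sampling on a grid\<close>

text \<open>Grid points are rounded away from \<open>0\<close>, so that tail bounds at \<open>t\<close> also hold at \<open>pt m t\<close>.\<close>

definition rnd :: "nat \<Rightarrow> real \<Rightarrow> int" where
  "rnd m t = (if 0 \<le> t then \<lceil>real m * t\<rceil> else \<lfloor>real m * t\<rfloor>)"

definition pt :: "nat \<Rightarrow> real \<Rightarrow> real" where
  "pt m t = real_of_int (rnd m t) / real m"

lemma pt_measurable[measurable]: "pt m \<in> borel_measurable borel"
  unfolding pt_def[abs_def] rnd_def by measurable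

lemma pt_outward:
  assumes "\<bar>t\<bar> \<le> real m"
  shows "0 \<le> t \<and> t \<le> pt m t \<or> t \<le> 0 \<and> pt m t \<le> t"
proof (cases "m = 0")
  case True
  then show ?thesis using assms by (simp add: pt_def)
next
  case False
  then show ?thesis
    using le_of_int_ceiling[of "real m * t"] of_int_floor_le[of "real m * t"]
    by (auto simp: pt_def rnd_def field_simps)
qed

lemma pt_close: "0 < m \<Longrightarrow> \<bar>pt m t - t\<bar> \<le> 1 / real m"
proof -
  assume m: "0 < m"
  have "\<bar>real_of_int (rnd m t) - real m * t\<bar> \<le> 1"
    unfolding rnd_def by (auto simp: abs_le_iff; linarith)
  then have "\<bar>real_of_int (rnd m t) - real m * t\<bar> / real m \<le> 1 / real m"
    by (intro divide_right_mono) auto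
  moreover have "pt m t - t = (real_of_int (rnd m t) - real m * t) / real m"
    using m by (simp add: pt_def field_simps)
  ultimately show ?thesis by simp
qed

lemma pt_tendsto: "(\<lambda>m. pt m t) \<longlonglongrightarrow> t"
proof -
  have "(\<lambda>m. pt m t - t) \<longlonglongrightarrow> 0"
  proof (rule Lim_null_comparison)
    show "\<forall>\<^sub>F m in sequentially. norm (pt m t - t) \<le> 1 / real m"
      using eventually_gt_at_top[of 0] by eventually_elim (simp add: pt_close)
  qed (rule lim_const_over_n)
  then show ?thesis by (simp add: LIM_zero_iff)
qed

definition samp :: "nat \<Rightarrow> (real \<Rightarrow> real) \<Rightarrow> real \<Rightarrow> real" where
  "samp m v t = (if \<bar>t\<bar> \<le> real m then v (pt m t) else 0)"

text \<open>The nodes of mesh \<open>1 / m\<close> in \<open>[- m, m]\<close>; their indices are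
  moved by \<open>m * m\<close> to start at \<open>0\<close>.\<close>

definition cells :: "nat \<Rightarrow> nat" where
  "cells m = 2 * m * m + 1"

definition node :: "nat \<Rightarrow> nat \<Rightarrow> real" where
  "node m i = real_of_int (int i - int (m * m)) / real m"

definition cell :: "nat \<Rightarrow> nat \<Rightarrow> real \<Rightarrow> real" where
  "cell m i t = (if \<bar>t\<bar> \<le> real m \<and> rnd m t = int i - int (m * m) then 1 else 0)"

lemma cell_measurable[measurable]: "cell m i \<in> borel_measurable borel"
  unfolding cell_def[abs_def] rnd_def by measurable

lemma integrable_cell[simp]: "integrable lborel (cell m i)"
proof (rule Bochner_Integration.integrable_bound)
  show "integrable lborel (indicator {- real m..real m} :: real \<Rightarrow> real)"
    by simp
  show "AE t in lborel. norm (cell m i t) \<le> norm (indicator {- real m..real m} t :: real)"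
    by (auto simp: cell_def indicator_def abs_le_iff minus_le_iff)
qed simp

lemma samp_eq_sum: "samp m v t = (\<Sum>i<cells m. v (node m i) * cell m i t)"
proof (cases "\<bar>t\<bar> \<le> real m")
  case True
  have "\<bar>rnd m t\<bar> \<le> int (m * m)"
  proof -
    have "\<bar>real m * t\<bar> \<le> real m * real m"
      using True by (simp add: abs_mult mult_left_mono)
    then have "real m * t \<le> real_of_int (int (m * m))" "real_of_int (- int (m * m)) \<le> real m * t"
      by (auto simp: abs_le_iff)
    then have "\<lceil>real m * t\<rceil> \<le> int (m * m)" "- int (m * m) \<le> \<lfloor>real m * t\<rfloor>"
      by (simp_all only: ceiling_le_iff le_floor_iff)
    moreover have "rnd m t = \<lceil>real m * t\<rceil> \<or> rnd m t = \<lfloor>real m * t\<rfloor>"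
      by (simp add: rnd_def)
    ultimately show ?thesis
      using floor_le_ceiling[of "real m * t"] by linarith
  qed
  then obtain i where i: "i < cells m" "rnd m t = int i - int (m * m)"
    by (intro that[of "nat (rnd m t + int (m * m))"]) (auto simp: cells_def nat_less_iff abs_le_iff)
  have "(\<Sum>j<cells m. v (node m j) * cell m j t) = (\<Sum>j<cells m. if j = i then v (node m i) else 0)"
    using True i by (intro sum.cong) (auto simp: cell_def)
  also have "\<dots> = v (node m i)"
    using i by simp
  finally show ?thesis
    using True i by (simp add: samp_def pt_def node_def)
qed (simp add: samp_def cell_def)

definition step :: "nat \<Rightarrow> nat \<Rightarrow> L1" where
  "step m i = abs_L1 (cell m i)"

lemma integrable_samp: "integrable lborel (samp m v)"
  unfolding samp_eq_sum[abs_def] by simp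

lemma abs_L1_samp: "abs_L1 (samp m v) = (\<Sum>i<cells m. v (node m i) *\<^sub>R step m i)"
  unfolding samp_eq_sum[abs_def] step_def
  by (subst abs_L1_sum[symmetric]) (auto simp: abs_L1_scaleR)

lemma node_rational: "node m i \<in> \<rat>"
  unfolding node_def by (intro Rats_divide) auto

text \<open>Tonelli: the mean of the norm is the integral over \<open>t\<close> of the pointwise
  means. The norm is measurable as a parameter integral, without any statement about measurability
  of the random element of \<open>L1\<close>.\<close>

lemma (in prob_space) mean_L1_le:
  fixes f :: "'a \<Rightarrow> real \<Rightarrow> real"
  assumes f: "case_prod f \<in> borel_measurable (M \<Otimes>\<^sub>M lborel)"
    and int: "\<And>\<omega>. integrable lborel (f \<omega>)" "\<And>t. integrable M (\<lambda>\<omega>. f \<omega> t)"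
    and a: "integrable lborel a" and le: "\<And>t. expectation (\<lambda>\<omega>. \<bar>f \<omega> t\<bar>) \<le> a t"
  shows "integrable M (\<lambda>\<omega>. norm (abs_L1 (f \<omega>)))"
    and "expectation (\<lambda>\<omega>. norm (abs_L1 (f \<omega>))) \<le> (\<integral>t. a t \<partial>lborel)"
proof -
  interpret L: pair_sigma_finite M lborel ..
  have a0: "0 \<le> a t" for t
    by (rule order_trans[OF _ le[of t]]) simp
  have m: "(\<lambda>(\<omega>, t). ennreal \<bar>f \<omega> t\<bar>) \<in> borel_measurable (M \<Otimes>\<^sub>M lborel)"
    using f by (simp add: case_prod_beta')
  have n: "(\<integral>\<^sup>+t. ennreal \<bar>f \<omega> t\<bar> \<partial>lborel) = ennreal (norm (abs_L1 (f \<omega>)))" for \<omega>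
    using int(1)[of \<omega>] by (subst nn_integral_eq_integral) (auto simp: norm_abs_L1)
  have "(\<integral>\<^sup>+\<omega>. ennreal (norm (abs_L1 (f \<omega>))) \<partial>M) = (\<integral>\<^sup>+\<omega>. (\<integral>\<^sup>+t. ennreal \<bar>f \<omega> t\<bar> \<partial>lborel) \<partial>M)"
    by (simp only: n)
  also have "\<dots> = (\<integral>\<^sup>+t. (\<integral>\<^sup>+\<omega>. ennreal \<bar>f \<omega> t\<bar> \<partial>M) \<partial>lborel)"
    by (rule L.Fubini'[OF m, symmetric])
  also have "\<dots> \<le> (\<integral>\<^sup>+t. ennreal (a t) \<partial>lborel)"
  proof (rule nn_integral_mono)
    fix t
    have "(\<integral>\<^sup>+\<omega>. ennreal \<bar>f \<omega> t\<bar> \<partial>M) = ennreal (expectation (\<lambda>\<omega>. \<bar>f \<omega> t\<bar>))"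
      using int(2)[of t] by (intro nn_integral_eq_integral) auto
    then show "(\<integral>\<^sup>+\<omega>. ennreal \<bar>f \<omega> t\<bar> \<partial>M) \<le> ennreal (a t)"
      using le[of t] by (simp add: ennreal_leI)
  qed
  also have "\<dots> = ennreal (\<integral>t. a t \<partial>lborel)"
    using a a0 by (intro nn_integral_eq_integral) auto
  finally have nn: "(\<integral>\<^sup>+\<omega>. ennreal (norm (abs_L1 (f \<omega>))) \<partial>M) \<le> ennreal (\<integral>t. a t \<partial>lborel)" .
  have meas: "(\<lambda>\<omega>. norm (abs_L1 (f \<omega>))) \<in> borel_measurable M"
  proof -
    have "(\<lambda>\<omega>. \<integral>t. \<bar>f \<omega> t\<bar> \<partial>lborel) \<in> borel_measurable M"
      using f by (intro lborel.borel_measurable_lebesgue_integral) (simp add: case_prod_beta')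
    then show ?thesis
      using int(1) by (simp add: norm_abs_L1)
  qed
  show i: "integrable M (\<lambda>\<omega>. norm (abs_L1 (f \<omega>)))"
    using meas nn by (intro integrableI_nonneg) (auto simp: le_less_trans)
  have "ennreal (expectation (\<lambda>\<omega>. norm (abs_L1 (f \<omega>)))) \<le> ennreal (\<integral>t. a t \<partial>lborel)"
    using nn i by (subst nn_integral_eq_integral[symmetric]) auto
  then show "expectation (\<lambda>\<omega>. norm (abs_L1 (f \<omega>))) \<le> (\<integral>t. a t \<partial>lborel)"
    using a0 by (simp add: ennreal_le_iff)
qed

section \<open>Uniform sampling error of the empirical process\<close>

context quantile_sequence
begin

lemma F_marg_measurable[measurable]: "F_marg M Y \<in> borel_measurable borel"
  by (rule borel_measurable_mono) (auto intro: monoI F_marg_mono)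

lemma AE_F_marg_continuous: "AE t in lborel. isCont (F_marg M Y) t"
proof -
  have "countable {t. \<not> isCont (F_marg M Y) t}"
    by (rule mono_ctble_discont) (auto intro: monoI F_marg_mono)
  then have "{t. \<not> isCont (F_marg M Y) t} \<in> null_sets lborel"
    by (rule countable_imp_null_set_lborel)
  then show ?thesis
    by (rule AE_I') auto
qed

text \<open>The factor \<open>3\<close> serves two processes at once: increments of the empirical
  process need \<open>2\<close>, those of the Gaussian family \<open>3\<close>.\<close>

definition err :: "nat \<Rightarrow> real \<Rightarrow> real" where
  "err m t = 3 * (if \<bar>t\<bar> \<le> real m then sqrt (\<Gamma> \<bar>F_marg M Y t - F_marg M Y (pt m t)\<bar>) else \<kappa> t)"

lemma err_nonneg: "0 \<le> err m t"
  by (simp add: err_def \<kappa>_nonneg \<Gamma>_nonneg)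

lemma F_marg_pt_le: "\<bar>t\<bar> \<le> real m \<Longrightarrow> \<bar>F_marg M Y t - F_marg M Y (pt m t)\<bar> \<le> H t"
  by (rule F_marg_diff_le_H[OF pt_outward])

lemma err_le: "err m t \<le> 3 * \<kappa> t"
  unfolding err_def using F_marg_pt_le[of t m] by (auto simp: \<kappa>_def intro!: \<Gamma>_mono)

lemma \<Gamma>_pt_measurable[measurable]: "(\<lambda>t. \<Gamma> \<bar>F_marg M Y t - F_marg M Y (pt m t)\<bar>) \<in> borel_measurable borel"
  by (rule \<Gamma>_comp_measurable) auto

lemma err_measurable[measurable]: "err m \<in> borel_measurable borel"
  unfolding err_def[abs_def] by measurable

lemma integrable_err: "integrable lborel (err m)"
proof (rule Bochner_Integration.integrable_bound[OF integrable_mult_right[OF integrable_\<kappa>, of 3]])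
  show "AE t in lborel. norm (err m t) \<le> norm (3 * \<kappa> t)"
    using err_le[of m] err_nonneg[of m] by (auto simp: \<kappa>_nonneg)
qed simp

definition \<delta> :: "nat \<Rightarrow> real" where
  "\<delta> m = (\<integral>t. err m t \<partial>lborel)"

text \<open>The monotone function \<open>F_marg\<close> has countably many discontinuities, so
  almost every \<open>t\<close> is a continuity point and eventually inside the window. The majorant
  \<open>3 * \<kappa> t\<close> is due to outward rounding.\<close>

lemma \<delta>_tendsto: "\<delta> \<longlonglongrightarrow> 0"
proof -
  have "(\<lambda>m. \<integral>t. err m t \<partial>lborel) \<longlonglongrightarrow> integral\<^sup>L lborel (\<lambda>t::real. 0)"
  proof (rule integral_dominated_convergence[where w = "\<lambda>t. 3 * \<kappa> t"])
    show "AE t in lborel. (\<lambda>m. err m t) \<longlonglongrightarrow> 0"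
      using AE_F_marg_continuous
    proof eventually_elim
      case (elim t)
      have "(\<lambda>m. F_marg M Y (pt m t)) \<longlonglongrightarrow> F_marg M Y t"
        by (rule isCont_tendsto_compose[OF elim pt_tendsto])
      then have "(\<lambda>m. \<bar>F_marg M Y t - F_marg M Y (pt m t)\<bar>) \<longlonglongrightarrow> \<bar>F_marg M Y t - F_marg M Y t\<bar>"
        by (intro tendsto_intros)
      then have "(\<lambda>m. \<Gamma> \<bar>F_marg M Y t - F_marg M Y (pt m t)\<bar>) \<longlonglongrightarrow> 0"
        by (intro \<Gamma>_tendsto_0) auto
      from tendsto_mult[OF tendsto_const[of 3] tendsto_real_sqrt[OF this]]
      have lim: "(\<lambda>m. 3 * sqrt (\<Gamma> \<bar>F_marg M Y t - F_marg M Y (pt m t)\<bar>)) \<longlonglongrightarrow> 0"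
        by simp
      have "\<forall>\<^sub>F m in sequentially. \<bar>t\<bar> \<le> real m"
        using filterlim_real_sequentially by (simp add: filterlim_at_top)
      then have "\<forall>\<^sub>F m in sequentially. 3 * sqrt (\<Gamma> \<bar>F_marg M Y t - F_marg M Y (pt m t)\<bar>) = err m t"
        by eventually_elim (simp add: err_def)
      from Lim_transform_eventually[OF lim this] show ?case .
    qed
    show "AE t in lborel. norm (err m t) \<le> 3 * \<kappa> t" for m
      using err_le[of m] err_nonneg[of m] by auto
  qed (use integrable_\<kappa> in auto)
  then show ?thesis
    by (simp add: \<delta>_def[abs_def])
qed

lemma X_joint_measurable[measurable]: "(\<lambda>(y, t). X t y) \<in> borel_measurable (path_space \<Otimes>\<^sub>M borel)"
proof -
  have "(\<lambda>(y, t). X t y) = (\<lambda>p. (if fst p 0 \<le> snd p then 1 else 0) - F_marg M Y (snd p))"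
    by (auto simp: X_def indicator_def fun_eq_iff)
  also have "\<dots> \<in> borel_measurable (path_space \<Otimes>\<^sub>M borel)"
    by measurable
  finally show ?thesis .
qed

lemma emp_joint_measurable: "(\<lambda>(y, t). emp n y t) \<in> borel_measurable (path_space \<Otimes>\<^sub>M borel)"
proof -
  have 1: "(\<lambda>(y, t). X t ((sh ^^ j) y)) \<in> borel_measurable (path_space \<Otimes>\<^sub>M borel)" for j
  proof -
    have "(\<lambda>p. ((sh ^^ j) (fst p), snd p)) \<in> measurable (path_space \<Otimes>\<^sub>M borel) (path_space \<Otimes>\<^sub>M borel)"
      by measurable
    from measurable_compose[OF this X_joint_measurable] show ?thesis
      by (simp add: case_prod_beta')
  qed
  have "(\<lambda>(y, t). emp n y t) = (\<lambda>p. (\<Sum>j<n. (\<lambda>(y, t). X t ((sh ^^ j) y)) p) / sqrt (real n))"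
    by (auto simp: emp_def P.bsum_def fun_eq_iff)
  also have "\<dots> \<in> borel_measurable (path_space \<Otimes>\<^sub>M borel)"
    using 1 by (intro borel_measurable_divide borel_measurable_sum) auto
  finally show ?thesis .
qed

lemma integrable_X_t: "integrable lborel (\<lambda>t. X t y)"
proof (rule Bochner_Integration.integrable_bound)
  show "integrable lborel (\<lambda>t. H t + indicator {- \<bar>y 0\<bar>..\<bar>y 0\<bar>} t)"
    using integrable_H by simp
  show "AE t in lborel. norm (X t y) \<le> norm (H t + indicator {- \<bar>y 0\<bar>..\<bar>y 0\<bar>} t)"
  proof (rule AE_I2)
    fix t
    consider "\<bar>t\<bar> \<le> \<bar>y 0\<bar>" | "\<bar>y 0\<bar> < t" | "t < - \<bar>y 0\<bar>" by linarith
    then show "norm (X t y) \<le> norm (H t + indicator {- \<bar>y 0\<bar>..\<bar>y 0\<bar>} t)"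
    proof cases
      case 1
      then show ?thesis
        using X_bound[of t y] H_nonneg[of t] by (auto simp: indicator_def abs_le_iff)
    next
      case 2
      then have "X t y = 1 - F_marg M Y t" by (simp add: X_def indicator_def)
      then show ?thesis
        using F_marg_upper_tail[of t] F_marg_01[of t] 2 H_nonneg[of t] by (auto simp: indicator_def)
    next
      case 3
      then have "X t y = - F_marg M Y t" by (simp add: X_def indicator_def)
      then show ?thesis
        using F_marg_lower_tail[of t] F_marg_01[of t] 3 H_nonneg[of t] by (auto simp: indicator_def)
    qed
  qed
next
  have "(\<lambda>t. X t y) = (\<lambda>t. (if y 0 \<le> t then 1 else 0) - F_marg M Y t)"
    by (auto simp: X_def indicator_def)
  then show "(\<lambda>t. X t y) \<in> borel_measurable lborel"
    by simp
qed

lemma integrable_emp: "integrable lborel (emp n y)"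
  unfolding emp_def[abs_def] P.bsum_def using integrable_X_t by simp

lemma integrable_PP_emp: "integrable PP (\<lambda>y. emp n y t)"
proof (rule integrable_PP_bounded[where b = "real n * 1 / sqrt (real n)"])
  show "(\<lambda>y. emp n y t) \<in> borel_measurable path_space"
    unfolding emp_def by measurable
  show "\<bar>emp n y t\<bar> \<le> real n * 1 / sqrt (real n)" for y
    unfolding emp_def using P.bsum_bound[OF X_bound] by (simp add: abs_div divide_right_mono)
qed

lemma samp_joint_measurable:
  assumes "\<And>x. v x \<in> borel_measurable N"
  shows "(\<lambda>(\<omega>, t). samp m (\<lambda>x. v x \<omega>) t) \<in> borel_measurable (N \<Otimes>\<^sub>M lborel)"
proof -
  note [measurable] = assms
  show ?thesis
    unfolding samp_eq_sum by measurable
qed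

text \<open>The bound is free of \<open>n\<close>; this uniformity plays the part of tightness in
  the final argument.\<close>

lemma emp_samp:
  "integrable PP (\<lambda>y. norm (abs_L1 (emp n y) - abs_L1 (samp m (emp n y))))"
  "(\<integral>y. norm (abs_L1 (emp n y) - abs_L1 (samp m (emp n y))) \<partial>PP) \<le> \<delta> m"
proof -
  let ?f = "\<lambda>y t. emp n y t - samp m (emp n y) t"
  have eq: "abs_L1 (emp n y) - abs_L1 (samp m (emp n y)) = abs_L1 (?f y)" for y
    by (rule abs_L1_diff[OF integrable_emp integrable_samp])
  have em: "(\<lambda>y. emp n y x) \<in> borel_measurable PP" for x
    using integrable_PP_emp[of n x] by auto
  have m1: "(\<lambda>(y, t). emp n y t) \<in> borel_measurable (PP \<Otimes>\<^sub>M lborel)"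
    using emp_joint_measurable[of n] by (simp cong: measurable_cong_sets)
  have m: "case_prod ?f \<in> borel_measurable (PP \<Otimes>\<^sub>M lborel)"
    using borel_measurable_diff[OF m1 samp_joint_measurable[of "\<lambda>x y. emp n y x", OF em]]
    by (simp add: case_prod_beta')
  have i1: "integrable lborel (?f y)" for y
    using integrable_emp integrable_samp by (rule Bochner_Integration.integrable_diff)
  have i2: "integrable PP (\<lambda>y. ?f y t)" for t
    using integrable_PP_emp by (cases "\<bar>t\<bar> \<le> real m") (auto simp: samp_def)
  have le: "(\<integral>y. \<bar>?f y t\<bar> \<partial>PP) \<le> err m t" for t
  proof (cases "\<bar>t\<bar> \<le> real m")
    case True
    have "0 \<le> sqrt (\<Gamma> \<bar>F_marg M Y t - F_marg M Y (pt m t)\<bar>)"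
      by (simp add: \<Gamma>_nonneg)
    with emp_diff_abs_le[of n t "pt m t"] show ?thesis
      unfolding samp_def err_def if_P[OF True] by linarith
  next
    case False
    have "(\<integral>y. \<bar>emp n y t - 0\<bar> \<partial>PP) \<le> 2 * \<kappa> t"
      using emp_abs_le[of n t] by (simp add: \<kappa>_def)
    with \<kappa>_nonneg[of t] show ?thesis
      unfolding samp_def err_def if_not_P[OF False] by linarith
  qed
  show "integrable PP (\<lambda>y. norm (abs_L1 (emp n y) - abs_L1 (samp m (emp n y))))"
    unfolding eq by (rule P.mean_L1_le(1)[OF m i1 i2 integrable_err le])
  show "(\<integral>y. norm (abs_L1 (emp n y) - abs_L1 (samp m (emp n y))) \<partial>PP) \<le> \<delta> m"
    unfolding eq \<delta>_def by (rule P.mean_L1_le(2)[OF m i1 i2 integrable_err le])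
qed

end

section \<open>Centered normal variables and the Gaussian limit\<close>

abbreviation mean_abs_normal :: real where
  "mean_abs_normal \<equiv> sqrt (2 / pi)"

lemma mean_abs_normal: "0 < mean_abs_normal" "mean_abs_normal \<le> 1"
  using pi_ge_two by simp_all

lemma std_normal_integrals:
  "integrable std_normal_distribution (\<lambda>z. \<bar>z\<bar>)" "(\<integral>z. \<bar>z\<bar> \<partial>std_normal_distribution) = mean_abs_normal"
  "integrable std_normal_distribution (\<lambda>z. z\<^sup>2)" "(\<integral>z. z\<^sup>2 \<partial>std_normal_distribution) = 1"
  using integrable_abs[OF integrable_std_normal_distribution_moment[of 1]] std_normal_distribution_odd_moments_abs[of 0]
    integrable_std_normal_distribution_moment[of 2] std_normal_distribution_even_moments(1)[of 1]
  by simp_all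

text \<open>Unlike in \<open>centered_gaussian\<close>, the scale is required to be nonnegative, so
  it is determined by the law as the standard deviation and limits of scales can be
  identified.\<close>

definition normal0 :: "'a measure \<Rightarrow> ('a \<Rightarrow> real) \<Rightarrow> real \<Rightarrow> bool" where
  "normal0 P W s \<longleftrightarrow> W \<in> borel_measurable P \<and> 0 \<le> s \<and>
    distr P borel W = distr std_normal_distribution borel (\<lambda>z. s * z)"

lemma normal0_measurable: "normal0 P W s \<Longrightarrow> W \<in> borel_measurable P"
  by (simp add: normal0_def)

lemma char_scaled_normal: "char (distr std_normal_distribution borel (\<lambda>z. s * z)) u = exp (- (u\<^sup>2 * s\<^sup>2 / 2))"
proof -
  have "char (distr std_normal_distribution borel (\<lambda>z. s * z)) u = char std_normal_distribution (u * s)"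
    unfolding char_def by (subst integral_distr) (auto simp: mult.assoc)
  then show ?thesis
    by (simp add: char_std_normal_distribution power_mult_distrib)
qed

lemma real_distribution_scaled_normal: "real_distribution (distr std_normal_distribution borel (\<lambda>z. s * z))"
proof -
  interpret prob_space std_normal_distribution
    by (rule prob_space_normal_density) simp
  show ?thesis
    by (rule real_distribution_distr) simp
qed

lemma (in prob_space) normal0_charI:
  assumes W[measurable]: "W \<in> borel_measurable M" and s: "0 \<le> s"
    and char: "\<And>u. expectation (\<lambda>x. iexp (u * W x)) = exp (- (u\<^sup>2 * s\<^sup>2 / 2))"
  shows "normal0 M W s"
  unfolding normal0_def
proof (intro conjI W s Levy_uniqueness real_distribution_scaled_normal)
  show "real_distribution (distr M borel W)"
    by (rule real_distribution_distr) simp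
  show "char (distr M borel W) = char (distr std_normal_distribution borel (\<lambda>z. s * z))"
    unfolding char_scaled_normal[abs_def] fun_eq_iff
    unfolding char_def by (subst integral_distr) (auto simp: char[symmetric])
qed

lemma normal0_transfer:
  fixes g :: "real \<Rightarrow> 'b::{banach, second_countable_topology}"
  assumes W: "normal0 P W s" and [measurable]: "g \<in> borel_measurable borel"
  shows "(\<integral>x. g (W x) \<partial>P) = (\<integral>z. g (s * z) \<partial>std_normal_distribution)"
    and "integrable P (\<lambda>x. g (W x)) \<longleftrightarrow> integrable std_normal_distribution (\<lambda>z. g (s * z))"
proof -
  note [measurable] = normal0_measurable[OF W]
  have eq: "distr P borel W = distr std_normal_distribution borel (\<lambda>z. s * z)"
    using W by (simp add: normal0_def)
  have "(\<integral>x. g (W x) \<partial>P) = (\<integral>y. g y \<partial>distr P borel W)"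
    by (rule integral_distr[symmetric]) measurable
  also have "\<dots> = (\<integral>z. g (s * z) \<partial>std_normal_distribution)"
    unfolding eq by (rule integral_distr) measurable
  finally show "(\<integral>x. g (W x) \<partial>P) = (\<integral>z. g (s * z) \<partial>std_normal_distribution)" .
  have "integrable P (\<lambda>x. g (W x)) \<longleftrightarrow> integrable (distr P borel W) g"
    by (rule integrable_distr_eq[symmetric]) measurable
  also have "\<dots> \<longleftrightarrow> integrable std_normal_distribution (\<lambda>z. g (s * z))"
    unfolding eq by (rule integrable_distr_eq) measurable
  finally show "integrable P (\<lambda>x. g (W x)) \<longleftrightarrow> integrable std_normal_distribution (\<lambda>z. g (s * z))" .
qed

lemma normal0_abs:
  assumes W: "normal0 P W s"
  shows "integrable P W" "(\<integral>x. \<bar>W x\<bar> \<partial>P) = s * mean_abs_normal"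
proof -
  have s: "0 \<le> s" using W by (simp add: normal0_def)
  have "integrable std_normal_distribution (\<lambda>z. s * z)"
    using integrable_std_normal_distribution_moment[of 1] by simp
  then show "integrable P W"
    using normal0_transfer(2)[OF W, of "\<lambda>x. x"] by simp
  show "(\<integral>x. \<bar>W x\<bar> \<partial>P) = s * mean_abs_normal"
    using normal0_transfer(1)[OF W, of abs] s std_normal_integrals(2) by (simp add: abs_mult)
qed

lemma normal0_square:
  assumes W: "normal0 P W s"
  shows "integrable P (\<lambda>x. (W x)\<^sup>2)" "(\<integral>x. (W x)\<^sup>2 \<partial>P) = s\<^sup>2"
  using normal0_transfer[OF W, of "\<lambda>x. x\<^sup>2"] std_normal_integrals(3,4) by (simp_all add: power_mult_distrib)

text \<open>For centered Gaussian variables, the first absolute moment determines the variance, so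
  convergence in mean forces the variances to converge.\<close>

lemma (in prob_space) normal0_limit:
  assumes W: "\<And>k. normal0 M (W k) (s k)" and Z[measurable]: "Z \<in> borel_measurable M"
    and T: "\<And>k. integrable M (T k)" "\<And>k. AE x in M. \<bar>Z x - W k x\<bar> \<le> T k x" "(\<lambda>k. expectation (T k)) \<longlonglongrightarrow> 0"
  shows "\<exists>\<sigma>. s \<longlonglongrightarrow> \<sigma> \<and> normal0 M Z \<sigma>"
proof -
  note [measurable] = normal0_measurable[OF W]
  have iZ: "integrable M (\<lambda>x. Z x - W k x)" for k
  proof (rule Bochner_Integration.integrable_bound[OF T(1)[of k]])
    show "AE x in M. norm (Z x - W k x) \<le> norm (T k x)"
      using T(2)[of k] by eventually_elim auto
  qed measurable
  have "integrable M (\<lambda>x. (Z x - W 0 x) + W 0 x)"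
    by (intro Bochner_Integration.integrable_add iZ normal0_abs(1)[OF W])
  then have Zi: "integrable M Z" by simp
  have close: "expectation (\<lambda>x. \<bar>Z x - W k x\<bar>) \<le> expectation (T k)" for k
    using iZ[of k] T(1)[of k] T(2)[of k] by (intro integral_mono_AE) auto
  have close0: "(\<lambda>k. expectation (\<lambda>x. \<bar>Z x - W k x\<bar>)) \<longlonglongrightarrow> 0"
    by (rule tendsto_sandwich[OF _ _ tendsto_const T(3)]) (auto simp: close)
  define m where "m = expectation (\<lambda>x. \<bar>Z x\<bar>)"
  have "\<bar>s k * mean_abs_normal - m\<bar> \<le> expectation (\<lambda>x. \<bar>Z x - W k x\<bar>)" for k
  proof -
    have "s k * mean_abs_normal - m = expectation (\<lambda>x. \<bar>W k x\<bar> - \<bar>Z x\<bar>)"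
      unfolding m_def normal0_abs(2)[OF W, symmetric]
      using Zi normal0_abs(1)[OF W] by simp
    also have "\<bar>\<dots>\<bar> \<le> expectation (\<lambda>x. \<bar>\<bar>W k x\<bar> - \<bar>Z x\<bar>\<bar>)"
      by (rule integral_abs_bound)
    also have "\<dots> \<le> expectation (\<lambda>x. \<bar>Z x - W k x\<bar>)"
      using Zi normal0_abs(1)[OF W] by (intro integral_mono) auto
    finally show ?thesis .
  qed
  then have "(\<lambda>k. s k * mean_abs_normal - m) \<longlonglongrightarrow> 0"
    by (intro Lim_null_comparison[OF _ close0]) auto
  then have "(\<lambda>k. s k * mean_abs_normal) \<longlonglongrightarrow> m"
    by (simp add: LIM_zero_iff)
  from tendsto_divide[OF this tendsto_const[of mean_abs_normal]]
  have s_lim: "s \<longlonglongrightarrow> m / mean_abs_normal"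
    using mean_abs_normal(1) by simp
  define \<sigma> where "\<sigma> = m / mean_abs_normal"
  have "normal0 M Z \<sigma>"
  proof (rule normal0_charI)
    show "0 \<le> \<sigma>"
      unfolding \<sigma>_def m_def by simp
    fix u :: real
    have "expectation (\<lambda>x. iexp (u * W k x)) = exp (- (u\<^sup>2 * (s k)\<^sup>2 / 2))" for k
    proof -
      have "expectation (\<lambda>x. iexp (u * W k x)) = char std_normal_distribution (u * s k)"
        using normal0_transfer(1)[OF W, of "\<lambda>x. iexp (u * x)" k] by (simp add: char_def mult.assoc)
      then show ?thesis
        by (simp add: char_std_normal_distribution power_mult_distrib)
    qed
    moreover have "(\<lambda>k. complex_of_real (exp (- (u\<^sup>2 * (s k)\<^sup>2 / 2)))) \<longlonglongrightarrow> of_real (exp (- (u\<^sup>2 * \<sigma>\<^sup>2 / 2)))"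
      unfolding \<sigma>_def by (intro tendsto_intros s_lim) auto
    ultimately have 1: "(\<lambda>k. expectation (\<lambda>x. iexp (u * W k x))) \<longlonglongrightarrow> of_real (exp (- (u\<^sup>2 * \<sigma>\<^sup>2 / 2)))"
      by simp
    have ii: "integrable M (\<lambda>x. iexp (u * V x))" if [measurable]: "V \<in> borel_measurable M" for V
      by (intro integrable_const_bound[of _ 1]) auto
    have "cmod (expectation (\<lambda>x. iexp (u * W k x)) - expectation (\<lambda>x. iexp (u * Z x)))
      \<le> \<bar>u\<bar> * expectation (\<lambda>x. \<bar>Z x - W k x\<bar>)" for k
    proof -
      have "cmod (expectation (\<lambda>x. iexp (u * W k x)) - expectation (\<lambda>x. iexp (u * Z x)))
        = cmod (expectation (\<lambda>x. iexp (u * W k x) - iexp (u * Z x)))"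
        using ii by simp
      also have "\<dots> \<le> expectation (\<lambda>x. cmod (iexp (u * W k x) - iexp (u * Z x)))"
        by (rule integral_norm_bound)
      also have "\<dots> \<le> expectation (\<lambda>x. \<bar>u\<bar> * \<bar>Z x - W k x\<bar>)"
      proof (rule integral_mono)
        show "integrable M (\<lambda>x. cmod (iexp (u * W k x) - iexp (u * Z x)))"
          by (intro integrable_norm Bochner_Integration.integrable_diff ii) measurable
        show "integrable M (\<lambda>x. \<bar>u\<bar> * \<bar>Z x - W k x\<bar>)"
          using iZ[of k] by simp
        fix x
        have "\<bar>u * W k x - u * Z x\<bar> = \<bar>u\<bar> * \<bar>Z x - W k x\<bar>"
          by (simp add: right_diff_distrib[symmetric] abs_mult abs_minus_commute)
        then show "cmod (iexp (u * W k x) - iexp (u * Z x)) \<le> \<bar>u\<bar> * \<bar>Z x - W k x\<bar>"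
          using cmod_iexp_diff_le[of "u * W k x" "u * Z x"] by simp
      qed
      finally show ?thesis
        by simp
    qed
    then have "(\<lambda>k. expectation (\<lambda>x. iexp (u * W k x)) - expectation (\<lambda>x. iexp (u * Z x))) \<longlonglongrightarrow> 0"
      by (intro Lim_null_comparison[OF _ tendsto_mult_right_zero[OF close0, of "\<bar>u\<bar>"]]) auto
    then have "(\<lambda>k. expectation (\<lambda>x. iexp (u * W k x))) \<longlonglongrightarrow> expectation (\<lambda>x. iexp (u * Z x))"
      by (simp add: LIM_zero_iff)
    with 1 show "expectation (\<lambda>x. iexp (u * Z x)) = of_real (exp (- (u\<^sup>2 * \<sigma>\<^sup>2 / 2)))"
      by (rule LIMSEQ_unique[rotated])
  qed measurable
  with s_lim show ?thesis
    unfolding \<sigma>_def by blast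
qed

section \<open>Gaussian step functions and their limit\<close>

text \<open>The joint law is prescribed at rational times only. These contain all grid nodes, and
  they are countable, so a Gaussian sequence provides them.\<close>

locale gaussian_family = quantile_sequence M Y + N: prob_space \<Omega>
  for M :: "'a measure" and Y :: "int \<Rightarrow> 'a \<Rightarrow> real" and \<Omega> :: "'c measure" +
  fixes V :: "real \<Rightarrow> 'c \<Rightarrow> real"
  assumes V_measurable[measurable]: "\<And>x. V x \<in> borel_measurable \<Omega>"
    and V_char: "\<And>(I :: nat set) c \<tau>. finite I \<Longrightarrow> (\<And>p. p \<in> I \<Longrightarrow> \<tau> p \<in> \<rat>) \<Longrightarrow>
      (\<integral>\<omega>. iexp (\<Sum>p\<in>I. c p * V (\<tau> p) \<omega>) \<partial>\<Omega>)
        = exp (- ((\<Sum>p\<in>I. \<Sum>q\<in>I. c p * c q * C_kernel M Y (\<tau> p) (\<tau> q)) / 2))"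
begin

abbreviation quad :: "nat set \<Rightarrow> (nat \<Rightarrow> real) \<Rightarrow> (nat \<Rightarrow> real) \<Rightarrow> real" where
  "quad I c \<tau> \<equiv> (\<Sum>p\<in>I. \<Sum>q\<in>I. c p * c q * C_kernel M Y (\<tau> p) (\<tau> q))"

lemma normal0_V:
  assumes I: "finite I" and \<tau>: "\<And>p. p \<in> I \<Longrightarrow> \<tau> p \<in> \<rat>"
  shows "normal0 \<Omega> (\<lambda>\<omega>. \<Sum>p\<in>I. c p * V (\<tau> p) \<omega>) (sqrt (quad I c \<tau>))"
proof (rule N.normal0_charI)
  have nn: "0 \<le> quad I c \<tau>" by (rule quadratic_C_kernel_nonneg[OF I])
  then show "0 \<le> sqrt (quad I c \<tau>)" by simp
  fix u :: real
  have "(\<integral>\<omega>. iexp (u * (\<Sum>p\<in>I. c p * V (\<tau> p) \<omega>)) \<partial>\<Omega>) = (\<integral>\<omega>. iexp (\<Sum>p\<in>I. (u * c p) * V (\<tau> p) \<omega>) \<partial>\<Omega>)"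
    by (simp add: sum_distrib_left mult.assoc)
  also have "\<dots> = exp (- ((\<Sum>p\<in>I. \<Sum>q\<in>I. (u * c p) * (u * c q) * C_kernel M Y (\<tau> p) (\<tau> q)) / 2))"
    by (rule V_char[OF I \<tau>])
  also have "(\<Sum>p\<in>I. \<Sum>q\<in>I. (u * c p) * (u * c q) * C_kernel M Y (\<tau> p) (\<tau> q)) = u\<^sup>2 * quad I c \<tau>"
    by (simp add: sum_distrib_left power2_eq_square mult_ac)
  finally show "(\<integral>\<omega>. iexp (u * (\<Sum>p\<in>I. c p * V (\<tau> p) \<omega>)) \<partial>\<Omega>) = exp (- (u\<^sup>2 * (sqrt (quad I c \<tau>))\<^sup>2 / 2))"
    using nn by simp
qed measurable

lemma V_moments:
  assumes x: "x \<in> \<rat>"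
  shows "integrable \<Omega> (V x)" "(\<integral>\<omega>. \<bar>V x \<omega>\<bar> \<partial>\<Omega>) \<le> 2 * sqrt (\<Gamma> (H x))"
proof -
  have n: "normal0 \<Omega> (V x) (sqrt (C_kernel M Y x x))"
    using normal0_V[of "{0}" "\<lambda>_. x" "\<lambda>_. 1"] x by simp
  show "integrable \<Omega> (V x)"
    by (rule normal0_abs(1)[OF n])
  have "C_kernel M Y x x \<le> 4 * \<Gamma> (H x)"
    using C_kernel_le[of x x] by (simp add: abs_le_iff)
  then have "sqrt (C_kernel M Y x x) \<le> sqrt (4 * \<Gamma> (H x))"
    by simp
  also have "\<dots> = 2 * sqrt (\<Gamma> (H x))"
    by (simp add: real_sqrt_mult)
  finally have le: "sqrt (C_kernel M Y x x) \<le> 2 * sqrt (\<Gamma> (H x))" .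
  have "(\<integral>\<omega>. \<bar>V x \<omega>\<bar> \<partial>\<Omega>) = sqrt (C_kernel M Y x x) * mean_abs_normal"
    by (rule normal0_abs(2)[OF n])
  also have "\<dots> \<le> 2 * sqrt (\<Gamma> (H x)) * 1"
    using le mean_abs_normal \<Gamma>_nonneg[OF H_nonneg] by (intro mult_mono) auto
  finally show "(\<integral>\<omega>. \<bar>V x \<omega>\<bar> \<partial>\<Omega>) \<le> 2 * sqrt (\<Gamma> (H x))" by simp
qed

text \<open>The variance of an increment is a sum of two differences of the kernel in one argument,
  at most \<open>8 * \<Gamma> ?d\<close>; rounding up to \<open>9\<close> gives a perfect
  square.\<close>

lemma V_diff_moment:
  assumes x: "x \<in> \<rat>" "x' \<in> \<rat>"
  shows "(\<integral>\<omega>. \<bar>V x \<omega> - V x' \<omega>\<bar> \<partial>\<Omega>) \<le> 3 * sqrt (\<Gamma> \<bar>F_marg M Y x - F_marg M Y x'\<bar>)"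
proof -
  let ?\<tau> = "\<lambda>p :: nat. if p = 0 then x else x'" and ?c = "\<lambda>p :: nat. if p = 0 then 1 else - 1 :: real"
  let ?d = "\<bar>F_marg M Y x - F_marg M Y x'\<bar>"
  have n: "normal0 \<Omega> (\<lambda>\<omega>. V x \<omega> - V x' \<omega>) (sqrt (quad {0, 1} ?c ?\<tau>))"
    using normal0_V[of "{0, 1}" ?\<tau> ?c] x by simp
  have "quad {0, 1} ?c ?\<tau> = (C_kernel M Y x x - C_kernel M Y x' x) + (C_kernel M Y x' x' - C_kernel M Y x x')"
    by simp
  also have "\<dots> \<le> 4 * \<Gamma> ?d + 4 * \<Gamma> ?d"
    using C_kernel_diff_le[of x x x' x] C_kernel_diff_le[of x' x' x x'] \<Gamma>_zero
    by (intro add_mono) (auto simp: abs_le_iff abs_minus_commute)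
  also have "\<dots> \<le> 9 * \<Gamma> ?d"
    using \<Gamma>_nonneg[of ?d] by simp
  finally have "sqrt (quad {0, 1} ?c ?\<tau>) \<le> sqrt (9 * \<Gamma> ?d)"
    by simp
  also have "\<dots> = 3 * sqrt (\<Gamma> ?d)"
    by (simp add: real_sqrt_mult)
  finally have le: "sqrt (quad {0, 1} ?c ?\<tau>) \<le> 3 * sqrt (\<Gamma> ?d)" .
  have "(\<integral>\<omega>. \<bar>V x \<omega> - V x' \<omega>\<bar> \<partial>\<Omega>) = sqrt (quad {0, 1} ?c ?\<tau>) * mean_abs_normal"
    by (rule normal0_abs(2)[OF n])
  also have "\<dots> \<le> 3 * sqrt (\<Gamma> ?d) * 1"
    using le mean_abs_normal \<Gamma>_nonneg[of ?d] by (intro mult_mono) auto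
  finally show ?thesis by simp
qed

definition G :: "nat \<Rightarrow> 'c \<Rightarrow> L1" where
  "G m \<omega> = abs_L1 (samp m (\<lambda>x. V x \<omega>))"

lemma G_eq: "G m \<omega> = (\<Sum>i<cells m. V (node m i) \<omega> *\<^sub>R step m i)"
  unfolding G_def by (rule abs_L1_samp)

lemma G_measurable[measurable]: "G m \<in> borel_measurable \<Omega>"
  unfolding G_eq[abs_def] by (rule borel_measurable_combination) simp

lemma pt_rational: "pt m t \<in> \<rat>"
  unfolding pt_def by (intro Rats_divide) auto

text \<open>Inside both windows the two grid values are compared through
  \<open>F_marg M Y t\<close>, using subadditivity of \<open>\<Gamma>\<close>. If only one window
  contains \<open>t\<close>, the remaining value is bounded by \<open>\<kappa> t\<close>, since its
  node is not closer to \<open>0\<close> than \<open>t\<close>.\<close>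

lemma samp_V_diff:
  "(\<integral>\<omega>. \<bar>samp m (\<lambda>x. V x \<omega>) t - samp m' (\<lambda>x. V x \<omega>) t\<bar> \<partial>\<Omega>) \<le> err m t + err m' t"
proof -
  have one: "(\<integral>\<omega>. \<bar>V (pt m t) \<omega>\<bar> \<partial>\<Omega>) \<le> 2 * \<kappa> t" if t: "\<bar>t\<bar> \<le> real m" for m
  proof -
    have "H (pt m t) \<le> H t"
      using pt_outward[OF t] by (intro H_antimono) auto
    then have "\<Gamma> (H (pt m t)) \<le> \<Gamma> (H t)"
      by (intro \<Gamma>_mono H_nonneg)
    then show ?thesis
      using V_moments(2)[OF pt_rational, of m t] by (simp add: \<kappa>_def) (meson mult_left_mono order_trans real_sqrt_le_mono zero_le_numeral)
  qed
  have k: "2 * \<kappa> t \<le> 3 * \<kappa> t"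
    using \<kappa>_nonneg[of t] by simp
  show ?thesis
  proof (cases "\<bar>t\<bar> \<le> real m"; cases "\<bar>t\<bar> \<le> real m'")
    assume t: "\<bar>t\<bar> \<le> real m" "\<bar>t\<bar> \<le> real m'"
    let ?a = "\<bar>F_marg M Y t - F_marg M Y (pt m t)\<bar>" and ?b = "\<bar>F_marg M Y t - F_marg M Y (pt m' t)\<bar>"
    have "\<Gamma> \<bar>F_marg M Y (pt m t) - F_marg M Y (pt m' t)\<bar> \<le> \<Gamma> (?a + ?b)"
      by (rule \<Gamma>_mono) auto
    also have "\<dots> \<le> \<Gamma> ?a + \<Gamma> ?b"
      by (rule \<Gamma>_subadd) auto
    finally have "sqrt (\<Gamma> \<bar>F_marg M Y (pt m t) - F_marg M Y (pt m' t)\<bar>) \<le> sqrt (\<Gamma> ?a + \<Gamma> ?b)"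
      by simp
    also have "\<dots> \<le> sqrt (\<Gamma> ?a) + sqrt (\<Gamma> ?b)"
      by (intro sqrt_add_le_add_sqrt \<Gamma>_nonneg) auto
    finally show ?thesis
      using V_diff_moment[OF pt_rational pt_rational, of m t m' t] t by (simp add: samp_def err_def)
  next
    assume t: "\<bar>t\<bar> \<le> real m" "\<not> \<bar>t\<bar> \<le> real m'"
    have "err m' t = 3 * \<kappa> t"
      unfolding err_def if_not_P[OF t(2)] ..
    moreover have "(\<integral>\<omega>. \<bar>samp m (\<lambda>x. V x \<omega>) t - samp m' (\<lambda>x. V x \<omega>) t\<bar> \<partial>\<Omega>) = (\<integral>\<omega>. \<bar>V (pt m t) \<omega>\<bar> \<partial>\<Omega>)"
      using t by (simp add: samp_def)
    ultimately show ?thesis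
      using one[OF t(1)] k err_nonneg[of m t] by linarith
  next
    assume t: "\<not> \<bar>t\<bar> \<le> real m" "\<bar>t\<bar> \<le> real m'"
    have "err m t = 3 * \<kappa> t"
      unfolding err_def if_not_P[OF t(1)] ..
    moreover have "(\<integral>\<omega>. \<bar>samp m (\<lambda>x. V x \<omega>) t - samp m' (\<lambda>x. V x \<omega>) t\<bar> \<partial>\<Omega>) = (\<integral>\<omega>. \<bar>V (pt m' t) \<omega>\<bar> \<partial>\<Omega>)"
      using t by (simp add: samp_def)
    ultimately show ?thesis
      using one[OF t(2)] k err_nonneg[of m' t] by linarith
  next
    assume t: "\<not> \<bar>t\<bar> \<le> real m" "\<not> \<bar>t\<bar> \<le> real m'"
    then show ?thesis
      using err_nonneg[of m t] err_nonneg[of m' t] by (simp add: samp_def)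
  qed
qed

lemma G_diff:
  "integrable \<Omega> (\<lambda>\<omega>. norm (G m \<omega> - G m' \<omega>))"
  "(\<integral>\<omega>. norm (G m \<omega> - G m' \<omega>) \<partial>\<Omega>) \<le> \<delta> m + \<delta> m'"
proof -
  let ?f = "\<lambda>\<omega> t. samp m (\<lambda>x. V x \<omega>) t - samp m' (\<lambda>x. V x \<omega>) t"
  have eq: "G m \<omega> - G m' \<omega> = abs_L1 (?f \<omega>)" for \<omega>
    unfolding G_def by (rule abs_L1_diff[OF integrable_samp integrable_samp])
  have m: "case_prod ?f \<in> borel_measurable (\<Omega> \<Otimes>\<^sub>M lborel)"
    using borel_measurable_diff[OF samp_joint_measurable[of V, OF V_measurable, of m] samp_joint_measurable[of V, OF V_measurable, of m']]
    by (simp add: case_prod_beta')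
  have i1: "integrable lborel (?f \<omega>)" for \<omega>
    by (intro Bochner_Integration.integrable_diff integrable_samp)
  have i: "integrable \<Omega> (\<lambda>\<omega>. samp m (\<lambda>x. V x \<omega>) t)" for m t
    using V_moments(1)[OF pt_rational, of m t] by (cases "\<bar>t\<bar> \<le> real m") (auto simp: samp_def)
  have i2: "integrable \<Omega> (\<lambda>\<omega>. ?f \<omega> t)" for t
    by (intro Bochner_Integration.integrable_diff i)
  have ie: "integrable lborel (\<lambda>t. err m t + err m' t)"
    by (intro Bochner_Integration.integrable_add integrable_err)
  show "integrable \<Omega> (\<lambda>\<omega>. norm (G m \<omega> - G m' \<omega>))"
    unfolding eq by (rule N.mean_L1_le(1)[OF m i1 i2 ie samp_V_diff])
  have "(\<integral>\<omega>. norm (G m \<omega> - G m' \<omega>) \<partial>\<Omega>) \<le> (\<integral>t. err m t + err m' t \<partial>lborel)"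
    unfolding eq by (rule N.mean_L1_le(2)[OF m i1 i2 ie samp_V_diff])
  then show "(\<integral>\<omega>. norm (G m \<omega> - G m' \<omega>) \<partial>\<Omega>) \<le> \<delta> m + \<delta> m'"
    using integrable_err by (simp add: \<delta>_def)
qed

text \<open>Along a subsequence with errors at most \<open>(1 / 2) ^ k\<close>, the mean step
  lengths are summable. Hence almost every path has summable steps, and completeness of
  \<open>L1\<close> gives a limit.\<close>

lemma G_limit:
  obtains r and Gl :: "'c \<Rightarrow> L1" and T :: "nat \<Rightarrow> 'c \<Rightarrow> real"
  where "filterlim r at_top sequentially" "Gl \<in> borel_measurable \<Omega>"
    "\<And>k. integrable \<Omega> (T k)" "\<And>k. AE \<omega> in \<Omega>. norm (Gl \<omega> - G (r k) \<omega>) \<le> T k \<omega>"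
    "(\<lambda>k. \<integral>\<omega>. T k \<omega> \<partial>\<Omega>) \<longlonglongrightarrow> 0"
proof -
  have ex: "\<exists>m\<ge>k. \<delta> m \<le> (1 / 2) ^ k" for k
  proof -
    have "\<forall>\<^sub>F m in sequentially. \<delta> m < (1 / 2) ^ k"
      using \<delta>_tendsto by (rule order_tendstoD) simp
    then obtain m where "k \<le> m" "\<delta> m < (1 / 2) ^ k"
      using eventually_happens'[OF sequentially_bot eventually_conj[OF _ eventually_ge_at_top[of k]]] by blast
    then show ?thesis by (intro exI[of _ m]) auto
  qed
  define r where "r k = (SOME m. k \<le> m \<and> \<delta> m \<le> (1 / 2) ^ k)" for k
  have r: "k \<le> r k" "\<delta> (r k) \<le> (1 / 2) ^ k" for k
    using someI_ex[OF ex[of k]] unfolding r_def by auto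
  have r_lim: "filterlim r at_top sequentially"
    by (rule filterlim_at_top_mono[OF filterlim_ident]) (auto simp: r)
  define D where "D k \<omega> = norm (G (r (Suc k)) \<omega> - G (r k) \<omega>)" for k \<omega>
  have D_int: "integrable \<Omega> (D k)" for k
    unfolding D_def[abs_def] by (rule G_diff(1))
  have D_meas[measurable]: "D k \<in> borel_measurable \<Omega>" for k
    using D_int[of k] by auto
  have D0: "0 \<le> D k \<omega>" for k \<omega>
    by (simp add: D_def)
  have D_le: "(\<integral>\<omega>. D k \<omega> \<partial>\<Omega>) \<le> 2 * (1 / 2) ^ k" for k
  proof -
    have "(1 / 2 :: real) ^ Suc k \<le> (1 / 2) ^ k" by simp
    then show ?thesis
      using G_diff(2)[of "r (Suc k)" "r k"] r(2)[of k] r(2)[of "Suc k"] unfolding D_def by linarith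
  qed
  have geo: "summable (\<lambda>k. 2 * (1 / 2 :: real) ^ k)"
    by (intro summable_mult summable_geometric) simp
  have sum_int: "summable (\<lambda>k. \<integral>\<omega>. D k \<omega> \<partial>\<Omega>)"
    by (rule summable_comparison_test'[OF geo, of 0]) (use D_le D0 in simp)
  have "(\<integral>\<^sup>+\<omega>. (\<Sum>k. ennreal (D k \<omega>)) \<partial>\<Omega>) = (\<Sum>k. ennreal (\<integral>\<omega>. D k \<omega> \<partial>\<Omega>))"
    by (subst nn_integral_suminf) (auto simp: nn_integral_eq_integral[OF D_int] D0)
  also have "\<dots> = ennreal (\<Sum>k. \<integral>\<omega>. D k \<omega> \<partial>\<Omega>)"
    by (rule suminf_ennreal2[OF _ sum_int]) (simp add: D0)
  also have "\<dots> \<noteq> \<infinity>" by simp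
  finally have fin: "AE \<omega> in \<Omega>. (\<Sum>k. ennreal (D k \<omega>)) \<noteq> \<infinity>"
    by (intro nn_integral_PInf_AE) auto
  define S where "S = {\<omega> \<in> space \<Omega>. (\<Sum>k. ennreal (D k \<omega>)) \<noteq> \<infinity>}"
  have S[measurable]: "S \<in> sets \<Omega>"
    unfolding S_def by measurable
  have S_sum: "summable (\<lambda>k. D k \<omega>)" if "\<omega> \<in> S" for \<omega>
    by (rule summable_suminf_not_top) (use that in \<open>auto simp: S_def D0\<close>)
  have AE_S: "AE \<omega> in \<Omega>. \<omega> \<in> S"
    using fin AE_space by eventually_elim (simp add: S_def)
  \<comment> \<open>Setting the sequence to \<open>0\<close> off \<open>S\<close> makes it converge
    everywhere, so that its limit is measurable.\<close>
  define G' where "G' k \<omega> = (if \<omega> \<in> S then G (r k) \<omega> else 0)" for k \<omega>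
  have conv: "\<exists>l. (\<lambda>k. G (r k) \<omega>) \<longlonglongrightarrow> l" if \<omega>: "\<omega> \<in> S" for \<omega>
  proof -
    obtain l where l: "(\<lambda>n. \<Sum>k<n. G (r (Suc k)) \<omega> - G (r k) \<omega>) \<longlonglongrightarrow> l"
      using L1_summable_norm[of "\<lambda>k. G (r (Suc k)) \<omega> - G (r k) \<omega>"] S_sum[OF \<omega>] by (auto simp: D_def)
    have "(\<lambda>n. (G (r n) \<omega> - G (r 0) \<omega>) + G (r 0) \<omega>) \<longlonglongrightarrow> l + G (r 0) \<omega>"
      using l[unfolded sum_lessThan_telescope[of "\<lambda>k. G (r k) \<omega>"]] by (intro tendsto_add tendsto_const)
    then show ?thesis by auto
  qed
  define Gl where "Gl \<omega> = lim (\<lambda>k. G' k \<omega>)" for \<omega>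
  have G'_lim: "(\<lambda>k. G' k \<omega>) \<longlonglongrightarrow> Gl \<omega>" for \<omega>
    unfolding Gl_def
    by (rule convergent_LIMSEQ_iff[THEN iffD1]) (cases "\<omega> \<in> S", auto simp: G'_def convergent_def conv)
  have G'_meas: "G' k \<in> borel_measurable \<Omega>" for k
    unfolding G'_def[abs_def] by (rule measurable_If_set) auto
  have Gl_meas: "Gl \<in> borel_measurable \<Omega>"
    by (rule borel_measurable_LIMSEQ_metric[OF G'_meas G'_lim])
  \<comment> \<open>The remaining step lengths dominate the distance to the limit almost surely, and
    their mean is the remainder of a convergent series.\<close>
  define T where "T k \<omega> = (\<Sum>j. D (j + k) \<omega>)" for k \<omega>
  have T_AE: "AE \<omega> in \<Omega>. norm (Gl \<omega> - G (r k) \<omega>) \<le> T k \<omega>" for k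
    using AE_S
  proof eventually_elim
    case (elim \<omega>)
    have sk: "summable (\<lambda>j. D (j + k) \<omega>)"
      using S_sum[OF elim] by (rule summable_ignore_initial_segment)
    have part: "norm (G (r (n + k)) \<omega> - G (r k) \<omega>) \<le> T k \<omega>" for n
    proof -
      have "norm (G (r (n + k)) \<omega> - G (r k) \<omega>) \<le> (\<Sum>j<n. D (j + k) \<omega>)"
      proof (induction n)
        case (Suc n)
        have "norm (G (r (Suc n + k)) \<omega> - G (r k) \<omega>)
          \<le> norm (G (r (Suc n + k)) \<omega> - G (r (n + k)) \<omega>) + norm (G (r (n + k)) \<omega> - G (r k) \<omega>)"
          by (metis norm_diff_triangle_le order_refl)
        with Suc show ?case by (simp add: D_def)
      qed simp
      also have "\<dots> \<le> T k \<omega>"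
        unfolding T_def by (rule sum_le_suminf[OF sk]) (auto simp: D0)
      finally show ?thesis .
    qed
    have "(\<lambda>n. G (r n) \<omega>) \<longlonglongrightarrow> Gl \<omega>"
      using G'_lim[of \<omega>] elim by (simp add: G'_def)
    then have "(\<lambda>n. norm (G (r (n + k)) \<omega> - G (r k) \<omega>)) \<longlonglongrightarrow> norm (Gl \<omega> - G (r k) \<omega>)"
      by (intro tendsto_intros LIMSEQ_ignore_initial_segment)
    then show ?case
      by (rule LIMSEQ_le_const2) (use part in blast)
  qed
  have sk: "summable (\<lambda>j. \<integral>\<omega>. D (j + k) \<omega> \<partial>\<Omega>)" for k
    using summable_ignore_initial_segment[OF sum_int] .
  have AE_sum: "AE \<omega> in \<Omega>. summable (\<lambda>j. norm (D (j + k) \<omega>))" for k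
    using AE_S
  proof eventually_elim
    case (elim \<omega>)
    show ?case
      using summable_ignore_initial_segment[OF S_sum[OF elim], of k] by (simp add: D0)
  qed
  have sk': "summable (\<lambda>j. \<integral>\<omega>. norm (D (j + k) \<omega>) \<partial>\<Omega>)" for k
    using sk[of k] by (simp add: D0)
  have T_int: "integrable \<Omega> (T k)" and T_eq: "(\<integral>\<omega>. T k \<omega> \<partial>\<Omega>) = (\<Sum>j. \<integral>\<omega>. D (j + k) \<omega> \<partial>\<Omega>)" for k
    unfolding T_def[abs_def]
    using integrable_suminf[OF D_int AE_sum sk'] integral_suminf[OF D_int AE_sum sk'] by auto
  have T_lim: "(\<lambda>k. \<integral>\<omega>. T k \<omega> \<partial>\<Omega>) \<longlonglongrightarrow> 0"
    unfolding T_eq by (rule suminf_exist_split2[OF sum_int])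
  show thesis
    by (rule that[of r Gl T, OF r_lim Gl_meas T_int T_AE T_lim])
qed

end

section \<open>Covariance of the limit and convergence in law\<close>

lemma lipschitz_mean_diff:
  fixes h :: "L1 \<Rightarrow> real"
  assumes "prob_space Q" and L: "L-lipschitz_on UNIV h" and B: "\<And>x. \<bar>h x\<bar> \<le> B"
    and m: "U \<in> borel_measurable Q" "W \<in> borel_measurable Q"
    and T: "integrable Q T" "AE x in Q. norm (U x - W x) \<le> T x"
  shows "\<bar>(\<integral>x. h (U x) \<partial>Q) - (\<integral>x. h (W x) \<partial>Q)\<bar> \<le> L * (\<integral>x. T x \<partial>Q)"
proof -
  interpret Q: prob_space Q by fact
  have [measurable]: "h \<in> borel_measurable borel"
    by (rule borel_measurable_continuous_onI[OF lipschitz_on_continuous_on[OF L]])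
  note [measurable] = m
  have i: "integrable Q (\<lambda>x. h (U x))" "integrable Q (\<lambda>x. h (W x))"
    using B by (auto intro!: Q.integrable_const_bound[of _ B])
  have "\<bar>(\<integral>x. h (U x) \<partial>Q) - (\<integral>x. h (W x) \<partial>Q)\<bar> = \<bar>\<integral>x. h (U x) - h (W x) \<partial>Q\<bar>"
    using i by simp
  also have "\<dots> \<le> (\<integral>x. \<bar>h (U x) - h (W x)\<bar> \<partial>Q)"
    by (rule integral_abs_bound)
  also have "\<dots> \<le> (\<integral>x. L * T x \<partial>Q)"
  proof (rule integral_mono_AE)
    show "AE x in Q. \<bar>h (U x) - h (W x)\<bar> \<le> L * T x"
      using T(2)
    proof eventually_elim
      case (elim x)
      have "\<bar>h (U x) - h (W x)\<bar> \<le> L * norm (U x - W x)"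
        using lipschitz_onD[OF L, of "U x" "W x"] by (simp add: dist_real_def dist_norm)
      also have "\<dots> \<le> L * T x"
        using elim lipschitz_on_nonneg[OF L] by (rule mult_left_mono)
      finally show ?case .
    qed
  qed (use i T(1) in auto)
  finally show ?thesis by simp
qed

lemma integrable_prod_mult:
  fixes g h :: "real \<Rightarrow> real"
  assumes g: "integrable lborel g" and h: "integrable lborel h"
  shows "integrable (lborel \<Otimes>\<^sub>M lborel) (\<lambda>(s, t). g s * h t)"
    and "(\<integral>(s, t). g s * h t \<partial>(lborel \<Otimes>\<^sub>M lborel)) = (\<integral>s. g s \<partial>lborel) * (\<integral>t. h t \<partial>lborel)"
proof -
  have [measurable]: "g \<in> borel_measurable borel" "h \<in> borel_measurable borel"
    using g h by auto
  show i: "integrable (lborel \<Otimes>\<^sub>M lborel) (\<lambda>(s, t). g s * h t)"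
    using g h by (intro lborel_pair.Fubini_integrable) (auto simp: abs_mult)
  show "(\<integral>(s, t). g s * h t \<partial>(lborel \<Otimes>\<^sub>M lborel)) = (\<integral>s. g s \<partial>lborel) * (\<integral>t. h t \<partial>lborel)"
    using lborel_pair.integral_fst'[OF i] by simp
qed

lemma AE_pair_lborel:
  fixes P Q :: "real \<Rightarrow> bool"
  assumes "AE s in lborel. P s" "AE t in lborel. Q t"
  shows "AE (s, t) in lborel \<Otimes>\<^sub>M lborel. P s \<and> Q t"
proof -
  obtain A where A: "{s \<in> space lborel. \<not> P s} \<subseteq> A" "emeasure lborel A = 0" "A \<in> sets lborel"
    using AE_E[OF assms(1)] by blast
  obtain B where B: "{s \<in> space lborel. \<not> Q s} \<subseteq> B" "emeasure lborel B = 0" "B \<in> sets lborel"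
    using AE_E[OF assms(2)] by blast
  have "A \<times> UNIV \<in> null_sets (lborel \<Otimes>\<^sub>M (lborel :: real measure))"
    using A by (intro lborel.times_in_null_sets1) auto
  moreover have "UNIV \<times> B \<in> null_sets ((lborel :: real measure) \<Otimes>\<^sub>M lborel)"
    using B by (intro lborel.times_in_null_sets2) auto
  ultimately have "A \<times> UNIV \<union> UNIV \<times> B \<in> null_sets (lborel \<Otimes>\<^sub>M lborel)"
    by (rule null_sets.Un)
  then show ?thesis
    by (rule AE_I') (use A(1) B(1) in auto)
qed

section \<open>The covariance form and its grid approximations\<close>

context quantile_sequence
begin

lemma cov_measurable: "(\<lambda>(s, t). cov k s t) \<in> borel_measurable (borel \<Otimes>\<^sub>M borel)"
proof -
  have 1: "(\<lambda>q. X (fst (fst q)) (snd q)) \<in> borel_measurable ((borel \<Otimes>\<^sub>M borel) \<Otimes>\<^sub>M path_space)"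
  proof -
    have "(\<lambda>q. (snd q, fst (fst q))) \<in> measurable ((borel \<Otimes>\<^sub>M borel) \<Otimes>\<^sub>M path_space) (path_space \<Otimes>\<^sub>M borel)"
      by measurable
    from measurable_compose[OF this X_joint_measurable] show ?thesis by simp
  qed
  have 2: "(\<lambda>q. X (snd (fst q)) ((sh ^^ k) (snd q))) \<in> borel_measurable ((borel \<Otimes>\<^sub>M borel) \<Otimes>\<^sub>M path_space)"
  proof -
    have "(\<lambda>q. ((sh ^^ k) (snd q), snd (fst q))) \<in> measurable ((borel \<Otimes>\<^sub>M borel) \<Otimes>\<^sub>M path_space) (path_space \<Otimes>\<^sub>M borel)"
      by measurable
    from measurable_compose[OF this X_joint_measurable] show ?thesis by simp
  qed
  have "(\<lambda>p. \<integral>y. X (fst p) y * X (snd p) ((sh ^^ k) y) \<partial>PP) \<in> borel_measurable (borel \<Otimes>\<^sub>M borel)"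
  proof (rule P.borel_measurable_lebesgue_integral)
    have "(\<lambda>q. X (fst (fst q)) (snd q) * X (snd (fst q)) ((sh ^^ k) (snd q)))
        \<in> borel_measurable ((borel \<Otimes>\<^sub>M borel) \<Otimes>\<^sub>M path_space)"
      using 1 2 by (rule borel_measurable_times)
    then show "(\<lambda>(p, y). X (fst p) y * X (snd p) ((sh ^^ k) y)) \<in> borel_measurable ((borel \<Otimes>\<^sub>M borel) \<Otimes>\<^sub>M PP)"
      by (simp add: case_prod_beta' cong: measurable_cong_sets)
  qed
  then show ?thesis
    by (simp add: cov_def case_prod_beta')
qed

lemma C_kernel_measurable[measurable]: "(\<lambda>p. C_kernel M Y (fst p) (snd p)) \<in> borel_measurable (borel \<Otimes>\<^sub>M borel)"
  unfolding C_kernel_eq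
  using cov_measurable[unfolded case_prod_beta']
  by (intro borel_measurable_add borel_measurable_times borel_measurable_const borel_measurable_suminf) auto

text \<open>A number bounded by \<open>\<Gamma> (H s)\<close> and by \<open>\<Gamma> (H t)\<close>
  is bounded by their geometric mean. This product form is integrable over the plane.\<close>

lemma C_kernel_le_\<kappa>: "\<bar>C_kernel M Y s t\<bar> \<le> 4 * (\<kappa> s * \<kappa> t)"
proof -
  let ?g = "\<Gamma> (min (H s) (H t))"
  have g: "0 \<le> ?g" "?g \<le> \<Gamma> (H s)" "?g \<le> \<Gamma> (H t)"
    by (auto intro!: \<Gamma>_nonneg \<Gamma>_mono simp: H_nonneg)
  then have "sqrt (?g * ?g) \<le> sqrt (\<Gamma> (H s) * \<Gamma> (H t))"
    by (intro real_sqrt_le_mono mult_mono) auto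
  then have "?g \<le> \<kappa> s * \<kappa> t"
    using g(1) by (simp add: \<kappa>_def real_sqrt_mult)
  then show ?thesis
    using C_kernel_le[of s t] by linarith
qed

lemma C_kernel_pt_le_\<kappa>:
  assumes "\<bar>s\<bar> \<le> real m" "\<bar>t\<bar> \<le> real m"
  shows "\<bar>C_kernel M Y (pt m s) (pt m t)\<bar> \<le> 4 * (\<kappa> s * \<kappa> t)"
proof -
  have le: "\<kappa> (pt m t) \<le> \<kappa> t" if "\<bar>t\<bar> \<le> real m" for t
  proof -
    have "H (pt m t) \<le> H t"
      using pt_outward[OF that] by (intro H_antimono) auto
    then show ?thesis
      unfolding \<kappa>_def by (intro real_sqrt_le_mono \<Gamma>_mono H_nonneg)
  qed
  have "\<kappa> (pt m s) * \<kappa> (pt m t) \<le> \<kappa> s * \<kappa> t"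
    using assms by (intro mult_mono le \<kappa>_nonneg)
  then show ?thesis
    using C_kernel_le_\<kappa>[of "pt m s" "pt m t"] by linarith
qed

text \<open>The kernel \<open>c\<close> is general so that one majorant serves both the limit kernel
  and its grid versions.\<close>

lemma Phi_dominated:
  assumes f: "f \<in> Linf" and g: "g \<in> Linf"
    and m[measurable]: "(\<lambda>(s, t). c s t) \<in> borel_measurable (borel \<Otimes>\<^sub>M borel)"
    and c: "\<And>s t. \<bar>c s t\<bar> \<le> 4 * (\<kappa> s * \<kappa> t)"
  obtains w where "integrable (lborel \<Otimes>\<^sub>M lborel) w" "w = (\<lambda>(s, t). \<bar>f s\<bar> * \<kappa> s * (4 * (\<bar>g t\<bar> * \<kappa> t)))"
    "\<And>p. norm ((\<lambda>(s, t). f s * g t * c s t) p) \<le> w p"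
    "integrable (lborel \<Otimes>\<^sub>M lborel) (\<lambda>(s, t). f s * g t * c s t)"
proof -
  define w where "w = (\<lambda>(s, t). \<bar>f s\<bar> * \<kappa> s * (4 * (\<bar>g t\<bar> * \<kappa> t)))"
  have abs: "integrable lborel (\<lambda>t. \<bar>h t\<bar> * \<kappa> t)" if "h \<in> Linf" for h
    using integrable_abs[OF integrable_Linf_mult[OF that integrable_\<kappa>]] by (simp add: abs_mult \<kappa>_nonneg)
  have w: "integrable (lborel \<Otimes>\<^sub>M lborel) w"
    unfolding w_def by (intro integrable_prod_mult(1) abs[OF f] integrable_mult_right abs[OF g])
  have le: "norm ((\<lambda>(s, t). f s * g t * c s t) p) \<le> w p" for p
  proof -
    obtain s t where p: "p = (s, t)" by force
    have "\<bar>f s\<bar> * \<bar>g t\<bar> * \<bar>c s t\<bar> \<le> \<bar>f s\<bar> * \<bar>g t\<bar> * (4 * (\<kappa> s * \<kappa> t))"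
      using c by (intro mult_left_mono) auto
    then show ?thesis
      by (simp add: p w_def abs_mult mult_ac)
  qed
  note [measurable] = Linf_measurable[OF f] Linf_measurable[OF g]
  have "(\<lambda>(s, t). f s * g t * c s t) \<in> borel_measurable (borel \<Otimes>\<^sub>M borel)"
  proof -
    have "(\<lambda>p. f (fst p) * g (snd p) * (\<lambda>(s, t). c s t) p) \<in> borel_measurable (borel \<Otimes>\<^sub>M borel)"
      by measurable
    then show ?thesis by (simp add: case_prod_beta')
  qed
  then have mm: "(\<lambda>(s, t). f s * g t * c s t) \<in> borel_measurable (lborel \<Otimes>\<^sub>M lborel)"
    by (simp cong: measurable_cong_sets)
  have "AE p in lborel \<Otimes>\<^sub>M lborel. norm ((\<lambda>(s, t). f s * g t * c s t) p) \<le> norm (w p)"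
    using order_trans[OF le abs_ge_self] by (intro AE_I2) simp
  then have "integrable (lborel \<Otimes>\<^sub>M lborel) (\<lambda>(s, t). f s * g t * c s t)"
    by (rule Bochner_Integration.integrable_bound[OF w mm])
  with w le show thesis
    by (intro that[of w]) (auto simp: w_def)
qed

lemma integrable_Phi:
  assumes "f \<in> Linf" "g \<in> Linf"
  shows "integrable (lborel \<Otimes>\<^sub>M lborel) (\<lambda>(s, t). f s * g t * C_kernel M Y s t)"
proof -
  have m: "(\<lambda>(s, t). C_kernel M Y s t) \<in> borel_measurable (borel \<Otimes>\<^sub>M borel)"
    using C_kernel_measurable by (simp add: case_prod_beta')
  show ?thesis
    by (rule Phi_dominated[OF assms m C_kernel_le_\<kappa>])
qed

lemma Phi_add_add:
  assumes f: "f \<in> Linf" and g: "g \<in> Linf"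
  shows "Phi M Y (\<lambda>t. f t + g t) (\<lambda>t. f t + g t) = Phi M Y f f + Phi M Y f g + Phi M Y g f + Phi M Y g g"
proof -
  have "(\<lambda>(s, t). (f s + g s) * (f t + g t) * C_kernel M Y s t)
    = (\<lambda>p. (\<lambda>(s, t). f s * f t * C_kernel M Y s t) p + (\<lambda>(s, t). f s * g t * C_kernel M Y s t) p
        + (\<lambda>(s, t). g s * f t * C_kernel M Y s t) p + (\<lambda>(s, t). g s * g t * C_kernel M Y s t) p)"
    by (auto simp: fun_eq_iff algebra_simps)
  then show ?thesis
    unfolding Phi_def
    using integrable_Phi[OF f f] integrable_Phi[OF f g] integrable_Phi[OF g f] integrable_Phi[OF g g]
    by (simp only: Bochner_Integration.integral_add Bochner_Integration.integrable_add)
qed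

lemma Phi_uminus: "Phi M Y (\<lambda>t. - f t) g = - Phi M Y f g" "Phi M Y f (\<lambda>t. - g t) = - Phi M Y f g"
  unfolding Phi_def by (simp_all add: case_prod_beta')

text \<open>The double sum is the integral of \<open>f s * f t\<close> against the kernel sampled in
  both variables, that is, the variance of \<open>pairing f\<close> on a Gaussian step function. The
  sampled kernel converges wherever \<open>F_marg\<close> is continuous at both arguments.\<close>

lemma grid_quad_tendsto:
  assumes f: "f \<in> Linf"
  shows "(\<lambda>m. \<Sum>i<cells m. \<Sum>j<cells m. pairing f (step m i) * pairing f (step m j) * C_kernel M Y (node m i) (node m j))
    \<longlonglongrightarrow> Phi M Y f f"
proof -
  define c where "c m s t = (if \<bar>s\<bar> \<le> real m \<and> \<bar>t\<bar> \<le> real m then C_kernel M Y (pt m s) (pt m t) else 0)" for m s t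
  have c_le: "\<bar>c m s t\<bar> \<le> 4 * (\<kappa> s * \<kappa> t)" for m s t
    unfolding c_def using C_kernel_pt_le_\<kappa>[of s m t] \<kappa>_nonneg by auto
  have c_sum: "c m s t = (\<Sum>i<cells m. \<Sum>j<cells m. C_kernel M Y (node m i) (node m j) * (cell m i s * cell m j t))" for m s t
  proof -
    have "c m s t = samp m (\<lambda>x. samp m (\<lambda>x'. C_kernel M Y x x') t) s"
      by (simp add: c_def samp_def)
    also have "\<dots> = (\<Sum>i<cells m. (\<Sum>j<cells m. C_kernel M Y (node m i) (node m j) * cell m j t) * cell m i s)"
      unfolding samp_eq_sum ..
    finally show ?thesis
      by (simp add: sum_distrib_left mult_ac)
  qed
  have c_meas: "(\<lambda>(s, t). c m s t) \<in> borel_measurable (borel \<Otimes>\<^sub>M borel)" for m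
    unfolding c_sum by measurable
  have pair: "pairing f (step m i) = (\<integral>t. f t * cell m i t \<partial>lborel)" for m i
    unfolding step_def by (rule pairing_abs_L1[OF f]) simp
  have fc: "integrable lborel (\<lambda>t. f t * cell m i t)" for m i
    by (rule integrable_Linf_mult[OF f]) simp
  have eq: "(\<integral>(s, t). f s * f t * c m s t \<partial>(lborel \<Otimes>\<^sub>M lborel))
    = (\<Sum>i<cells m. \<Sum>j<cells m. pairing f (step m i) * pairing f (step m j) * C_kernel M Y (node m i) (node m j))" for m
  proof -
    have "(\<integral>(s, t). f s * f t * c m s t \<partial>(lborel \<Otimes>\<^sub>M lborel))
      = (\<integral>p. (\<Sum>i<cells m. \<Sum>j<cells m. C_kernel M Y (node m i) (node m j) *
          (\<lambda>(s, t). (f s * cell m i s) * (f t * cell m j t)) p) \<partial>(lborel \<Otimes>\<^sub>M lborel))"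
      unfolding c_sum by (intro Bochner_Integration.integral_cong refl) (auto simp: sum_distrib_left mult_ac)
    also have "\<dots> = (\<Sum>i<cells m. \<Sum>j<cells m. C_kernel M Y (node m i) (node m j) *
          (\<integral>p. (\<lambda>(s, t). (f s * cell m i s) * (f t * cell m j t)) p \<partial>(lborel \<Otimes>\<^sub>M lborel)))"
      using integrable_prod_mult(1)[OF fc fc]
      by (subst Bochner_Integration.integral_sum, (intro Bochner_Integration.integrable_sum integrable_mult_right; simp)?)+ simp
    finally show ?thesis
      using integrable_prod_mult(2)[OF fc fc] by (simp add: pair mult_ac)
  qed
  have "(\<lambda>m. \<integral>p. (\<lambda>(s, t). f s * f t * c m s t) p \<partial>(lborel \<Otimes>\<^sub>M lborel))
    \<longlonglongrightarrow> (\<integral>p. (\<lambda>(s, t). f s * f t * C_kernel M Y s t) p \<partial>(lborel \<Otimes>\<^sub>M lborel))"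
  proof -
    let ?w = "\<lambda>(s, t). \<bar>f s\<bar> * \<kappa> s * (4 * (\<bar>f t\<bar> * \<kappa> t))"
    have w: "integrable (lborel \<Otimes>\<^sub>M lborel) ?w"
      and le: "norm ((\<lambda>(s, t). f s * f t * c m s t) p) \<le> ?w p"
      and i: "integrable (lborel \<Otimes>\<^sub>M lborel) (\<lambda>(s, t). f s * f t * c m s t)" for m p
      by (rule Phi_dominated[OF f f c_meas[of m] c_le]; simp)+
    show ?thesis
    proof (rule integral_dominated_convergence[where w = ?w])
      show "(\<lambda>(s, t). f s * f t * C_kernel M Y s t) \<in> borel_measurable (lborel \<Otimes>\<^sub>M lborel)"
        using integrable_Phi[OF f f] by auto
      show "(\<lambda>(s, t). f s * f t * c m s t) \<in> borel_measurable (lborel \<Otimes>\<^sub>M lborel)" for m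
        using i[of m] by auto
      show "AE p in lborel \<Otimes>\<^sub>M lborel. norm ((\<lambda>(s, t). f s * f t * c m s t) p) \<le> ?w p" for m
        by (intro AE_I2 le)
      show "AE p in lborel \<Otimes>\<^sub>M lborel. (\<lambda>m. (\<lambda>(s, t). f s * f t * c m s t) p) \<longlonglongrightarrow> (\<lambda>(s, t). f s * f t * C_kernel M Y s t) p"
        using AE_pair_lborel[OF AE_F_marg_continuous AE_F_marg_continuous]
      proof eventually_elim
        case (elim p)
        obtain s t where p: "p = (s, t)" by force
        have F0: "(\<lambda>m. \<Gamma> \<bar>F_marg M Y (pt m x) - F_marg M Y x\<bar>) \<longlonglongrightarrow> 0" if "isCont (F_marg M Y) x" for x
        proof (rule \<Gamma>_tendsto_0)
          have "(\<lambda>m. \<bar>F_marg M Y (pt m x) - F_marg M Y x\<bar>) \<longlonglongrightarrow> \<bar>F_marg M Y x - F_marg M Y x\<bar>"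
            by (intro tendsto_intros isCont_tendsto_compose[OF that pt_tendsto])
          then show "(\<lambda>m. \<bar>F_marg M Y (pt m x) - F_marg M Y x\<bar>) \<longlonglongrightarrow> 0" by simp
        qed simp
        have "(\<lambda>m. 4 * \<Gamma> \<bar>F_marg M Y (pt m s) - F_marg M Y s\<bar> + 4 * \<Gamma> \<bar>F_marg M Y (pt m t) - F_marg M Y t\<bar>) \<longlonglongrightarrow> 4 * 0 + 4 * 0"
          using elim by (intro tendsto_intros F0) (auto simp: p)
        then have z: "(\<lambda>m. 4 * \<Gamma> \<bar>F_marg M Y (pt m s) - F_marg M Y s\<bar> + 4 * \<Gamma> \<bar>F_marg M Y (pt m t) - F_marg M Y t\<bar>) \<longlonglongrightarrow> 0"
          by simp
        have "(\<lambda>m. C_kernel M Y (pt m s) (pt m t) - C_kernel M Y s t) \<longlonglongrightarrow> 0"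
          by (rule Lim_null_comparison[OF _ z]) (simp add: C_kernel_diff_le)
        then have 1: "(\<lambda>m. C_kernel M Y (pt m s) (pt m t)) \<longlonglongrightarrow> C_kernel M Y s t"
          by (simp add: LIM_zero_iff)
        have "\<forall>\<^sub>F m in sequentially. max \<bar>s\<bar> \<bar>t\<bar> \<le> real m"
          by (rule filterlim_real_sequentially[unfolded filterlim_at_top, rule_format])
        then have "\<forall>\<^sub>F m in sequentially. C_kernel M Y (pt m s) (pt m t) = c m s t"
          by eventually_elim (simp add: c_def)
        with 1 have "(\<lambda>m. c m s t) \<longlonglongrightarrow> C_kernel M Y s t"
          by (rule Lim_transform_eventually)
        then show ?case
          unfolding p by (simp add: tendsto_mult_left)
      qed
    qed (rule w)
  qed
  then show ?thesis
    unfolding eq Phi_def .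
qed

text \<open>Here \<open>n\<close> and the path are fixed, in contrast to \<open>emp_samp\<close>.
  The purpose is measurability: the empirical process becomes a pointwise limit of finite
  combinations of step functions.\<close>

lemma emp_samp_tendsto: "(\<lambda>m. abs_L1 (samp m (emp n y))) \<longlonglongrightarrow> abs_L1 (emp n y)"
proof -
  \<comment> \<open>This majorant does not increase with \<open>\<bar>t\<bar>\<close>, so outward
    rounding keeps sampled values below it.\<close>
  define w where "w t = (\<Sum>j<n. H t + indicator {- \<bar>y j\<bar>..\<bar>y j\<bar>} t) / sqrt (real n)" for t
  have w_int: "integrable lborel w"
    unfolding w_def using integrable_H by simp
  have X_le: "\<bar>X t z\<bar> \<le> H t + indicator {- \<bar>z 0\<bar>..\<bar>z 0\<bar>} t" for t z
  proof -
    consider "\<bar>t\<bar> \<le> \<bar>z 0\<bar>" | "\<bar>z 0\<bar> < t" | "t < - \<bar>z 0\<bar>" by linarith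
    then show ?thesis
    proof cases
      case 1
      then show ?thesis
        using X_bound[of t z] H_nonneg[of t] by (auto simp: indicator_def abs_le_iff)
    next
      case 2
      then have "X t z = 1 - F_marg M Y t" by (simp add: X_def indicator_def)
      then show ?thesis
        using F_marg_upper_tail[of t] F_marg_01[of t] 2 H_nonneg[of t] by (auto simp: indicator_def)
    next
      case 3
      then have "X t z = - F_marg M Y t" by (simp add: X_def indicator_def)
      then show ?thesis
        using F_marg_lower_tail[of t] F_marg_01[of t] 3 H_nonneg[of t] by (auto simp: indicator_def)
    qed
  qed
  have sh0: "(sh ^^ j) y 0 = y j" for j
    by (simp add: sh_funpow)
  have emp_le: "\<bar>emp n y t\<bar> \<le> w t" for t
  proof -
    have "\<bar>\<Sum>j<n. X t ((sh ^^ j) y)\<bar> \<le> (\<Sum>j<n. H t + indicator {- \<bar>y j\<bar>..\<bar>y j\<bar>} t)"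
      by (rule order_trans[OF sum_abs sum_mono]) (use X_le[of t "(sh ^^ _) y"] in \<open>simp add: sh0\<close>)
    then show ?thesis
      unfolding emp_def P.bsum_def w_def by (simp add: abs_div divide_right_mono)
  qed
  have w_pt: "w (pt m t) \<le> w t" if t: "\<bar>t\<bar> \<le> real m" for m t
  proof -
    have "\<bar>t\<bar> \<le> \<bar>pt m t\<bar>"
      using pt_outward[OF t] by auto
    then show ?thesis
      unfolding w_def
      by (intro divide_right_mono sum_mono add_mono H_antimono) (auto simp: indicator_def abs_le_iff)
  qed
  have w0: "0 \<le> w t" for t
    using emp_le[of t] by (rule order_trans[OF abs_ge_zero])
  have "(\<lambda>m. \<integral>t. \<bar>samp m (emp n y) t - emp n y t\<bar> \<partial>lborel) \<longlonglongrightarrow> integral\<^sup>L lborel (\<lambda>t::real. 0)"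
  proof (rule integral_dominated_convergence[where w = "\<lambda>t. 2 * w t"])
    show "AE t in lborel. (\<lambda>m. \<bar>samp m (emp n y) t - emp n y t\<bar>) \<longlonglongrightarrow> 0"
    proof -
      have "AE t in lborel. t \<notin> y ` {..<n}"
        by (rule AE_not_in) (auto intro: countable_imp_null_set_lborel countable_finite)
      with AE_F_marg_continuous show ?thesis
      proof eventually_elim
        case (elim t)
        have "isCont (\<lambda>t. \<Sum>j<n. indicator {..t} (y j) - F_marg M Y t) t"
        proof (intro continuous_intros)
          fix j assume "j \<in> {..<n}"
          then have "t \<noteq> y j" using elim(2) by auto
          then have "isCont (indicator {y j..} :: real \<Rightarrow> real) t"
            by (simp add: isCont_indicator)
          moreover have "(\<lambda>t. indicator {..t} (y j)) = (indicator {y j..} :: real \<Rightarrow> real)"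
            by (auto simp: indicator_def fun_eq_iff)
          ultimately show "isCont (\<lambda>t. indicator {..t} (y j) :: real) t" by simp
          show "isCont (F_marg M Y) t" by (rule elim(1))
        qed
        then have "isCont (\<lambda>t. emp n y t) t"
          unfolding emp_def P.bsum_def X_def sh0 by (cases "n = 0") auto
        then have "(\<lambda>m. emp n y (pt m t)) \<longlonglongrightarrow> emp n y t"
          by (rule isCont_tendsto_compose[OF _ pt_tendsto])
        then have lim: "(\<lambda>m. \<bar>emp n y (pt m t) - emp n y t\<bar>) \<longlonglongrightarrow> 0"
          by (intro tendsto_rabs_zero LIM_zero)
        have "\<forall>\<^sub>F m in sequentially. \<bar>t\<bar> \<le> real m"
          using filterlim_real_sequentially by (simp add: filterlim_at_top)
        then have "\<forall>\<^sub>F m in sequentially. \<bar>emp n y (pt m t) - emp n y t\<bar> = \<bar>samp m (emp n y) t - emp n y t\<bar>"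
          by eventually_elim (simp add: samp_def)
        from Lim_transform_eventually[OF lim this] show ?case .
      qed
    qed
    show "AE t in lborel. norm \<bar>samp m (emp n y) t - emp n y t\<bar> \<le> 2 * w t" for m
    proof (rule AE_I2)
      fix t
      have "\<bar>samp m (emp n y) t\<bar> \<le> w t"
        using order_trans[OF emp_le w_pt, of t m] w0[of t] by (simp add: samp_def)
      then show "norm \<bar>samp m (emp n y) t - emp n y t\<bar> \<le> 2 * w t"
        using emp_le[of t] by simp
    qed
    show "(\<lambda>t. \<bar>samp m (emp n y) t - emp n y t\<bar>) \<in> borel_measurable lborel" for m
      using integrable_emp[of n y] integrable_samp[of m "emp n y"] by auto
  qed (use w_int in auto)
  moreover have "norm (abs_L1 (samp m (emp n y)) - abs_L1 (emp n y)) = (\<integral>t. \<bar>samp m (emp n y) t - emp n y t\<bar> \<partial>lborel)" for m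
    using integrable_emp[of n y] integrable_samp[of m "emp n y"] by (simp add: abs_L1_diff norm_abs_L1)
  ultimately have "(\<lambda>m. norm (abs_L1 (samp m (emp n y)) - abs_L1 (emp n y))) \<longlonglongrightarrow> 0"
    by simp
  then show ?thesis
    by (rule LIM_zero_cancel[OF tendsto_norm_zero_cancel])
qed

lemma emp_measurable: "(\<lambda>y. emp n y x) \<in> borel_measurable path_space"
  unfolding emp_def by measurable

lemma abs_L1_samp_emp_measurable: "(\<lambda>y. abs_L1 (samp m (emp n y))) \<in> borel_measurable path_space"
  unfolding abs_L1_samp by (rule borel_measurable_combination) (rule emp_measurable)

lemma abs_L1_emp_measurable[measurable]: "(\<lambda>y. abs_L1 (emp n y)) \<in> borel_measurable path_space"
  by (rule borel_measurable_LIMSEQ_metric[OF abs_L1_samp_emp_measurable emp_samp_tendsto])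

text \<open>\<open>hist n\<close> reads \<open>Y n\<close>, ..., \<open>Y 1\<close> backwards, which
  only reorders the sum. For \<open>n = 0\<close> both sides are zero, the right one through
  division by zero.\<close>

lemma emp_process_eq: "emp_process M Y n \<omega> t = emp n (hist n \<omega>) t"
proof (cases "n = 0")
  case False
  have "(\<Sum>i = 1..n. indicator {..t} (Y (int i) \<omega>)) = (\<Sum>j<n. indicator {..t} (hist n \<omega> j) :: real)"
    unfolding hist_def
    by (rule sum.reindex_bij_witness[of _ "\<lambda>j. n - j" "\<lambda>i. n - i"]) (auto simp: of_nat_diff)
  then have "P.bsum (X t) n (hist n \<omega>) = (\<Sum>i = 1..n. indicator {..t} (Y (int i) \<omega>)) - real n * F_marg M Y t"
    by (simp add: P.bsum_def X_def sh_funpow sum_subtractf)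
  moreover have "sqrt (real n) * (1 / real n * S - F) = (S - real n * F) / sqrt (real n)" for S F
    using False by (simp add: field_simps)
  ultimately show ?thesis
    by (simp add: emp_process_def F_emp_def emp_def)
qed (simp add: emp_process_def emp_def)

end

section \<open>The limit law, its covariance and convergence in law\<close>

context gaussian_family
begin

lemma emp_samp_fidi:
  fixes h :: "L1 \<Rightarrow> real"
  assumes h: "continuous_on UNIV h" and B: "\<And>x. \<bar>h x\<bar> \<le> B"
  shows "(\<lambda>n. \<integral>y. h (abs_L1 (samp m (emp n y))) \<partial>PP) \<longlonglongrightarrow> (\<integral>\<omega>. h (G m \<omega>) \<partial>\<Omega>)"
proof -
  let ?h = "\<lambda>x :: nat \<Rightarrow> real. h (\<Sum>i<cells m. x i *\<^sub>R step m i)"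
  have em: "(\<lambda>y. emp n y x) \<in> borel_measurable PP" for n x
    using emp_measurable[of n x] by simp
  interpret W: fidi_convergence PP \<Omega> "\<lambda>n y l. emp n y (node m l)" "\<lambda>\<omega> l. V (node m l) \<omega>" "cells m"
  proof
    show "(\<lambda>y. emp n y (node m l)) \<in> borel_measurable PP" for n l
      by (rule em)
    show "(\<lambda>n. \<integral>y. iexp (\<Sum>l<cells m. u l * emp n y (node m l)) \<partial>PP)
      \<longlonglongrightarrow> (\<integral>\<omega>. iexp (\<Sum>l<cells m. u l * V (node m l) \<omega>) \<partial>\<Omega>)" for u
    proof -
      have "(\<Sum>l<cells m. u l * emp n y (node m l)) = P.bsum (comb {..<cells m} u (node m)) n y / sqrt (real n)" for n y
        unfolding emp_def P.bsum_def comb_def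
        by (subst sum.swap) (simp add: sum_distrib_left sum_divide_distrib)
      then show ?thesis
        using fidi_clt[of "{..<cells m}" u "node m"] V_char[of "{..<cells m}" "node m" u]
        by (simp only: finite_lessThan node_rational)
    qed
  qed simp
  have "continuous_on UNIV ?h"
  proof (rule continuous_on_compose2[OF h])
    show "continuous_on UNIV (\<lambda>x :: nat \<Rightarrow> real. \<Sum>i<cells m. x i *\<^sub>R step m i)"
      by (intro continuous_intros continuous_on_product_coordinates)
  qed simp
  then have "(\<lambda>n. \<integral>y. ?h (\<lambda>l. emp n y (node m l)) \<partial>PP) \<longlonglongrightarrow> (\<integral>\<omega>. ?h (\<lambda>l. V (node m l) \<omega>) \<partial>\<Omega>)"
  proof (rule W.weak_convergence[of ?h B])
    show "\<bar>?h x\<bar> \<le> B" for x by (rule B)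
    show "?h x = ?h y" if "\<And>l. l < cells m \<Longrightarrow> x l = y l" for x y
      using that by simp
  qed
  then show ?thesis
    by (simp only: abs_L1_samp G_eq)
qed

theorem gaussian_limit_law:
  "\<exists>N :: L1 measure. centered_gaussian N \<and> has_covariance_Phi M Y N \<and>
    converges_in_law M (\<lambda>n \<omega>. abs_L1 (emp_process M Y n \<omega>)) N"
proof -
  obtain r and Gl :: "'c \<Rightarrow> L1" and T :: "nat \<Rightarrow> 'c \<Rightarrow> real"
    where r: "filterlim r at_top sequentially" and Gl[measurable]: "Gl \<in> borel_measurable \<Omega>"
    and T: "\<And>k. integrable \<Omega> (T k)" "\<And>k. AE \<omega> in \<Omega>. norm (Gl \<omega> - G (r k) \<omega>) \<le> T k \<omega>"
      "(\<lambda>k. \<integral>\<omega>. T k \<omega> \<partial>\<Omega>) \<longlonglongrightarrow> 0"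
    by (rule G_limit) (rule that)
  define L where "L = distr \<Omega> borel Gl"
  have prob_L: "prob_space L"
    unfolding L_def by (rule N.prob_space_distr) simp
  have sets_L: "sets L = sets borel"
    by (simp add: L_def)
  \<comment> \<open>One limit argument serves twice: it shows that continuous functionals of
    \<open>Gl\<close> are Gaussian, and it gives their standard deviations as limits of quadratic
    forms, which are identified below by \<open>grid_quad_tendsto\<close>.\<close>
  have gauss: "\<exists>\<sigma>. (\<lambda>k. sqrt (quad {..<cells (r k)} (\<lambda>i. \<phi> (step (r k) i)) (node (r k)))) \<longlonglongrightarrow> \<sigma>
      \<and> normal0 \<Omega> (\<lambda>\<omega>. \<phi> (Gl \<omega>)) \<sigma>" if \<phi>: "bounded_linear \<phi>" for \<phi> :: "L1 \<Rightarrow> real"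
  proof -
    interpret bounded_linear \<phi> by fact
    obtain K where K: "0 \<le> K" "\<And>x. norm (\<phi> x) \<le> norm x * K"
      using nonneg_bounded by blast
    have \<phi>_meas[measurable]: "\<phi> \<in> borel_measurable borel"
      by (intro borel_measurable_continuous_onI linear_continuous_on \<phi>)
    show ?thesis
    proof (rule N.normal0_limit[where T = "\<lambda>k \<omega>. T k \<omega> * K" and W = "\<lambda>k \<omega>. \<phi> (G (r k) \<omega>)"])
      fix k
      have eq: "(\<lambda>\<omega>. \<phi> (G (r k) \<omega>)) = (\<lambda>\<omega>. \<Sum>i<cells (r k). \<phi> (step (r k) i) * V (node (r k) i) \<omega>)"
        unfolding G_eq by (simp add: sum scaleR mult.commute)
      show "normal0 \<Omega> (\<lambda>\<omega>. \<phi> (G (r k) \<omega>)) (sqrt (quad {..<cells (r k)} (\<lambda>i. \<phi> (step (r k) i)) (node (r k))))"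
        unfolding eq by (rule normal0_V) (auto simp: node_rational)
      show "integrable \<Omega> (\<lambda>\<omega>. T k \<omega> * K)"
        using T(1) by simp
      show "AE \<omega> in \<Omega>. \<bar>\<phi> (Gl \<omega>) - \<phi> (G (r k) \<omega>)\<bar> \<le> T k \<omega> * K"
        using T(2)[of k]
      proof eventually_elim
        case (elim \<omega>)
        have "\<bar>\<phi> (Gl \<omega>) - \<phi> (G (r k) \<omega>)\<bar> \<le> norm (Gl \<omega> - G (r k) \<omega>) * K"
          using K(2)[of "Gl \<omega> - G (r k) \<omega>"] by (simp add: diff)
        also have "\<dots> \<le> T k \<omega> * K"
          using elim K(1) by (rule mult_right_mono)
        finally show ?case .
      qed
    next
      show "(\<lambda>k. \<integral>\<omega>. T k \<omega> * K \<partial>\<Omega>) \<longlonglongrightarrow> 0"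
        using tendsto_mult_left_zero[OF T(3), of K] by simp
    qed measurable
  qed
  have "centered_gaussian L"
    unfolding centered_gaussian_def
  proof (intro conjI allI impI prob_L sets_L)
    fix \<phi> :: "L1 \<Rightarrow> real" assume \<phi>: "bounded_linear \<phi>"
    then have [measurable]: "\<phi> \<in> borel_measurable borel"
      by (intro borel_measurable_continuous_onI linear_continuous_on)
    obtain \<sigma> where "normal0 \<Omega> (\<lambda>\<omega>. \<phi> (Gl \<omega>)) \<sigma>"
      using gauss[OF \<phi>] by blast
    moreover have "distr L borel \<phi> = distr \<Omega> borel (\<lambda>\<omega>. \<phi> (Gl \<omega>))"
      unfolding L_def by (subst distr_distr) (auto simp: comp_def)
    ultimately show "\<exists>\<sigma>. distr L borel \<phi> = distr std_normal_distribution borel (\<lambda>z. \<sigma> * z)"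
      unfolding normal0_def by auto
  qed
  moreover have "has_covariance_Phi M Y L"
    unfolding has_covariance_Phi_def
  proof (intro conjI allI ballI)
    show "summable (\<lambda>k. C_term M Y s t (Suc k))" for s t
      unfolding C_term_eq by (rule summable_cov)
    have sq: "integrable \<Omega> (\<lambda>\<omega>. (pairing f (Gl \<omega>))\<^sup>2)" "(\<integral>\<omega>. (pairing f (Gl \<omega>))\<^sup>2 \<partial>\<Omega>) = Phi M Y f f"
      if f: "f \<in> Linf" for f
    proof -
      obtain \<sigma> where \<sigma>: "(\<lambda>k. sqrt (quad {..<cells (r k)} (\<lambda>i. pairing f (step (r k) i)) (node (r k)))) \<longlonglongrightarrow> \<sigma>"
        "normal0 \<Omega> (\<lambda>\<omega>. pairing f (Gl \<omega>)) \<sigma>"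
        using gauss[OF bounded_linear_pairing[OF f]] by blast
      have "(\<lambda>k. sqrt (quad {..<cells (r k)} (\<lambda>i. pairing f (step (r k) i)) (node (r k)))) \<longlonglongrightarrow> sqrt (Phi M Y f f)"
        by (intro tendsto_real_sqrt filterlim_compose[OF grid_quad_tendsto[OF f] r])
      with \<sigma>(1) have "\<sigma> = sqrt (Phi M Y f f)"
        by (rule LIMSEQ_unique)
      moreover have "0 \<le> Phi M Y f f"
        by (rule LIMSEQ_le_const[OF grid_quad_tendsto[OF f]]) (auto intro!: quadratic_C_kernel_nonneg)
      ultimately show "integrable \<Omega> (\<lambda>\<omega>. (pairing f (Gl \<omega>))\<^sup>2)" "(\<integral>\<omega>. (pairing f (Gl \<omega>))\<^sup>2 \<partial>\<Omega>) = Phi M Y f f"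
        using normal0_square[OF \<sigma>(2)] by simp_all
    qed
    fix f g assume f: "f \<in> Linf" and g: "g \<in> Linf"
    show "integrable (lborel \<Otimes>\<^sub>M lborel) (\<lambda>(s, t). f s * g t * C_kernel M Y s t)"
      by (rule integrable_Phi[OF f g])
    note ng = Linf_uminus[OF g]
    have padd: "pairing (\<lambda>t. f t + g t) x = pairing f x + pairing g x" if g: "g \<in> Linf" for x g
      unfolding pairing_def
      using integrable_Linf_mult[OF f integrable_rep_L1, of x] integrable_Linf_mult[OF g integrable_rep_L1, of x]
      by (simp add: distrib_right)
    have pneg: "pairing (\<lambda>t. - g t) x = - pairing g x" for x
      unfolding pairing_def by simp
    \<comment> \<open>Variances give only the diagonal values of \<open>Phi\<close>. Polarization
      recovers the covariance and, as \<open>Phi\<close> may be asymmetric, produces the mean of its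
      two orders.\<close>
    have prod: "pairing f x * pairing g x
      = ((pairing (\<lambda>t. f t + g t) x)\<^sup>2 - (pairing (\<lambda>t. f t + - g t) x)\<^sup>2) / 4" for x
      unfolding padd[OF g] padd[OF ng] pneg by (simp add: power2_eq_square algebra_simps)
    have "has_bochner_integral \<Omega> (\<lambda>\<omega>. pairing f (Gl \<omega>) * pairing g (Gl \<omega>)) ((Phi M Y f g + Phi M Y g f) / 2)"
    proof -
      have "Phi M Y (\<lambda>t. f t + - g t) (\<lambda>t. f t + - g t)
        = Phi M Y f f - Phi M Y f g - Phi M Y g f + Phi M Y g g"
        unfolding Phi_add_add[OF f ng] Phi_uminus by simp
      note sq_diff = sq[OF Linf_add[OF f ng], unfolded this]
      have "has_bochner_integral \<Omega> (\<lambda>\<omega>. (pairing (\<lambda>t. f t + g t) (Gl \<omega>))\<^sup>2 - (pairing (\<lambda>t. f t + - g t) (Gl \<omega>))\<^sup>2)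
        (2 * (Phi M Y f g + Phi M Y g f))"
        unfolding has_bochner_integral_iff Bochner_Integration.integral_diff[OF sq(1)[OF Linf_add[OF f g]] sq_diff(1)]
          sq(2)[OF Linf_add[OF f g]] sq_diff(2) Phi_add_add[OF f g]
        using Bochner_Integration.integrable_diff[OF sq(1)[OF Linf_add[OF f g]] sq_diff(1)] by simp
      from has_bochner_integral_divide_zero[OF this, of 4] show ?thesis
        unfolding prod by (simp add: distrib_left[symmetric] del: distrib_left_numeral)
    qed
    moreover have [measurable]: "pairing f \<in> borel_measurable borel" "pairing g \<in> borel_measurable borel"
      using f g by (auto intro!: borel_measurable_continuous_onI linear_continuous_on bounded_linear_pairing)
    ultimately show "has_bochner_integral L (\<lambda>x. pairing f x * pairing g x) ((Phi M Y f g + Phi M Y g f) / 2)"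
      unfolding L_def has_bochner_integral_iff by (simp add: integrable_distr_eq integral_distr)
  qed
  moreover have "converges_in_law M (\<lambda>n \<omega>. abs_L1 (emp_process M Y n \<omega>)) L"
  proof (rule converges_in_law_lipschitz[OF prob_space_axioms prob_L sets_L])
    have eq: "abs_L1 (emp_process M Y n \<omega>) = abs_L1 (emp n (hist n \<omega>))" for n \<omega>
      by (simp add: emp_process_eq[abs_def])
    show "(\<lambda>\<omega>. abs_L1 (emp_process M Y n \<omega>)) \<in> borel_measurable M" for n
      unfolding eq by (rule measurable_compose[OF hist_measurable abs_L1_emp_measurable])
    fix h :: "L1 \<Rightarrow> real" and c B
    assume lip: "c-lipschitz_on UNIV h" and B: "\<And>x. \<bar>h x\<bar> \<le> B"
    have cont: "continuous_on UNIV h"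
      by (rule lipschitz_on_continuous_on[OF lip])
    have [measurable]: "h \<in> borel_measurable borel"
      by (rule borel_measurable_continuous_onI[OF cont])
    have e1: "(\<integral>\<omega>. h (abs_L1 (emp_process M Y n \<omega>)) \<partial>M) = (\<integral>y. h (abs_L1 (emp n y)) \<partial>PP)" for n
      unfolding eq by (rule integral_hist) measurable
    have e2: "(\<integral>x. h x \<partial>L) = (\<integral>\<omega>. h (Gl \<omega>) \<partial>\<Omega>)"
      unfolding L_def by (rule integral_distr) measurable
    have a: "\<bar>(\<integral>y. h (abs_L1 (emp n y)) \<partial>PP) - (\<integral>y. h (abs_L1 (samp m (emp n y))) \<partial>PP)\<bar> \<le> c * \<delta> m" for n m
    proof -
      have "\<bar>(\<integral>y. h (abs_L1 (emp n y)) \<partial>PP) - (\<integral>y. h (abs_L1 (samp m (emp n y))) \<partial>PP)\<bar>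
        \<le> c * (\<integral>y. norm (abs_L1 (emp n y) - abs_L1 (samp m (emp n y))) \<partial>PP)"
        using abs_L1_emp_measurable[of n] abs_L1_samp_emp_measurable[of m n]
        by (intro lipschitz_mean_diff[OF P.prob_space_axioms lip B _ _ emp_samp(1)]) auto
      also have "\<dots> \<le> c * \<delta> m"
        using emp_samp(2) lipschitz_on_nonneg[OF lip] by (rule mult_left_mono)
      finally show ?thesis .
    qed
    have b: "\<bar>(\<integral>\<omega>. h (Gl \<omega>) \<partial>\<Omega>) - (\<integral>\<omega>. h (G (r k) \<omega>) \<partial>\<Omega>)\<bar> \<le> c * (\<integral>\<omega>. T k \<omega> \<partial>\<Omega>)" for k
      by (rule lipschitz_mean_diff[OF N.prob_space_axioms lip B Gl G_measurable T(1,2)])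
    show "(\<lambda>n. \<integral>\<omega>. h (abs_L1 (emp_process M Y n \<omega>)) \<partial>M) \<longlonglongrightarrow> (\<integral>x. h x \<partial>L)"
      unfolding e1 e2
    proof (rule tendstoI)
      \<comment> \<open>First \<open>k\<close> is chosen, which fixes the grid; its error for the
        empirical process is the same for all \<open>n\<close>, so \<open>n\<close> can be taken
        large afterwards.\<close>
      fix e :: real assume e: "0 < e"
      have "(\<lambda>k. c * \<delta> (r k)) \<longlonglongrightarrow> 0"
        by (rule tendsto_mult_right_zero[OF filterlim_compose[OF \<delta>_tendsto r]])
      then have "\<forall>\<^sub>F k in sequentially. c * \<delta> (r k) < e / 3"
        by (rule order_tendstoD) (use e in simp)
      moreover have "\<forall>\<^sub>F k in sequentially. c * (\<integral>\<omega>. T k \<omega> \<partial>\<Omega>) < e / 3"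
        by (rule order_tendstoD(2)[OF tendsto_mult_right_zero[OF T(3)]]) (use e in simp)
      ultimately obtain k where k: "c * \<delta> (r k) < e / 3" "c * (\<integral>\<omega>. T k \<omega> \<partial>\<Omega>) < e / 3"
        using eventually_happens'[OF sequentially_bot eventually_conj] by blast
      have "\<forall>\<^sub>F n in sequentially. dist (\<integral>y. h (abs_L1 (samp (r k) (emp n y))) \<partial>PP) (\<integral>\<omega>. h (G (r k) \<omega>) \<partial>\<Omega>) < e / 3"
        by (rule tendstoD[OF emp_samp_fidi[OF cont B]]) (use e in simp)
      then show "\<forall>\<^sub>F n in sequentially. dist (\<integral>y. h (abs_L1 (emp n y)) \<partial>PP) (\<integral>\<omega>. h (Gl \<omega>) \<partial>\<Omega>) < e"
      proof eventually_elim
        case (elim n)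
        then show ?case
          using a[of n "r k"] b[of k] k unfolding dist_real_def by linarith
      qed
    qed
  qed
  ultimately show ?thesis by blast
qed

end

lemma (in quantile_sequence) gaussian_family_exists:
  obtains \<Omega> :: "(nat \<Rightarrow> real) measure" and V where "gaussian_family M Y \<Omega> V"
proof -
  define r where "r = from_nat_into (\<rat> :: real set)"
  \<comment> \<open>Covariance matrices are symmetric, unlike \<open>C_kernel\<close>. Exchanging
    the two summation indices shows that the average has the same quadratic forms.\<close>
  define K where "K p q = (C_kernel M Y (r p) (r q) + C_kernel M Y (r q) (r p)) / 2" for p q
  have quad: "(\<Sum>p\<in>I. \<Sum>q\<in>I. c p * c q * K (\<sigma> p) (\<sigma> q))
      = (\<Sum>p\<in>I. \<Sum>q\<in>I. c p * c q * C_kernel M Y (r (\<sigma> p)) (r (\<sigma> q)))" for I :: "nat set" and c \<sigma>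
  proof -
    have "(\<Sum>p\<in>I. \<Sum>q\<in>I. c p * c q * C_kernel M Y (r (\<sigma> q)) (r (\<sigma> p)))
        = (\<Sum>p\<in>I. \<Sum>q\<in>I. c p * c q * C_kernel M Y (r (\<sigma> p)) (r (\<sigma> q)))"
      by (subst sum.swap) (simp add: mult.commute)
    then show ?thesis
      by (simp add: K_def distrib_left add_divide_distrib sum.distrib sum_divide_distrib[symmetric])
  qed
  have "psd_kernel K"
    unfolding psd_kernel_def
  proof (intro conjI allI impI)
    show "K p q = K q p" for p q
      by (simp add: K_def add.commute)
    show "0 \<le> (\<Sum>p\<in>I. \<Sum>q\<in>I. c p * c q * K p q)" if "finite I" for I and c :: "nat \<Rightarrow> real"
      using quad[of c "\<lambda>p. p" I] quadratic_C_kernel_nonneg[OF that, of c r] by simp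
  qed
  then obtain \<Omega> :: "(nat \<Rightarrow> real) measure" and S :: "nat \<Rightarrow> (nat \<Rightarrow> real) \<Rightarrow> real" where
    \<Omega>: "prob_space \<Omega>" and S: "\<And>p. S p \<in> borel_measurable \<Omega>"
    and char: "\<And>(I :: nat set) c \<sigma>. finite I \<Longrightarrow> (\<integral>\<omega>. iexp (\<Sum>p\<in>I. c p * S (\<sigma> p) \<omega>) \<partial>\<Omega>)
      = exp (- ((\<Sum>p\<in>I. \<Sum>q\<in>I. c p * c q * K (\<sigma> p) (\<sigma> q)) / 2))"
    by (rule gaussian_sequence_exists) (rule that)
  define V where "V x = S (to_nat_on (\<rat> :: real set) x)" for x :: real
  have "gaussian_family M Y \<Omega> V"
  proof (intro gaussian_family.intro gaussian_family_axioms.intro quantile_sequence_axioms \<Omega>)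
    show "V x \<in> borel_measurable \<Omega>" for x
      by (simp add: V_def S)
    fix I :: "nat set" and c \<tau> :: "nat \<Rightarrow> real"
    assume I: "finite I" and \<tau>: "\<And>p. p \<in> I \<Longrightarrow> \<tau> p \<in> \<rat>"
    have "r (to_nat_on (\<rat> :: real set) (\<tau> p)) = \<tau> p" if "p \<in> I" for p
      unfolding r_def by (rule from_nat_into_to_nat_on[OF countable_rat \<tau>[OF that]])
    then show "(\<integral>\<omega>. iexp (\<Sum>p\<in>I. c p * V (\<tau> p) \<omega>) \<partial>\<Omega>)
        = exp (- ((\<Sum>p\<in>I. \<Sum>q\<in>I. c p * c q * C_kernel M Y (\<tau> p) (\<tau> q)) / 2))"
      using char[OF I, of c "\<lambda>p. to_nat_on (\<rat> :: real set) (\<tau> p)"] quad[of c "\<lambda>p. to_nat_on (\<rat> :: real set) (\<tau> p)" I]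
      by (simp add: V_def cong: sum.cong)
  qed
  then show thesis
    by (rule that)
qed

theorem proposition3p5:
  fixes M :: "'a measure" and Y :: "int \<Rightarrow> 'a \<Rightarrow> real"
  assumes "prob_space M"
    and "\<And>i. Y i \<in> borel_measurable M"
    and "stationary M Y"
    and "ergodic M Y"
    and "(\<Sum>k. ennreal (1 / sqrt (real (Suc k))) * quantile_integral M Y (tilde_alpha M Y (Suc k))) < \<infinity>"
    and "tilde_alpha M Y 1 = 0 \<Longrightarrow> quantile_integral M Y 1 < \<infinity>"
  shows "(\<forall>n. \<forall>\<omega>\<in>space M. integrable lborel (emp_process M Y n \<omega>)) \<and>
    (\<exists>N :: L1 measure.
        centered_gaussian N \<and>
        has_covariance_Phi M Y N \<and>
        converges_in_law M (\<lambda>n \<omega>. abs_L1 (emp_process M Y n \<omega>)) N)"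
proof -
  interpret quantile_sequence M Y
    using assms
    by (intro quantile_sequence.intro stationary_sequence.intro stationary_sequence_axioms.intro
        quantile_sequence_axioms.intro)
  obtain \<Omega> :: "(nat \<Rightarrow> real) measure" and V where "gaussian_family M Y \<Omega> V"
    by (rule gaussian_family_exists)
  then interpret gaussian_family M Y \<Omega> V .
  \<comment> \<open>Integrability gives \<open>abs_L1\<close> its meaning: the quotient map says
    nothing about functions outside the domain of \<open>L1_rel\<close>.\<close>
  have "integrable lborel (emp_process M Y n \<omega>)" for n \<omega>
    using integrable_emp[of n "hist n \<omega>"] by (simp add: emp_process_eq[abs_def])
  then show ?thesis
    using gaussian_limit_law by blast
qed

end
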